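(* Let $(Y,S)$ be an aperiodic, finitely generated, and strongly uniquely ergodic multiplicative topological dynamical system, and let $\nu$ be the unique Borel probability measure on $Y$ that pretends to be invariant under $S$. Let $\eta\colon\mathbb{N}\to\mathbb{C}$ be a nilsequence and denote by $M(\eta)=\lim_{N\to\infty}\frac1N\sum_{n=1}^N\eta(n)$ its mean value. Then $$\lim_{N\to\infty}\frac1N\sum_{n=1}^N\eta(n)\,g(S_ny)=M(\eta)\left(\int g\,d\nu\right)$$ for every $y\in Y$ and every $g\in C(Y)$.
   Context: $\mathbb{N}=\{1,2,3,\ldots\}$ and $\mathbb{P}$ is the set of primes. $C(Y)$ denotes continuous complex-valued functions on $Y$. A multiplicative topological dynamical system is a pair $(Y,S)$ where $Y$ is a compact metric space and $S=(S_n)_{n\in\mathbb{N}}$ is an action of $(\mathbb{N},\cdot)$ on $Y$ by continuous maps, i.e. $S_{nm}=S_n\circ S_m$ for all $n,m$. It is finitely generated if there are finitely many continuous maps $R_1,\ldots,R_d\colon Y\to Y$ with $S_p\in\{R_1,\ldots,R_d\}$ for all primes $p$. A Borel probability measure $\nu$ on $Y$ pretends to be invariant under $S$ if there is $P\subset\mathbb{P}$ with $\sum_{p\in\mathbb{P}\setminus P}1/p<\infty$ such that $\nu$ is invariant under $S_p$ for all $p\in P$. $(Y,S)$ is strongly uniquely ergodic if exactly one Borel probability measure on $Y$ pretends to be invariant under $S$. Two bounded functions $a,b\colon\mathbb{N}\to\mathbb{C}$ are asymptotically uncorrelated if $$\lim_{N\to\infty}\left(\frac1N\sum_{n=1}^N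 a(n)\overline{b(n)}-\Big(\frac1N\sum_{n=1}^N a(n)\Big)\Big(\frac1N\sum_{n=1}^N\overline{b(n)}\Big)\right)=0.$$ A function $P\colon\mathbb{N}\to\mathbb{C}$ is periodic if there is $m\in\mathbb{N}$ with $P(n+m)=P(n)$ for all $n$. $(Y,S)$ is aperiodic if for every periodic $P$, every $g\in C(Y)$ and every $y\in Y$, the sequences $P(n)$ and $g(S_ny)$ are asymptotically uncorrelated. A nilsystem is a pair $(X,T)$ with $X=G/\Gamma$, $G$ a nilpotent Lie group, $\Gamma$ a discrete co-compact subgroup, and $T(x)=ax$ for a fixed $a\in G$. A nilsequence is a sequence of the form $\eta(n)=f(T^nx)$, $n\in\mathbb{N}$, with $(X,T)$ a nilsystem, $x\in X$ and $f\in C(X)$. (The mean value of a nilsequence exists.) *)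

theory Defs
  imports
    "HOL-Probability.Probability"
    "HOL-Algebra.Left_Coset"
    "HOL-Algebra.Generated_Groups"
begin

section \<open>Multiplicative topological dynamical systems\<close>

text \<open>
  The index set is the set of positive integers throughout: the value at \<open>0\<close> of a family or
  sequence indexed by \<^typ>\<open>nat\<close> is never constrained and never used.
\<close>

definition mult_tds :: "(nat \<Rightarrow> 'y::metric_space \<Rightarrow> 'y) \<Rightarrow> bool" where
  "mult_tds S \<longleftrightarrow>
     compact (UNIV :: 'y set) \<and>
     (\<forall>n\<ge>1. continuous_on UNIV (S n)) \<and>
     (\<forall>n\<ge>1. \<forall>m\<ge>1. S (n * m) = S n \<circ> S m)"

definition finitely_generated :: "(nat \<Rightarrow> 'y::metric_space \<Rightarrow> 'y) \<Rightarrow> bool" where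
  "finitely_generated S \<longleftrightarrow>
     (\<exists>\<R>. finite \<R> \<and> (\<forall>R\<in>\<R>. continuous_on UNIV R) \<and> (\<forall>p. prime p \<longrightarrow> S p \<in> \<R>))"

definition borel_probability :: "'y::metric_space measure \<Rightarrow> bool" where
  "borel_probability \<nu> \<longleftrightarrow> prob_space \<nu> \<and> sets \<nu> = sets borel"

definition pretends_invariant :: "(nat \<Rightarrow> 'y::metric_space \<Rightarrow> 'y) \<Rightarrow> 'y measure \<Rightarrow> bool" where
  "pretends_invariant S \<nu> \<longleftrightarrow>
     (\<exists>P \<subseteq> {p. prime p}.
        (\<lambda>p. 1 / real p) summable_on ({p. prime p} - P) \<and>
        (\<forall>p\<in>P. distr \<nu> borel (S p) = \<nu>))"

definition strongly_uniquely_ergodic :: "(nat \<Rightarrow> 'y::metric_space \<Rightarrow> 'y) \<Rightarrow> bool" where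
  "strongly_uniquely_ergodic S \<longleftrightarrow> (\<exists>!\<nu>. borel_probability \<nu> \<and> pretends_invariant S \<nu>)"

definition cesaro :: "(nat \<Rightarrow> complex) \<Rightarrow> nat \<Rightarrow> complex" where
  "cesaro a N = (\<Sum>n=1..N. a n) / of_nat N"

definition asymptotically_uncorrelated :: "(nat \<Rightarrow> complex) \<Rightarrow> (nat \<Rightarrow> complex) \<Rightarrow> bool" where
  "asymptotically_uncorrelated a b \<longleftrightarrow>
     (\<lambda>N. cesaro (\<lambda>n. a n * cnj (b n)) N - cesaro a N * cesaro (\<lambda>n. cnj (b n)) N)
       \<longlonglongrightarrow> 0"

definition periodic_seq :: "(nat \<Rightarrow> complex) \<Rightarrow> bool" where
  "periodic_seq P \<longleftrightarrow> (\<exists>m\<ge>1. \<forall>n\<ge>1. P (n + m) = P n)"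

definition aperiodic :: "(nat \<Rightarrow> 'y::metric_space \<Rightarrow> 'y) \<Rightarrow> bool" where
  "aperiodic S \<longleftrightarrow>
     (\<forall>P g y. periodic_seq P \<longrightarrow> continuous_on UNIV g \<longrightarrow>
        asymptotically_uncorrelated P (\<lambda>n. g (S n y)))"

definition mean_value :: "(nat \<Rightarrow> complex) \<Rightarrow> complex" where
  "mean_value \<eta> = lim (cesaro \<eta>)"


section \<open>Lie groups\<close>

text \<open>
  \<open>C_k_on k U f\<close> says that \<open>f\<close> is of class \<open>C\<^sup>k\<close> on \<open>U\<close>. It is meant for open \<open>U\<close> and a
  finite-dimensional domain, where continuity of all directional derivatives \<open>x \<mapsto> Df(x)v\<close>
  amounts to continuity of the derivative.
\<close>

primrec C_k_on ::
  "nat \<Rightarrow> 'a::real_normed_vector set \<Rightarrow> ('a \<Rightarrow> 'b::real_normed_vector) \<Rightarrow> bool" where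
  "C_k_on 0 U f \<longleftrightarrow> continuous_on U f"
| "C_k_on (Suc k) U f \<longleftrightarrow>
     (\<forall>x\<in>U. f differentiable (at x)) \<and> (\<forall>v. C_k_on k U (\<lambda>x. frechet_derivative f (at x) v))"

definition smooth_on ::
  "'a::real_normed_vector set \<Rightarrow> ('a \<Rightarrow> 'b::real_normed_vector) \<Rightarrow> bool" where
  "smooth_on U f \<longleftrightarrow> (\<forall>k. C_k_on k U f)"

text \<open>
  Charts \<open>(U, \<phi>)\<close> take values in a finite-dimensional normed space \<open>'e\<close>. The class
  \<^class>\<open>euclidean_space\<close> is not used for \<open>'e\<close> because it excludes dimension \<open>0\<close>, hence
  discrete Lie groups; the instance below provides a model space of dimension \<open>0\<close>.
\<close>

instantiation unit :: real_normed_vector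
begin

definition zero_unit :: unit where "zero_unit = ()"
definition plus_unit :: "unit \<Rightarrow> unit \<Rightarrow> unit" where "plus_unit x y = ()"
definition scaleR_unit :: "real \<Rightarrow> unit \<Rightarrow> unit" where "scaleR_unit r x = ()"
definition norm_unit :: "unit \<Rightarrow> real" where "norm_unit x = 0"
definition dist_unit :: "unit \<Rightarrow> unit \<Rightarrow> real" where "dist_unit x y = 0"
definition sgn_unit :: "unit \<Rightarrow> unit" where "sgn_unit x = ()"
definition uniformity_unit :: "(unit \<times> unit) filter" where
  "uniformity_unit = (INF e\<in>{0<..}. principal {(x, y). dist x y < e})"
definition open_unit :: "unit set \<Rightarrow> bool" where
  "open_unit U \<longleftrightarrow> (\<forall>x\<in>U. eventually (\<lambda>(x', y). x' = x \<longrightarrow> y \<in> U) uniformity)"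

instance
  by standard (simp_all add: norm_unit_def dist_unit_def uniformity_unit_def open_unit_def)

end

definition chart :: "'g topology \<Rightarrow> 'g set \<times> ('g \<Rightarrow> 'e::real_normed_vector) \<Rightarrow> bool" where
  "chart T = (\<lambda>(U, \<phi>).
     openin T U \<and> open (\<phi> ` U) \<and>
     homeomorphic_map (subtopology T U) (top_of_set (\<phi> ` U)) \<phi>)"

definition smooth_atlas ::
  "'g topology \<Rightarrow> ('g set \<times> ('g \<Rightarrow> 'e::real_normed_vector)) set \<Rightarrow> bool" where
  "smooth_atlas T \<A> \<longleftrightarrow>
     (\<forall>c\<in>\<A>. chart T c) \<and>
     (\<Union>(U, \<phi>)\<in>\<A>. U) = topspace T \<and>
     (\<forall>(U, \<phi>)\<in>\<A>. \<forall>(V, \<psi>)\<in>\<A>. smooth_on (\<phi> ` (U \<inter> V)) (\<psi> \<circ> inv_into U \<phi>))"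

locale lie_group = group G
  for G :: "('g, 'm) monoid_scheme" (structure) +
  fixes T :: "'g topology"
    and \<A> :: "('g set \<times> ('g \<Rightarrow> 'e::real_normed_vector)) set"
  assumes topspace_eq: "topspace T = carrier G"
    and hausdorff: "Hausdorff_space T"
    and second_count: "second_countable T"
    and finite_dim: "\<exists>B :: 'e set. finite B \<and> span B = UNIV"
    and atlas: "smooth_atlas T \<A>"
    and continuous_mult: "continuous_map (prod_topology T T) T (\<lambda>(x, y). x \<otimes> y)"
    and continuous_inv: "continuous_map T T (\<lambda>x. inv x)"
    and smooth_mult: "\<And>U \<phi> V \<psi> W \<theta>.
      \<lbrakk>(U, \<phi>) \<in> \<A>; (V, \<psi>) \<in> \<A>; (W, \<theta>) \<in> \<A>\<rbrakk> \<Longrightarrow>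
      smooth_on {(u, v). u \<in> \<phi> ` U \<and> v \<in> \<psi> ` V \<and> inv_into U \<phi> u \<otimes> inv_into V \<psi> v \<in> W}
        (\<lambda>(u, v). \<theta> (inv_into U \<phi> u \<otimes> inv_into V \<psi> v))"
    and smooth_inv: "\<And>U \<phi> W \<theta>.
      \<lbrakk>(U, \<phi>) \<in> \<A>; (W, \<theta>) \<in> \<A>\<rbrakk> \<Longrightarrow>
      smooth_on {u \<in> \<phi> ` U. inv (inv_into U \<phi> u) \<in> W} (\<lambda>u. \<theta> (inv (inv_into U \<phi> u)))"

primrec lower_central :: "('g, 'm) monoid_scheme \<Rightarrow> nat \<Rightarrow> 'g set" where
  "lower_central G 0 = carrier G"
| "lower_central G (Suc k) = generate G
     {x \<otimes>\<^bsub>G\<^esub> y \<otimes>\<^bsub>G\<^esub> inv\<^bsub>G\<^esub> x \<otimes>\<^bsub>G\<^esub> inv\<^bsub>G\<^esub> y | x y. x \<in> lower_central G k \<and> y \<in> carrier G}"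

definition nilpotent :: "('g, 'm) monoid_scheme \<Rightarrow> bool" where
  "nilpotent G \<longleftrightarrow> (\<exists>k. lower_central G k = {\<one>\<^bsub>G\<^esub>})"


section \<open>Nilsystems and nilsequences\<close>

definition quotient_topology :: "'a topology \<Rightarrow> ('a \<Rightarrow> 'b) \<Rightarrow> 'b topology" where
  "quotient_topology T q =
     topology (\<lambda>V. V \<subseteq> q ` topspace T \<and> openin T {x \<in> topspace T. q x \<in> V})"

lemma openin_quotient_topology:
  "openin (quotient_topology T q) V \<longleftrightarrow>
     V \<subseteq> q ` topspace T \<and> openin T {x \<in> topspace T. q x \<in> V}"
proof -
  have "istopology (\<lambda>V. V \<subseteq> q ` topspace T \<and> openin T {x \<in> topspace T. q x \<in> V})"
    (is "istopology ?L")
    unfolding istopology_def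
  proof (intro conjI allI impI)
    fix V W assume V: "?L V" and W: "?L W"
    have "{x \<in> topspace T. q x \<in> V \<inter> W} =
        {x \<in> topspace T. q x \<in> V} \<inter> {x \<in> topspace T. q x \<in> W}" by auto
    with V W show "openin T {x \<in> topspace T. q x \<in> V \<inter> W}" by auto
    from V show "V \<inter> W \<subseteq> q ` topspace T" by auto
  next
    fix \<V> assume *: "\<forall>V\<in>\<V>. ?L V"
    have "{x \<in> topspace T. q x \<in> \<Union>\<V>} = (\<Union>V\<in>\<V>. {x \<in> topspace T. q x \<in> V})" by auto
    with * show "openin T {x \<in> topspace T. q x \<in> \<Union>\<V>}" by auto
    from * show "\<Union>\<V> \<subseteq> q ` topspace T" by auto
  qed
  then show ?thesis by (simp add: quotient_topology_def)
qed

lemma topspace_quotient_topology [simp]: "topspace (quotient_topology T q) = q ` topspace T"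
proof (rule antisym)
  show "topspace (quotient_topology T q) \<subseteq> q ` topspace T"
    by (metis openin_quotient_topology openin_topspace)
  have "{x \<in> topspace T. q x \<in> q ` topspace T} = topspace T" by auto
  then have "openin (quotient_topology T q) (q ` topspace T)"
    by (simp add: openin_quotient_topology)
  then show "q ` topspace T \<subseteq> topspace (quotient_topology T q)"
    by (rule openin_subset)
qed

lemma quotient_map_quotient_topology: "quotient_map T (quotient_topology T q) q"
  by (auto simp: quotient_map_def openin_quotient_topology)

definition coset_space :: "('g, 'm) monoid_scheme \<Rightarrow> 'g topology \<Rightarrow> 'g set \<Rightarrow> 'g set topology" where
  "coset_space G T \<Gamma> = quotient_topology T (\<lambda>x. x <#\<^bsub>G\<^esub> \<Gamma>)"

locale nilsystem = lie_group G T \<A>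
  for G :: "('g, 'm) monoid_scheme" (structure) and T
    and \<A> :: "('g set \<times> ('g \<Rightarrow> 'e::real_normed_vector)) set" +
  fixes \<Gamma> :: "'g set" and a :: 'g
  assumes nilpotent: "nilpotent G"
    and subgroup: "subgroup \<Gamma> G"
    and discrete: "subtopology T \<Gamma> = discrete_topology \<Gamma>"
    and cocompact: "compact_space (coset_space G T \<Gamma>)"
    and translation: "a \<in> carrier G"

text \<open>
  HOL has no quantification over types, so the type \<open>'g\<close> carrying the group and the model
  space \<open>'e\<close> of the charts are arguments. A theorem assuming \<open>nilsequence TYPE('g) TYPE('e) \<eta>\<close>
  with type variables \<open>'g\<close>, \<open>'e\<close> covers nilsystems on every nilpotent Lie group.
\<close>

definition nilsequence ::
  "'g itself \<Rightarrow> 'e::real_normed_vector itself \<Rightarrow> (nat \<Rightarrow> complex) \<Rightarrow> bool" where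
  "nilsequence _ _ \<eta> \<longleftrightarrow>
     (\<exists>(G :: 'g monoid) T (\<A> :: ('g set \<times> ('g \<Rightarrow> 'e)) set) \<Gamma> a x f.
        nilsystem G T \<A> \<Gamma> a \<and>
        x \<in> lcosets\<^bsub>G\<^esub> \<Gamma> \<and>
        continuous_map (coset_space G T \<Gamma>) euclidean f \<and>
        (\<forall>n\<ge>1. \<eta> n = f (((\<lambda>z. a <#\<^bsub>G\<^esub> z) ^^ n) x)))"

end

(* Averages of g(S_n y). Aperiodicity applied to the indicator of the multiples of m shows that the
   averages of n |-> g(S_n y) up to N and of n |-> g(S_m S_n y) up to N/m agree asymptotically. If S_r = S_q
   for primes r < q, the averages of g o S_r are therefore invariant under the scale q/r, and by finite
   generation such scales come arbitrarily close to 1 for all primes r outside a set with convergent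
   reciprocal sum. So every weak limit of the empirical measures pretends to be invariant, and is nu.

   Nilsequences. After replacing the translation a by a power a^k, f(a^n x) is a uniform limit of sums of
   a constant and of sequences w such that w(pn) and w(qn) are asymptotically orthogonal whenever p ~= q
   are positive. To see this, G is replaced by a subgroup generated by a and a normal subgroup N which is
   generated by arbitrarily small elements and on which every continuous character trivial on Gamma and
   at a is trivial; since passing to kernels of characters decreases the dimension, such N exist. The
   function f splits into functions that transform by characters under a term of the lower central
   series of N, and for these van der Corput's inequality gives an induction along the series. The norm
   coming from a chart replaces the Lie algebra: small elements have small square roots.

   Correlation. On each residue class mod k a constant is periodic, and aperiodicity applies. For
   the sequences w, Katai's criterion applies: by the pigeonhole principle S_(pn) y = R (S_n y) with one
   map R for all p in a set of primes with divergent reciprocal sum. *)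
theory Submission
  imports Defs "HOL-Number_Theory.Number_Theory" "HOL-Computational_Algebra.Squarefree" "HOL-Real_Asymp.Real_Asymp" "HOL-Library.Product_Plus" "HOL-Algebra.Free_Abelian_Groups"
begin

section \<open>Averages and the van der Corput inequality\<close>

text \<open>Orthogonality of w(pn) and w(qn) is an averaging statement for the pair (a^p, a^q) on K
  x K. A function on which level j of the central series acts by characters psi1 and psi2 averages
  to 0 along this pair unless psi1^(p^(j+1)) psi2^(q^(j+1)) is trivial: a van der Corput derivative
  passes from level j+1 to level j, and the commutator with a contributes one more factor p or q.
  When psi2 is the conjugate of psi1, what remains is a power of psi1 whose exponent is nonzero
  exactly because p ~= q, and generation by small elements excludes nontrivial continuous characters
  with a trivial power. The splitting into functions with characters would usually come from Haar
  measure on a compact abelian quotient. Here an invariant mean on a discrete free abelian group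
  takes its place, and total boundedness of the translates of a function replaces compactness of the
  group.\<close>

lemma norm_cesaro_le:
 assumes "!!n. n >= 1 ==> norm (a n) <= B" "0 <= B"
 shows "norm (cesaro a N) <= B"
proof -
 have "norm (\<Sum>n=1..N. a n) <= of_nat (card {1..N}) * B"
  by (rule sum_norm_bound) (use assms in auto)
 thus ?thesis
  using assms(2) by (auto simp: cesaro_def norm_divide divide_simps mult.commute)
qed

lemma cesaro_add: "cesaro (\<lambda>n. a n + b n) N = cesaro a N + cesaro b N"
 by (simp add: cesaro_def sum.distrib add_divide_distrib)

lemma cesaro_diff: "cesaro (\<lambda>n. a n - b n) N = cesaro a N - cesaro b N"
 by (simp add: cesaro_def sum_subtractf diff_divide_distrib)

lemma cesaro_cmult: "cesaro (\<lambda>n. c * a n) N = c * cesaro a N"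
 by (simp add: cesaro_def sum_distrib_left)

lemma cesaro_cmult_right: "cesaro (\<lambda>n. a n * c) N = cesaro a N * c"
 by (simp add: cesaro_def sum_distrib_right)

lemma cesaro_sum: "cesaro (\<lambda>n. \<Sum>i\<in>I. a i n) N = (\<Sum>i\<in>I. cesaro (a i) N)"
 unfolding cesaro_def by (subst sum.swap) (simp add: sum_divide_distrib)

lemma cesaro_const: "N >= 1 ==> cesaro (\<lambda>_. c) N = c"
 by (simp add: cesaro_def)

lemma norm_cesaro_diff_le:
 assumes "!!n. n >= 1 ==> norm (a n - b n) <= e" "0 <= e"
 shows "norm (cesaro a N - cesaro b N) <= e"
 using norm_cesaro_le[of "\<lambda>n. a n - b n" e N] assms by (simp add: cesaro_diff)

lemma norm_cesaro_shift:
 assumes B: "!!n. norm (a n) <= B"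
 shows "norm (cesaro (\<lambda>n. a (n + h)) N - cesaro a N) <= 2 * B * real h / real N"
proof (cases "N = 0")
 case False
 have B0: "B >= 0" using B[of 0] norm_ge_zero order_trans by blast
 have eq: "(\<Sum>n=1..N. a (n + h)) - (\<Sum>n=1..N. a n) = (\<Sum>n=N+1..N+h. a n) - (\<Sum>n=1..h. a n)"
 proof (induction h)
  case (Suc h)
  have "(\<Sum>n=1..M. a (n + Suc h)) + a (Suc h) = (\<Sum>n=1..M. a (n + h)) + a (M + Suc h)" for M
   by (induction M) (simp_all add: algebra_simps)
  from this[of N] have "(\<Sum>n=1..N. a (n + Suc h)) = (\<Sum>n=1..N. a (n + h)) + a (N + Suc h) - a (Suc h)"
   by (metis add_diff_cancel_right')
  moreover have "(\<Sum>n=1..N. a (n + h)) = (\<Sum>n=1..N. a n) + (\<Sum>n=N+1..N+h. a n) - (\<Sum>n=1..h. a n)"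
   using Suc by (metis add_diff_eq diff_add_cancel add.commute)
  ultimately show ?case by simp
 qed auto
 have "norm (\<Sum>n=N+1..N+h. a n) <= of_nat (card {N+1..N+h}) * B"
  by (rule sum_norm_bound) (rule B)
 moreover have "norm (\<Sum>n=1..h. a n) <= of_nat (card {1..h}) * B"
  by (rule sum_norm_bound) (rule B)
 ultimately have "norm ((\<Sum>n=1..N. a (n + h)) - (\<Sum>n=1..N. a n)) <= 2 * B * real h"
  unfolding eq using norm_triangle_ineq4[of "\<Sum>n=N+1..N+h. a n" "\<Sum>n=1..h. a n"] by (simp add: algebra_simps)
 thus ?thesis
  by (simp add: cesaro_def norm_divide divide_right_mono flip: diff_divide_distrib)
qed (simp add: cesaro_def)

lemma norm_cesaro_power2_le:
 "(norm (cesaro a N))^2 <= (\<Sum>n=1..N. (norm (a n))^2) / real N"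
proof (cases "N = 0")
 case False
 have "(norm (\<Sum>n=1..N. a n))^2 <= (\<Sum>n=1..N. norm (a n) * 1)\<^sup>2"
  by (intro power_mono) (auto intro: order_trans[OF norm_sum])
 also have "... <= (\<Sum>n=1..N. (norm (a n))^2) * (\<Sum>n=1..N. 1^2)"
  by (rule Cauchy_Schwarz_ineq_sum)
 finally show ?thesis
  using False by (simp add: cesaro_def norm_divide power_divide divide_simps power2_eq_square)
qed (simp add: cesaro_def)

text \<open>For fixed \<open>h\<close> each distance \<open>d >= 1\<close> is attained by at most
  two \<open>h'\<close>, one on each side.\<close>

lemma sum_dist_le:
 fixes C :: "nat => real"
 assumes "!!d. C d >= 0" "h < H"
 shows "(\<Sum>h'<H. C (if h' <= h then h - h' else h' - h)) <= C 0 + 2 * (\<Sum>d=1..<H. C d)"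
proof -
 have *: "{..<H} = {..h} \<union> {h<..<H}" using assms by auto
 have "(\<Sum>h'<H. C (if h' <= h then h - h' else h' - h)) =
   (\<Sum>h'\<le>h. C (h - h')) + (\<Sum>h'\<in>{h<..<H}. C (h' - h))"
  unfolding * by (subst sum.union_disjoint) (auto intro!: sum.cong)
 also have "(\<Sum>h'\<le>h. C (h - h')) = (\<Sum>d\<le>h. C d)"
  by (rule sum.reindex_bij_witness[of _ "\<lambda>d. h - d" "\<lambda>d. h - d"]) auto
 also have "(\<Sum>h'\<in>{h<..<H}. C (h' - h)) = (\<Sum>d\<in>{1..<H-h}. C d)"
  by (rule sum.reindex_bij_witness[of _ "\<lambda>d. d + h" "\<lambda>d. d - h"]) auto
 also have "... <= (\<Sum>d=1..<H. C d)"
  by (rule sum_mono2) (use assms in auto)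
 also have "(\<Sum>d\<le>h. C d) = C 0 + (\<Sum>d\<in>{1..h}. C d)"
  by (simp add: atMost_atLeast0 sum.atLeast_Suc_atMost)
 also have "(\<Sum>d\<in>{1..h}. C d) <= (\<Sum>d=1..<H. C d)"
  by (rule sum_mono2) (use assms in auto)
 finally show ?thesis by simp
qed

text \<open>\<open>u\<close> is replaced by \<open>v\<close>, the mean of \<open>H\<close>
  consecutive terms, and Cauchy-Schwarz turns the square into correlations of shifts. The bound
  holds for each \<open>N\<close>, with errors only in \<open>r\<close>, so it applies to a whole
  family of sequences at once.\<close>

lemma van_der_corput_ineq:
 fixes u :: "nat => complex"
 assumes B: "!!n. norm (u n) <= B" and H: "H >= 1" and N: "N >= 1"
  and c: "!!d. 1 <= d ==> d < H ==> norm (cesaro (\<lambda>n. u (n + d) * cnj (u n)) N) <= c d"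
 defines "r \<equiv> real H / real N"
 shows "(norm (cesaro u N))^2 <= B\<^sup>2 / H + 2 / H * (\<Sum>d=1..<H. c d) + 4 * B^2 * r + 4 * B^2 * (r + r^2)"
proof -
 have B0: "B >= 0" using B[of 0] norm_ge_zero order_trans by blast
 have r0: "r >= 0" by (simp add: r_def)
 define v where "v n = (\<Sum>h<H. u (n + h)) / of_nat H" for n
 have vB: "norm (v n) <= B" for n
  using sum_norm_bound[of "{..<H}" "\<lambda>h. u (n + h)" B] B H
  by (simp add: v_def norm_divide divide_simps mult.commute)
 have "norm (cesaro v N - cesaro u N) <= 2 * B * r"
 proof -
  have "cesaro v N = (\<Sum>h<H. cesaro (\<lambda>n. u (n + h)) N) / of_nat H"
   unfolding v_def using cesaro_cmult_right[of "\<lambda>n. \<Sum>h<H. u (n + h)" "1 / of_nat H" N]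
   by (simp add: cesaro_sum)
  hence "cesaro v N - cesaro u N = (\<Sum>h<H. cesaro (\<lambda>n. u (n + h)) N - cesaro u N) / of_nat H"
   using H by (simp add: sum_subtractf field_simps)
  moreover have "norm (\<Sum>h<H. cesaro (\<lambda>n. u (n + h)) N - cesaro u N) <= of_nat (card {..<H}) * (2 * B * r)"
  proof (rule sum_norm_bound)
   fix h assume "h \<in> {..<H}"
   hence "2 * B * real h / real N <= 2 * B * r"
    using B0 unfolding r_def by (auto intro!: mult_left_mono divide_right_mono simp flip: times_divide_eq_right)
   thus "norm (cesaro (\<lambda>n. u (n + h)) N - cesaro u N) <= 2 * B * r"
    using norm_cesaro_shift[of u B h N, OF B] by linarith
  qed
  ultimately show ?thesis using H by (simp only: norm_divide norm_of_nat) (simp add: pos_divide_le_eq mult.commute)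
 qed
 hence n1: "norm (cesaro u N) <= norm (cesaro v N) + 2 * B * r"
  using norm_triangle_ineq2[of "cesaro u N" "cesaro v N"] by (simp add: norm_minus_commute)
 have n2: "norm (cesaro v N) <= B" by (rule norm_cesaro_le) (use vB B0 in auto)
 \<comment> \<open>\<open>c d\<close> concerns the shifts \<open>d\<close> and \<open>0\<close>; the
   extra \<open>2 * B^2 * r\<close> pays for moving the pair \<open>h\<close>, \<open>h'\<close>
   there. The value 0 from \<open>H\<close> on keeps \<open>C\<close> nonnegative
   everywhere.\<close>
 define C where "C d = (if d = 0 then B\<^sup>2 else if d < H then c d + 2 * B^2 * r else 0)" for d
 have C0: "C d >= 0" for d
  using order_trans[OF norm_ge_zero c[of d]] B0 r0 by (auto simp: C_def intro!: add_nonneg_nonneg)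
 define w where "w h h' = cesaro (\<lambda>n. u (n + h) * cnj (u (n + h'))) N" for h h'
 have w: "norm (w h h') <= C (h - h')" if "h' <= h" "h < H" for h h'
 proof (cases "h = h'")
  case True
  show ?thesis unfolding w_def C_def using True B B0
   by (auto intro!: norm_cesaro_le simp: norm_mult power2_eq_square mult_mono)
 next
  case False
  define d where "d = h - h'"
  have d: "1 <= d" "d < H" "h = h' + d" using that False by (auto simp: d_def)
  have "norm (cesaro (\<lambda>n. u (n + h' + d) * cnj (u (n + h'))) N - cesaro (\<lambda>n. u (n + d) * cnj (u n)) N)
    <= 2 * B^2 * real h' / real N"
   by (rule norm_cesaro_shift[of "\<lambda>n. u (n + d) * cnj (u n)" "B^2" h' N])
    (use B B0 in "auto simp: norm_mult power2_eq_square mult_mono")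
  also have "... <= 2 * B^2 * r"
   unfolding r_def using that by (auto intro!: mult_left_mono divide_right_mono simp flip: times_divide_eq_right)
  finally have "norm (w h h') <= norm (cesaro (\<lambda>n. u (n + d) * cnj (u n)) N) + 2 * B^2 * r"
   unfolding w_def d(3) add.assoc[symmetric]
   using norm_triangle_ineq2[of "cesaro (\<lambda>n. u (n + h' + d) * cnj (u (n + h'))) N"
     "cesaro (\<lambda>n. u (n + d) * cnj (u n)) N"] by linarith
  with c[OF d(1,2)] show ?thesis using d by (simp add: C_def)
 qed
 have wsym: "norm (w h h') = norm (w h' h)" for h h'
 proof -
  have "w h h' = cnj (w h' h)" by (simp add: w_def cesaro_def mult.commute)
  thus ?thesis by simp
 qed
 have "(\<Sum>n=1..N. (norm (v n))^2) / real N = Re (\<Sum>h<H. \<Sum>h'<H. w h h') / H^2"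
 proof -
  have "complex_of_real ((\<Sum>n=1..N. (norm (v n))^2) / real N) = cesaro (\<lambda>n. v n * cnj (v n)) N"
   by (simp only: cesaro_def complex_norm_square[symmetric]) simp
  also have "... = cesaro (\<lambda>n. \<Sum>h<H. \<Sum>h'<H. u (n + h) * cnj (u (n + h'))) N / of_nat (H^2)"
   using cesaro_cmult_right[of "\<lambda>n. \<Sum>h<H. \<Sum>h'<H. u (n + h) * cnj (u (n + h'))" "1 / of_nat (H^2)" N]
   by (simp add: v_def sum_product power2_eq_square)
  also have "... = (\<Sum>h<H. \<Sum>h'<H. w h h') / of_nat (H^2)"
   by (simp only: cesaro_sum w_def)
  finally have "Re (complex_of_real ((\<Sum>n=1..N. (norm (v n))^2) / real N)) = Re ((\<Sum>h<H. \<Sum>h'<H. w h h') / of_nat (H^2))"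
   by simp
  thus ?thesis unfolding Re_divide_of_nat by simp
 qed
 also have "Re (\<Sum>h<H. \<Sum>h'<H. w h h') <= (\<Sum>h<H. \<Sum>h'<H. norm (w h h'))"
  by (intro order_trans[OF complex_Re_le_cmod] order_trans[OF norm_sum] sum_mono norm_sum)
 also have "... <= (\<Sum>h<H. \<Sum>h'<H. C (if h' <= h then h - h' else h' - h))"
 proof (intro sum_mono)
  fix h h' assume "h \<in> {..<H}" "h' \<in> {..<H}"
  thus "norm (w h h') <= C (if h' <= h then h - h' else h' - h)"
   using w[of h' h] w[of h h'] wsym[of h h'] by auto
 qed
 also have "... <= (\<Sum>h<H. C 0 + 2 * (\<Sum>d=1..<H. C d))"
  by (intro sum_mono sum_dist_le C0) auto
 also have "... = H * (B^2 + 2 * (\<Sum>d=1..<H. c d + 2 * B^2 * r))"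
  by (simp add: C_def)
 also have "... <= H * (B^2 + 2 * (\<Sum>d=1..<H. c d) + 4 * B^2 * r * H)"
  using H r0 by (intro mult_left_mono) (auto simp: sum.distrib algebra_simps of_nat_diff)
 also have "... / H^2 = B^2 / H + 2 / H * (\<Sum>d=1..<H. c d) + 4 * B^2 * r"
  using H by (simp add: field_simps power2_eq_square)
 finally have "(\<Sum>n=1..N. (norm (v n))^2) / real N <= B\<^sup>2 / H + 2 / H * (\<Sum>d=1..<H. c d) + 4 * B^2 * r"
  using H by (simp add: divide_right_mono)
 hence n3: "(norm (cesaro v N))^2 <= B\<^sup>2 / H + 2 / H * (\<Sum>d=1..<H. c d) + 4 * B^2 * r"
  using norm_cesaro_power2_le[of v N] by linarith
 have "(norm (cesaro u N))^2 <= (norm (cesaro v N) + 2 * B * r)\<^sup>2"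
  by (intro power_mono n1) auto
 also have "... = (norm (cesaro v N))^2 + 4 * B * r * norm (cesaro v N) + 4 * B^2 * r^2"
  by (simp add: power2_eq_square algebra_simps)
 also have "4 * B * r * norm (cesaro v N) <= 4 * B * r * B"
  using n2 B0 r0 by (intro mult_left_mono) auto
 finally show ?thesis using n3 by (simp add: power2_eq_square algebra_simps)
qed

text \<open>Only finitely many shifts \<open>d < H\<close> occur and \<open>B\<close> is common to
  all \<open>z\<close>, so one threshold for \<open>N\<close> serves the whole family;
  \<open>e\<close> absorbs the terms in \<open>H / N\<close>.\<close>

lemma van_der_corput_uniform:
 fixes u :: "'z => nat => complex" and H :: nat and B e :: real
 assumes B: "!!z n. z \<in> Z ==> norm (u z n) <= B" and H: "H >= 1" and e: "e > 0"
  and c: "!!d. 1 <= d ==> d < H ==>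
   \<forall>\<^sub>F N in sequentially. \<forall>z\<in>Z. norm (cesaro (\<lambda>n. u z (n + d) * cnj (u z n)) N) <= c d"
 shows "\<forall>\<^sub>F N in sequentially. \<forall>z\<in>Z. (norm (cesaro (u z) N))^2 <= B\<^sup>2 / H + 2 / H * (\<Sum>d=1..<H. c d) + e"
proof -
 have c': "\<forall>\<^sub>F N in sequentially. \<forall>d\<in>{1..<H}. \<forall>z\<in>Z.
   norm (cesaro (\<lambda>n. u z (n + d) * cnj (u z n)) N) <= c d"
  by (rule eventually_ball_finite) (use c in auto)
 have "(\<lambda>N. 4 * B^2 * (real H / real N) + 4 * B^2 * ((real H / real N) + (real H / real N)^2)) \<longlonglongrightarrow>
   4 * B^2 * 0 + 4 * B^2 * (0 + 0^2)"
  by (intro tendsto_intros lim_const_over_n)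
 hence "\<forall>\<^sub>F N in sequentially. 4 * B^2 * (real H / real N) +
   4 * B^2 * ((real H / real N) + (real H / real N)^2) < e"
  by (rule order_tendstoD) (use e in auto)
 with c' eventually_ge_at_top[of 1] show ?thesis
 proof eventually_elim
  case (elim N)
  show ?case
  proof
   fix z assume z: "z \<in> Z"
   show "(norm (cesaro (u z) N))^2 <= B\<^sup>2 / H + 2 / H * (\<Sum>d=1..<H. c d) + e"
    using van_der_corput_ineq[of "u z" B H N c] B z H elim by fastforce
  qed
 qed
qed

section \<open>Divergence of the sum of the reciprocals of primes\<close>

text \<open>Phrased by finite partial sums, so that the negation is a plain upper bound and finite
  unions can be handled by pigeonhole.\<close>

definition recip_divergent :: "nat set => bool" where
 "recip_divergent P \<equiv> (\<forall>L. \<exists>F\<subseteq>P. finite F & (\<Sum>p\<in>F. 1 / real p) >= L)"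

lemma recip_divergent_Un:
 assumes "recip_divergent (A \<union> B)"
 shows "recip_divergent A \<or> recip_divergent B"
proof (rule ccontr)
 assume "\<not> ?thesis"
 then obtain L M where L: "!!F. F \<subseteq> A ==> finite F ==> (\<Sum>p\<in>F. 1 / real p) < L"
  and M: "!!F. F \<subseteq> B ==> finite F ==> (\<Sum>p\<in>F. 1 / real p) < M"
  unfolding recip_divergent_def by (meson not_le)
 obtain F where F: "F \<subseteq> A \<union> B" "finite F" "(\<Sum>p\<in>F. 1 / real p) >= L + M"
  using assms unfolding recip_divergent_def by blast
 have "(\<Sum>p\<in>F. 1 / real p) = (\<Sum>p\<in>F \<inter> A. 1 / real p) + (\<Sum>p\<in>F - A. 1 / real p)"
  using F(2) by (rule sum.Int_Diff)
 moreover have "(\<Sum>p\<in>F \<inter> A. 1 / real p) < L" "(\<Sum>p\<in>F - A. 1 / real p) < M"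
  using F by (auto intro!: L M)
 ultimately show False using F(3) by linarith
qed

lemma recip_divergent_finite_cover:
 assumes "finite I" "recip_divergent (\<Union>i\<in>I. A i)"
 shows "\<exists>i\<in>I. recip_divergent (A i)"
 using assms
proof (induction I rule: finite_induct)
 case empty
 hence False by (simp add: recip_divergent_def) (metis not_one_le_zero)
 thus ?case ..
next
 case (insert i I)
 thus ?case using recip_divergent_Un[of "A i" "\<Union>i\<in>I. A i"] by auto
qed

lemma not_recip_divergent_finite: "finite A ==> \<not> recip_divergent A"
proof
 assume A: "finite A" "recip_divergent A"
 then obtain F where F: "F \<subseteq> A" "(\<Sum>p\<in>F. 1 / real p) >= (\<Sum>p\<in>A. 1 / real p) + 1"
  unfolding recip_divergent_def by blast
 moreover have "(\<Sum>p\<in>F. 1 / real p) <= (\<Sum>p\<in>A. 1 / real p)"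
  by (rule sum_mono2) (use A F in auto)
 ultimately show False by linarith
qed

lemma sum_multiples:
 fixes f :: "nat => 'a::comm_monoid_add"
 assumes "d > 0"
 shows "(\<Sum>n=1..N. if d dvd n then f n else 0) = (\<Sum>m=1..N div d. f (d * m))"
proof -
 have "(\<Sum>n=1..N. if d dvd n then f n else 0) = (\<Sum>n\<in>{n\<in>{1..N}. d dvd n}. f n)"
  by (rule sum.inter_filter[symmetric]) simp
 also have "... = (\<Sum>m=1..N div d. f (d * m))"
  by (rule sum.reindex_bij_witness[of _ "\<lambda>m. d * m" "\<lambda>n. n div d"])
   (use assms in "auto simp: less_eq_div_iff_mult_less_eq div_le_mono dvd_div_eq_0_iff mult.commute
    Suc_le_eq div_greater_zero_iff dvd_imp_le")
 finally show ?thesis .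
qed

lemma card_multiples: "d > 0 ==> card {n\<in>{1..N}. d dvd n} = N div d" for d N :: nat
 using sum_multiples[where f = "\<lambda>_. 1::nat" and d = d and N = N] by (simp add: sum.inter_filter[symmetric])

text \<open>Erdos's argument: if the primes outside a finite set \<open>F\<close> had reciprocal sum at most \<open>1/2\<close>,
 at least half of the integers up to \<open>N\<close> would be products of a square and a squarefree
 \<open>F\<close>-smooth number, but there are only \<open>O(sqrt N)\<close> of these.\<close>

lemma recip_divergent_primes: "recip_divergent {p. prime p}"
proof (rule ccontr)
 assume "\<not> ?thesis"
 then obtain L where L: "!!F. F \<subseteq> {p. prime p} ==> finite F ==> (\<Sum>p\<in>F. 1 / real p) <= L"
  unfolding recip_divergent_def by (meson linear)
 define S where "S = (\<lambda>F. \<Sum>p\<in>F. 1 / real p) ` {F. F \<subseteq> {p. prime p} & finite F}"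
 have bdd: "bdd_above S" using L by (auto simp: S_def bdd_above_def)
 have ne: "S ~= {}" by (auto simp: S_def)
 obtain F where F: "F \<subseteq> {p. prime p}" "finite F" "(\<Sum>p\<in>F. 1 / real p) > Sup S - 1/2"
  using less_cSup_iff[OF ne bdd, of "Sup S - 1/2"] by (auto simp: S_def)
 have tail: "(\<Sum>p\<in>Q. 1 / real p) <= 1/2" if Q: "Q \<subseteq> {p. prime p} - F" "finite Q" for Q
 proof -
  have "(\<Sum>p\<in>F \<union> Q. 1 / real p) <= Sup S"
   by (rule cSup_upper[OF _ bdd]) (use Q F in "auto simp: S_def")
  moreover have "(\<Sum>p\<in>F \<union> Q. 1 / real p) = (\<Sum>p\<in>F. 1 / real p) + (\<Sum>p\<in>Q. 1 / real p)"
   by (rule sum.union_disjoint) (use Q F in auto)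
  ultimately show ?thesis using F(3) by linarith
 qed
 \<comment> \<open>There are at most \<open>2 ^ card F * sqrt N\<close> smooth numbers, which is
   less than \<open>N / 2\<close> because \<open>sqrt N\<close> exceeds
   \<open>2 * 2 ^ card F\<close>.\<close>
 define N where "N = (2 * 2 ^ card F + 1 :: nat)^2"
 define sm where "sm = {n\<in>{1..N}. prime_factors n \<subseteq> F}"
 define Q where "Q = {p. prime p & p <= N} - F"
 have fQ: "finite Q" by (auto simp: Q_def)
 have "{1..N} \<subseteq> sm \<union> (\<Union>p\<in>Q. {n\<in>{1..N}. p dvd n})"
 proof
  fix n assume n: "n \<in> {1..N}"
  show "n \<in> sm \<union> (\<Union>p\<in>Q. {n\<in>{1..N}. p dvd n})"
  proof (cases "prime_factors n \<subseteq> F")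
   case False
   then obtain p where p: "p \<in> prime_factors n" "p \<notin> F" by auto
   hence "p dvd n" "prime p" by (auto simp: in_prime_factors_iff)
   moreover have "p <= N" using dvd_imp_le[OF \<open>p dvd n\<close>] n by simp
   ultimately have "p \<in> Q" using p by (simp add: Q_def)
   with \<open>p dvd n\<close> n show ?thesis by blast
  qed (use n in "simp add: sm_def")
 qed
 hence "card {1..N} <= card (sm \<union> (\<Union>p\<in>Q. {n\<in>{1..N}. p dvd n}))"
  by (rule card_mono[rotated]) (use fQ in "auto simp: sm_def")
 also have "... <= card sm + card (\<Union>p\<in>Q. {n\<in>{1..N}. p dvd n})" by (rule card_Un_le)
 also have "card (\<Union>p\<in>Q. {n\<in>{1..N}. p dvd n}) <= (\<Sum>p\<in>Q. card {n\<in>{1..N}. p dvd n})"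
  by (rule card_UN_le[OF fQ])
 also have "... = (\<Sum>p\<in>Q. N div p)"
  by (rule sum.cong[OF refl], rule card_multiples) (auto simp: Q_def prime_gt_0_nat)
 finally have "real N <= real (card sm) + (\<Sum>p\<in>Q. real (N div p))"
  by (simp flip: of_nat_sum of_nat_add)
 also have "(\<Sum>p\<in>Q. real (N div p)) <= (\<Sum>p\<in>Q. N * (1 / real p))"
  by (intro sum_mono) (use of_nat_div_le_of_nat in "simp")
 also have "... = N * (\<Sum>p\<in>Q. 1 / real p)" by (simp add: sum_distrib_left)
 also have "... <= N * (1/2)" by (intro mult_left_mono tail) (use fQ in "auto simp: Q_def")
 finally have half: "real N <= 2 * real (card sm)" by simp
 define h where "h n = (prime_factors (squarefree_part n), square_part n)" for n :: nat
 have "inj_on h sm"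
 proof (rule inj_onI)
  fix m n assume mn: "m \<in> sm" "n \<in> sm" "h m = h n"
  hence "prime_factors (squarefree_part m) = prime_factors (squarefree_part n)" by (simp add: h_def)
  moreover have "squarefree_part k = \<Prod>(prime_factors (squarefree_part k))" if "k \<in> sm" for k
  proof -
   have k: "squarefree_part k ~= 0" "squarefree (squarefree_part k)" using that by (auto simp: sm_def)
   have "squarefree_part k = (\<Prod>p\<in>prime_factors (squarefree_part k). p ^ multiplicity p (squarefree_part k))"
    by (rule prime_factorization_nat) (use k in "simp only: bot_nat_0.not_eq_extremum")
   also have "... = (\<Prod>p\<in>prime_factors (squarefree_part k). p)"
    using k squarefree_factorial_semiring'[of "squarefree_part k"] by (intro prod.cong) auto
   finally show ?thesis by simp
  qed
  ultimately have "squarefree_part m = squarefree_part n" using mn by metis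
  moreover have "square_part m = square_part n" using mn by (simp add: h_def)
  ultimately show "m = n" by (metis squarefree_decompose)
 qed
 moreover have "h ` sm \<subseteq> Pow F \<times> {1..2 * 2 ^ card F + 1}"
 proof
  fix x assume "x \<in> h ` sm"
  then obtain n where n: "n \<in> sm" "x = h n" by auto
  have n0: "n ~= 0" "n <= N" using n by (auto simp: sm_def)
  have d: "n = squarefree_part n * square_part n ^ 2" by (rule squarefree_decompose)
  have "prime_factors (squarefree_part n) \<subseteq> prime_factors n"
   using n0 by (intro dvd_prime_factors) (metis d dvd_triv_left, metis d dvd_triv_left)
  moreover have "(square_part n)^2 <= N"
   by (metis d dvd_imp_le dvd_triv_right n0 le_trans not_gr_zero)
  hence "square_part n <= 2 * 2 ^ card F + 1" unfolding N_def using power2_nat_le_eq_le by blast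
  moreover have "square_part n >= 1" using n0 d by (metis Suc_leI bot_nat_0.not_eq_extremum mult_0_right power2_eq_square One_nat_def)
  ultimately show "x \<in> Pow F \<times> {1..2 * 2 ^ card F + 1}" using n by (auto simp: h_def sm_def)
 qed
 ultimately have "card sm <= card (Pow F \<times> {1..2 * 2 ^ card F + 1::nat})"
  using F(2) by (intro card_inj_on_le[of h]) auto
 also have "... = 2 ^ card F * (2 * 2 ^ card F + 1)"
  using F(2) by (simp add: card_cartesian_product card_Pow)
 finally have "N <= 2 * (2 ^ card F * (2 * 2 ^ card F + 1))" using half by linarith
 thus False by (simp add: N_def power2_eq_square)
qed

section \<open>Katai's orthogonality criterion\<close>

lemma div_over_n_tendsto:
 assumes "d > 0"
 shows "(\<lambda>N. real (N div d) / real N) \<longlonglongrightarrow> 1 / real d"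
proof -
 have "(\<lambda>N. real_of_int \<lfloor>real N / real d\<rfloor> / real N) \<longlonglongrightarrow> 1 / real d"
  using assms by (real_asymp simp: inverse_eq_divide)
 thus ?thesis by (simp add: floor_divide_of_nat_eq)
qed

lemma sum_upto_div:
 fixes f :: "nat => 'a::comm_monoid_add"
 assumes "d > 0"
 shows "(\<Sum>m=1..N div d. f m) = (\<Sum>m=1..N. if d * m <= N then f m else 0)"
proof -
 have "m <= N" if "m * d <= N" for m using le_trans[OF _ that, of m] assms by simp
 hence "{1..N div d} = {m\<in>{1..N}. d * m <= N}"
  using assms by (auto simp: less_eq_div_iff_mult_less_eq mult.commute)
 thus ?thesis by (simp only: sum.inter_filter finite_atLeastAtMost)
qed

lemma sum_swap3: "(\<Sum>n\<in>A. \<Sum>p\<in>F. \<Sum>q\<in>G. f n p q) = (\<Sum>p\<in>F. \<Sum>q\<in>G. \<Sum>n\<in>A. f n p q)"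
 by (subst sum.swap, rule sum.cong[OF refl], rule sum.swap)

text \<open>For fixed \<open>F\<close> the second moment of \<open>omega\<close> is a finite
  combination of the densities \<open>(N div d) / N\<close>, which converge. Distinct primes are
  coprime, so the limiting variance is at most \<open>L\<close>; the slack 1 in \<open>L + 1\<close>
  absorbs the convergence.\<close>

lemma turan_kubilius:
 fixes F :: "nat set"
 assumes F: "finite F" "!!p. p \<in> F ==> prime p"
 defines "L \<equiv> \<Sum>p\<in>F. 1 / real p"
 defines "omega \<equiv> \<lambda>n. \<Sum>p\<in>F. of_bool (p dvd n) :: real"
 shows "\<forall>\<^sub>F N in sequentially. (\<Sum>n=1..N. (omega n - L)^2) <= real N * (L + 1)"
proof -
 have lcm0: "lcm p q > 0" if "p \<in> F" "q \<in> F" for p q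
  using F(2) that prime_gt_0_nat by (simp add: lcm_pos_nat)
 have cnt: "(\<Sum>n=1..N. of_bool (d dvd n) :: real) = real (N div d)" if "d > 0" for d N
  using sum_multiples[OF that, where f = "\<lambda>_. 1::real"] by (simp add: of_bool_def)
 have eq: "(\<Sum>n=1..N. (omega n - L)^2) / real N =
   (\<Sum>p\<in>F. \<Sum>q\<in>F. real (N div lcm p q) / real N)
   - 2 * L * (\<Sum>p\<in>F. real (N div p) / real N) + L^2" if "N > 0" for N
 proof -
  have "(omega n - L)^2 = (\<Sum>p\<in>F. \<Sum>q\<in>F. of_bool (lcm p q dvd n)) - 2 * L * omega n + L^2" for n
  proof -
   have "omega n * omega n = (\<Sum>p\<in>F. \<Sum>q\<in>F. of_bool (p dvd n) * of_bool (q dvd n))"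
    unfolding omega_def by (rule sum_product)
   also have "... = (\<Sum>p\<in>F. \<Sum>q\<in>F. of_bool (lcm p q dvd n))"
    by (intro sum.cong refl) (auto simp: lcm_least_iff)
   finally show ?thesis by (simp add: power2_eq_square algebra_simps)
  qed
  hence "(\<Sum>n=1..N. (omega n - L)^2) =
    (\<Sum>n=1..N. \<Sum>p\<in>F. \<Sum>q\<in>F. of_bool (lcm p q dvd n)) -
    2 * L * (\<Sum>n=1..N. omega n) + real N * L^2"
   by (simp add: sum.distrib sum_subtractf flip: sum_distrib_left)
  also have "... =
    (\<Sum>p\<in>F. \<Sum>q\<in>F. \<Sum>n=1..N. of_bool (lcm p q dvd n)) -
    2 * L * (\<Sum>p\<in>F. \<Sum>n=1..N. of_bool (p dvd n)) + real N * L^2"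
   unfolding omega_def by (intro arg_cong2[where f = "(-)"] arg_cong2[where f = "(+)"] arg_cong2[where f = "(*)"]
    refl sum_swap3 sum.swap)
  also have "(\<Sum>p\<in>F. \<Sum>n=1..N. of_bool (p dvd n) :: real) = (\<Sum>p\<in>F. real (N div p))"
   by (intro sum.cong cnt refl) (use F prime_gt_0_nat in auto)
  also have "(\<Sum>p\<in>F. \<Sum>q\<in>F. \<Sum>n=1..N. of_bool (lcm p q dvd n) :: real) =
    (\<Sum>p\<in>F. \<Sum>q\<in>F. real (N div lcm p q))"
   by (intro sum.cong cnt refl lcm0)
  finally show ?thesis using that by (simp add: add_divide_distrib diff_divide_distrib flip: sum_divide_distrib)
 qed
 define R where "R N = (\<Sum>p\<in>F. \<Sum>q\<in>F. real (N div lcm p q) / real N)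
   - 2 * L * (\<Sum>p\<in>F. real (N div p) / real N) + L^2" for N
 have "R \<longlonglongrightarrow> (\<Sum>p\<in>F. \<Sum>q\<in>F. 1 / real (lcm p q)) - 2 * L * (\<Sum>p\<in>F. 1 / real p) + L^2"
  unfolding R_def by (intro tendsto_add tendsto_diff tendsto_sum tendsto_mult_left tendsto_const div_over_n_tendsto lcm0) (use F prime_gt_0_nat in auto)
 moreover have "(\<Sum>p\<in>F. \<Sum>q\<in>F. 1 / real (lcm p q)) <= L + L^2"
 proof -
  have "(\<Sum>p\<in>F. \<Sum>q\<in>F. 1 / real (lcm p q)) <=
    (\<Sum>p\<in>F. \<Sum>q\<in>F. (if p = q then 1 / real p else 0) + 1 / real p * (1 / real q))"
  proof (intro sum_mono)
   fix p q assume pq: "p \<in> F" "q \<in> F"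
   show "1 / real (lcm p q) <= (if p = q then 1 / real p else 0) + 1 / real p * (1 / real q)"
    using lcm_coprime[OF primes_coprime, of p q] F(2) pq by auto
  qed
  also have "... = L + L^2"
   using F(1) by (simp add: sum.distrib L_def power2_eq_square sum_product)
  finally show ?thesis .
 qed
 ultimately have "(\<Sum>p\<in>F. \<Sum>q\<in>F. 1 / real (lcm p q)) - 2 * L * (\<Sum>p\<in>F. 1 / real p) + L^2 < L + 1"
  by (simp add: L_def[symmetric] power2_eq_square)
 hence "\<forall>\<^sub>F N in sequentially. R N < L + 1"
  using \<open>R \<longlonglongrightarrow> _\<close> order_tendstoD(2) by blast
 with eventually_gt_at_top[of 0] show ?thesis
 proof eventually_elim
  case (elim N)
  hence "(\<Sum>n=1..N. (omega n - L)^2) / real N <= L + 1" using eq[of N] R_def by simp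
  thus ?case using elim by (simp add: divide_simps mult.commute)
 qed
qed

lemma filterlim_div_at_top: "d > 0 ==> filterlim (\<lambda>N. N div d) sequentially sequentially" for d :: nat
 unfolding filterlim_at_top
proof
 fix Z assume "d > 0"
 show "\<forall>\<^sub>F N in sequentially. Z <= N div d"
  using eventually_ge_at_top[of "Z * d"]
  by eventually_elim (use \<open>d > 0\<close> in "simp add: less_eq_div_iff_mult_less_eq")
qed

text \<open>By Turan-Kubilius \<open>omega\<close> is close to \<open>L\<close> on average, so
  \<open>eta n * a n\<close> may be weighted by \<open>omega n / L\<close>. Writing
  \<open>n = p * m\<close> and using \<open>a (p * m) = h m\<close> leaves \<open>h m\<close> times
  a sum over \<open>p\<close>. Cauchy-Schwarz in \<open>m\<close> removes \<open>h\<close>, and of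
  the remaining correlations of \<open>eta\<close> only the diagonal \<open>p = q\<close> survives.
  Both errors are of order \<open>sqrt L\<close>, while \<open>L\<close> is unbounded. A common
  \<open>h\<close> for all \<open>p\<close> in \<open>P\<close> takes the place of multiplicativity
  of \<open>a\<close>.\<close>

theorem katai_criterion:
 fixes eta a h :: "nat => complex"
 assumes B': "!!n. norm (eta n) <= B'" "!!n. norm (a n) <= B'"
  and P: "!!p. p \<in> P ==> prime p" "recip_divergent P"
  and h: "!!p n. p \<in> P ==> n >= 1 ==> a (p * n) = h n"
  and corr: "!!p q. p \<in> P ==> q \<in> P ==> p ~= q ==> cesaro (\<lambda>n. eta (p * n) * cnj (eta (q * n))) \<longlonglongrightarrow> 0"
 shows "cesaro (\<lambda>n. eta n * a n) \<longlonglongrightarrow> 0"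
proof -
 define B where "B = B' + 1"
 have B: "norm (eta n) <= B" "norm (a n) <= B" for n using B'[of n] by (auto simp: B_def)
 have "B' >= 0" using B'(1)[of 0] norm_ge_zero order_trans by blast
 hence B1: "B > 0" and B0: "B >= 0" by (auto simp: B_def)
 have hB: "norm (h n) <= B" if "n >= 1" for n
 proof -
  have "P ~= {}" using P(2) not_recip_divergent_finite by blast
  thus ?thesis using h[OF _ that] B(2) by (metis ex_in_conv)
 qed
 have key: "\<forall>\<^sub>F N in sequentially. norm (cesaro (\<lambda>n. eta n * a n) N) * L <= B\<^sup>2 * sqrt (L + 1) + B * sqrt (B^2 * L + 1)"
  if F: "F \<subseteq> P" "finite F" "L = (\<Sum>p\<in>F. 1 / real p)" for F L
 proof -
  have Fp: "p > 0" "prime p" if "p \<in> F" for p using that F P(1) prime_gt_0_nat by auto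
  have L0: "L >= 0" unfolding F by (simp add: sum_nonneg)
  define omega where "omega n = (\<Sum>p\<in>F. of_bool (p dvd n) :: real)" for n
  have corr2: "\<forall>\<^sub>F N in sequentially. \<forall>p\<in>F. \<forall>q\<in>F. p ~= q -->
    norm (cesaro (\<lambda>n. eta (p * n) * cnj (eta (q * n))) (N div max p q)) <= 1 / (real (card F) ^ 2 + 1)"
  proof (intro eventually_ball_finite ballI F(2))
   fix p q assume pq: "p \<in> F" "q \<in> F"
   show "\<forall>\<^sub>F N in sequentially. p ~= q -->
    norm (cesaro (\<lambda>n. eta (p * n) * cnj (eta (q * n))) (N div max p q)) <= 1 / (real (card F) ^ 2 + 1)"
   proof (cases "p = q")
    case False
    have "filterlim (\<lambda>N. N div max p q) sequentially sequentially"
     by (rule filterlim_div_at_top) (use Fp(1)[OF pq(1)] in "simp add: less_max_iff_disj")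
    moreover have "cesaro (\<lambda>n. eta (p * n) * cnj (eta (q * n))) \<longlonglongrightarrow> 0"
     by (rule corr) (use False pq F in auto)
    ultimately have "(\<lambda>N. cesaro (\<lambda>n. eta (p * n) * cnj (eta (q * n))) (N div max p q)) \<longlonglongrightarrow> 0"
     by (rule filterlim_compose[rotated])
    hence "(\<lambda>N. norm (cesaro (\<lambda>n. eta (p * n) * cnj (eta (q * n))) (N div max p q))) \<longlonglongrightarrow> 0"
     by (rule tendsto_norm_zero)
    hence "\<forall>\<^sub>F N in sequentially. norm (cesaro (\<lambda>n. eta (p * n) * cnj (eta (q * n))) (N div max p q)) < 1 / (real (card F) ^ 2 + 1)"
     by (rule order_tendstoD) (simp add: add_nonneg_pos)
    thus ?thesis by eventually_elim simp
   qed simp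
  qed
  have TK: "\<forall>\<^sub>F N in sequentially. (\<Sum>n=1..N. (omega n - L)^2) <= real N * (L + 1)"
   unfolding omega_def F(3) by (rule turan_kubilius) (use F(2) Fp in auto)
  show ?thesis using corr2 TK eventually_ge_at_top[of 1]
  proof eventually_elim
   case (elim N)
   \<comment> \<open>There are at most \<open>card F ^ 2\<close> off-diagonal pairs, so errors of
     size \<open>N * e\<close> add up to at most \<open>N\<close>.\<close>
   define e where "e = 1 / (real (card F) ^ 2 + 1)"
   have e: "e > 0" "real (card F) ^ 2 * e <= 1" by (auto simp: e_def add_nonneg_pos divide_simps)
   define S where "S = (\<Sum>n=1..N. eta n * a n * of_real (omega n))"
   have 1: "(\<Sum>n=1..N. eta n * a n) * of_real L = S - (\<Sum>n=1..N. eta n * a n * of_real (omega n - L))"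
    by (simp add: S_def algebra_simps sum_subtractf sum_distrib_left sum_distrib_right)
   have 2: "norm (\<Sum>n=1..N. eta n * a n * of_real (omega n - L)) <= B\<^sup>2 * (real N * sqrt (L + 1))"
   proof -
    have "norm (\<Sum>n=1..N. eta n * a n * of_real (omega n - L)) <= (\<Sum>n=1..N. B^2 * (1 * \<bar>omega n - L\<bar>))"
    proof (rule order_trans[OF norm_sum], rule sum_mono)
     fix n
     have "norm (eta n) * norm (a n) <= B * B" by (intro mult_mono B) (use B0 in auto)
     thus "norm (eta n * a n * of_real (omega n - L)) <= B\<^sup>2 * (1 * \<bar>omega n - L\<bar>)"
      by (simp add: norm_mult power2_eq_square mult_right_mono del: of_real_diff)
    qed
    also have "... = B^2 * (\<Sum>n=1..N. 1 * \<bar>omega n - L\<bar>)" by (simp add: sum_distrib_left)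
    also have "(\<Sum>n=1..N. 1 * \<bar>omega n - L\<bar>) <= sqrt ((\<Sum>n=1..N. 1^2) * (\<Sum>n=1..N. \<bar>omega n - L\<bar>\<^sup>2))"
     by (rule real_le_rsqrt) (rule Cauchy_Schwarz_ineq_sum)
    also have "... <= sqrt (real N * (real N * (L + 1)))"
     by (rule real_sqrt_le_mono) (use elim in "auto intro!: mult_left_mono")
    also have "... = real N * sqrt (L + 1)" by (simp add: real_sqrt_mult flip: mult.assoc)
    finally show ?thesis by (simp add: mult_left_mono)
   qed
   define X where "X m = (\<Sum>p\<in>F. if p * m <= N then eta (p * m) else 0)" for m
   have "S = (\<Sum>p\<in>F. \<Sum>n=1..N. if p dvd n then eta n * a n else 0)"
    unfolding S_def omega_def by (subst sum.swap) (auto simp: sum_distrib_left intro!: sum.cong)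
   also have "... = (\<Sum>p\<in>F. \<Sum>m=1..N div p. eta (p * m) * h m)"
   proof (rule sum.cong[OF refl])
    fix p assume p: "p \<in> F"
    have "(\<Sum>n=1..N. if p dvd n then eta n * a n else 0) = (\<Sum>m=1..N div p. eta (p * m) * a (p * m))"
     by (rule sum_multiples) (use Fp p in auto)
    also have "... = (\<Sum>m=1..N div p. eta (p * m) * h m)"
     by (intro sum.cong) (use h p F in auto)
    finally show "(\<Sum>n=1..N. if p dvd n then eta n * a n else 0) = (\<Sum>m=1..N div p. eta (p * m) * h m)" .
   qed
   also have "... = (\<Sum>p\<in>F. \<Sum>m=1..N. h m * (if p * m <= N then eta (p * m) else 0))"
   proof (rule sum.cong[OF refl])
    fix p assume p: "p \<in> F"
    show "(\<Sum>m=1..N div p. eta (p * m) * h m) = (\<Sum>m=1..N. h m * (if p * m <= N then eta (p * m) else 0))"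
     unfolding sum_upto_div[OF Fp(1)[OF p]] by (intro sum.cong) (auto simp: mult.commute)
   qed
   also have "... = (\<Sum>m=1..N. h m * X m)"
    unfolding X_def by (subst sum.swap) (simp add: sum_distrib_left)
   finally have S: "S = (\<Sum>m=1..N. h m * X m)" .
   have "(\<Sum>m=1..N. (norm (X m))^2) <= real N * (B^2 * L + 1)"
   proof -
    define Y where "Y p q = (\<Sum>m=1..N div max p q. eta (p * m) * cnj (eta (q * m)))" for p q
    have "complex_of_real (\<Sum>m=1..N. (norm (X m))^2) = (\<Sum>m=1..N. X m * cnj (X m))"
     by (simp only: of_real_sum complex_norm_square)
    also have "... = (\<Sum>m=1..N. \<Sum>p\<in>F. \<Sum>q\<in>F. if max p q * m <= N then eta (p * m) * cnj (eta (q * m)) else 0)"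
     unfolding X_def cnj_sum sum_product by (intro sum.cong refl) (auto simp: nat_mult_max_left)
    also have "... = (\<Sum>p\<in>F. \<Sum>q\<in>F. \<Sum>m=1..N. if max p q * m <= N then eta (p * m) * cnj (eta (q * m)) else 0)"
     by (rule sum_swap3)
    also have "... = (\<Sum>p\<in>F. \<Sum>q\<in>F. Y p q)"
    proof (rule sum.cong[OF refl], rule sum.cong[OF refl])
     fix p q assume "p \<in> F" "q \<in> F"
     hence "max p q > 0" using Fp(1)[of p] by (simp add: less_max_iff_disj)
     thus "(\<Sum>m=1..N. if max p q * m <= N then eta (p * m) * cnj (eta (q * m)) else 0) = Y p q"
      unfolding Y_def by (rule sum_upto_div[symmetric])
    qed
    finally have "(\<Sum>m=1..N. (norm (X m))^2) = Re (\<Sum>p\<in>F. \<Sum>q\<in>F. Y p q)"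
     by (metis Re_complex_of_real)
    also have "... <= (\<Sum>p\<in>F. \<Sum>q\<in>F. norm (Y p q))"
     by (intro order_trans[OF complex_Re_le_cmod] order_trans[OF norm_sum] sum_mono norm_sum)
    also have "... <= (\<Sum>p\<in>F. \<Sum>q\<in>F. (if p = q then B\<^sup>2 * (N * (1 / p)) else 0) + N * e)"
    proof (intro sum_mono)
     fix p q assume pq: "p \<in> F" "q \<in> F"
     show "norm (Y p q) <= (if p = q then B\<^sup>2 * (N * (1 / p)) else 0) + N * e"
     proof (cases "p = q")
      case True
      have "norm (Y p q) <= of_nat (card {1..N div p}) * B^2"
       unfolding Y_def True max.idem
       by (rule sum_norm_bound) (use B B0 in "auto simp: norm_mult power2_eq_square intro!: mult_mono")
      also have "... <= (real N / real p) * B^2"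
       by (intro mult_right_mono) (auto simp: of_nat_div_le_of_nat)
      finally show ?thesis using True e by (simp add: mult.commute add_increasing2)
     next
      case False
      have "norm (Y p q) = real (N div max p q) * norm (cesaro (\<lambda>n. eta (p * n) * cnj (eta (q * n))) (N div max p q))"
       by (simp add: Y_def cesaro_def norm_divide)
      also have "... <= real N * e"
       by (intro mult_mono) (use elim(1) pq False in "auto simp: e_def")
      finally show ?thesis using False by simp
     qed
    qed
    also have "... = B^2 * N * L + N * (real (card F) ^ 2 * e)"
     using F(2) by (simp add: sum.distrib F(3) sum_distrib_left power2_eq_square)
    also have "... <= real N * (B^2 * L + 1)"
     using mult_left_mono[OF e(2), of "real N"] by (simp add: algebra_simps)
    finally show ?thesis .
   qed
   moreover have "(norm S)^2 <= (\<Sum>m=1..N. (norm (h m))^2) * (\<Sum>m=1..N. (norm (X m))^2)"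
   proof -
    have "norm S <= (\<Sum>m=1..N. norm (h m) * norm (X m))"
     unfolding S by (rule order_trans[OF norm_sum]) (simp add: norm_mult)
    hence "(norm S)^2 <= (\<Sum>m=1..N. norm (h m) * norm (X m))\<^sup>2" by (simp add: power_mono)
    also have "... <= (\<Sum>m=1..N. (norm (h m))^2) * (\<Sum>m=1..N. (norm (X m))^2)"
     by (rule Cauchy_Schwarz_ineq_sum)
    finally show ?thesis .
   qed
   moreover have "(\<Sum>m=1..N. (norm (h m))^2) <= real N * B^2"
    using sum_bounded_above[of "{1..N}" "\<lambda>m. (norm (h m))^2" "B^2"] hB by (auto simp: power_mono)
   moreover have "(\<Sum>m=1..N. (norm (h m))^2) * (\<Sum>m=1..N. (norm (X m))^2) <=
     (real N * B^2) * (real N * (B^2 * L + 1))"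
    by (intro mult_mono calculation) (auto intro: sum_nonneg)
   ultimately have "(norm S)^2 <= (real N * B^2) * (real N * (B^2 * L + 1))"
    by linarith
   also have "... = (real N * (B * sqrt (B^2 * L + 1)))^2"
    using L0 by (simp add: power_mult_distrib power2_eq_square)
   finally have 3: "norm S <= real N * (B * sqrt (B^2 * L + 1))"
    by (rule power2_le_imp_le) (use B0 L0 in simp)
   have "norm (\<Sum>n=1..N. eta n * a n) * L = norm ((\<Sum>n=1..N. eta n * a n) * of_real L)"
    using L0 by (simp add: norm_mult)
   also have "... <= real N * (B^2 * sqrt (L + 1) + B * sqrt (B^2 * L + 1))"
    unfolding 1 using norm_triangle_ineq4[of S "\<Sum>n=1..N. eta n * a n * of_real (omega n - L)"] 2 3
    by (simp add: algebra_simps)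
   finally show ?case
    using elim(3) by (simp add: cesaro_def norm_divide divide_simps mult.commute)
  qed
 qed
 show ?thesis
 proof (rule tendstoI)
  fix \<epsilon> :: real assume \<epsilon>: "\<epsilon> > 0"
  have "((\<lambda>L. (B^2 * sqrt (L + 1) + B * sqrt (B^2 * L + 1)) / L) \<longlongrightarrow> 0) at_top"
   using B1 by real_asymp
  hence "\<forall>\<^sub>F L in at_top. (B^2 * sqrt (L + 1) + B * sqrt (B^2 * L + 1)) / L < \<epsilon>"
   using \<epsilon> by (rule order_tendstoD)
  then obtain L0 where L0: "!!L. L >= L0 ==> (B^2 * sqrt (L + 1) + B * sqrt (B^2 * L + 1)) / L < \<epsilon>"
   by (auto simp: eventually_at_top_linorder)
  obtain F where F: "F \<subseteq> P" "finite F" "(\<Sum>p\<in>F. 1 / real p) >= max L0 1"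
   using P(2) unfolding recip_divergent_def by blast
  define L where "L = (\<Sum>p\<in>F. 1 / real p)"
  have L: "L >= L0" "L > 0" using F by (auto simp: L_def)
  from key[OF F(1,2) L_def] show "\<forall>\<^sub>F N in sequentially. dist (cesaro (\<lambda>n. eta n * a n) N) 0 < \<epsilon>"
  proof eventually_elim
   case (elim N)
   hence "norm (cesaro (\<lambda>n. eta n * a n) N) <= (B^2 * sqrt (L + 1) + B * sqrt (B^2 * L + 1)) / L"
    using L by (simp add: divide_simps mult.commute)
   also have "... < \<epsilon>" using L0 L by blast
   finally show ?case by simp
  qed
 qed
qed

section \<open>Weak limits of empirical measures on a compact metric space\<close>

text \<open>The points of the space are coded by ternary expansions recording membership in a countable
 family of balls. Closeness of codes forces closeness of points, so that the decoding extends
 continuously to the closure of the set of codes and Helly's selection theorem on the real line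
 applies.\<close>

definition digit_code :: "(nat => 'y set) => 'y => real" where
 "digit_code b y = suminf (\<lambda>i. of_bool (y \<in> b i) * (1/3) ^ i)"

lemma digit_code_summable: "summable (\<lambda>i. of_bool (y \<in> b i) * (1/3 :: real) ^ i)"
 by (rule summable_comparison_test[of _ "\<lambda>i. (1/3 :: real) ^ i"]) (auto intro!: summable_geometric exI[of _ 0])

text \<open>All digits after position \<open>i\<close> together weigh at most
  \<open>(1/3) ^ i / 2\<close>, half of one digit at \<open>i\<close>. So the first differing digit
  already separates the codes; base 2 would leave no gap.\<close>

lemma digit_code_close:
 assumes "\<bar>digit_code b y - digit_code b y'\<bar> < (1/3) ^ K / 2" "i < K"
 shows "y \<in> b i \<longleftrightarrow> y' \<in> b i"
 using assms(2)
proof (induction i rule: less_induct)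
 case (less i)
 define d where "d y k = of_bool (y \<in> b k) * (1/3 :: real) ^ k" for y k
 have sm: "summable (d y)" for y unfolding d_def by (rule digit_code_summable)
 have split: "digit_code b y = (\<Sum>k<i. d y k) + d y i + suminf (\<lambda>k. d y (k + Suc i))" for y
  unfolding digit_code_def d_def[symmetric]
  using suminf_split_initial_segment[OF sm, of y "Suc i"] by simp
 have "(\<Sum>k<i. d y k) = (\<Sum>k<i. d y' k)"
  by (rule sum.cong) (use less in "auto simp: d_def")
 hence eq: "digit_code b y - digit_code b y' = (d y i - d y' i) + (suminf (\<lambda>k. d y (k + Suc i)) - suminf (\<lambda>k. d y' (k + Suc i)))"
  by (simp add: split)
 have g: "(\<lambda>k. (1/3 :: real) ^ (k + Suc i)) sums ((1/3) ^ i / 2)"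
  using sums_mult2[OF geometric_sums[of "1/3::real"], of "(1/3) ^ Suc i"] by (simp add: power_add mult.commute)
 have tail: "0 <= suminf (\<lambda>k. d y (k + Suc i))" "suminf (\<lambda>k. d y (k + Suc i)) <= (1/3) ^ i / 2" for y
 proof -
  have s: "summable (\<lambda>k. d y (k + Suc i))" using sm by (rule summable_ignore_initial_segment)
  show "0 <= suminf (\<lambda>k. d y (k + Suc i))" by (rule suminf_nonneg[OF s]) (auto simp: d_def)
  have "suminf (\<lambda>k. d y (k + Suc i)) <= suminf (\<lambda>k. (1/3 :: real) ^ (k + Suc i))"
   by (rule suminf_le[OF _ s sums_summable[OF g]]) (simp add: d_def)
  thus "suminf (\<lambda>k. d y (k + Suc i)) <= (1/3) ^ i / 2" using sums_unique[OF g] by simp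
 qed
 have pw: "(1/3 :: real) ^ K <= (1/3) ^ i" using less by (intro power_decreasing) auto
 show ?case
 proof (rule ccontr)
  assume "\<not> ?thesis"
  hence "\<bar>d y i - d y' i\<bar> = (1/3) ^ i" by (auto simp: d_def)
  hence "\<bar>digit_code b y - digit_code b y'\<bar> >= (1/3) ^ i / 2"
   using eq tail[of y] tail[of y'] by linarith
  with assms(1) pw show False by linarith
 qed
qed

text \<open>The balls come from finite covers with radius \<open>1 / (j + 1)\<close> for every
  \<open>j\<close>. If two codes agree on all digits belonging to level \<open>j\<close>, both
  points lie in one ball of that level.\<close>

lemma compact_separating_code:
 assumes "compact (UNIV :: 'y::metric_space set)"
 obtains c :: "'y::metric_space => real" where "!!y. \<bar>c y\<bar> <= 2"
  "!!e. e > 0 ==> \<exists>d>0. \<forall>y y'. \<bar>c y - c y'\<bar> < d --> dist y y' < e"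
proof -
 have "\<exists>F. finite F & (UNIV :: 'y set) \<subseteq> (\<Union>x\<in>F. ball x (1 / real (Suc j)))" for j
 proof -
  have "(UNIV :: 'y set) \<subseteq> (\<Union>x\<in>UNIV. ball x (1 / real (Suc j)))"
   by (meson UNIV_I UN_I centre_in_ball of_nat_0_less_iff subsetI zero_less_Suc zero_less_divide_1_iff)
  from compactE_image[OF assms open_ball this] show ?thesis by metis
 qed
 then obtain F where F: "!!j. finite (F j)" "!!j. (UNIV :: 'y set) \<subseteq> (\<Union>x\<in>F j. ball x (1 / real (Suc j)))"
  by metis
 define D where "D = (\<Union>j. F j \<times> {j})"
 have cD: "countable D" unfolding D_def
  by (rule countable_UN) (auto intro!: countable_finite F(1) finite_cartesian_product)
 have "D ~= {}"
 proof -
  have "F 0 ~= {}" using F(2)[of 0] by (metis UN_empty UNIV_not_empty subset_empty)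
  then obtain x where "x \<in> F 0" by blast
  thus ?thesis by (auto simp: D_def)
 qed
 with cD have D: "range (from_nat_into D) = D" by (simp add: range_from_nat_into)
 define b where "b i = (case from_nat_into D i of (x, j) => ball x (1 / real (Suc j)))" for i
 show ?thesis
 proof (rule that[of "digit_code b"])
  fix y
  have "digit_code b y <= suminf (\<lambda>i. (1/3 :: real) ^ i)" unfolding digit_code_def
   by (rule suminf_le[OF _ digit_code_summable]) (auto intro: summable_geometric)
  moreover have "0 <= digit_code b y" unfolding digit_code_def
   by (rule suminf_nonneg[OF digit_code_summable]) simp
  ultimately show "\<bar>digit_code b y\<bar> <= 2" by (simp add: suminf_geometric)
 next
  fix e :: real assume "e > 0"
  then obtain j where j: "1 / real (Suc j) < e / 2"
   by (metis half_gt_zero_iff nat_approx_posE)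
  define K where "K = Suc (Max (to_nat_on D ` (F j \<times> {j})))"
  show "\<exists>d>0. \<forall>y y'. \<bar>digit_code b y - digit_code b y'\<bar> < d --> dist y y' < e"
  proof (intro exI conjI allI impI)
   fix y y' assume y: "\<bar>digit_code b y - digit_code b y'\<bar> < (1/3) ^ K / 2"
   obtain x where x: "x \<in> F j" "y \<in> ball x (1 / real (Suc j))" using F(2)[of j] by blast
   define i where "i = to_nat_on D (x, j)"
   have "i < K" unfolding K_def i_def using F(1)[of j] x by (simp add: less_Suc_eq_le)
   moreover have "b i = ball x (1 / real (Suc j))"
    using cD x by (simp add: b_def i_def D_def)
   ultimately have "y' \<in> ball x (1 / real (Suc j))" using digit_code_close[OF y] x by blast
   with x j have "dist x y < e / 2" "dist x y' < e / 2" by auto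
   thus "dist y y' < e" by (rule dist_triangle_half_r)
  qed simp
 qed
qed

text \<open>\<open>c\<close> itself need not be continuous. But points whose codes are near the same
  real number are close together, so a limit of codes singles out a point, and this point moves
  little with the limit.\<close>

lemma compact_code_decode:
 assumes comp: "compact (UNIV :: 'y::metric_space set)"
 obtains c :: "'y::metric_space => real" and dec :: "real => 'y" where
  "!!y. \<bar>c y\<bar> <= 2" "!!y. dec (c y) = y" "continuous_on (closure (range c)) dec"
proof -
 obtain c :: "'y => real" where cB: "!!y. \<bar>c y\<bar> <= 2" and c: "!!e. e > 0 ==> \<exists>d>0. \<forall>y y'. \<bar>c y - c y'\<bar> < d --> dist y y' < e"
  using compact_separating_code[OF comp] by blast
 define lim where "lim t y \<longleftrightarrow> (\<forall>e>0. \<exists>d>0. \<forall>y'. \<bar>c y' - t\<bar> < d --> dist y' y < e)" for t y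
 have ex: "\<exists>y. lim t y" if t: "t \<in> closure (range c)" for t
 proof -
  obtain f where f: "!!n. f n \<in> range c" "f \<longlonglongrightarrow> t" using t unfolding closure_sequential by blast
  have "\<exists>y. f n = c y" for n using f(1)[of n] by (rule rangeE) blast
  then obtain u where u: "!!n. f n = c (u n)" by metis
  obtain y r where r: "strict_mono (r :: nat => nat)" "(u \<circ> r) \<longlonglongrightarrow> y"
   using comp unfolding compact_eq_seq_compact_metric seq_compact_def by blast
  have "lim t y" unfolding lim_def
  proof (intro allI impI)
   fix e :: real assume "e > 0"
   then obtain d where d: "d > 0" "!!y y'. \<bar>c y - c y'\<bar> < d ==> dist y y' < e / 2"
    using c[of "e/2"] by auto
   show "\<exists>d>0. \<forall>y'. \<bar>c y' - t\<bar> < d --> dist y' y < e"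
   proof (intro exI[of _ "d/2"] conjI allI impI)
    fix y' assume y': "\<bar>c y' - t\<bar> < d / 2"
    have "\<forall>\<^sub>F n in sequentially. dist (f (r n)) t < d / 2"
     using LIMSEQ_subseq_LIMSEQ[OF f(2) r(1)] half_gt_zero[OF d(1)] unfolding tendsto_iff o_def by blast
    moreover have "\<forall>\<^sub>F n in sequentially. dist (u (r n)) y < e / 2"
     using r(2) half_gt_zero[OF \<open>e > 0\<close>] unfolding tendsto_iff o_def by blast
    ultimately have "\<forall>\<^sub>F n in sequentially. dist (f (r n)) t < d / 2 & dist (u (r n)) y < e / 2"
     by eventually_elim simp
    then obtain n where n: "dist (f (r n)) t < d / 2" "dist (u (r n)) y < e / 2"
     using eventually_happens'[OF sequentially_bot] by blast
    have "\<bar>c y' - c (u (r n))\<bar> < d" using n(1) y' unfolding u dist_real_def by linarith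
    hence "dist y' (u (r n)) < e / 2" by (rule d(2))
    thus "dist y' y < e" using n(2) dist_triangle[of y' y "u (r n)"] by linarith
   qed (use d in simp)
  qed
  thus ?thesis ..
 qed
 define dec where "dec t = (SOME y. lim t y)" for t
 have dec: "lim t (dec t)" if "t \<in> closure (range c)" for t
  unfolding dec_def using ex[OF that] by (rule someI_ex)
 show ?thesis
 proof (rule that[of c dec])
  fix y
  show "\<bar>c y\<bar> <= 2" by (rule cB)
  have "lim (c y) (dec (c y))" by (rule dec) (simp add: closure_def)
  hence "dist y (dec (c y)) < e" if "e > 0" for e using that unfolding lim_def by (metis abs_zero diff_self)
  hence "\<not> dist y (dec (c y)) > 0" by blast
  thus "dec (c y) = y" by simp
 next
  show "continuous_on (closure (range c)) dec"
   unfolding continuous_on_iff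
  proof (intro ballI allI impI)
   fix t e assume t: "t \<in> closure (range c)" and e: "(e :: real) > 0"
   obtain d where d: "d > 0" "!!y'. \<bar>c y' - t\<bar> < d ==> dist y' (dec t) < e / 2"
    using dec[OF t] e unfolding lim_def by (metis half_gt_zero)
   show "\<exists>d>0. \<forall>t'\<in>closure (range c). dist t' t < d --> dist (dec t') (dec t) < e"
   proof (intro exI[of _ "d/2"] conjI ballI impI)
    fix t' assume t': "t' \<in> closure (range c)" "dist t' t < d / 2"
    obtain d' where d': "d' > 0" "!!y'. \<bar>c y' - t'\<bar> < d' ==> dist y' (dec t') < e / 2"
     using dec[OF t'(1)] e unfolding lim_def by (metis half_gt_zero)
    obtain y' where y': "dist (c y') t' < min (d/2) d'"
     using t'(1) d(1) d'(1) unfolding closure_approachable by (metis imageE half_gt_zero min_less_iff_conj)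
    have "dist y' (dec t') < e / 2" by (rule d') (use y' in "simp add: dist_real_def")
    moreover have "dist y' (dec t) < e / 2"
    proof (rule d)
     show "\<bar>c y' - t\<bar> < d" using y' t'(2) unfolding dist_real_def min_less_iff_conj by linarith
    qed
    ultimately show "dist (dec t') (dec t) < e" by (metis dist_commute dist_triangle_half_l)
   qed (use d in simp)
  qed
 qed
qed

lemma empirical_weak_limit:
 fixes u :: "nat => 'y::metric_space" and s :: "nat => nat"
 assumes comp: "compact (UNIV :: 'y set)" and s: "!!k. s k >= 1"
 obtains r \<mu> where "strict_mono (r :: nat => nat)" "borel_probability \<mu>"
  "!!f :: 'y => real. continuous_on UNIV f ==>
    (\<lambda>k. (\<Sum>n=1..s (r k). f (u n)) / real (s (r k))) \<longlonglongrightarrow> (\<integral>x. f x \<partial>\<mu>)"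
proof -
 obtain c :: "'y => real" and dec where B: "!!y. \<bar>c y\<bar> <= 2"
  and c: "!!y. dec (c y) = y" "continuous_on (closure (range c)) dec"
  by (rule compact_code_decode[OF comp]) blast
 define E where "E = closure (range c)"
 have E: "closed E" "E ~= {}" by (auto simp: E_def)
 have cE: "c y \<in> E" for y unfolding E_def by (rule subsetD[OF closure_subset]) simp
 \<comment> \<open>The source measure is discrete, so that \<open>c\<close> may be an arbitrary
   function.\<close>
 define \<mu> where "\<mu> k = distr (measure_pmf (pmf_of_set {1..s k})) borel (c \<circ> u)" for k

 have rd: "real_distribution (\<mu> k)" for k
  unfolding \<mu>_def real_distribution_def real_distribution_axioms_def
  by (auto intro!: prob_space.prob_space_distr measure_pmf.prob_space_axioms)
 have int: "integral\<^sup>L (\<mu> k) f = (\<Sum>n=1..s k. f (c (u n))) / real (s k)"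
  if "f \<in> borel_measurable borel" for f :: "real => real" and k
  unfolding \<mu>_def using s[of k] that
  by (subst integral_distr) (auto simp: integral_pmf_of_set o_def)
 have "tight \<mu>" unfolding tight_def
 proof (intro conjI allI impI rd)
  fix e :: real assume "e > 0"
  have "- 3 < c y" "c y <= 2" for y using B[of y] by linarith+
  hence "measure (\<mu> k) {- 3<..2} = 1" for k
   unfolding \<mu>_def by (subst measure_distr) (auto simp: measure_pmf.prob_eq_1 intro!: AE_I2)
  thus "\<exists>a b. a < b & (\<forall>n. measure (\<mu> n) {a<..b} > 1 - e)"
   using \<open>e > 0\<close> by (intro exI[of _ "-3"] exI[of _ 2]) auto
 qed
 from tight_imp_convergent_subsubsequence[OF this strict_mono_id]
 obtain r M where r: "strict_mono (r :: nat => nat)" "real_distribution M" "weak_conv_m (\<mu> \<circ> r) M"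
  by auto
 interpret M: real_distribution M by fact
 have bM: "f \<in> borel_measurable M" if "f \<in> borel_measurable borel" for f :: "real => real"
  using that by simp
 have conv: "(\<lambda>k. (\<Sum>n=1..s (r k). f (c (u n))) / real (s (r k))) \<longlonglongrightarrow> integral\<^sup>L M f"
  if f: "continuous_on UNIV f" "!!x. \<bar>f x\<bar> <= C" for f :: "real => real" and C
 proof -
  have "(\<lambda>k. integral\<^sup>L ((\<mu> \<circ> r) k) f) \<longlonglongrightarrow> integral\<^sup>L M f"
   by (rule weak_conv_imp_integral_bdd_continuous_conv[OF _ r(2,3), of f C])
    (use f rd in "auto simp: o_def continuous_on_eq_continuous_at")
  thus ?thesis by (simp add: int borel_measurable_continuous_onI f o_def)
 qed
 \<comment> \<open>Tested against the truncated distance to \<open>E\<close>, which vanishes at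
   every code.\<close>
 have ME: "AE x in M. x \<in> E"
 proof -
  let ?f = "\<lambda>x. min 1 (infdist x E)"
  have cf: "continuous_on UNIV ?f" by (intro continuous_intros)
  have "(\<lambda>k. (\<Sum>n=1..s (r k). ?f (c (u n))) / real (s (r k))) \<longlonglongrightarrow> integral\<^sup>L M ?f"
   by (rule conv[OF cf, of 1]) (auto simp: infdist_nonneg)
  hence "(\<lambda>k. 0) \<longlonglongrightarrow> integral\<^sup>L M ?f" using cE by simp
  hence "integral\<^sup>L M ?f = 0" using LIMSEQ_unique tendsto_const by blast
  moreover have "integrable M ?f"
   by (rule M.integrable_const_bound[of _ 1])
    (auto simp: infdist_nonneg intro!: bM borel_measurable_continuous_onI[OF cf])
  ultimately have "AE x in M. ?f x = 0"
   using integral_nonneg_eq_0_iff_AE[of M ?f] by (auto simp: infdist_nonneg)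
  thus ?thesis
   by eventually_elim (use E in_closed_iff_infdist_zero in "auto simp: min_def split: if_splits")
 qed
 define dec' where "dec' t = (if t \<in> E then dec t else dec 0)" for t
 have meas: "dec' \<in> M \<rightarrow>\<^sub>M borel"
  using borel_measurable_continuous_on_if[of E dec "\<lambda>_. dec 0"] E c(2)
  unfolding dec'_def E_def[symmetric] by (simp add: measurable_cong_sets[OF M.events_eq_borel refl])
 define nu where "nu = distr M borel dec'"
 show ?thesis
 proof (rule that[OF r(1)])
  show "borel_probability nu"
   unfolding borel_probability_def nu_def by (simp add: M.prob_space_distr[OF meas])
  fix f :: "'y => real" assume f: "continuous_on UNIV f"
  have "bounded (range f)" using compact_continuous_image[OF f comp] compact_imp_bounded by blast
  then obtain C where C: "!!y. \<bar>f y\<bar> <= C" unfolding bounded_iff by auto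
  have "continuous_on E (f \<circ> dec)"
   using c(2) f unfolding E_def[symmetric] by (intro continuous_on_compose) (auto intro: continuous_on_subset)
  \<comment> \<open>\<open>f\<close> after \<open>dec\<close> lives on \<open>E\<close> only; its
    Tietze extension is a bounded continuous function on the line, to which weak convergence
    applies.\<close>
  then obtain phi where phi: "continuous_on UNIV phi" "!!x. x \<in> E ==> phi x = (f \<circ> dec) x" "!!x. norm (phi x) <= C"
  proof (rule Tietze[of E "f \<circ> dec" UNIV C])
   show "0 <= C" using C[of undefined] by linarith
  qed (use E C in auto)
  have "(\<lambda>k. (\<Sum>n=1..s (r k). phi (c (u n))) / real (s (r k))) \<longlonglongrightarrow> integral\<^sup>L M phi"
   by (rule conv[OF phi(1), of C]) (use phi(3) in auto)
  also have "integral\<^sup>L M phi = integral\<^sup>L M (\<lambda>x. f (dec' x))"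
  proof (rule integral_cong_AE)
   show "phi \<in> borel_measurable M" by (intro bM borel_measurable_continuous_onI phi)
   show "(\<lambda>x. f (dec' x)) \<in> borel_measurable M"
    by (rule measurable_compose[OF meas borel_measurable_continuous_onI[OF f]])
   show "AE x in M. phi x = f (dec' x)"
    using ME by eventually_elim (simp add: phi(2) dec'_def)
  qed
  also have "... = integral\<^sup>L nu f"
   unfolding nu_def by (rule integral_distr[symmetric, OF meas]) (use f in "rule borel_measurable_continuous_onI")
  finally show "(\<lambda>k. (\<Sum>n=1..s (r k). f (u n)) / real (s (r k))) \<longlonglongrightarrow> (\<integral>x. f x \<partial>nu)"
   using phi(2) cE c(1) by simp
 qed
qed

text \<open>Indicators of closed sets are pointwise limits of the functions
  \<open>max 0 (1 - k * infdist x C)\<close>, and closed sets form an intersection-stable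
  generator.\<close>

lemma borel_probability_eqI:
 fixes \<mu> nu :: "'y::metric_space measure"
 assumes \<mu>: "borel_probability \<mu>" and nu: "borel_probability nu"
  and eq: "!!f :: 'y => real. continuous_on UNIV f ==> (!!x. 0 <= f x & f x <= 1) ==> (\<integral>x. f x \<partial>\<mu>) = (\<integral>x. f x \<partial>nu)"
 shows "\<mu> = nu"
proof -
 interpret \<mu>: prob_space \<mu> using \<mu> by (simp add: borel_probability_def)
 interpret nu: prob_space nu using nu by (simp add: borel_probability_def)
 have sets: "sets \<mu> = sets borel" "sets nu = sets borel" using \<mu> nu by (auto simp: borel_probability_def)
 have lim: "(\<lambda>k. \<integral>x. max 0 (1 - real k * infdist x C) \<partial>M) \<longlonglongrightarrow> measure M C"
  if C: "closed C" "C ~= {}" and M: "prob_space M" "sets M = sets borel" for M and C :: "'y set"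
 proof -
  interpret M: prob_space M by fact
  have [measurable]: "C \<in> sets M" using C M by simp
  have bm: "f \<in> borel_measurable M" if "continuous_on UNIV f" for f :: "'y => real"
   using borel_measurable_continuous_onI[OF that] unfolding measurable_cong_sets[OF M(2) refl] .
  have "(\<lambda>k. \<integral>x. max 0 (1 - real k * infdist x C) \<partial>M) \<longlonglongrightarrow> (\<integral>x. indicator C x \<partial>M)"
  proof (rule integral_dominated_convergence[where w = "\<lambda>_. 1"])
   show "(\<lambda>x. max 0 (1 - real k * infdist x C)) \<in> borel_measurable M" for k
    by (intro bm continuous_intros)
   show "AE x in M. (\<lambda>k. max 0 (1 - real k * infdist x C)) \<longlonglongrightarrow> indicator C x"
   proof (intro AE_I2)
    fix x
    show "(\<lambda>k. max 0 (1 - real k * infdist x C)) \<longlonglongrightarrow> indicator C x"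
    proof (cases "x \<in> C")
     case False
     hence "infdist x C > 0" using C by (metis in_closed_iff_infdist_zero infdist_nonneg less_eq_real_def)
     obtain K where "real K > 1 / infdist x C" using reals_Archimedean2 by blast
     have "\<forall>\<^sub>F k in sequentially. max 0 (1 - real k * infdist x C) = indicator C x"
      using eventually_ge_at_top[of K]
     proof eventually_elim
      case (elim k)
      have "1 < real K * infdist x C" using \<open>infdist x C > 0\<close> \<open>real K > _\<close> by (simp add: field_simps)
      also have "... <= real k * infdist x C" using elim \<open>infdist x C > 0\<close> by (intro mult_right_mono) auto
      finally show ?case using False by simp
     qed
     thus ?thesis by (rule tendsto_eventually)
    qed simp
   qed
   show "AE x in M. norm (max 0 (1 - real k * infdist x C)) <= 1" for k
    by (intro AE_I2) (simp add: infdist_nonneg)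
  qed auto
  thus ?thesis by simp
 qed
 have "emeasure \<mu> C = emeasure nu C" if "closed C" for C
 proof (cases "C = {}")
  case False
  have "(\<integral>x. max 0 (1 - real k * infdist x C) \<partial>\<mu>) = (\<integral>x. max 0 (1 - real k * infdist x C) \<partial>nu)" for k
   by (rule eq) (auto intro!: continuous_intros simp: infdist_nonneg)
  with lim[OF that False \<mu>.prob_space_axioms sets(1)] lim[OF that False nu.prob_space_axioms sets(2)]
  have "measure \<mu> C = measure nu C" using LIMSEQ_unique by auto
  thus ?thesis by (simp add: \<mu>.emeasure_eq_measure nu.emeasure_eq_measure)
 qed simp
 thus ?thesis
  by (intro measure_eqI_generator_eq[of "Collect closed" UNIV \<mu> nu "\<lambda>_. UNIV"])
   (auto simp: sets borel_eq_closed Int_stable_def \<mu>.emeasure_eq_measure)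
qed

section \<open>Averages along orbits of a multiplicative system\<close>

text \<open>Only the terms between \<open>M\<close> and \<open>N\<close> and the change of
  normalization matter, and each accounts for a fraction \<open>(N - M) / N\<close>.\<close>

lemma norm_cesaro_diff_le_scale:
 assumes B: "!!n. n >= 1 ==> norm (a n) <= B" "0 <= B" and MN: "M <= N"
 shows "norm (cesaro a N - cesaro a M) <= 2 * B * (real N - real M) / real N"
proof (cases "M = 0")
 case True
 have "norm (cesaro a N) <= B" by (rule norm_cesaro_le) (use B in auto)
 thus ?thesis using True B(2) by (cases "N = 0") (auto simp: cesaro_def)
next
 case False
 have N: "real N > 0" using False MN by simp
 have split: "(\<Sum>n=1..N. a n) = (\<Sum>n=1..M. a n) + (\<Sum>n=M+1..N. a n)"
  using sum.ub_add_nat[of 1 M a "N - M"] MN False by simp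
 have eq: "cesaro a N - cesaro a M = (\<Sum>n=M+1..N. a n) / of_nat N - cesaro a M * ((of_nat N - of_nat M) / of_nat N)"
  using False N unfolding cesaro_def split by (simp add: field_simps)
 have "norm (\<Sum>n=M+1..N. a n) <= of_nat (card {M+1..N}) * B"
  by (rule sum_norm_bound) (use B in auto)
 hence 1: "norm ((\<Sum>n=M+1..N. a n) / of_nat N) <= B * (real N - real M) / real N"
  using MN N by (simp add: norm_divide divide_right_mono of_nat_diff mult.commute)
 have "norm ((of_nat N - of_nat M) / of_nat N :: complex) = (real N - real M) / real N"
  using MN by (simp add: norm_divide norm_of_nat of_nat_diff flip: of_nat_diff)
 hence 2: "norm (cesaro a M * ((of_nat N - of_nat M) / of_nat N)) <= B * ((real N - real M) / real N)"
  unfolding norm_mult using norm_cesaro_le[of a B M] B MN by (intro mult_mono) auto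
 have "norm (cesaro a N - cesaro a M) <= B * (real N - real M) / real N + B * ((real N - real M) / real N)"
  unfolding eq by (rule order_trans[OF norm_triangle_ineq4 add_mono[OF 1 2]])
 thus ?thesis by simp
qed

text \<open>Were all ratios at least \<open>1 + e\<close>, the reciprocals would decay
  geometrically; \<open>1 + 1 / e\<close> is the sum of the powers of \<open>1 / (1 + e)\<close>.
  The induction adds a new smallest element, which is why the bound carries the lower bound
  \<open>m\<close>.\<close>

lemma recip_divergent_close_pair:
 assumes "recip_divergent Q" "Q \<subseteq> {1..}" "e > 0"
 shows "\<exists>p\<in>Q. \<exists>q\<in>Q. p < q & real q < (1 + e) * real p"
proof (rule ccontr)
 assume "\<not> ?thesis"
 hence gap: "(1 + e) * real p <= real q" if "p \<in> Q" "q \<in> Q" "p < q" for p q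
  using that by (metis not_le)
 have le: "F \<subseteq> Q --> (\<forall>m>0. (\<forall>p\<in>F. m <= real p) --> (\<Sum>p\<in>F. 1 / real p) <= (1 + 1 / e) / m)" if "finite F" for F
  using that
 proof (induction F rule: finite_linorder_min_induct)
  case empty thus ?case using assms(3) by simp
 next
  case (insert b F)
  show ?case
  proof (intro impI allI)
   fix m :: real assume F: "insert b F \<subseteq> Q" "m > 0" "\<forall>p\<in>insert b F. m <= real p"
   hence b: "real b > 0" using assms(2) by auto
   have "(1 + e) * real b > 0" using b assms(3) by simp
   moreover have "\<forall>p\<in>F. (1 + e) * real b <= real p" using insert(2) gap F(1) by blast
   ultimately have "(\<Sum>p\<in>F. 1 / real p) <= (1 + 1 / e) / ((1 + e) * real b)"
    using insert(3) F(1) by blast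
   hence "(\<Sum>p\<in>insert b F. 1 / real p) <= 1 / real b + (1 + 1 / e) / ((1 + e) * real b)"
    using insert by (subst sum.insert) auto
   also have "... = (1 + 1 / e) / real b" using b assms(3) by (simp add: divide_simps) (simp add: algebra_simps)
   also have "... <= (1 + 1 / e) / m" using F assms(3) by (intro divide_left_mono) auto
   finally show "(\<Sum>p\<in>insert b F. 1 / real p) <= (1 + 1 / e) / m" .
  qed
 qed
 obtain F where F: "F \<subseteq> Q" "finite F" "(\<Sum>p\<in>F. 1 / real p) >= 2 + 1 / e"
  using assms(1) unfolding recip_divergent_def by blast
 have "\<forall>p\<in>F. 1 <= real p" using F(1) assms(2) by force
 hence "(\<Sum>p\<in>F. 1 / real p) <= (1 + 1 / e) / 1" using le[OF F(2)] F(1) zero_less_one by blast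
 thus False using F(3) by simp
qed

lemma cesaro_dilate:
 fixes S :: "nat => 'y::metric_space => 'y"
 assumes S: "mult_tds S" "aperiodic S" and g: "continuous_on UNIV g" and m: "m >= 1"
 shows "(\<lambda>N. cesaro (\<lambda>n. g (S n y)) N - cesaro (\<lambda>n. g (S m (S n y))) (N div m)) \<longlonglongrightarrow> 0"
proof -
 define P where "P n = (of_bool (m dvd n) :: complex)" for n
 have "periodic_seq P" unfolding periodic_seq_def P_def using m by (intro exI[of _ m]) auto
 \<comment> \<open>\<open>asymptotically_uncorrelated\<close> conjugates its second argument, so it
   is applied to the conjugate of \<open>g\<close>.\<close>
 moreover have "continuous_on UNIV (\<lambda>x. cnj (g x))" using g by (intro continuous_intros)
 ultimately have "asymptotically_uncorrelated P (\<lambda>n. cnj (g (S n y)))"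
  using S(2) unfolding aperiodic_def by blast
 hence lim: "(\<lambda>N. cesaro (\<lambda>n. P n * g (S n y)) N - cesaro P N * cesaro (\<lambda>n. g (S n y)) N) \<longlonglongrightarrow> 0"
  unfolding asymptotically_uncorrelated_def by simp
 define f where "f N = cesaro (\<lambda>n. g (S n y)) N - cesaro (\<lambda>n. g (S m (S n y))) (N div m)" for N
 have 1: "cesaro (\<lambda>n. P n * g (S n y)) N = of_real (real (N div m) / real N) * cesaro (\<lambda>n. g (S m (S n y))) (N div m)" for N
 proof -
  have "(\<Sum>n=1..N. P n * g (S n y)) = (\<Sum>n=1..N. if m dvd n then g (S n y) else 0)"
   by (intro sum.cong) (auto simp: P_def)
  also have "... = (\<Sum>k=1..N div m. g (S (m * k) y))" by (rule sum_multiples) (use m in auto)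
  also have "... = (\<Sum>k=1..N div m. g (S m (S k y)))"
   by (intro sum.cong) (use S(1) m in "auto simp: mult_tds_def")
  finally show ?thesis by (simp add: cesaro_def)
 qed
 have 2: "cesaro P N = of_real (real (N div m) / real N)" for N
 proof -
  have "(\<Sum>n=1..N. P n) = (\<Sum>n=1..N. if m dvd n then 1 else 0)"
   by (intro sum.cong) (auto simp: P_def)
  also have "... = (\<Sum>k=1..N div m. 1)" by (rule sum_multiples) (use m in auto)
  finally show ?thesis by (simp add: cesaro_def)
 qed
 have lim1: "(\<lambda>N. of_real (real (N div m) / real N) * f N) \<longlonglongrightarrow> 0"
  using tendsto_minus[OF lim] unfolding 1 2 f_def by (simp add: algebra_simps)
 have "(\<lambda>N. real (N div m) / real N) \<longlonglongrightarrow> 1 / real m" by (rule div_over_n_tendsto) (use m in auto)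
 hence lim2: "(\<lambda>N. complex_of_real (real (N div m) / real N)) \<longlonglongrightarrow> of_real (1 / real m)" by (rule tendsto_of_real)
 \<comment> \<open>Both averages carry the density of the multiples of \<open>m\<close>; it tends to
   \<open>1 / m\<close>, which is not 0, and can be divided out.\<close>
 have "(\<lambda>N. of_real (real (N div m) / real N) * f N / of_real (real (N div m) / real N)) \<longlonglongrightarrow> 0 / of_real (1 / real m)"
  by (rule tendsto_divide[OF lim1 lim2]) (use m in auto)
 moreover have "\<forall>\<^sub>F N in sequentially. of_real (real (N div m) / real N) * f N / of_real (real (N div m) / real N) = f N"
  using eventually_ge_at_top[of m] by eventually_elim (use m in "auto simp: div_eq_0_iff")
 ultimately have "f \<longlonglongrightarrow> 0" by (simp add: tendsto_cong)
 thus ?thesis unfolding f_def .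
qed

lemma compact_continuous_bounded:
 fixes g :: "'y::metric_space => complex"
 assumes "compact (UNIV :: 'y set)" "continuous_on UNIV g"
 obtains B where "!!x. norm (g x) <= B" "B > 0"
proof -
 have "bounded (range g)" using compact_continuous_image[OF assms(2,1)] compact_imp_bounded by blast
 then obtain B where "!!x. norm (g x) <= B" unfolding bounded_iff by auto
 thus ?thesis by (intro that[of "max B 1"]) (auto simp: le_max_iff_disj)
qed

text \<open>Two primes \<open>r < q\<close> acting by the same map as \<open>p\<close> make the averages of \<open>g \<circ> S p\<close> asymptotically
 invariant under the scale \<open>q / r\<close>. If this is close to \<open>1\<close>, some power of it is close to \<open>p\<close>.\<close>

lemma orbit_average_invariant:
 fixes S :: "nat => 'y::metric_space => 'y"
 assumes S: "mult_tds S" "aperiodic S" and g: "continuous_on UNIV g"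
  and p: "prime p" "recip_divergent {q. prime q & S q = S p}"
 shows "(\<lambda>N. cesaro (\<lambda>n. g (S n y)) N - cesaro (\<lambda>n. g (S p (S n y))) N) \<longlonglongrightarrow> 0"
proof -
 define A where "A = cesaro (\<lambda>n. g (S p (S n y)))"
 have "compact (UNIV :: 'y set)" using S(1) by (simp add: mult_tds_def)
 then obtain B where B: "!!x. norm (g x) <= B" "B > 0" by (rule compact_continuous_bounded[OF _ g]) blast
 have dil: "(\<lambda>N. cesaro (\<lambda>n. g (S n y)) N - A (N div m)) \<longlonglongrightarrow> 0" if "prime m" "S m = S p" for m
  using cesaro_dilate[OF S g, of m y] that prime_ge_1_nat unfolding A_def by auto
 have p1: "real p > 1" using prime_gt_1_nat[OF p(1)] by simp
 have "(\<lambda>N. A (N div p) - A N) \<longlonglongrightarrow> 0"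
 proof (rule tendstoI)
  fix d :: real assume d: "d > 0"
  define e where "e = d / (16 * B)"
  have e: "e > 0" using d B by (simp add: e_def)
  have "{q. prime q & S q = S p} \<subseteq> {1..}" using prime_ge_1_nat by auto
  from recip_divergent_close_pair[OF p(2) this e]
  obtain r q where rq: "prime r" "S r = S p" "prime q" "S q = S p" "r < q" "real q < (1 + e) * real r" by blast
  have r0: "real r > 0" "real q > 0" using rq prime_gt_0_nat by auto
  define l where "l = real q / real r"
  have l: "1 < l" "l < 1 + e" using rq r0 by (auto simp: l_def field_simps)
  \<comment> \<open>At \<open>N = M * r\<close> the quotient \<open>N div r\<close> is exactly
    \<open>M\<close>, and \<open>N div q\<close> is \<open>s M\<close>, that is,
    \<open>M / l\<close> rounded down.\<close>
  define s where "s M = (M * r) div q" for M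
  have at_top: "filterlim (\<lambda>M. M * r) sequentially sequentially"
   using r0 by (intro filterlim_subseq) (auto simp: strict_mono_def)
  have s: "filterlim s sequentially sequentially" unfolding s_def
   by (rule filterlim_compose[OF filterlim_div_at_top at_top]) (use r0 in simp)
  have "(\<lambda>N. A (N div r) - A (N div q)) \<longlonglongrightarrow> 0"
   using tendsto_diff[OF dil[of q] dil[of r]] rq by simp
  from filterlim_compose[OF this at_top] have 1: "(\<lambda>M. A M - A (s M)) \<longlonglongrightarrow> 0"
   using r0 by (simp add: s_def)
  have 2: "(\<lambda>M. A M - A ((s ^^ i) M)) \<longlonglongrightarrow> 0" for i
  proof (induction i)
   case (Suc i)
   from tendsto_add[OF 1 filterlim_compose[OF this s]] show ?case by (simp add: funpow_swap1)
  qed simp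
  have s1: "real (s M) <= real M / l" "real M / l - 1 <= real (s M)" for M
  proof -
   have "real (s M) = real_of_int \<lfloor>real M / l\<rfloor>"
    unfolding s_def l_def using floor_divide_of_nat_eq[of "M * r" q, where 'a = real] by simp
   thus "real (s M) <= real M / l" "real M / l - 1 <= real (s M)" by linarith+
  qed
  \<comment> \<open>Each step loses less than 1 by rounding, and dividing by \<open>l > 1\<close>
    does not enlarge earlier losses.\<close>
  have si: "real ((s ^^ i) M) <= real M / l ^ i & real M / l ^ i - real i <= real ((s ^^ i) M)" for i M
  proof (induction i)
   case (Suc i)
   let ?x = "real ((s ^^ i) M)"
   have "?x / l <= real M / l ^ i / l" "(real M / l ^ i - real i) / l <= ?x / l"
    using Suc l by (intro divide_right_mono; simp)+
   moreover have "real i / l <= real i" using l by (simp add: field_simps mult_le_cancel_right1)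
   ultimately show ?case using s1[of "(s ^^ i) M"] by (simp add: diff_divide_distrib mult.commute)
  qed simp
  \<comment> \<open>The first power of \<open>l\<close> that reaches \<open>p\<close> overshoots by
    a factor of at most \<open>1 + e\<close>; hence \<open>(s ^^ i) M\<close> and
    \<open>M div p\<close> differ by at most \<open>e * M / p + i\<close>.\<close>
  define i where "i = (LEAST i. real p <= l ^ i)"
  have "\<exists>i. real p <= l ^ i" using real_arch_pow[OF l(1)] less_imp_le by blast
  hence i: "real p <= l ^ i" unfolding i_def by (rule LeastI_ex)
  then obtain j where j: "i = Suc j" using p1 by (cases i) auto
  have "l ^ j < real p" using not_less_Least[of j "\<lambda>i. real p <= l ^ i"] j by (simp add: i_def)
  hence i': "l ^ i <= (1 + e) * real p" unfolding j using l by (simp add: mult_mono)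
  have "\<forall>\<^sub>F M in sequentially. dist (A M - A ((s ^^ i) M)) 0 < d / 2"
   by (rule tendstoD[OF 2]) (use d in simp)
  moreover have "\<forall>\<^sub>F M in sequentially. real M >= max (2 * real p) (16 * B * real p * real i / d)"
   by (rule eventually_compose_filterlim[OF eventually_ge_at_top filterlim_real_sequentially])
  ultimately show "\<forall>\<^sub>F M in sequentially. dist (A (M div p) - A M) 0 < d"
  proof eventually_elim
   case (elim M)
   let ?x = "real M / real p" and ?k = "(s ^^ i) M"
   have "real (M div p) = real_of_int \<lfloor>?x\<rfloor>" using floor_divide_of_nat_eq[of M p, where 'a = real] by simp
   hence Mp: "real (M div p) <= ?x" "?x - 1 <= real (M div p)" by linarith+
   have x: "?x >= 2" "16 * B * real i <= d * ?x" using elim d p1 by (auto simp: field_simps)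
   have "real M / l ^ i <= ?x" using i p1 by (intro divide_left_mono) auto
   hence "real ?k <= ?x" using si[of i M] by linarith
   hence k: "?k <= M div p" using p1 by (simp add: less_eq_div_iff_mult_less_eq field_simps flip: of_nat_mult)
   have "?x / (1 + e) <= real M / l ^ i"
    using i' l e p1 unfolding divide_divide_eq_left by (intro divide_left_mono) (auto simp: mult.commute)
   moreover have 3: "x - e * x <= x / (1 + e)" if "x >= 0" for x :: real
    using e that by (subst pos_le_divide_eq) (auto simp: algebra_simps)
   have "?x - e * ?x <= ?x / (1 + e)" by (rule 3) simp
   ultimately have "real (M div p) - real ?k <= e * ?x + real i" using si[of i M] Mp(1) by linarith
   hence "2 * B * (real (M div p) - real ?k) / real (M div p) <= 2 * B * (e * ?x + real i) / (?x / 2)"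
    using Mp x k B e by (intro frac_le mult_left_mono mult_nonneg_nonneg) auto
   also have "... = (d / 4 * ?x + 4 * B * real i) / ?x" using x B by (simp add: e_def field_simps)
   also have "... <= d / 2" using x by (subst pos_divide_le_eq) auto
   finally have "norm (A (M div p) - A ?k) <= d / 2"
    unfolding A_def using norm_cesaro_diff_le_scale[OF _ _ k, of "\<lambda>n. g (S p (S n y))" B] B by force
   moreover have "norm (A (M div p) - A M) <= norm (A (M div p) - A ?k) + norm (A M - A ?k)"
    using norm_triangle_ineq4[of "A (M div p) - A ?k" "A M - A ?k"] by simp
   ultimately show ?case using elim(1) unfolding dist_0_norm norm_conv_dist[symmetric] by linarith
  qed
 qed
 from tendsto_add[OF dil[OF p(1) refl] this] show ?thesis unfolding A_def by simp
qed

text \<open>The classes of primes with the same map are finite in number, and a finite union of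
  classes with bounded reciprocal sums again has bounded reciprocal sums; \<open>P\<close> drops
  exactly these classes.\<close>

lemma almost_all_primes_invariant:
 fixes S :: "nat => 'y::metric_space => 'y"
 assumes S: "mult_tds S" "aperiodic S" "finitely_generated S"
 shows "\<exists>P\<subseteq>{p. prime p}. (\<lambda>p. 1 / real p) summable_on ({p. prime p} - P) &
  (\<forall>p\<in>P. \<forall>g y. continuous_on UNIV g -->
  (\<lambda>N. cesaro (\<lambda>n. g (S n y)) N - cesaro (\<lambda>n. g (S p (S n y))) N) \<longlonglongrightarrow> 0)"
proof -
 define c where "c R = {p. prime p & S p = R}" for R
 define P where "P = {p. prime p & recip_divergent (c (S p))}"
 obtain \<R> where R: "finite \<R>" "!!p. prime p ==> S p \<in> \<R>" using S(3) unfolding finitely_generated_def by blast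
 have "{p. prime p} - P = (\<Union>R\<in>{R\<in>\<R>. \<not> recip_divergent (c R)}. c R)" using R(2) by (auto simp: P_def c_def)
 hence "\<not> recip_divergent ({p. prime p} - P)"
  using recip_divergent_finite_cover[of "{R\<in>\<R>. \<not> recip_divergent (c R)}" c] R(1) by auto
 then obtain L where L: "!!F. F \<subseteq> {p. prime p} - P ==> finite F ==> (\<Sum>p\<in>F. 1 / real p) <= L"
  unfolding recip_divergent_def by (meson linear)
 have "(\<lambda>p. 1 / real p) summable_on ({p. prime p} - P)"
  by (rule nonneg_bdd_above_summable_on, simp, rule bdd_aboveI2[of _ _ L]) (use L in blast)
 moreover have "(\<lambda>N. cesaro (\<lambda>n. g (S n y)) N - cesaro (\<lambda>n. g (S p (S n y))) N) \<longlonglongrightarrow> 0"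
  if "p \<in> P" "continuous_on UNIV g" for p g y
  by (rule orbit_average_invariant[OF S(1,2)]) (use that in "simp_all add: P_def c_def")
 ultimately show ?thesis by (intro exI[of _ P]) (simp add: P_def Collect_mono_iff)
qed

theorem orbit_average_tendsto_integral:
 fixes S :: "nat => 'y::metric_space => 'y"
 assumes S: "mult_tds S" "aperiodic S" "finitely_generated S" "strongly_uniquely_ergodic S"
  and nu: "borel_probability nu" "pretends_invariant S nu" and g: "continuous_on UNIV g"
 shows "cesaro (\<lambda>n. g (S n y)) \<longlonglongrightarrow> (\<integral>x. g x \<partial>nu)"
proof -
 have comp: "compact (UNIV :: 'y set)" using S(1) by (simp add: mult_tds_def)
 interpret nu: prob_space nu using nu by (simp add: borel_probability_def)
 obtain P where P: "P \<subseteq> {p. prime p}" "(\<lambda>p. 1 / real p) summable_on ({p. prime p} - P)"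
  "!!p g y. p \<in> P ==> continuous_on UNIV g ==>
   (\<lambda>N. cesaro (\<lambda>n. g (S n y)) N - cesaro (\<lambda>n. g (S p (S n y))) N) \<longlonglongrightarrow> 0"
  using almost_all_primes_invariant[OF S(1-3)] by blast
 have Sc: "continuous_on UNIV (S p)" if "p \<in> P" for p
  using S(1) P(1) that prime_ge_1_nat unfolding mult_tds_def by auto
 have bm: "f \<in> borel_measurable \<mu>" if "continuous_on UNIV f" "borel_probability \<mu>"
  for f :: "'y => 'b::metric_space" and \<mu>
  using borel_measurable_continuous_onI[OF that(1)] that(2)
   measurable_cong_sets[of \<mu> "borel :: 'y measure" "borel :: 'b measure" "borel :: 'b measure"]
  by (auto simp: borel_probability_def)
 have real: "(\<lambda>N. (\<Sum>n=1..N. f (S n y)) / real N) \<longlonglongrightarrow> (\<integral>x. f x \<partial>nu)"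
  if f: "continuous_on UNIV f" for f :: "'y => real"
 proof (rule ccontr)
  define X where "X N = (\<Sum>n=1..N. f (S n y)) / real N" for N
  assume "\<not> ?thesis"
  then obtain e where e: "e > 0" "!!N. \<exists>n\<ge>N. dist (X n) (\<integral>x. f x \<partial>nu) >= e"
   unfolding X_def[symmetric] lim_sequentially by (metis not_less)
  \<comment> \<open>An increasing sequence of scales at which the average stays at distance
    \<open>e\<close> from the integral; a weak limit along it would have to be
    \<open>nu\<close>.\<close>
  define s where "s = rec_nat (SOME n. n >= 1 & dist (X n) (\<integral>x. f x \<partial>nu) >= e)
    (\<lambda>_ m. SOME n. n >= Suc m & dist (X n) (\<integral>x. f x \<partial>nu) >= e)"
  have s0: "s 0 >= 1 & dist (X (s 0)) (\<integral>x. f x \<partial>nu) >= e"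
   using someI_ex[OF e(2)[of 1, unfolded]] by (simp add: s_def)
  have sS: "s (Suc k) >= Suc (s k) & dist (X (s (Suc k))) (\<integral>x. f x \<partial>nu) >= e" for k
   using someI_ex[OF e(2)[of "Suc (s k)"]] by (simp add: s_def)
  have mono: "strict_mono s" using sS by (simp add: strict_mono_Suc_iff Suc_le_eq)
  have s: "s k >= 1" "dist (X (s k)) (\<integral>x. f x \<partial>nu) >= e" for k
  proof -
   show "s k >= 1" using s0 sS by (cases k) (auto intro: order_trans[OF _ conjunct1[OF sS]])
   show "dist (X (s k)) (\<integral>x. f x \<partial>nu) >= e" using s0 sS by (cases k) auto
  qed
  obtain r \<mu> where r: "strict_mono (r :: nat => nat)" "borel_probability \<mu>"
   "!!f :: 'y => real. continuous_on UNIV f ==>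
    (\<lambda>k. (\<Sum>n=1..s (r k). f (S n y)) / real (s (r k))) \<longlonglongrightarrow> (\<integral>x. f x \<partial>\<mu>)"
   by (rule empirical_weak_limit[where s = s, OF comp s(1), where u = "\<lambda>n. S n y"]) blast
  interpret \<mu>: prob_space \<mu> using r by (simp add: borel_probability_def)
  have srmono: "strict_mono (s \<circ> r)" using mono r(1) by (rule strict_mono_o)
  have "distr \<mu> borel (S p) = \<mu>" if p: "p \<in> P" for p
  proof (rule borel_probability_eqI)
   have m: "S p \<in> \<mu> \<rightarrow>\<^sub>M borel" by (rule bm[OF Sc[OF p] r(2)])
   show "borel_probability (distr \<mu> borel (S p))"
    unfolding borel_probability_def by (simp add: \<mu>.prob_space_distr[OF m])
   fix h :: "'y => real" assume h: "continuous_on UNIV h"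
   have "(\<lambda>N. cesaro (\<lambda>n. of_real (h (S n y))) N - cesaro (\<lambda>n. of_real (h (S p (S n y)))) N) \<longlonglongrightarrow> 0"
    by (rule P(3)[OF p, of "\<lambda>x. of_real (h x)"]) (use h in "intro continuous_intros")
   hence "(\<lambda>N. Re (cesaro (\<lambda>n. of_real (h (S n y))) N - cesaro (\<lambda>n. of_real (h (S p (S n y)))) N)) \<longlonglongrightarrow> Re 0"
    by (rule tendsto_Re)
   hence "(\<lambda>N. (\<Sum>n=1..N. h (S n y)) / real N - (\<Sum>n=1..N. h (S p (S n y))) / real N) \<longlonglongrightarrow> 0"
    by (simp add: cesaro_def Re_divide_of_nat)
   from LIMSEQ_subseq_LIMSEQ[OF this srmono]
   have "(\<lambda>k. (\<Sum>n=1..s (r k). h (S n y)) / real (s (r k)) - (\<Sum>n=1..s (r k). h (S p (S n y))) / real (s (r k))) \<longlonglongrightarrow> 0"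
    by (simp add: o_def)
   moreover have hc: "continuous_on UNIV (\<lambda>x. h (S p x))" using h Sc[OF p]
    by (metis continuous_on_compose2 subset_UNIV)
   ultimately have "(\<integral>x. h x \<partial>\<mu>) - (\<integral>x. h (S p x) \<partial>\<mu>) = 0"
    using LIMSEQ_unique tendsto_diff[OF r(3)[OF h] r(3)[OF hc]] by blast
   thus "(\<integral>x. h x \<partial>distr \<mu> borel (S p)) = (\<integral>x. h x \<partial>\<mu>)"
    using integral_distr[OF m borel_measurable_continuous_onI[OF h]] by simp
  qed (rule r)
  hence "pretends_invariant S \<mu>"
   unfolding pretends_invariant_def using P(1,2) by (intro exI[of _ P]) auto
  hence "\<mu> = nu" using S(4) nu r(2) unfolding strongly_uniquely_ergodic_def by blast
  hence "(\<lambda>k. X (s (r k))) \<longlonglongrightarrow> (\<integral>x. f x \<partial>nu)" using r(3)[OF f] by (simp add: X_def)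
  hence "\<forall>\<^sub>F k in sequentially. dist (X (s (r k))) (\<integral>x. f x \<partial>nu) < e" using e(1) by (rule tendstoD)
  then obtain k where "dist (X (s (r k))) (\<integral>x. f x \<partial>nu) < e" using eventually_happens'[OF sequentially_bot] by blast
  thus False using s(2)[of "r k"] by simp
 qed
 obtain B where B: "!!x. norm (g x) <= B" "B > 0" by (rule compact_continuous_bounded[OF comp g]) blast
 have int: "integrable nu g" by (rule nu.integrable_const_bound[of _ B]) (use B bm g nu in auto)
 have "(\<lambda>N. Complex ((\<Sum>n=1..N. Re (g (S n y))) / real N) ((\<Sum>n=1..N. Im (g (S n y))) / real N))
   \<longlonglongrightarrow> Complex (\<integral>x. Re (g x) \<partial>nu) (\<integral>x. Im (g x) \<partial>nu)"
  by (intro tendsto_Complex real continuous_intros g)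
 moreover have "Complex ((\<Sum>n=1..N. Re (g (S n y))) / real N) ((\<Sum>n=1..N. Im (g (S n y))) / real N) = cesaro (\<lambda>n. g (S n y)) N" for N
  by (simp add: cesaro_def complex_eq_iff Re_divide_of_nat Im_divide_of_nat)
 moreover have "Complex (\<integral>x. Re (g x) \<partial>nu) (\<integral>x. Im (g x) \<partial>nu) = (\<integral>x. g x \<partial>nu)"
  using int by (simp add: complex_eq_iff)
 ultimately show ?thesis by simp
qed

section \<open>Invariant means and characters of abelian groups\<close>

definition bdd_fun :: "('d => complex) => bool" where
 "bdd_fun f \<equiv> (\<exists>B. \<forall>x. norm (f x) <= B)"

lemma bdd_funI: "(!!x. norm (f x) <= B) ==> bdd_fun f"
 by (auto simp: bdd_fun_def)

lemma bdd_funE: assumes "bdd_fun f" obtains B where "!!x. norm (f x) <= B" "B >= 0"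
 using assms norm_ge_zero order_trans unfolding bdd_fun_def by metis

lemma bdd_fun_compose: "bdd_fun f ==> bdd_fun (\<lambda>x. f (p x))"
 by (auto simp: bdd_fun_def)

lemma bdd_fun_cnj [intro]: "bdd_fun f ==> bdd_fun (\<lambda>x. cnj (f x))"
 by (auto simp: bdd_fun_def)

lemma bdd_fun_cmult [intro]:
 assumes "bdd_fun f"
 shows "bdd_fun (\<lambda>x. c * f x)" "bdd_fun (\<lambda>x. f x * c)"
proof -
 obtain B where B: "!!x. norm (f x) <= B" by (rule bdd_funE[OF assms]) blast
 thus "bdd_fun (\<lambda>x. c * f x)" "bdd_fun (\<lambda>x. f x * c)"
  by (auto simp: norm_mult mult.commute[of _ "norm c"] intro!: bdd_funI[of _ "norm c * B"] mult_left_mono B)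
qed

lemma bdd_fun_const [intro, simp]: "bdd_fun (\<lambda>x. c)"
 by (rule bdd_funI[of _ "norm c"]) simp

lemma bdd_fun_binary [intro]:
 assumes "bdd_fun f" "bdd_fun g"
 shows "bdd_fun (\<lambda>x. f x + g x)" "bdd_fun (\<lambda>x. f x - g x)" "bdd_fun (\<lambda>x. f x * g x)"
proof -
 obtain B C where B: "!!x. norm (f x) <= B" "!!x. norm (g x) <= C" "B >= 0" "C >= 0"
  using assms by (metis bdd_funE)
 show "bdd_fun (\<lambda>x. f x + g x)" "bdd_fun (\<lambda>x. f x - g x)"
  by (intro bdd_funI[of _ "B + C"] norm_triangle_le norm_triangle_le_diff add_mono B)+
 show "bdd_fun (\<lambda>x. f x * g x)"
  by (auto simp: norm_mult intro!: bdd_funI[of _ "B * C"] mult_mono B)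
qed

lemma bdd_fun_sum [intro]: "(!!i. i \<in> I ==> bdd_fun (f i)) ==> bdd_fun (\<lambda>x. \<Sum>i\<in>I. f i x)"
 by (induction I rule: infinite_finite_induct) auto

lemma bdd_fun_shift: "bdd_fun f ==> bdd_fun (\<lambda>x. f (d + x))"
 by (rule bdd_fun_compose)

lemmas bdd_fun_rules = bdd_fun_const bdd_fun_cnj bdd_fun_cmult bdd_fun_binary bdd_fun_sum bdd_fun_shift

text \<open>The group is taken discrete, and \<open>M\<close> plays the part of Haar measure on a
  compactification of it. All conditions concern bounded functions only.\<close>

locale invariant_mean =
 fixes M :: "('d::ab_group_add => complex) => complex"
 assumes mean_add: "bdd_fun f ==> bdd_fun g ==> M (\<lambda>x. f x + g x) = M f + M g"
  and mean_scale: "bdd_fun f ==> M (\<lambda>x. c * f x) = c * M f"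
  and mean_cnj: "bdd_fun f ==> M (\<lambda>x. cnj (f x)) = cnj (M f)"
  and mean_bound: "(!!x. norm (f x) <= B) ==> norm (M f) <= B"
  and mean_one: "M (\<lambda>_. 1) = 1"
  and mean_shift: "bdd_fun f ==> M (\<lambda>x. f (d + x)) = M f"

definition avg :: "nat => 'd::ab_group_add => ('d => complex) => 'd => complex" where
 "avg k c f x = (\<Sum>i<k. f (((+) c ^^ i) x)) / of_nat k"

lemma funpow_add_left: "((+) c ^^ i) (d + x) = d + ((+) c ^^ i) x" for c :: "'d::ab_group_add"
 by (induction i) (auto simp: add.left_commute)

definition avgs :: "nat => 'd::ab_group_add list => ('d => complex) => 'd => complex" where
 "avgs k L f = foldr (avg k) L f"

lemma avgs_algebra:
 "avgs k L (\<lambda>x. f x + g x) = (\<lambda>x. avgs k L f x + avgs k L g x)"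
 "avgs k L (\<lambda>x. c * f x) = (\<lambda>x. c * avgs k L f x)"
 "avgs k L (\<lambda>x. cnj (f x)) = (\<lambda>x. cnj (avgs k L f x))"
 "avgs k L (\<lambda>x. f (d + x)) = (\<lambda>x. avgs k L f (d + x))"
 unfolding avgs_def
 by (induction L) (auto simp: avg_def fun_eq_iff sum.distrib add_divide_distrib sum_distrib_left funpow_add_left)

lemma avgs_bound:
 assumes "k >= 1" "!!x. norm (f x) <= B" shows "norm (avgs k L f x) <= B"
 unfolding avgs_def
proof (induction L arbitrary: x)
 case (Cons c L)
 have "norm (\<Sum>i<k. foldr (avg k) L f (((+) c ^^ i) x)) <= of_nat (card {..<k}) * B"
  by (rule sum_norm_bound) (rule Cons)
 thus ?case using assms(1) by (simp add: avg_def[of k c] norm_divide divide_simps mult.commute)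
qed (use assms in auto)

lemma avgs_one: "k >= 1 ==> avgs k L (\<lambda>_. 1) = (\<lambda>_. 1)"
 unfolding avgs_def by (induction L) (auto simp: avg_def fun_eq_iff)

lemma avgs_almost_invariant:
 assumes "k >= 1" and B: "!!x. norm (f x) <= B" and c: "c \<in> set L"
 shows "norm (avgs k L f (c + x) - avgs k L f x) <= 2 * B / real k"
 using c
proof (induction L arbitrary: x)
 case (Cons a L)
 define h where "h = avgs k L f"
 have h: "avgs k (a # L) f = avg k a h" by (simp add: avgs_def h_def)
 show ?case
 proof (cases "c = a")
  case True
  have "(\<Sum>i<k. h (((+) a ^^ i) (a + x))) - (\<Sum>i<k. h (((+) a ^^ i) x)) = h (((+) a ^^ k) x) - h x"
   by (induction k) (simp_all add: funpow_add_left add_diff_eq diff_add_eq)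
  moreover have "norm (h (((+) a ^^ k) x) - h x) <= B + B"
   unfolding h_def by (rule norm_triangle_le_diff) (intro add_mono avgs_bound[OF assms(1) B])
  ultimately show ?thesis unfolding h True avg_def using assms(1)
   by (simp add: norm_divide divide_right_mono flip: diff_divide_distrib)
 next
  case False
  have "norm (\<Sum>i<k. h (c + ((+) a ^^ i) x) - h (((+) a ^^ i) x)) <= of_nat (card {..<k}) * (2 * B / real k)"
   by (rule sum_norm_bound) (use Cons False in "auto simp: h_def")
  thus ?thesis unfolding h avg_def using assms(1)
   by (simp add: norm_divide divide_simps funpow_add_left sum_subtractf mult.commute flip: diff_divide_distrib)
 qed
qed auto

text \<open>Iterated averages along finitely many group elements, evaluated at 0, are linear,
  normalized and nearly invariant. Linearity and each bound on the lack of invariance are closed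
  conditions on a product of discs, which is compact by Tychonoff, so it suffices to satisfy
  finitely many of them at a time.\<close>

theorem invariant_mean_exists: "\<exists>M :: ('d::ab_group_add => complex) => complex. invariant_mean M"
proof -
 define b where "b f = (if bdd_fun f then SUP x. norm (f x) else 0)" for f :: "'d => complex"
 have b: "norm (f x) <= b f" if "bdd_fun f" for f x
  unfolding b_def using that by (auto simp: bdd_fun_def bdd_above_def intro!: cSUP_upper)
 have b_le: "b f <= B" if "!!x. norm (f x) <= B" for f B
  unfolding b_def using that by (auto intro!: cSUP_least simp: bdd_fun_def)
 define X where "X = (\<Pi>\<^sub>E f\<in>UNIV. cball (0::complex) (b f))"
 have X: "compact X"
  using compactin_PiE[of "\<lambda>_. euclidean :: complex topology" UNIV "\<lambda>f. cball 0 (b f)"]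
  unfolding X_def compactin_euclidean_iff euclidean_product_topology by auto
 have cont: "continuous_on UNIV (\<lambda>m. m f)" for f :: "'d => complex" by (rule continuous_on_product_coordinates)
 define Lin where "Lin = {m :: ('d => complex) => complex. m (\<lambda>_. 1) = 1 & (\<forall>f. \<not> bdd_fun f \<or> m (\<lambda>x. cnj (f x)) = cnj (m f)) &
   (\<forall>f c. \<not> bdd_fun f \<or> m (\<lambda>x. c * f x) = c * m f) &
   (\<forall>f g. \<not> bdd_fun f \<or> \<not> bdd_fun g \<or> m (\<lambda>x. f x + g x) = m f + m g)}"
 have Lin: "closed Lin" unfolding Lin_def
  by (intro closed_Collect_conj closed_Collect_all closed_Collect_disj closed_Collect_const closed_Collect_eq
    continuous_intros cont)
 \<comment> \<open>\<open>p = (d, n)\<close> asks for invariance under \<open>d\<close> up to order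
   \<open>1 / (n + 1)\<close>; all \<open>n\<close> together give exact invariance.\<close>
 define K where "K p = {m :: ('d => complex) => complex. \<forall>f. \<not> bdd_fun f \<or>
  norm (m (\<lambda>x. f (fst p + x)) - m f) <= 2 * b f / real (Suc (snd p))}" for p
 have K: "closed (K p)" for p unfolding K_def
  by (intro closed_Collect_all closed_Collect_disj closed_Collect_const closed_Collect_le continuous_intros cont)
 have "(X \<inter> Lin) \<inter> \<Inter> (range K) ~= {}"
 proof (rule compact_imp_fip[OF compact_Int_closed[OF X Lin]])
  fix F' assume F': "finite F'" "F' \<subseteq> range K"
  then obtain J where J: "finite J" "F' = K ` J" by (metis finite_subset_image)
  obtain L where L: "set L = fst ` J" using finite_list[of "fst ` J"] J(1) by auto
  define k where "k = Suc (Max (insert 0 (snd ` J)))"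
  have k: "snd p < k" if "p \<in> J" for p using J(1) that by (auto simp: k_def less_Suc_eq_le)
  define m where "m f = (if bdd_fun f then avgs k L f 0 else 0)" for f
  have k1: "k >= 1" by (simp add: k_def)
  have "m \<in> X" unfolding X_def m_def using avgs_bound[OF k1 b] by (auto simp: b_def)
  moreover have "m \<in> Lin" unfolding Lin_def m_def using avgs_one[OF k1, of L] by (auto simp: avgs_algebra)
  moreover have "m \<in> K p" if p: "p \<in> J" for p
  proof -
   have "norm (m (\<lambda>x. f (fst p + x)) - m f) <= 2 * b f / real (Suc (snd p))" if f: "bdd_fun f" for f
   proof -
    have "norm (avgs k L f (fst p + 0) - avgs k L f 0) <= 2 * b f / real k"
     by (rule avgs_almost_invariant[OF k1 b[OF f]]) (use p L in auto)
    also have "... <= 2 * b f / real (Suc (snd p))"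
     using k[OF p] order_trans[OF norm_ge_zero b[OF f]] by (intro divide_left_mono) auto
    finally show ?thesis using f bdd_fun_compose[OF f, of "\<lambda>x. fst p + x"] by (simp add: m_def avgs_algebra(4))
   qed
   thus ?thesis by (auto simp: K_def)
  qed
  ultimately show "(X \<inter> Lin) \<inter> \<Inter> F' ~= {}" using J(2) by blast
 qed (use K in auto)
 then obtain m where m: "m \<in> X" "m \<in> Lin" "!!p. m \<in> K p" by blast
 have "invariant_mean m"
 proof
  fix f g :: "'d => complex" and c d B
  show "bdd_fun f ==> bdd_fun g ==> m (\<lambda>x. f x + g x) = m f + m g" "bdd_fun f ==> m (\<lambda>x. c * f x) = c * m f"
   "bdd_fun f ==> m (\<lambda>x. cnj (f x)) = cnj (m f)" "m (\<lambda>_. 1) = 1"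
   using m(2) by (auto simp: Lin_def)
  show "norm (m f) <= B" if "!!x. norm (f x) <= B"
   using m(1) b_le[OF that] unfolding X_def by (auto simp: PiE_iff intro: order_trans)
  assume f: "bdd_fun f"
  have "norm (m (\<lambda>x. f (d + x)) - m f) <= 2 * b f / real (Suc n)" for n
   using m(3)[of "(d, n)"] f by (auto simp: K_def)
  moreover have "(\<lambda>n. 2 * b f / real (Suc n)) \<longlonglongrightarrow> 0"
   by (rule LIMSEQ_Suc[OF lim_const_over_n])
  ultimately have "norm (m (\<lambda>x. f (d + x)) - m f) <= 0"
   by (intro LIMSEQ_le[OF tendsto_const]) auto
  thus "m (\<lambda>x. f (d + x)) = m f" by simp
 qed
 thus ?thesis by blast
qed

section \<open>Characters of a discrete abelian group and the seminorm of an invariant mean\<close>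

definition character :: "('d::ab_group_add => complex) => bool" where
 "character xi \<equiv> (\<forall>x y. xi (x + y) = xi x * xi y) & (\<forall>x. norm (xi x) = 1)"

lemma character_cnj: "character xi ==> character (\<lambda>x. cnj (xi x))"
 by (simp add: character_def)

lemma character_bdd: "character xi ==> bdd_fun xi"
 by (rule bdd_funI[of _ 1]) (simp add: character_def)

lemma unit_mult_cnj: "norm z = 1 ==> z * cnj z = 1"
 by (metis complex_norm_square of_real_1 one_power2)

text \<open>The circle has no small subgroups: squaring expands a neighbourhood of 1.\<close>

lemma no_small_powers:
 fixes z :: complex
 assumes "!!n. norm (z ^ n - 1) <= 3/4"
 shows "z = 1"
proof (rule ccontr)
 assume z: "z ~= 1"
 have step: "(5/4) ^ n * norm (z - 1) <= norm (z ^ (2 ^ n) - 1)" for n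
 proof (induction n)
  case (Suc n)
  define w where "w = z ^ (2 ^ n)"
  have "norm (w - 1) <= 3/4" unfolding w_def by (rule assms)
  hence "5/4 <= norm (w + 1)" using norm_triangle_ineq4[of "w + 1" "w - 1"] by simp
  hence "5/4 * ((5/4) ^ n * norm (z - 1)) <= norm (w + 1) * norm (w - 1)"
   by (intro mult_mono) (use Suc in "auto simp: w_def")
  also have "... = norm (z ^ (2 ^ Suc n) - 1)"
  proof -
   have "z ^ (2 ^ Suc n) = w * w" by (simp add: w_def mult_2 power_add)
   thus ?thesis by (simp add: algebra_simps flip: norm_mult)
  qed
  finally show ?case by simp
 qed simp
 obtain n where "3/4 / norm (z - 1) < (5/4) ^ n" using real_arch_pow[of "5/4"] by auto
 hence "3/4 < (5/4) ^ n * norm (z - 1)" using z by (simp add: divide_simps)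
 with step[of n] assms[of "2 ^ n"] show False by linarith
qed

text \<open>The vectors of values on \<open>C\<close> are rounded to a finite net; this sorts the
  indices into finitely many classes, and one index is kept from each.\<close>

lemma finite_evaluation_net:
 fixes \<Phi> :: "'i => 'c => complex"
 assumes "finite C" "!!i c. i \<in> I ==> c \<in> C ==> norm (\<Phi> i c) <= B" "e > 0"
 obtains J where "finite J" "J \<subseteq> I" "!!i. i \<in> I ==> \<exists>j\<in>J. \<forall>c\<in>C. norm (\<Phi> i c - \<Phi> j c) < e"
proof -
 have "seq_compact (cball (0::complex) B)" using compact_cball compact_imp_seq_compact by blast
 from seq_compact_imp_totally_bounded[OF this] assms(3)
 obtain G where G: "finite G" "cball (0::complex) B \<subseteq> (\<Union>g\<in>G. ball g (e/2))" by (meson half_gt_zero)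
 define r where "r i = restrict (\<lambda>c. SOME g. g \<in> G & dist g (\<Phi> i c) < e/2) C" for i
 have r: "r i c \<in> G & dist (r i c) (\<Phi> i c) < e/2" if "i \<in> I" "c \<in> C" for i c
 proof -
  have "\<exists>g. g \<in> G & dist g (\<Phi> i c) < e/2" using G(2) assms(2)[OF that] by (auto simp: subset_iff)
  from someI_ex[OF this] show ?thesis using that by (simp add: r_def)
 qed
 have "r ` I \<subseteq> C \<rightarrow>\<^sub>E G" using r by (auto simp: r_def PiE_def)
 hence "finite (r ` I)" by (rule finite_subset) (rule finite_PiE[OF assms(1) G(1)])
 then obtain J where J: "finite J" "J \<subseteq> I" "r ` I = r ` J" by (metis finite_subset_image order_refl)
 show ?thesis
 proof (rule that[OF J(1,2)])
  fix i assume i: "i \<in> I"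
  then obtain j where j: "j \<in> J" "r i = r j" using J(3) by (metis imageE imageI)
  have "norm (\<Phi> i c - \<Phi> j c) < e" if c: "c \<in> C" for c
   using r[OF i c] r[of j c] j J(2) c dist_triangle_half_r[of "r i c" "\<Phi> i c" e "\<Phi> j c"]
   by (auto simp: dist_norm)
  with j show "\<exists>j\<in>J. \<forall>c\<in>C. norm (\<Phi> i c - \<Phi> j c) < e" by blast
 qed
qed

context invariant_mean
begin

lemma mean_zero [simp]: "M (\<lambda>_. 0) = 0"
 using mean_bound[of "\<lambda>_. 0" 0] by simp

lemma mean_const [simp]: "M (\<lambda>_. c) = c"
 using mean_scale[of "\<lambda>_. 1" c] mean_one by simp

lemma mean_diff: "bdd_fun f ==> bdd_fun g ==> M (\<lambda>x. f x - g x) = M f - M g"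
 using mean_add[of f "\<lambda>x. - 1 * g x"] mean_scale[of g "- 1"] bdd_fun_cmult(1)[of g "- 1"] by simp

lemma mean_scale_right: "bdd_fun f ==> M (\<lambda>x. f x * c) = M f * c"
 using mean_scale[of f c] by (simp add: mult.commute)

lemma mean_sum: "(!!i. i \<in> I ==> bdd_fun (f i)) ==> M (\<lambda>x. \<Sum>i\<in>I. f i x) = (\<Sum>i\<in>I. M (f i))"
 by (induction I rule: infinite_finite_induct) (auto simp: mean_add bdd_fun_sum)

lemma mean_nonneg:
 assumes u: "!!x. 0 <= u x" "!!x. u x <= B"
 shows "M (\<lambda>x. of_real (u x)) = of_real (Re (M (\<lambda>x. of_real (u x))))" "0 <= Re (M (\<lambda>x. of_real (u x)))"
  "Re (M (\<lambda>x. of_real (u x))) <= B"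
proof -
 have b: "bdd_fun (\<lambda>x. of_real (u x))" by (rule bdd_funI[of _ B]) (simp add: u)
 from mean_cnj[OF b] show "M (\<lambda>x. of_real (u x)) = of_real (Re (M (\<lambda>x. of_real (u x))))"
  by (simp add: complex_eq_iff)
 have "norm (M (\<lambda>x. of_real (u x) - of_real (B / 2))) <= B / 2"
 proof (rule mean_bound)
  fix x show "norm (complex_of_real (u x) - of_real (B / 2)) <= B / 2"
   unfolding of_real_diff[symmetric] norm_of_real using u[of x] by linarith
 qed
 hence "norm (M (\<lambda>x. of_real (u x)) - of_real (B / 2)) <= B / 2"
  by (subst (asm) mean_diff[OF b]) auto
 hence "\<bar>Re (M (\<lambda>x. of_real (u x)) - of_real (B / 2))\<bar> <= B / 2"
  by (rule order_trans[OF abs_Re_le_cmod])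
 hence "\<bar>Re (M (\<lambda>x. of_real (u x))) - B / 2\<bar> <= B / 2" by simp
 thus "0 <= Re (M (\<lambda>x. of_real (u x)))" "Re (M (\<lambda>x. of_real (u x))) <= B" by linarith+
qed

definition ip :: "('d => complex) => ('d => complex) => complex" where
 "ip f g = M (\<lambda>x. f x * cnj (g x))"

definition nrm :: "('d => complex) => real" where
 "nrm f = sqrt (Re (ip f f))"

lemma ip_self:
 assumes "bdd_fun f" shows "ip f f = of_real ((nrm f)^2)" and nrm_nonneg: "nrm f >= 0"
proof -
 obtain B where B: "!!x. norm (f x) <= B" by (rule bdd_funE[OF assms]) blast
 hence "!!x. (norm (f x))^2 <= B\<^sup>2" by (simp add: power_mono)
 from mean_nonneg[of "\<lambda>x. (norm (f x))^2", OF _ this]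
 show "ip f f = of_real ((nrm f)^2)" "nrm f >= 0" by (auto simp: ip_def nrm_def complex_norm_square[symmetric])
qed

lemma nrm_le:
 assumes "!!x. norm (f x) <= B" shows "nrm f <= B"
proof -
 have B: "B >= 0" using assms[of undefined] norm_ge_zero order_trans by blast
 have "!!x. (norm (f x))^2 <= B\<^sup>2" using assms by (simp add: power_mono)
 from mean_nonneg(3)[of "\<lambda>x. (norm (f x))^2", OF _ this] show ?thesis
  unfolding nrm_def ip_def using B by (simp add: complex_norm_square[symmetric] real_le_lsqrt)
qed

lemma ip_left:
 assumes "bdd_fun f" "bdd_fun g" "bdd_fun h"
 shows "ip (\<lambda>x. f x + g x) h = ip f h + ip g h" "ip (\<lambda>x. c * f x) h = c * ip f h"
  "ip (\<lambda>x. f x - g x) h = ip f h - ip g h"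
 unfolding ip_def using assms
 by (auto simp: distrib_right left_diff_distrib mult.assoc intro!: mean_add mean_diff mean_scale)

lemma ip_cnj: "bdd_fun f ==> bdd_fun g ==> ip g f = cnj (ip f g)"
 unfolding ip_def by (subst mean_cnj[symmetric]) (auto simp: mult.commute)

lemma ip_right:
 assumes "bdd_fun f" "bdd_fun g" "bdd_fun h"
 shows "ip h (\<lambda>x. f x + g x) = ip h f + ip h g" "ip h (\<lambda>x. c * f x) = cnj c * ip h f"
  "ip h (\<lambda>x. f x - g x) = ip h f - ip h g"
 unfolding ip_def using assms
 by (auto simp: distrib_left right_diff_distrib mult.left_commute intro!: mean_add mean_diff mean_scale)

lemma ip_shift: "bdd_fun f ==> bdd_fun g ==> ip (\<lambda>x. f (d + x)) (\<lambda>x. g (d + x)) = ip f g"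
 unfolding ip_def by (rule mean_shift[of "\<lambda>x. f x * cnj (g x)"]) auto

lemma cauchy_schwarz:
 assumes f: "bdd_fun f" and g: "bdd_fun g"
 shows "norm (ip f g) <= nrm f * nrm g"
proof -
 have ineq: "2 * s * (norm (ip f g))^2 <= (nrm f)\<^sup>2 + s^2 * (norm (ip f g))^2 * (nrm g)^2" for s :: real
 proof -
  define t where "t = of_real s * ip f g"
  have tg: "bdd_fun (\<lambda>x. t * g x)" using g by auto
  have "ip (\<lambda>x. f x - t * g x) (\<lambda>x. f x - t * g x) = ip f f - cnj t * ip f g - t * ip g f + t * cnj t * ip g g"
   using f g tg by (simp add: ip_left ip_right bdd_fun_binary algebra_simps)
  also have "... = of_real ((nrm f)^2) - 2 * of_real s * (ip f g * cnj (ip f g)) + of_real (s^2) * (ip f g * cnj (ip f g)) * of_real ((nrm g)^2)"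
   using ip_self(1)[OF f] ip_self(1)[OF g] ip_cnj[OF f g] by (simp add: t_def algebra_simps power2_eq_square)
  also have "ip f g * cnj (ip f g) = of_real ((norm (ip f g))^2)" by (rule complex_norm_square[symmetric])
  finally have "of_real ((nrm (\<lambda>x. f x - t * g x))^2) =
    (of_real ((nrm f)^2 - 2 * s * (norm (ip f g))^2 + s^2 * (norm (ip f g))^2 * (nrm g)^2) :: complex)"
   using ip_self(1)[of "\<lambda>x. f x - t * g x"] f tg by (simp add: bdd_fun_binary)
  hence "(nrm (\<lambda>x. f x - t * g x))^2 = (nrm f)^2 - 2 * s * (norm (ip f g))^2 + s^2 * (norm (ip f g))^2 * (nrm g)^2"
   by (simp only: of_real_eq_iff)
  thus ?thesis using zero_le_power2[of "nrm (\<lambda>x. f x - t * g x)"] by linarith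
 qed
 have "(norm (ip f g))^2 <= (nrm f * nrm g)\<^sup>2"
 proof (cases "nrm g = 0")
  case True
  \<comment> \<open>\<open>nrm\<close> is only a seminorm; if it vanishes at \<open>g\<close>, a
    large multiplier \<open>s\<close> in the quadratic inequality excludes a nonzero inner
    product.\<close>
  have "norm (ip f g) = 0"
  proof (rule ccontr)
   assume "norm (ip f g) ~= 0"
   hence "2 * (((nrm f)^2 + 1) / (norm (ip f g))^2) * (norm (ip f g))^2 = 2 * ((nrm f)^2 + 1)" by simp
   with ineq[of "((nrm f)^2 + 1) / (norm (ip f g))^2"] True show False by (simp add: power2_eq_square) (smt (verit) zero_le_square)
  qed
  thus ?thesis by simp
 next
  case False
  hence "(nrm g)^2 > 0" by simp
  with ineq[of "1 / (nrm g)^2"] have "(norm (ip f g))^2 / (nrm g)^2 <= (nrm f)\<^sup>2"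
  proof -
   have "(1 / (nrm g)^2)^2 * (norm (ip f g))^2 * (nrm g)^2 = (norm (ip f g))^2 / (nrm g)^2"
    using False by (simp add: power2_eq_square)
   with ineq[of "1 / (nrm g)^2"] show ?thesis by simp
  qed
  with \<open>(nrm g)\<^sup>2 > 0\<close> show ?thesis by (simp add: power_mult_distrib divide_simps)
 qed
 thus ?thesis by (rule power2_le_imp_le) (use nrm_nonneg f g in simp)
qed

lemma character_orthogonal:
 assumes xi: "character xi" "character xi'" "xi ~= xi'"
 shows "ip xi xi' = 0"
proof -
 obtain d where d: "xi d ~= xi' d" using xi(3) by auto
 have b: "bdd_fun xi" "bdd_fun xi'" using xi by (auto intro: character_bdd)
 have "ip (\<lambda>x. xi (d + x)) (\<lambda>x. xi' (d + x)) = ip (\<lambda>x. xi d * xi x) (\<lambda>x. xi' d * xi' x)"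
  using xi by (simp add: character_def)
 also have "... = xi d * cnj (xi' d) * ip xi xi'" using b by (simp add: ip_left ip_right bdd_fun_cmult)
 finally have "xi d * cnj (xi' d) * ip xi xi' = ip xi xi'" using ip_shift b by simp
 moreover have "xi d * cnj (xi' d) ~= 1"
 proof
  assume "xi d * cnj (xi' d) = 1"
  hence "xi d * (xi' d * cnj (xi' d)) = xi' d" by (metis mult.left_commute mult.right_neutral)
  moreover have "xi' d * cnj (xi' d) = 1" using xi(2) by (intro unit_mult_cnj) (simp add: character_def)
  ultimately show False using d by (metis mult.right_neutral)
 qed
 ultimately show ?thesis by (metis mult_cancel_right1)
qed

lemma character_ip_self: "character xi ==> ip xi xi = 1"
 unfolding ip_def using unit_mult_cnj by (simp add: character_def mean_one)

end

section \<open>Invariant sesquilinear forms and approximate joint eigenfunctions\<close>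

lemma roots_of_unity_orthogonal:
 assumes "i < N" "j < N"
 shows "(\<Sum>k<N. cnj (cis (2 * pi * real k / real N)) ^ i * cis (2 * pi * real k / real N) ^ j) = (if i = j then of_nat N else 0)"
proof -
 define theta where "theta = 2 * pi * (real j - real i) / real N"
 have eq: "cnj (cis (2 * pi * real k / real N)) ^ i * cis (2 * pi * real k / real N) ^ j = cis theta ^ k" for k
 proof -
  have "cnj (cis (2 * pi * real k / real N)) = cis (- (2 * pi * real k / real N))" by (rule cis_cnj)
  thus ?thesis
   by (simp only: Complex.DeMoivre cis_mult) (rule arg_cong[where f = cis], simp add: theta_def diff_divide_distrib algebra_simps)
 qed
 show ?thesis
 proof (cases "i = j")
  case False
  have "cis theta ~= 1"
  proof
   assume "cis theta = 1"
   hence "cos theta = 1" by (simp add: complex_eq_iff)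
   then obtain m :: int where "theta = of_int m * 2 * pi" using cos_one_2pi_int by blast
   hence "2 * pi * ((real j - real i) / real N) = 2 * pi * of_int m" by (simp add: theta_def mult_ac)
   hence "(real j - real i) / real N = of_int m" by (simp only: mult_cancel_left) simp
   hence "real j - real i = of_int m * real N" using assms by (simp add: field_simps)
   hence "real_of_int (int j - int i) = real_of_int (m * int N)" by simp
   hence m: "int j - int i = m * int N" by (simp only: of_int_eq_iff)
   hence "m ~= 0" using False by auto
   hence "1 * int N <= \<bar>m\<bar> * int N" by (intro mult_right_mono) auto
   also have "... = \<bar>int j - int i\<bar>" unfolding m by (simp add: abs_mult)
   finally show False using assms by linarith
  qed
  moreover have "cis theta ^ N = 1"
  proof -
   have "real N * theta = 2 * pi * of_int (int j - int i)" using assms by (simp add: theta_def)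
   thus ?thesis using cis_multiple_2pi[of "of_int (int j - int i)"] by (simp only: Complex.DeMoivre) simp
  qed
  ultimately show ?thesis unfolding eq using False by (simp add: geometric_sum)
 next
  case True
  hence "theta = 0" by (simp add: theta_def)
  thus ?thesis unfolding eq using True by simp
 qed
qed

text \<open>Invariance under simultaneous translation is included because it makes all diagonal
  terms of a Fourier average equal to the original value of the form.\<close>

definition sesquilinear :: "(('d::ab_group_add => complex) => ('d => complex) => complex) => bool" where
 "sesquilinear B \<equiv>
   (\<forall>f g h c. bdd_fun f --> bdd_fun g --> bdd_fun h -->
    B (\<lambda>x. f x + g x) h = B f h + B g h & B h (\<lambda>x. f x + g x) = B h f + B h g &
    B (\<lambda>x. c * f x) h = c * B f h & B h (\<lambda>x. c * f x) = cnj c * B h f) &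
   (\<forall>f g d. bdd_fun f --> bdd_fun g --> B (\<lambda>x. f (d + x)) (\<lambda>x. g (d + x)) = B f g)"

lemma sesquilinear_sum:
 assumes "sesquilinear B" "finite I" "!!i. i \<in> I ==> bdd_fun (f i)" "bdd_fun h"
 shows "B (\<lambda>x. \<Sum>i\<in>I. c i * f i x) h = (\<Sum>i\<in>I. c i * B (f i) h)"
  "B h (\<lambda>x. \<Sum>i\<in>I. c i * f i x) = (\<Sum>i\<in>I. cnj (c i) * B h (f i))"
proof -
 have "(B (\<lambda>x. \<Sum>i\<in>I. c i * f i x) h = (\<Sum>i\<in>I. c i * B (f i) h)) &
  (B h (\<lambda>x. \<Sum>i\<in>I. c i * f i x) = (\<Sum>i\<in>I. cnj (c i) * B h (f i)))"
  using assms(2,3)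
 proof (induction I rule: finite_induct)
  case empty
  have "B (\<lambda>x. 0 * h x) h = 0 * B h h" "B h (\<lambda>x. 0 * h x) = cnj 0 * B h h"
   using assms(1,4) unfolding sesquilinear_def by blast+
  thus ?case by simp
 next
  case (insert i I)
  have b: "bdd_fun (\<lambda>x. c i * f i x)" "bdd_fun (\<lambda>x. \<Sum>i\<in>I. c i * f i x)"
   by (intro bdd_fun_rules insert.prems; simp)+
  have "B (\<lambda>x. c i * f i x + (\<Sum>i\<in>I. c i * f i x)) h = B (\<lambda>x. c i * f i x) h + B (\<lambda>x. \<Sum>i\<in>I. c i * f i x) h"
   "B h (\<lambda>x. c i * f i x + (\<Sum>i\<in>I. c i * f i x)) = B h (\<lambda>x. c i * f i x) + B h (\<lambda>x. \<Sum>i\<in>I. c i * f i x)"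
   "B (\<lambda>x. c i * f i x) h = c i * B (f i) h" "B h (\<lambda>x. c i * f i x) = cnj (c i) * B h (f i)"
   using assms(1,4) b insert.prems[of i] unfolding sesquilinear_def by blast+
  thus ?case using insert by simp
 qed
 thus "B (\<lambda>x. \<Sum>i\<in>I. c i * f i x) h = (\<Sum>i\<in>I. c i * B (f i) h)"
  "B h (\<lambda>x. \<Sum>i\<in>I. c i * f i x) = (\<Sum>i\<in>I. cnj (c i) * B h (f i))" by auto
qed

definition invariant_subspace :: "('d::ab_group_add => complex) set => bool" where
 "invariant_subspace W \<equiv> (\<forall>g\<in>W. \<forall>d. (\<lambda>x. g (d + x)) \<in> W) &
   (\<forall>(I :: nat set) c g. finite I --> (\<forall>i\<in>I. g i \<in> W) --> (\<lambda>x. \<Sum>i\<in>I. c i * g i x) \<in> W)"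

context invariant_mean
begin

lemma sesquilinear_ip: "sesquilinear ip"
 unfolding sesquilinear_def by (intro conjI allI impI ip_left ip_right ip_shift)

text \<open>The defect form of one translation is invariant again. After it has been subtracted, the
  next translation can be treated with the form that remains.\<close>

lemma sesquilinear_combine:
 assumes B: "sesquilinear B"
 shows "sesquilinear (\<lambda>f g. B f g - of_real A * ip (\<lambda>x. f (c + x) - z * f x) (\<lambda>x. g (c + x) - z * g x))"
proof -
 have D: "sesquilinear (\<lambda>f g. ip (\<lambda>x. f (c + x) - z * f x) (\<lambda>x. g (c + x) - z * g x))"
  unfolding sesquilinear_def
 proof (intro conjI allI impI)
  fix f g h :: "'d => complex" and a
  assume b: "bdd_fun f" "bdd_fun g" "bdd_fun h"
  have b': "bdd_fun (\<lambda>x. k (c + x) - z * k x)" if "bdd_fun k" for k by (intro bdd_fun_rules that)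
  have e: "(\<lambda>x. f (c + x) + g (c + x) - z * (f x + g x)) = (\<lambda>x. (f (c + x) - z * f x) + (g (c + x) - z * g x))"
   "(\<lambda>x. a * f (c + x) - z * (a * f x)) = (\<lambda>x. a * (f (c + x) - z * f x))"
   by (auto simp: fun_eq_iff algebra_simps)
  show "ip (\<lambda>x. f (c + x) + g (c + x) - z * (f x + g x)) (\<lambda>x. h (c + x) - z * h x) =
    ip (\<lambda>x. f (c + x) - z * f x) (\<lambda>x. h (c + x) - z * h x) + ip (\<lambda>x. g (c + x) - z * g x) (\<lambda>x. h (c + x) - z * h x)"
   "ip (\<lambda>x. h (c + x) - z * h x) (\<lambda>x. f (c + x) + g (c + x) - z * (f x + g x)) =
    ip (\<lambda>x. h (c + x) - z * h x) (\<lambda>x. f (c + x) - z * f x) + ip (\<lambda>x. h (c + x) - z * h x) (\<lambda>x. g (c + x) - z * g x)"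
   "ip (\<lambda>x. a * f (c + x) - z * (a * f x)) (\<lambda>x. h (c + x) - z * h x) = a * ip (\<lambda>x. f (c + x) - z * f x) (\<lambda>x. h (c + x) - z * h x)"
   "ip (\<lambda>x. h (c + x) - z * h x) (\<lambda>x. a * f (c + x) - z * (a * f x)) = cnj a * ip (\<lambda>x. h (c + x) - z * h x) (\<lambda>x. f (c + x) - z * f x)"
   unfolding e using ip_left[OF b'[OF b(1)] b'[OF b(2)] b'[OF b(3)]] ip_right[OF b'[OF b(1)] b'[OF b(2)] b'[OF b(3)]]
   by auto
 next
  fix f g :: "'d => complex" and d
  assume b: "bdd_fun f" "bdd_fun g"
  have b': "bdd_fun (\<lambda>x. k (c + x) - z * k x)" if "bdd_fun k" for k by (intro bdd_fun_rules that)
  show "ip (\<lambda>x. f (d + (c + x)) - z * f (d + x)) (\<lambda>x. g (d + (c + x)) - z * g (d + x)) =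
    ip (\<lambda>x. f (c + x) - z * f x) (\<lambda>x. g (c + x) - z * g x)"
   using ip_shift[OF b'[OF b(1)] b'[OF b(2)], of d] by (simp add: add.left_commute)
 qed
 show ?thesis unfolding sesquilinear_def
  using B D unfolding sesquilinear_def
  by (intro conjI allI impI) (simp_all add: algebra_simps)
qed

text \<open>Fourier averages over the \<open>N\<close>-th roots of unity split \<open>f\<close> into \<open>N\<close> pieces which share out
 the value of an invariant form, while their total deviation from being eigenfunctions of a
 translation is \<open>O(1/N)\<close>. Hence some piece is a good approximate eigenfunction.\<close>

lemma approx_eigenfunction:
 assumes B: "sesquilinear B" and f: "bdd_fun f" "Re (B f f) > 0" and A: "A >= 0"
  and W: "f \<in> W" "invariant_subspace W"
 shows "\<exists>g z. bdd_fun g & g \<in> W & norm z = 1 &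
  Re (B g g) - A * (nrm (\<lambda>x. g (c + x) - z * g x))^2 > 0"
proof -
 obtain b where b: "!!x. norm (f x) <= b" "b >= 0" using bdd_funE[OF f(1)] by metis
 \<comment> \<open>The total weighted deviation of the \<open>N\<close> pieces is at most
   \<open>4 * A * b^2 / N\<close>, hence below the value of the form that they share.\<close>
 obtain N :: nat where N: "4 * A * b^2 / Re (B f f) < real N" "N >= 1"
  using reals_Archimedean2[of "max (4 * A * b^2 / Re (B f f)) 1"] by (auto simp: less_max_iff_disj intro: that)
 define t where "t i = ((+) c ^^ i) 0" for i
 have t: "t (Suc i) = c + t i" for i by (simp add: t_def)
 define w where "w k = cis (2 * pi * real k / real N)" for k
 have w: "norm (w k) = 1" "w k ^ N = 1" for k
  using N cis_multiple_2pi[of "of_nat k"] by (auto simp: w_def Complex.DeMoivre mult_ac)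
 define g where "g k x = (\<Sum>i<N. (cnj (w k) ^ i / of_nat N) * f (t i + x))" for k x
 have fb: "bdd_fun (\<lambda>x. f (d + x))" for d by (rule bdd_fun_compose[OF f(1)])
 have gb: "bdd_fun (g k)" for k unfolding g_def by (intro bdd_fun_rules f(1))
 have "(\<lambda>x. f (d + x)) \<in> W" for d using W unfolding invariant_subspace_def by blast
 hence gW: "g k \<in> W" for k
  unfolding g_def[abs_def] using W(2) finite_lessThan[of N] unfolding invariant_subspace_def
  by (elim conjE allE[of _ "{..<N}"] allE[of _ "\<lambda>i. cnj (w k) ^ i / of_nat N"] allE[of _ "\<lambda>i x. f (t i + x)"]) simp
 have 1: "(\<Sum>k<N. B (g k) (g k)) = B f f"
 proof -
  define X where "X i j = B (\<lambda>x. f (t i + x)) (\<lambda>x. f (t j + x))" for i j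
  have X: "X i i = B f f" for i unfolding X_def using B f(1) unfolding sesquilinear_def by blast
  have "B (g k) (g k) = (\<Sum>i<N. \<Sum>j<N. (cnj (w k) ^ i * w k ^ j) * (X i j / of_nat (N * N)))" for k
  proof -
   have "B (g k) (g k) = (\<Sum>i<N. (cnj (w k) ^ i / of_nat N) * B (\<lambda>x. f (t i + x)) (g k))"
    unfolding g_def[of k, abs_def] by (rule sesquilinear_sum(1)[OF B _ fb]) (use gb[of k] in "simp_all add: g_def[abs_def]")
   also have "... = (\<Sum>i<N. (cnj (w k) ^ i / of_nat N) * (\<Sum>j<N. cnj (cnj (w k) ^ j / of_nat N) * X i j))"
    unfolding g_def[of k, abs_def] X_def by (intro sum.cong refl arg_cong2[where f = "(*)"] sesquilinear_sum(2)[OF B _ fb fb]) simp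
   also have "... = (\<Sum>i<N. \<Sum>j<N. (cnj (w k) ^ i * w k ^ j) * (X i j / of_nat (N * N)))"
    unfolding sum_distrib_left by (intro sum.cong refl) (simp del: sum_distrib_left)
   finally show ?thesis .
  qed
  hence "(\<Sum>k<N. B (g k) (g k)) = (\<Sum>k<N. \<Sum>i<N. \<Sum>j<N. (cnj (w k) ^ i * w k ^ j) * (X i j / of_nat (N * N)))"
   by (simp only:)
  also have "... = (\<Sum>i<N. \<Sum>j<N. \<Sum>k<N. (cnj (w k) ^ i * w k ^ j) * (X i j / of_nat (N * N)))"
   by (rule sum_swap3)
  also have "... = (\<Sum>i<N. \<Sum>j<N. (if i = j then of_nat N else 0) * (X i j / of_nat (N * N)))"
   unfolding sum_distrib_right[symmetric] w_def by (intro sum.cong refl) (simp add: roots_of_unity_orthogonal)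
  also have "... = (\<Sum>i<N. of_nat N * (X i i / of_nat (N * N)))"
  proof (rule sum.cong[OF refl])
   fix i assume "i \<in> {..<N}"
   thus "(\<Sum>j<N. (if i = j then of_nat N else 0) * (X i j / of_nat (N * N))) =
     of_nat N * (X i i / of_nat (N * N))"
   proof -
    have "(if i = j then of_nat N else 0) * Y = (if i = j then of_nat N * Y else 0)" for j and Y :: complex by simp
    thus ?thesis using \<open>i \<in> {..<N}\<close> by (simp only: sum.delta' finite_lessThan if_True)
   qed
  qed
  also have "... = (\<Sum>i<N. of_nat N * (B f f / of_nat (N * N)))"
   unfolding X ..
  also have "... = B f f" using N by simp
  finally show ?thesis .
 qed
 have 2: "nrm (\<lambda>x. g k (c + x) - w k * g k x) <= 2 * b / real N" for k
 proof (rule nrm_le)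
  fix x
  have u: "cnj (w k) * w k = 1" using unit_mult_cnj[OF w(1)] by (simp add: mult.commute)
  have tel: "(\<Sum>i<n. cnj (w k) ^ i * f (t (Suc i) + x)) - w k * (\<Sum>i<n. cnj (w k) ^ i * f (t i + x)) =
    w k * (cnj (w k) ^ n * f (t n + x) - f (t 0 + x))" for n
  proof (induction n)
   case (Suc n)
   have "w k * (cnj (w k) ^ Suc n * y) = (cnj (w k) * w k) * (cnj (w k) ^ n * y)" for y by simp
   hence v: "w k * (cnj (w k) ^ Suc n * y) = cnj (w k) ^ n * y" for y unfolding u by simp
   show ?case using Suc unfolding sum.lessThan_Suc right_diff_distrib distrib_left v by (simp add: algebra_simps)
  qed simp
  have "g k (c + x) - w k * g k x = ((\<Sum>i<N. cnj (w k) ^ i * f (t (Suc i) + x)) - w k * (\<Sum>i<N. cnj (w k) ^ i * f (t i + x))) / of_nat N"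
   by (simp add: g_def t sum_divide_distrib diff_divide_distrib sum_distrib_left mult_ac add_ac)
  also have "norm ... = norm (w k * (f (t N + x) - f (t 0 + x))) / real N"
   unfolding tel using w(2)[of k] by (simp add: norm_divide flip: complex_cnj_power)
  also have "... <= 2 * b / real N"
   using norm_triangle_ineq4[of "f (t N + x)" "f (t 0 + x)"] b(1)[of "t N + x"] b(1)[of "t 0 + x"]
   by (intro divide_right_mono) (auto simp: norm_mult w)
  finally show "norm (g k (c + x) - w k * g k x) <= 2 * b / real N" .
 qed
 have "\<exists>k<N. Re (B (g k) (g k)) - A * (nrm (\<lambda>x. g k (c + x) - w k * g k x))^2 > 0"
 proof (rule ccontr)
  assume "\<not> ?thesis"
  hence "(\<Sum>k<N. Re (B (g k) (g k)) - A * (nrm (\<lambda>x. g k (c + x) - w k * g k x))^2) <= 0"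
   by (intro sum_nonpos) (meson lessThan_iff not_less)
  hence "Re (B f f) <= (\<Sum>k<N. A * (nrm (\<lambda>x. g k (c + x) - w k * g k x))^2)"
   by (simp add: sum_subtractf flip: 1)
  also have "... <= (\<Sum>k<N. A * (2 * b / real N)^2)"
   by (intro sum_mono mult_left_mono power_mono 2 A nrm_nonneg) (intro bdd_fun_rules gb)
  also have "... = 4 * A * b^2 / real N" using N by (simp add: power2_eq_square)
  finally show False using N f(2) by (simp add: field_simps)
 qed
 thus ?thesis using gb gW w by blast
qed

text \<open>The form \<open>B'\<close> already contains the defect for the new translation
  \<open>a\<close>, so positivity of \<open>B'\<close> at the final function controls all defects at
  once. Of the step for \<open>a\<close> only the eigenvalue is kept, not the function.\<close>

lemma approx_joint_eigenfunction:
 assumes "finite C" and B: "sesquilinear B" and f: "bdd_fun f" "Re (B f f) > 0" and A: "A >= 0"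
  and W: "f \<in> W" "invariant_subspace W"
 shows "\<exists>g z. bdd_fun g & g \<in> W & (\<forall>c\<in>C. norm (z c) = 1) &
  Re (B g g) - A * (\<Sum>c\<in>C. (nrm (\<lambda>x. g (c + x) - z c * g x))^2) > 0"
 using assms(1) B f W(1)
proof (induction C arbitrary: B f rule: finite_induct)
 case (insert a C)
 obtain g z where g: "bdd_fun g" "g \<in> W" "norm z = 1" "Re (B g g) - A * (nrm (\<lambda>x. g (a + x) - z * g x))^2 > 0"
  using approx_eigenfunction[OF insert.prems(1-3) A insert.prems(4) W(2), of a] by blast
 define B' where "B' f h = B f h - of_real A * ip (\<lambda>x. f (a + x) - z * f x) (\<lambda>x. h (a + x) - z * h x)" for f h
 have B': "sesquilinear B'" unfolding B'_def by (rule sesquilinear_combine) (rule insert.prems)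
 have B'f: "Re (B' f f) = Re (B f f) - A * (nrm (\<lambda>x. f (a + x) - z * f x))^2" if "bdd_fun f" for f
  unfolding B'_def by (subst ip_self, intro bdd_fun_rules that) simp
 obtain h y where h: "bdd_fun h" "h \<in> W" "\<forall>c\<in>C. norm (y c) = 1"
  "Re (B' h h) - A * (\<Sum>c\<in>C. (nrm (\<lambda>x. h (c + x) - y c * h x))^2) > 0"
  using insert.IH[OF B' g(1) _ g(2)] B'f[OF g(1)] g(4) by auto
 have "(\<Sum>c\<in>C. (nrm (\<lambda>x. h (c + x) - (y(a := z)) c * h x))^2) = (\<Sum>c\<in>C. (nrm (\<lambda>x. h (c + x) - y c * h x))^2)"
  by (intro sum.cong) (use insert in auto)
 hence "Re (B h h) - A * (\<Sum>c\<in>insert a C. (nrm (\<lambda>x. h (c + x) - (y(a := z)) c * h x))^2) > 0"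
  using h(4) B'f[OF h(1)] insert by (simp add: algebra_simps)
 thus ?case using h g(3) insert.hyps by (intro exI[of _ h] exI[of _ "y(a := z)"]) auto
qed auto

end

lemma norm_cis_minus_one_le: "norm (cis b - 1) <= \<bar>b\<bar>"
proof -
 have alg: "(c - 1)^2 + s^2 = (s^2 + c^2) + 1 - 2 * c" for c s :: real by (simp add: power2_eq_square algebra_simps)
 have "(norm (cis b - 1))^2 = (cos b - 1)^2 + (sin b)^2" by (simp add: cmod_power2)
 also have "... = ((sin b)^2 + (cos b)^2) + 1 - 2 * cos b" by (rule alg)
 also have "... = 2 - 2 * cos (2 * (b / 2))" unfolding sin_cos_squared_add by simp
 also have "... = 4 * (sin (b / 2))^2" by (simp only: cos_double_sin) simp
 finally have "(norm (cis b - 1))^2 = 4 * (sin (b / 2))^2" .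
 moreover have "(sin (b / 2))^2 <= (b / 2)\<^sup>2" using abs_sin_x_le_abs_x[of "b/2"] by (simp only: abs_le_square_iff)
 ultimately have "(norm (cis b - 1))^2 <= \<bar>b\<bar>\<^sup>2" by (simp add: power_divide)
 thus ?thesis by (rule power2_le_imp_le) simp
qed

context invariant_mean
begin

text \<open>The logarithm of the defect of an approximate character is a real cocycle; averaging it in one
 variable shows that it is a coboundary, which corrects the approximate character.\<close>

lemma character_near_approximate_character:
 assumes e: "e > 0"
 obtains kappa where "kappa > 0" "!!z :: 'd => complex. (!!x. norm (z x) = 1) ==> (!!x y. norm (z (x + y) - z x * z y) <= kappa) ==>
  \<exists>xi. character xi & (\<forall>x. norm (xi x - z x) <= e)"
proof -
 have "isCont Ln 1" by (rule continuous_at_Ln) simp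
 then obtain d where d: "d > 0" "!!w. norm (w - 1) < d ==> norm (Ln w) < min e 1"
  using e unfolding continuous_at_eps_delta dist_norm by (metis Ln_1 diff_zero min_less_iff_conj zero_less_one)
 show ?thesis
 proof (rule that[of "d / 2"])
  show "d / 2 > 0" using d by simp
 next
  fix z :: "'d => complex"
  assume z: "!!x. norm (z x) = 1" "!!x y. norm (z (x + y) - z x * z y) <= d / 2"
  have zz: "z x * cnj (z x) = 1" for x using z(1) by (rule unit_mult_cnj)
  define u where "u x y = z (x + y) * cnj (z x * z y)" for x y
  define beta where "beta x y = Im (Ln (u x y))" for x y
  have un: "norm (u x y) = 1" for x y by (simp add: u_def norm_mult z)
  have uz: "u x y * (z x * z y) = z (x + y)" for x y
  proof -
   have "u x y * (z x * z y) = z (x + y) * ((z x * cnj (z x)) * (z y * cnj (z y)))" by (simp add: u_def)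
   thus ?thesis by (simp add: zz)
  qed
  have beta: "\<bar>beta x y\<bar> <= min e 1" for x y
  proof -
   have "(u x y - 1) * (z x * z y) = z (x + y) - z x * z y" by (simp add: left_diff_distrib uz)
   hence "norm (u x y - 1) = norm (z (x + y) - z x * z y)" by (metis norm_mult z(1) mult.right_neutral)
   also have "... < d" using z(2)[of x y] d(1) by linarith
   finally show ?thesis using d(2)[of "u x y"] abs_Im_le_cmod[of "Ln (u x y)"] by (simp add: beta_def)
  qed
  have cis: "cis (beta x y) = u x y" for x y
  proof -
   have "u x y ~= 0" using un[of x y] by auto
   hence "exp (Ln (u x y)) = u x y" "Re (Ln (u x y)) = 0" using un[of x y] by auto
   thus ?thesis unfolding beta_def by (simp add: exp_eq_polar)
  qed
  have coc: "beta x y + beta (x + y) t = beta y t + beta x (y + t)" for x y t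
  proof -
   define a where "a = beta x y + beta (x + y) t - (beta y t + beta x (y + t))"
   have "u x y * u (x + y) t = (z (x + y) * cnj (z (x + y))) * (z (x + y + t) * cnj (z x * z y * z t))" by (simp add: u_def)
   moreover have "u y t * u x (y + t) = (z (y + t) * cnj (z (y + t))) * (z (x + y + t) * cnj (z x * z y * z t))"
    by (simp add: u_def add.assoc)
   ultimately have "u x y * u (x + y) t = u y t * u x (y + t)" by (simp only: zz)
   hence "cis (beta x y + beta (x + y) t) = cis (beta y t + beta x (y + t))" by (simp add: cis flip: cis_mult)
   hence "cis a = 1" unfolding a_def by (metis cis_divide cis_neq_zero divide_self)
   hence "cos a = 1" by (simp add: complex_eq_iff)
   then obtain n :: int where n: "a = of_int n * 2 * pi" using cos_one_2pi_int by blast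
   \<comment> \<open>The cap 1 in \<open>min e 1\<close> on the four logarithms keeps
     \<open>a\<close> below a full turn, which forces the integer to be 0.\<close>
   have "\<bar>a\<bar> <= 4" using beta[of x y] beta[of "x + y" t] beta[of y t] beta[of x "y + t"] unfolding a_def by linarith
   have "n = 0"
   proof (rule ccontr)
    assume "n ~= 0"
    hence "1 * (2 * pi) <= \<bar>of_int n\<bar> * (2 * pi)" by (intro mult_right_mono) auto
    also have "... = \<bar>a\<bar>" by (simp add: n abs_mult)
    finally show False using \<open>\<bar>a\<bar> <= 4\<close> pi_gt3 by linarith
   qed
   thus ?thesis using n by (simp add: a_def)
  qed
  have bb: "bdd_fun (\<lambda>t. of_real (beta x t))" for x by (rule bdd_funI[of _ "min e 1"]) (use beta in simp)
  define b where "b x = Re (M (\<lambda>t. of_real (beta x t)))" for x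
  have Mb: "M (\<lambda>t. of_real (beta x t)) = of_real (b x)" for x
   using mean_cnj[OF bb[of x]] by (simp add: b_def complex_eq_iff)
  have b_add: "beta x y + b (x + y) = b y + b x" for x y
  proof -
   have "M (\<lambda>t. of_real (beta x y) + of_real (beta (x + y) t)) = M (\<lambda>t. of_real (beta y t) + of_real (beta x (y + t)))"
    by (simp only: coc flip: of_real_add)
   also have "... = of_real (b y) + of_real (b x)"
    using mean_add[OF bb bdd_fun_shift[OF bb]] mean_shift[OF bb[of x], of y] by (simp add: Mb)
   finally have "complex_of_real (beta x y + b (x + y)) = of_real (b y + b x)"
    using mean_add[OF bdd_fun_const bb[of "x + y"]] by (simp add: Mb)
   thus ?thesis by (simp only: of_real_eq_iff)
  qed
  define xi where "xi x = z x * cis (b x)" for x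
  have "xi (x + y) = xi x * xi y" for x y
  proof -
   have "xi (x + y) = z x * z y * (cis (beta x y) * cis (b (x + y)))"
    unfolding xi_def cis by (metis uz mult.commute mult.left_commute)
   thus ?thesis by (simp add: cis_mult b_add xi_def add.commute)
  qed
  hence "character xi" by (simp add: character_def xi_def norm_mult z)
  moreover have "norm (xi x - z x) <= e" for x
  proof -
   have "norm (complex_of_real (b x)) <= e" unfolding Mb[symmetric]
    by (rule mean_bound) (use beta[of x] in simp)
   moreover have "norm (xi x - z x) = norm (cis (b x) - 1)"
   proof -
    have "xi x - z x = z x * (cis (b x) - 1)" by (simp add: xi_def right_diff_distrib)
    thus ?thesis by (simp add: norm_mult z)
   qed
   ultimately show ?thesis using norm_cis_minus_one_le[of "b x"] by simp
  qed
  ultimately show "\<exists>xi. character xi & (\<forall>x. norm (xi x - z x) <= e)" by blast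
 qed
qed

section \<open>Convolution with a tent kernel and approximation by finitely many characters\<close>

definition conv :: "('d => complex) => ('d => complex) => 'd => complex" where
 "conv l f x = M (\<lambda>s. l s * f (s + x))"

lemma bdd_fun_shift_right: "bdd_fun f ==> bdd_fun (\<lambda>s. f (s + x))"
 by (rule bdd_fun_compose)

lemma norm_mean_mult_le:
 assumes "bdd_fun l" "bdd_fun f" "!!s. norm (l s) <= K"
 shows "norm (M (\<lambda>s. l s * f (s + x))) <= K * nrm f"
proof -
 have b: "bdd_fun (\<lambda>s. f (s + x))" "bdd_fun (\<lambda>s. cnj (l s))" using assms by (auto intro: bdd_fun_shift_right)
 have "nrm (\<lambda>s. f (s + x)) = nrm f" unfolding nrm_def using ip_shift[OF assms(2,2), of x] by (simp add: add.commute)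
 moreover have "M (\<lambda>s. l s * f (s + x)) = ip (\<lambda>s. f (s + x)) (\<lambda>s. cnj (l s))" by (simp add: ip_def mult.commute)
 moreover have "nrm (\<lambda>s. cnj (l s)) <= K" by (rule nrm_le) (use assms in simp)
 ultimately show ?thesis using cauchy_schwarz[OF b] mult_left_mono[of "nrm (\<lambda>s. cnj (l s))" K "nrm f"] nrm_nonneg[OF assms(2)]
  by (simp add: mult.commute)
qed

lemma conv_linear:
 assumes "bdd_fun l" "bdd_fun f" "bdd_fun g"
 shows "conv l (\<lambda>x. f x + g x) = (\<lambda>x. conv l f x + conv l g x)" "conv l (\<lambda>x. c * f x) = (\<lambda>x. c * conv l f x)"
  "conv l (\<lambda>x. f (d + x)) = (\<lambda>x. conv l f (d + x))" "conv l (\<lambda>x. f x - g x) = (\<lambda>x. conv l f x - conv l g x)"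
proof -
 have b: "bdd_fun (\<lambda>s. l s * f (s + x))" "bdd_fun (\<lambda>s. l s * g (s + x))" for x
  by (intro bdd_fun_rules bdd_fun_shift_right assms)+
 show "conv l (\<lambda>x. f x + g x) = (\<lambda>x. conv l f x + conv l g x)" "conv l (\<lambda>x. f x - g x) = (\<lambda>x. conv l f x - conv l g x)"
  "conv l (\<lambda>x. c * f x) = (\<lambda>x. c * conv l f x)" "conv l (\<lambda>x. f (d + x)) = (\<lambda>x. conv l f (d + x))"
  unfolding conv_def using mean_add[OF b] mean_diff[OF b] mean_scale[OF b(1), of c]
  by (auto simp: fun_eq_iff distrib_left right_diff_distrib mult.left_commute add.left_commute)
qed

lemma conv_displacement:
 assumes "bdd_fun l" "bdd_fun f" "!!s. norm (l (- t + s) - l s) <= K"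
 shows "norm (conv l f (t + x) - conv l f x) <= K * nrm f"
proof -
 have b: "bdd_fun (\<lambda>s. l s * f (s + y))" "bdd_fun (\<lambda>s. l (- t + s) * f (s + y))" for y
  by (intro bdd_fun_rules bdd_fun_shift_right assms)+
 have "conv l f (t + x) = M (\<lambda>s. l (- t + s) * f (s + x))"
  unfolding conv_def using mean_shift[OF b(1)[of "t + x"], of "- t"] by (simp add: algebra_simps)
 hence "conv l f (t + x) - conv l f x = M (\<lambda>s. (l (- t + s) - l s) * f (s + x))"
  unfolding conv_def using mean_diff[OF b(2) b(1)] by (simp add: left_diff_distrib)
 moreover have "bdd_fun (\<lambda>s. l (- t + s) - l s)" by (intro bdd_fun_rules assms)
 ultimately show ?thesis using norm_mean_mult_le[OF _ assms(2,3), of "\<lambda>s. s"] by simp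
qed

text \<open>Rotate \<open>M f\<close> onto the nonnegative axis by a unit \<open>w\<close>; then
  \<open>u - Re (w * f)\<close> is a nonnegative function, and so is its mean.\<close>

lemma norm_mean_le_mean:
 assumes "!!x. norm (f x) <= u x" "!!x. u x <= B"
 shows "norm (M f) <= Re (M (\<lambda>x. of_real (u x)))"
proof -
 have fB: "norm (f x) <= B" and u0: "0 <= u x" for x
  using assms[of x] norm_ge_zero[of "f x"] by linarith+
 have f: "bdd_fun f" using fB by (rule bdd_funI)
 have u: "bdd_fun (\<lambda>x. of_real (u x))" by (rule bdd_funI[of _ B]) (use assms(2) u0 in simp)
 obtain w where w: "norm w = 1" "w * M f = of_real (norm (M f))"
 proof (cases "M f = 0")
  case False
  show ?thesis
   by (rule that[of "of_real (norm (M f)) / M f"]) (use False in "auto simp: norm_divide")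
 qed (use that[of 1] in auto)
 define v where "v x = u x - Re (w * f x)" for x
 have r: "\<bar>Re (w * f x)\<bar> <= u x" for x
  using abs_Re_le_cmod[of "w * f x"] assms(1)[of x] w(1) by (simp add: norm_mult)
 have v: "0 <= v x" "v x <= 2 * B" for x using r[of x] assms(2)[of x] unfolding v_def by linarith+
 have "complex_of_real (v x) = of_real (u x) - (1/2) * (w * f x + cnj (w * f x))" for x
  by (simp add: v_def complex_eq_iff diff_divide_distrib)
 hence "M (\<lambda>x. of_real (v x)) = M (\<lambda>x. of_real (u x) - (1/2) * (w * f x + cnj (w * f x)))" by simp
 also have "... = M (\<lambda>x. of_real (u x)) - (1/2) * (w * M f + cnj (w * M f))"
 proof -
  have b1: "bdd_fun (\<lambda>x. w * f x)" "bdd_fun (\<lambda>x. cnj (w * f x))" by (intro bdd_fun_rules f)+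
  have "M (\<lambda>x. (1/2) * (w * f x + cnj (w * f x))) = (1/2) * (w * M f + cnj (w * M f))"
   using mean_scale[OF bdd_fun_binary(1)[OF b1], of "1/2"] mean_add[OF b1] mean_cnj[OF b1(1)] mean_scale[OF f, of w] by simp
  moreover have "bdd_fun (\<lambda>x. (1/2) * (w * f x + cnj (w * f x)))" by (intro bdd_fun_rules f)
  ultimately show ?thesis by (simp only: mean_diff[OF u])
 qed
 finally have "Re (M (\<lambda>x. of_real (v x))) = Re (M (\<lambda>x. of_real (u x))) - norm (M f)" by (simp add: w(2))
 thus ?thesis using mean_nonneg(2)[of v "2 * B"] v by simp
qed

text \<open>An approximate identity at scale \<open>eta\<close>, of mass \<open>th\<close> and
  bounded by 1 instead of being normalized. The Lipschitz clause makes convolutions with it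
  equicontinuous.\<close>

definition tent_kernel :: "('d => real) => real => ('d => complex) => real => bool" where
 "tent_kernel rho eta l th \<equiv> bdd_fun l & (\<forall>s. norm (l s) <= 1) & (\<forall>s t. norm (l (- t + s) - l s) <= rho t / eta) &
  M l = of_real th & 0 < th & th <= 1 &
  (\<forall>f k. bdd_fun f --> (\<forall>s. rho s <= eta --> norm (f s - f 0) <= k) --> norm (M (\<lambda>s. l s * f s) - of_real th * f 0) <= th * k)"

lemma tent_kernel_exists:
 fixes rho :: "'d => real"
 assumes rho: "rho 0 = 0" "!!x. rho (- x) = rho x" "!!x y. rho (x + y) <= rho x + rho y"
  and net: "!!e. e > 0 ==> \<exists>C. finite C & (\<forall>x. \<exists>c\<in>C. rho (x - c) <= e)" and eta: "eta > 0"
 shows "\<exists>l th. tent_kernel rho eta l th"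
proof -
 have rho0: "rho x >= 0" for x using rho(3)[of x "- x"] rho(1,2) by simp
 have rhod: "\<bar>rho x - rho y\<bar> <= rho (x - y)" for x y
  using rho(3)[of "x - y" y] rho(3)[of "y - x" x] rho(2)[of "x - y"] by simp
 define l0 where "l0 s = max 0 (1 - rho s / eta)" for s
 define l where "l s = complex_of_real (l0 s)" for s
 have l0: "0 <= l0 s" "l0 s <= 1" for s using rho0[of s] eta by (auto simp: l0_def)
 have lb: "norm (l s) <= 1" for s using l0[of s] by (simp add: l_def)
 have bl: "bdd_fun l" using lb by (rule bdd_funI)
 have ll: "norm (l (- t + s) - l s) <= rho t / eta" for s t
 proof -
  have "\<bar>l0 (- t + s) - l0 s\<bar> <= \<bar>rho (- t + s) / eta - rho s / eta\<bar>" unfolding l0_def by linarith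
  also have "... = \<bar>rho (- t + s) - rho s\<bar> / eta" using eta by (metis abs_divide abs_of_pos diff_divide_distrib)
  also have "... <= rho t / eta" using rhod[of "- t + s" s] rho(2)[of t] eta by (intro divide_right_mono) auto
  finally show ?thesis by (simp add: l_def flip: of_real_diff)
 qed
 define th where "th = Re (M l)"
 have thM: "M l = of_real th" "th <= 1" using mean_nonneg[of l0 1] l0 by (auto simp: th_def l_def[abs_def])
 \<comment> \<open>Finitely many translates of the tent have a sum of at least 1/2 everywhere; each
   has mean \<open>th\<close>, so \<open>th\<close> cannot be 0.\<close>
 have th0: "th > 0"
 proof -
  obtain C where C: "finite C" "!!x. \<exists>c\<in>C. rho (x - c) <= eta / 2" using net[of "eta/2"] eta by auto
  have lo: "1/2 <= (\<Sum>c\<in>C. l0 (- c + x))" for x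
  proof -
   obtain c where c: "c \<in> C" "rho (x - c) <= eta / 2" using C(2) by blast
   hence "1/2 <= l0 (- c + x)" using eta by (simp add: l0_def field_simps)
   also have "... <= (\<Sum>c\<in>C. l0 (- c + x))" using C(1) c l0 by (intro member_le_sum) auto
   finally show ?thesis .
  qed
  have "norm (M (\<lambda>x. 1/2)) <= Re (M (\<lambda>x. of_real (\<Sum>c\<in>C. l0 (- c + x))))"
  proof (rule norm_mean_le_mean)
   show "norm (1/2 :: complex) <= (\<Sum>c\<in>C. l0 (- c + x))" for x using lo[of x] by simp
   show "(\<Sum>c\<in>C. l0 (- c + x)) <= real (card C)" for x
    using sum_bounded_above[of C "\<lambda>c. l0 (- c + x)" 1] l0 by simp
  qed
  also have "M (\<lambda>x. of_real (\<Sum>c\<in>C. l0 (- c + x))) = (\<Sum>c\<in>C. M (\<lambda>x. l (- c + x)))"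
   using mean_sum[of C "\<lambda>c x. l (- c + x)", OF bdd_fun_shift[OF bl]] by (simp add: l_def)
  also have "... = of_nat (card C) * of_real th" by (simp only: mean_shift[OF bl] thM sum_constant)
  finally have "0 < real (card C) * th" by simp
  thus ?thesis by (simp add: zero_less_mult_iff)
 qed
 have "norm (M (\<lambda>s. l s * f s) - of_real th * f 0) <= th * k"
  if f: "bdd_fun f" "!!s. rho s <= eta ==> norm (f s - f 0) <= k" for f k
 proof -
  have k: "k >= 0" using f(2)[of 0] eta rho(1) by simp
  have "M (\<lambda>s. l s * f s) - of_real th * f 0 = M (\<lambda>s. l s * f s) - M (\<lambda>s. l s * f 0)"
   using mean_scale_right[OF bl] thM by simp
  also have "... = M (\<lambda>s. l s * (f s - f 0))"
   unfolding right_diff_distrib by (rule mean_diff[symmetric]) (intro bdd_fun_rules bl f)+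
  also have "norm ... <= Re (M (\<lambda>s. of_real (l0 s * k)))"
  proof (rule norm_mean_le_mean[where B = k])
   show "norm (l s * (f s - f 0)) <= l0 s * k" for s
   proof (cases "rho s <= eta")
    case True
    thus ?thesis using f(2)[of s] l0(1)[of s] by (simp add: norm_mult l_def mult_left_mono)
   next
    case False
    hence "l0 s = 0" using eta by (simp add: l0_def)
    thus ?thesis by (simp add: l_def)
   qed
   show "l0 s * k <= k" for s using mult_right_mono[OF l0(2) k] by simp
  qed
  also have "... = th * k" using mean_scale_right[OF bl, of "of_real k"] thM by (simp add: l_def)
  finally show ?thesis .
 qed
 with bl lb ll thM th0 show ?thesis unfolding tent_kernel_def by (intro exI[of _ l] exI[of _ th] conjI allI impI) simp_all
qed

text \<open>A form of the Peter-Weyl theorem without a compact group. Let \<open>G\<close> be the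
  part of \<open>h\<close> orthogonal to the finite set \<open>X\<close> of characters that are
  nearly 1 on a small ball. If \<open>G\<close> were not small, the smoothing \<open>T\<close> would
  give a form that is positive at \<open>G\<close>, hence an approximate joint eigenfunction
  \<open>f\<close> for a finite net of translations, still orthogonal to \<open>X\<close>. Then
  \<open>e = T f\<close> is pointwise an approximate eigenfunction, its eigenvalues form an
  approximate character, and a true character \<open>xi\<close> near them lies in \<open>X\<close>
  because \<open>e\<close> is Lipschitz. But \<open>e\<close> is close to \<open>e 0 * xi\<close>,
  so \<open>ip e f\<close> is too small for the positivity of the form.\<close>

lemma character_approximation:
 fixes rho :: "'d => real"
 assumes rho: "rho 0 = 0" "!!x. rho (- x) = rho x" "!!x y. rho (x + y) <= rho x + rho y"
  and net: "!!e. e > 0 ==> \<exists>C. finite C & (\<forall>x. \<exists>c\<in>C. rho (x - c) <= e)"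
  and h: "bdd_fun h" "K >= 0" "!!s x. norm (h (s + x) - h x) <= K * rho s"
  and delta: "delta > 0"
 shows "\<exists>X a. finite X & (\<forall>xi\<in>X. character xi) & nrm (\<lambda>x. h x - (\<Sum>xi\<in>X. a xi * xi x)) <= delta"
proof -
 define eta where "eta = delta / (2 * (K + 1))"
 have eta: "eta > 0" "K * eta <= delta / 2" using delta h(2) by (auto simp: eta_def field_simps)
 obtain l th where tent: "tent_kernel rho eta l th" using tent_kernel_exists[of rho, OF rho net eta(1)] by blast
 hence bl: "bdd_fun l" and lb: "!!s. norm (l s) <= 1" and ll: "!!s t. norm (l (- t + s) - l s) <= rho t / eta"
  and th0: "th > 0" and thM: "th <= 1" by (simp_all only: tent_kernel_def simp_thms)
 define c0 where "c0 = th / 4"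
 have c0: "c0 > 0" "c0 < 1" using th0 thM by (auto simp: c0_def)
 \<comment> \<open>On this ball the displacement of \<open>e\<close> and the error
   \<open>c0 / 16\<close> of \<open>xi\<close> add up to \<open>c0 / 8\<close>, which divided by the
   lower bound \<open>c0 / 2\<close> for \<open>e\<close> at \<open>x0\<close> gives
   \<open>1/4\<close>.\<close>
 define X where "X = {xi. character xi & (\<forall>s. rho s <= eta * c0 / 16 --> norm (xi s - 1) <= 1/4)}"
 \<comment> \<open>Two members that agree up to \<open>1/4\<close> on a finite net have a quotient
   within \<open>3/4\<close> of 1 everywhere, so the quotient is trivial.\<close>
 have "finite X"
 proof -
  obtain C where C: "finite C" "!!x. \<exists>c\<in>C. rho (x - c) <= eta * c0 / 16" using net[of "eta * c0 / 16"] eta(1) c0 by auto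
  obtain J where J: "finite J" "J \<subseteq> X" "!!xi. xi \<in> X ==> \<exists>xi'\<in>J. \<forall>c\<in>C. norm (xi c - xi' c) < 1/4"
  proof (rule finite_evaluation_net[OF C(1), of X "\<lambda>xi. xi" 1 "1/4"])
   show "norm (xi c) <= 1" if "xi \<in> X" for xi c using that by (simp add: X_def character_def)
  qed (auto intro: that)
  have "X \<subseteq> J"
  proof
   fix xi assume xi: "xi \<in> X"
   then obtain xi' where xi': "xi' \<in> J" "!!c. c \<in> C ==> norm (xi c - xi' c) < 1/4" using J(3) by blast
   have ch: "character xi" "character xi'" "!!s. rho s <= eta * c0 / 16 ==> norm (xi s - 1) <= 1/4 & norm (xi' s - 1) <= 1/4"
    using xi xi' J(2) by (auto simp: X_def)
   define psi where "psi x = xi x * cnj (xi' x)" for x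
   have close: "norm (psi x - 1) <= 3/4" for x
   proof -
    obtain c where c: "c \<in> C" "rho (x - c) <= eta * c0 / 16" using C(2) by blast
    have x: "xi x = xi c * xi (x - c)" "xi' x = xi' c * xi' (x - c)"
     using ch(1,2) unfolding character_def by (metis add_diff_cancel_left' add.commute diff_add_cancel)+
    have "psi x - 1 = (xi x - xi' x) * cnj (xi' x)"
     using ch(2) unit_mult_cnj[of "xi' x"] by (simp add: psi_def left_diff_distrib character_def)
    hence "norm (psi x - 1) = norm (xi x - xi' x)" using ch(2) by (simp add: norm_mult character_def)
    also have "xi x - xi' x = (xi c - xi' c) * xi (x - c) + xi' c * ((xi (x - c) - 1) - (xi' (x - c) - 1))"
     unfolding x by (simp add: algebra_simps)
    also have "norm ... <= norm (xi c - xi' c) + norm ((xi (x - c) - 1) - (xi' (x - c) - 1))"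
     by (rule order_trans[OF norm_triangle_ineq]) (use ch in "simp add: norm_mult character_def")
    also have "... <= 1/4 + (1/4 + 1/4)"
     using xi'(2)[OF c(1)] ch(3)[OF c(2)] norm_triangle_ineq4[of "xi (x - c) - 1" "xi' (x - c) - 1"] by linarith
    finally show ?thesis by simp
   qed
   have "psi x ^ n = psi (((+) x ^^ n) 0)" for x n
   proof (induction n)
    case 0
    have "xi 0 = 1" "xi' 0 = 1" using ch(1,2) unfolding character_def
     by (metis add_0 mult_cancel_right1 norm_zero zero_neq_one)+
    thus ?case by (simp add: psi_def)
   next
    case (Suc n)
    thus ?case using ch(1,2) by (simp add: psi_def character_def)
   qed
   hence one: "psi x = 1" for x using no_small_powers[of "psi x"] close by simp
   have "xi x = xi' x" for x
   proof -
    have "xi x * (cnj (xi' x) * xi' x) = xi' x" using one[of x] by (simp add: psi_def mult.assoc[symmetric])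
    moreover have "cnj (xi' x) * xi' x = 1" using unit_mult_cnj[of "xi' x"] ch(2) by (simp add: character_def mult.commute)
    ultimately show ?thesis by simp
   qed
   hence "xi = xi'" by auto
   with xi' show "xi \<in> J" by simp
  qed
  thus ?thesis using J(1) finite_subset by blast
 qed
 have Xb: "bdd_fun xi" if "xi \<in> X" for xi using that by (auto simp: X_def intro: character_bdd)
 define P where "P x = (\<Sum>xi\<in>X. ip h xi * xi x)" for x
 define G where "G x = h x - P x" for x
 have bP: "bdd_fun P" unfolding P_def by (intro bdd_fun_rules Xb)
 have bG: "bdd_fun G" unfolding G_def by (intro bdd_fun_rules h bP)
 have GX: "ip G xi = 0" if xi: "xi \<in> X" for xi
 proof -
  have "ip P xi = (\<Sum>xi'\<in>X. ip h xi' * ip xi' xi)"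
   unfolding P_def[abs_def] by (rule sesquilinear_sum(1)[OF sesquilinear_ip \<open>finite X\<close>]) (use Xb xi in auto)
  also have "... = ip h xi * ip xi xi"
  proof (subst sum.remove[OF \<open>finite X\<close> xi])
   have "(\<Sum>xi'\<in>X - {xi}. ip h xi' * ip xi' xi) = 0"
    by (rule sum.neutral) (use xi character_orthogonal in "auto simp: X_def")
   thus "ip h xi * ip xi xi + (\<Sum>xi'\<in>X - {xi}. ip h xi' * ip xi' xi) = ip h xi * ip xi xi" by simp
  qed
  finally have "ip P xi = ip h xi" using xi character_ip_self by (simp add: X_def)
  thus ?thesis unfolding G_def[abs_def] using ip_left(3)[OF h(1) bP Xb[OF xi]] by simp
 qed
 have "nrm G <= delta"
 proof (rule ccontr)
  assume "\<not> nrm G <= delta"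
  hence ng: "nrm G > delta" by simp
  define T where "T = conv l"
  have bT: "bdd_fun (T f)" if "bdd_fun f" for f
   unfolding T_def conv_def using norm_mean_mult_le[OF bl that lb] by (intro bdd_funI[of _ "nrm f"]) simp
  have Tle: "norm (T f x) <= nrm f" if "bdd_fun f" for f x
   unfolding T_def conv_def using norm_mean_mult_le[OF bl that lb] by simp
  have 1: "Re (ip (T G) G) >= th / 2 * (nrm G)^2"
  proof -
   have TP: "T P = (\<lambda>x. \<Sum>xi\<in>X. (ip h xi * M (\<lambda>s. l s * xi s)) * xi x)"
   proof
    fix x
    have "T P x = M (\<lambda>s. \<Sum>xi\<in>X. (ip h xi * xi x) * (l s * xi s))"
     unfolding T_def conv_def P_def sum_distrib_left
     by (intro arg_cong[of _ _ M] ext sum.cong refl) (auto simp: X_def character_def)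
    also have "... = (\<Sum>xi\<in>X. M (\<lambda>s. (ip h xi * xi x) * (l s * xi s)))"
     by (rule mean_sum) (intro bdd_fun_rules bl Xb)
    also have "... = (\<Sum>xi\<in>X. (ip h xi * M (\<lambda>s. l s * xi s)) * xi x)"
    proof (rule sum.cong[OF refl])
     fix xi assume "xi \<in> X"
     hence "bdd_fun (\<lambda>s. l s * xi s)" by (intro bdd_fun_rules bl Xb)
     thus "M (\<lambda>s. (ip h xi * xi x) * (l s * xi s)) = (ip h xi * M (\<lambda>s. l s * xi s)) * xi x"
      by (subst mean_scale) (simp_all only: mult_ac)
    qed
    finally show "T P x = (\<Sum>xi\<in>X. (ip h xi * M (\<lambda>s. l s * xi s)) * xi x)" .
   qed
   have "ip G (T P) = 0" unfolding TP
    by (subst sesquilinear_sum(2)[OF sesquilinear_ip \<open>finite X\<close> Xb bG]) (auto simp: GX)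
   hence TP0: "ip (T P) G = 0" using ip_cnj[OF bG bT[OF bP]] by simp
   have TG: "T G = (\<lambda>x. T h x - T P x)" unfolding T_def G_def[abs_def] by (rule conv_linear(4)[OF bl h(1) bP])
   have P0: "ip P G = 0"
   proof -
    have "ip G P = 0" unfolding P_def[abs_def]
     by (subst sesquilinear_sum(2)[OF sesquilinear_ip \<open>finite X\<close> Xb bG]) (auto simp: GX)
    thus ?thesis using ip_cnj[OF bG bP] by simp
   qed
   have hG: "ip h G = of_real ((nrm G)^2)"
    using ip_left(3)[OF h(1) bP bG] P0 ip_self(1)[OF bG] unfolding G_def[abs_def] by simp
   define D where "D x = T h x - of_real th * h x" for x
   have bD: "bdd_fun D" unfolding D_def by (intro bdd_fun_rules bT h)
   have "norm (D x) <= th * (K * eta)" for x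
   proof -
    have "norm (h (s + x) - h (0 + x)) <= K * eta" if "rho s <= eta" for s
     using h(3)[of s x] mult_left_mono[OF that h(2)] by simp
    moreover have "bdd_fun (\<lambda>s. h (s + x))" by (rule bdd_fun_shift_right[OF h(1)])
    ultimately have "norm (M (\<lambda>s. l s * h (s + x)) - of_real th * h (0 + x)) <= th * (K * eta)"
     using tent unfolding tent_kernel_def by fast
    thus ?thesis by (simp add: D_def T_def conv_def)
   qed
   hence "nrm D <= th * (K * eta)" by (rule nrm_le)
   also have "... <= th * (delta / 2)" using eta th0 by (intro mult_left_mono) auto
   finally have nD: "nrm D <= th * (delta / 2)" .
   have "ip (T G) G = ip D G + of_real th * ip h G"
   proof -
    have "ip (T G) G = ip (T h) G" unfolding TG using ip_left(3)[OF bT[OF h(1)] bT[OF bP] bG] TP0 by simp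
    moreover have "ip D G = ip (T h) G - of_real th * ip h G"
     unfolding D_def[abs_def] using ip_left(3)[OF bT[OF h(1)] _ bG, of "\<lambda>x. of_real th * h x"] ip_left(2)[OF h(1) h(1) bG] h(1) by auto
    ultimately show ?thesis by simp
   qed
   hence "Re (ip (T G) G) = Re (ip D G) + th * (nrm G)^2" by (simp add: hG)
   moreover have "\<bar>Re (ip D G)\<bar> <= th * (delta / 2) * nrm G"
    using abs_Re_le_cmod[of "ip D G"] cauchy_schwarz[OF bD bG] mult_right_mono[OF nD nrm_nonneg[OF bG]] by linarith
   moreover have "th * (delta / 2) * nrm G <= th / 2 * (nrm G)^2"
    using mult_right_mono[OF less_imp_le[OF ng], of "th / 2 * nrm G"] th0 nrm_nonneg[OF bG] by (simp add: power2_eq_square algebra_simps)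
   ultimately show ?thesis by linarith
  qed
  have "c0 / 32 > 0" using c0 by simp
  then obtain kappa0 where kappa0: "kappa0 > 0" "!!z :: 'd => complex. (!!x. norm (z x) = 1) ==> (!!x y. norm (z (x + y) - z x * z y) <= kappa0) ==>
    \<exists>xi. character xi & (\<forall>x. norm (xi x - z x) <= c0 / 32)"
   by (rule character_near_approximate_character) blast
  \<comment> \<open>\<open>kappa0 * c0 / 6\<close> bounds the multiplicativity defect
    \<open>3 * kappa / (c0 / 2)\<close> by \<open>kappa0\<close>; \<open>c0 / 32\<close> keeps the
    total error of \<open>xi\<close> below \<open>c0 / 16\<close>.\<close>
  define kappa where "kappa = min (c0 / 32) (kappa0 * c0 / 6)"
  have kappa: "kappa > 0" "kappa <= c0 / 32" "kappa <= kappa0 * c0 / 6" using c0 kappa0(1) by (auto simp: kappa_def)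
  \<comment> \<open>With this weight the bound \<open>n^2 / A\<close> for a defect is the square of
    \<open>kappa / 2 * n\<close>.\<close>
  define A where "A = 4 / kappa^2"
  obtain C where C: "finite C" "!!x. \<exists>c\<in>C. rho (x - c) <= kappa * eta / 2" using net[of "kappa * eta / 2"] eta(1) kappa by auto
  define B where "B f g = ip (T f) g - of_real c0 * ip f g" for f g
  have "sesquilinear B"
  proof -
   have TT: "T (\<lambda>x. f x + g x) = (\<lambda>x. T f x + T g x)" "T (\<lambda>x. c * f x) = (\<lambda>x. c * T f x)" "T (\<lambda>x. f (d + x)) = (\<lambda>x. T f (d + x))"
    if "bdd_fun f" "bdd_fun g" for f g c d unfolding T_def using conv_linear[OF bl that] by auto
   show ?thesis unfolding sesquilinear_def B_def
    by (simp add: TT ip_left ip_right ip_shift bT algebra_simps)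
  qed
  \<comment> \<open>Orthogonality to \<open>X\<close> has to survive the passage from
    \<open>G\<close> to \<open>f\<close>. Characters are eigenfunctions of translations, so their
    orthogonal complement is translation invariant.\<close>
  define W where "W = {f. bdd_fun f & (\<forall>xi\<in>X. ip f xi = 0)}"
  have "invariant_subspace W" unfolding invariant_subspace_def
  proof (intro conjI ballI allI impI)
   fix g d assume g: "g \<in> W"
   have bg: "bdd_fun g" using g by (simp add: W_def)
   have "ip (\<lambda>x. g (d + x)) xi = 0" if xi: "xi \<in> X" for xi
   proof -
    have ch: "xi (d + x) = xi d * xi x" "norm (xi d) = 1" for x using xi by (auto simp: X_def character_def)
    have "0 = ip (\<lambda>x. g (d + x)) (\<lambda>x. xi (d + x))" using ip_shift[OF bg Xb[OF xi], of d] g xi by (simp add: W_def)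
    also have "... = cnj (xi d) * ip (\<lambda>x. g (d + x)) xi"
     unfolding ch(1) by (rule ip_right(2)[OF Xb[OF xi] Xb[OF xi] bdd_fun_shift[OF bg]])
    finally show ?thesis using ch(2) by auto
   qed
   thus "(\<lambda>x. g (d + x)) \<in> W" using bg by (simp add: W_def bdd_fun_shift)
  next
   fix I :: "nat set" and c g assume I: "finite I" "\<forall>i\<in>I. g i \<in> W"
   hence b: "!!i. i \<in> I ==> bdd_fun (g i)" by (simp add: W_def)
   have "ip (\<lambda>x. \<Sum>i\<in>I. c i * g i x) xi = 0" if xi: "xi \<in> X" for xi
    by (subst sesquilinear_sum(1)[OF sesquilinear_ip I(1) b Xb[OF xi]]) (use I xi in "auto simp: W_def")
   thus "(\<lambda>x. \<Sum>i\<in>I. c i * g i x) \<in> W" using b by (auto simp: W_def intro!: bdd_fun_rules)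
  qed
  moreover have "Re (B G G) > 0"
  proof -
   have "Re (B G G) >= th / 4 * (nrm G)^2" using 1 ip_self(1)[OF bG] by (simp add: B_def c0_def)
   moreover have "th / 4 * (nrm G)^2 > 0" using th0 ng delta by (intro mult_pos_pos) auto
   ultimately show ?thesis by linarith
  qed
  moreover have "G \<in> W" using bG GX by (simp add: W_def)
  ultimately obtain f z where f: "bdd_fun f" "f \<in> W" "!!c. c \<in> C ==> norm (z c) = 1"
    "Re (B f f) - A * (\<Sum>c\<in>C. (nrm (\<lambda>x. f (c + x) - z c * f x))^2) > 0"
   using approx_joint_eigenfunction[OF C(1) \<open>sesquilinear B\<close> bG, of A W] by (auto simp: A_def)
  define n where "n = nrm f"
  define e where "e = T f"
  have be: "bdd_fun e" unfolding e_def by (rule bT[OF f(1)])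
  have eB: "norm (e x) <= n" for x unfolding e_def n_def by (rule Tle[OF f(1)])
  have n0: "n >= 0" unfolding n_def by (rule nrm_nonneg[OF f(1)])
  have A0: "A > 0" using kappa by (simp add: A_def)
  define Q where "Q = (\<Sum>c\<in>C. (nrm (\<lambda>x. f (c + x) - z c * f x))^2)"
  have Q0: "Q >= 0" unfolding Q_def by (rule sum_nonneg) simp
  have main: "Re (ip e f) > c0 * n^2 + A * Q"
   using f(4) ip_self(1)[OF f(1)] unfolding B_def e_def n_def Q_def[symmetric] by simp
  have ipn: "norm (ip e f) <= nrm e * n" unfolding n_def by (rule cauchy_schwarz[OF be f(1)])
  have "nrm e <= n" by (rule nrm_le) (rule eB)
  hence "Re (ip e f) <= n * n"
   using ipn complex_Re_le_cmod[of "ip e f"] mult_right_mono[of "nrm e" n n] n0 by linarith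
  hence n2: "c0 * n^2 + A * Q < n\<^sup>2" using main by (simp add: power2_eq_square)
  have npos: "n > 0"
  proof (rule ccontr)
   assume "\<not> n > 0"
   hence "n = 0" using n0 by simp
   thus False using n2 mult_nonneg_nonneg[OF less_imp_le[OF A0] Q0] by simp
  qed
  have eig: "norm (e (c + x) - z c * e x) <= kappa / 2 * n" if c: "c \<in> C" for c x
  proof -
   have bd: "bdd_fun (\<lambda>x. f (c + x) - z c * f x)" by (intro bdd_fun_rules f)
   have "(nrm (\<lambda>x. f (c + x) - z c * f x))^2 <= Q"
    unfolding Q_def by (rule member_le_sum[OF c]) (use C(1) in auto)
   also have "0 <= c0 * n^2" using c0 by simp
   hence "Q * A <= n\<^sup>2" using n2 by (simp add: mult.commute)
   hence "Q <= n\<^sup>2 / A" using A0 by (simp add: pos_le_divide_eq)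
   also have "... = (kappa / 2 * n)^2" using kappa(1) by (simp add: A_def power2_eq_square)
   finally have "nrm (\<lambda>x. f (c + x) - z c * f x) <= kappa / 2 * n" by (rule power2_le_imp_le) (use kappa(1) n0 in simp)
   moreover have "e (c + x) - z c * e x = T (\<lambda>x. f (c + x) - z c * f x) x"
    unfolding e_def T_def
    by (subst conv_linear(4)[OF bl], (intro bdd_fun_rules f)+) (simp add: conv_linear(2,3)[OF bl f(1) f(1)])
   ultimately show ?thesis using Tle[OF bd, of x] by simp
  qed
  obtain p where p: "!!x. p x \<in> C" "!!x. rho (x - p x) <= kappa * eta / 2" using C(2) by metis
  define y where "y x = z (p x)" for x
  have y1: "norm (y x) = 1" for x using f(3) p by (simp add: y_def)
  have disp: "norm (e (t + x) - e x) <= rho t / eta * n" for t x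
   unfolding e_def T_def n_def by (rule conv_displacement[OF bl f(1) ll])
  have ye: "norm (e (d + x) - y d * e x) <= kappa * n" for d x
  proof -
   have "norm (e ((d - p d) + (p d + x)) - e (p d + x)) <= rho (d - p d) / eta * n" by (rule disp)
   also have "... <= (kappa * eta / 2) / eta * n" using p(2)[of d] eta(1) n0 by (intro mult_right_mono divide_right_mono) auto
   finally have "norm (e (d + x) - e (p d + x)) <= kappa / 2 * n" using eta(1) by (simp add: algebra_simps)
   thus ?thesis using eig[OF p(1)[of d], of x] norm_triangle_ineq[of "e (d + x) - e (p d + x)" "e (p d + x) - y d * e x"]
    by (simp add: y_def)
  qed
  obtain x0 where x0: "norm (e x0) > c0 / 2 * n"
  proof (rule ccontr)
   assume "\<not> thesis"
   hence "norm (e x) <= c0 / 2 * n" for x using that by (meson not_less)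
   hence "nrm e <= c0 / 2 * n" by (rule nrm_le)
   hence "nrm e * n <= c0 / 2 * n * n" using n0 by (rule mult_right_mono)
   hence "Re (ip e f) <= c0 / 2 * n^2" using ipn complex_Re_le_cmod[of "ip e f"] by (simp add: power2_eq_square)
   moreover have "c0 / 2 * n^2 <= c0 * n^2" using c0 by simp
   ultimately show False using main mult_nonneg_nonneg[OF less_imp_le[OF A0] Q0] by linarith
  qed
  have cancel: "norm w <= k / (c0 / 2)" if "norm (w * e x0) <= k * n" for w k
  proof -
   have "norm w * (c0 / 2 * n) <= norm w * norm (e x0)" using x0 by (intro mult_left_mono) auto
   hence "norm w * (c0 / 2) * n <= k * n" using that by (simp add: norm_mult)
   thus ?thesis using npos c0 by (simp add: pos_le_divide_eq)
  qed
  have "norm (y (s + t) - y s * y t) <= kappa0" for s t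
  proof -
   have "(y (s + t) - y s * y t) * e x0 = - (e ((s + t) + x0) - y (s + t) * e x0)
     + ((e (s + (t + x0)) - y s * e (t + x0)) + y s * (e (t + x0) - y t * e x0))"
    by (simp add: algebra_simps)
   also have "norm ... <= kappa * n + (kappa * n + kappa * n)"
   proof (intro norm_triangle_le add_mono)
    show "norm (y s * (e (t + x0) - y t * e x0)) <= kappa * n" using ye by (simp add: norm_mult y1)
    show "norm (- (e ((s + t) + x0) - y (s + t) * e x0)) <= kappa * n" unfolding norm_minus_cancel by (rule ye)
   qed (rule ye)
   also have "... = 3 * kappa * n" by simp
   finally have "norm (y (s + t) - y s * y t) <= 3 * kappa / (c0 / 2)" by (rule cancel)
   also have "... <= kappa0" using kappa(3) c0 by (simp add: field_simps)
   finally show ?thesis .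
  qed
  then obtain xi where xi: "character xi" "!!x. norm (xi x - y x) <= c0 / 32" using kappa0(2)[of y] y1 by blast
  have xie: "norm (e (d + x) - xi d * e x) <= c0 / 16 * n" for d x
  proof -
   have "e (d + x) - xi d * e x = (e (d + x) - y d * e x) - (xi d - y d) * e x" by (simp add: algebra_simps)
   also have "norm ... <= kappa * n + c0 / 32 * n"
   proof (rule norm_triangle_le_diff, rule add_mono[OF ye])
    have "norm (xi d - y d) * norm (e x) <= c0 / 32 * n" using c0 by (intro mult_mono xi eB) auto
    thus "norm ((xi d - y d) * e x) <= c0 / 32 * n" by (simp add: norm_mult)
   qed
   also have "... <= c0 / 16 * n" using mult_right_mono[OF kappa(2) n0] by (simp add: algebra_simps)
   finally show ?thesis .
  qed
  have "xi \<in> X" unfolding X_def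
  proof (intro CollectI conjI allI impI xi(1))
   fix s assume s: "rho s <= eta * c0 / 16"
   have "(xi s - 1) * e x0 = (e (s + x0) - e x0) - (e (s + x0) - xi s * e x0)" by (simp add: algebra_simps)
   also have "norm ... <= rho s / eta * n + c0 / 16 * n" by (intro norm_triangle_le_diff add_mono disp xie)
   also have "... <= (eta * c0 / 16) / eta * n + c0 / 16 * n"
    using s eta(1) n0 by (intro add_mono mult_right_mono divide_right_mono) auto
   also have "... = c0 / 8 * n" using eta(1) by simp
   finally have "norm (xi s - 1) <= c0 / 8 / (c0 / 2)" by (rule cancel)
   thus "norm (xi s - 1) <= 1 / 4" using c0 by simp
  qed
  hence "ip f xi = 0" using f(2) by (simp add: W_def)
  hence xif: "ip xi f = 0" using ip_cnj[OF f(1) character_bdd[OF xi(1)]] by simp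
  have bxi: "bdd_fun (\<lambda>x. e 0 * xi x)" by (intro bdd_fun_rules character_bdd xi)
  have "ip e f = ip (\<lambda>x. e x - e 0 * xi x) f"
   using ip_left(3)[OF be bxi f(1)] ip_left(2)[OF character_bdd[OF xi(1)] be f(1), of "e 0"] xif by simp
  moreover have "nrm (\<lambda>x. e x - e 0 * xi x) <= c0 / 16 * n"
   by (rule nrm_le) (use xie[of _ 0] in "simp add: mult.commute")
  ultimately have "norm (ip e f) <= c0 / 16 * n * n"
   using cauchy_schwarz[OF bdd_fun_binary(2)[OF be bxi] f(1)] mult_right_mono[OF _ n0] unfolding n_def[symmetric] by (metis order_trans)
  moreover have "c0 / 16 * n * n <= c0 * n^2" using c0 n0 by (simp add: power2_eq_square)
  ultimately show False
   using main complex_Re_le_cmod[of "ip e f"] mult_nonneg_nonneg[OF less_imp_le[OF A0] Q0] by linarith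
 qed
 thus ?thesis using \<open>finite X\<close> unfolding G_def[abs_def] P_def
  by (intro exI[of _ X] exI[of _ "ip h"]) (auto simp: X_def)
qed

text \<open>Only the tent kernel \<open>h\<close> is approximated by characters:
  \<open>F z 0\<close> is nearly the mean of \<open>h * F z\<close> divided by the mass
  \<open>m\<close>, and the character sum for \<open>h\<close> turns this into Fourier components of
  \<open>F z\<close>. Hence the same characters and coefficients serve all \<open>z\<close>. The
  length \<open>rho\<close> is a supremum over \<open>Z\<close>, and closure of the family under
  translations gives its triangle inequality and symmetry.\<close>

theorem almost_periodic_approximation:
 fixes F :: "'z => 'd => complex"
 assumes B: "!!z d. z \<in> Z ==> norm (F z d) <= B" and Z: "Z ~= {}"
  and translate: "!!z d. z \<in> Z ==> \<exists>z'\<in>Z. F z' = (\<lambda>x. F z (d + x))"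
  and net: "!!e. e > 0 ==> \<exists>C. finite C & (\<forall>d. \<exists>c\<in>C. \<forall>z\<in>Z. norm (F z d - F z c) <= e)"
  and e: "e > 0"
 shows "\<exists>X a. finite X & (\<forall>xi\<in>X. character xi) &
  (\<forall>z\<in>Z. norm (F z 0 - (\<Sum>xi\<in>X. a xi * M (\<lambda>d. cnj (xi d) * F z d))) <= e)"
proof -
 define R where "R d = (\<lambda>z. norm (F z d - F z 0)) ` Z" for d
 have bdd: "bdd_above (R d)" for d unfolding R_def bdd_above_def
 proof (intro exI[of _ "B + B"] ballI)
  fix x assume "x \<in> (\<lambda>z. norm (F z d - F z 0)) ` Z"
  then obtain z where z: "z \<in> Z" "x = norm (F z d - F z 0)" by blast
  show "x <= B + B" unfolding z(2) by (rule norm_triangle_le_diff[OF add_mono[OF B[OF z(1)] B[OF z(1)]]])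
 qed
 define rho where "rho d = Sup (R d)" for d
 have rho_le: "rho d <= k" if "!!z. z \<in> Z ==> norm (F z d - F z 0) <= k" for d k
  unfolding rho_def using Z that by (intro cSup_least) (auto simp: R_def)
 have rho_ge: "norm (F z (s + d) - F z d) <= rho s" if z: "z \<in> Z" for z d s
 proof -
  obtain z' where z': "z' \<in> Z" "F z' = (\<lambda>x. F z (d + x))" using translate[OF z] by blast
  have "norm (F z' s - F z' 0) <= rho s"
   unfolding rho_def using z'(1) by (intro cSup_upper bdd) (auto simp: R_def)
  thus ?thesis by (simp add: z' add.commute)
 qed
 have rho0: "rho 0 = 0" using rho_le[of 0 0] rho_ge[of _ 0 0] Z by fastforce
 have rhom: "rho (- d) <= rho d" for d
  by (rule rho_le) (use rho_ge[of _ d "- d"] in "simp add: norm_minus_commute")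
 have rhominus: "rho (- d) = rho d" for d using rhom[of d] rhom[of "- d"] by simp
 have rhoadd: "rho (s + t) <= rho s + rho t" for s t
 proof (rule rho_le)
  fix z assume z: "z \<in> Z"
  have "norm (F z (s + t) - F z 0) <= norm (F z (s + t) - F z t) + norm (F z (t + 0) - F z 0)"
   using norm_triangle_ineq[of "F z (s + t) - F z t" "F z t - F z 0"] by simp
  thus "norm (F z (s + t) - F z 0) <= rho s + rho t" using rho_ge[OF z, of s t] rho_ge[OF z, of t 0] by linarith
 qed
 have rhonet: "\<exists>C. finite C & (\<forall>x. \<exists>c\<in>C. rho (x - c) <= k)" if "k > 0" for k
 proof -
  obtain C where C: "finite C" "!!d. \<exists>c\<in>C. \<forall>z\<in>Z. norm (F z d - F z c) <= k" using net[OF \<open>k > 0\<close>] by blast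
  have "\<exists>c\<in>C. rho (x - c) <= k" for x
  proof -
   obtain c where c: "c \<in> C" "!!z. z \<in> Z ==> norm (F z x - F z c) <= k" using C(2) by blast
   have "rho (x - c) <= k"
   proof (rule rho_le)
    fix z assume "z \<in> Z"
    then obtain z' where z': "z' \<in> Z" "F z' = (\<lambda>y. F z (- c + y))" using translate by blast
    obtain z'' where "z'' \<in> Z" "F z'' = (\<lambda>y. F z (- c + y))" using z' by blast
    thus "norm (F z (x - c) - F z 0) <= k" using c(2)[of z''] by (simp add: add.commute)
   qed
   thus ?thesis using c by blast
  qed
  thus ?thesis using C(1) by blast
 qed
 define k where "k = e / 2"
 have k: "k > 0" using e by (simp add: k_def)
 obtain h m where tent: "tent_kernel rho k h m" using tent_kernel_exists[of rho, OF rho0 rhominus rhoadd rhonet k] by blast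
 hence bh: "bdd_fun h" and hlip: "!!s t. norm (h (- t + s) - h s) <= rho t / k" and hm: "m > 0"
  by (simp_all only: tent_kernel_def simp_thms)
 have hlip': "norm (h (s + x) - h x) <= (1 / k) * rho s" for s x using hlip[of "- s" x] by (simp add: rhominus)
 define delta where "delta = k * m / (\<bar>B\<bar> + 1)"
 have delta: "delta > 0" "delta * \<bar>B\<bar> <= k * m" using k hm by (auto simp: delta_def divide_simps mult_left_mono)
 obtain X a where X: "finite X" "!!xi. xi \<in> X ==> character xi" "nrm (\<lambda>x. h x - (\<Sum>xi\<in>X. a xi * xi x)) <= delta"
  using character_approximation[of rho, OF rho0 rhominus rhoadd rhonet bh _ hlip' delta(1)] k by auto
 have main: "norm (F z 0 - (\<Sum>xi\<in>X. (a xi / of_real m) * M (\<lambda>d. xi d * F z d))) <= e" if z: "z \<in> Z" for z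
 proof -
  have bF: "bdd_fun (F z)" by (rule bdd_funI[of _ B]) (use B z in auto)
  have bX: "bdd_fun xi" if "xi \<in> X" for xi using X(2)[OF that] by (rule character_bdd)
  have bhF: "bdd_fun (\<lambda>d. h d * F z d)" by (intro bdd_fun_rules bh bF)
  have 1: "norm (M (\<lambda>d. h d * F z d) - of_real m * F z 0) <= m * k"
  proof -
   have "norm (F z s - F z 0) <= k" if "rho s <= k" for s using rho_ge[OF z, of s 0] that by simp
   with tent bF show ?thesis unfolding tent_kernel_def by blast
  qed
  have 2: "norm (M (\<lambda>d. h d * F z d) - (\<Sum>xi\<in>X. a xi * M (\<lambda>d. xi d * F z d))) <= delta * \<bar>B\<bar>"
  proof -
   have b1: "bdd_fun (\<lambda>d. xi d * F z d)" if "xi \<in> X" for xi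
    by (rule bdd_fun_binary(3)[OF bX[OF that] bF])
   have b2: "bdd_fun (\<lambda>d. \<Sum>xi\<in>X. a xi * (xi d * F z d))"
    by (rule bdd_fun_sum, rule bdd_fun_cmult(1), rule b1)
   have b3: "bdd_fun (\<lambda>x. h x - (\<Sum>xi\<in>X. a xi * xi x))"
    by (rule bdd_fun_binary(2)[OF bh], rule bdd_fun_sum, rule bdd_fun_cmult(1), rule bX)
   have eq: "(\<Sum>xi\<in>X. a xi * M (\<lambda>d. xi d * F z d)) = M (\<lambda>d. \<Sum>xi\<in>X. a xi * (xi d * F z d))"
   proof (subst mean_sum)
    show "bdd_fun (\<lambda>d. a xi * (xi d * F z d))" if "xi \<in> X" for xi by (rule bdd_fun_cmult(1)[OF b1[OF that]])
    show "(\<Sum>xi\<in>X. a xi * M (\<lambda>d. xi d * F z d)) = (\<Sum>xi\<in>X. M (\<lambda>d. a xi * (xi d * F z d)))"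
     by (rule sum.cong[OF refl], rule mean_scale[OF b1, symmetric])
   qed
   have eq2: "(h d - (\<Sum>xi\<in>X. a xi * xi d)) * F z d = h d * F z d - (\<Sum>xi\<in>X. a xi * (xi d * F z d))" for d
    by (simp only: left_diff_distrib sum_distrib_right mult.assoc)
   have "M (\<lambda>d. h d * F z d) - (\<Sum>xi\<in>X. a xi * M (\<lambda>d. xi d * F z d)) =
     M (\<lambda>d. (h d - (\<Sum>xi\<in>X. a xi * xi d)) * F z d)"
    unfolding eq eq2 by (rule mean_diff[OF bhF b2, symmetric])
   also have "... = ip (\<lambda>d. h d - (\<Sum>xi\<in>X. a xi * xi d)) (\<lambda>d. cnj (F z d))" by (simp add: ip_def)
   also have "norm ... <= nrm (\<lambda>d. h d - (\<Sum>xi\<in>X. a xi * xi d)) * nrm (\<lambda>d. cnj (F z d))"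
    by (rule cauchy_schwarz[OF b3 bdd_fun_cnj[OF bF]])
   also have "... <= delta * \<bar>B\<bar>"
   proof (rule mult_mono[OF X(3)])
    show "nrm (\<lambda>d. cnj (F z d)) <= \<bar>B\<bar>" by (rule nrm_le) (use order_trans[OF B[OF z] abs_ge_self] in simp)
   qed (use delta nrm_nonneg[OF bdd_fun_cnj[OF bF]] in auto)
   finally show ?thesis .
  qed
  have "of_real m * (F z 0 - (\<Sum>xi\<in>X. (a xi / of_real m) * M (\<lambda>d. xi d * F z d))) =
    (M (\<lambda>d. h d * F z d) - (\<Sum>xi\<in>X. a xi * M (\<lambda>d. xi d * F z d))) - (M (\<lambda>d. h d * F z d) - of_real m * F z 0)"
   using hm by (simp add: right_diff_distrib sum_distrib_left)
  also have "norm ... <= delta * \<bar>B\<bar> + m * k" by (rule norm_triangle_le_diff[OF add_mono[OF 2 1]])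
  also have "... <= m * e" using delta(2) by (simp add: k_def algebra_simps)
  finally show ?thesis using hm by (simp add: norm_mult)
 qed
 \<comment> \<open>Passing to the conjugate characters brings the components into the form
   \<open>cnj (xi d) * F z d\<close>.\<close>
 have inj: "inj_on (\<lambda>xi d. cnj (xi d)) X" by (rule inj_onI) (metis complex_cnj_cnj ext)
 show ?thesis
 proof (intro exI conjI ballI)
  show "finite ((\<lambda>xi d. cnj (xi d)) ` X)" using X(1) by simp
  show "character xi" if "xi \<in> (\<lambda>xi d. cnj (xi d)) ` X" for xi using that X(2) character_cnj by auto
  fix z assume "z \<in> Z"
  from main[OF this] show "norm (F z 0 - (\<Sum>xi\<in>(\<lambda>xi d. cnj (xi d)) ` X. (a (\<lambda>d. cnj (xi d)) / of_real m) * M (\<lambda>d. cnj (xi d) * F z d))) <= e"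
   by (simp add: sum.reindex[OF inj])
 qed
qed

end

section \<open>Nilpotent groups with a compactness condition\<close>

text \<open>Groups are written additively, although they are not commutative.\<close>

lemmas group_simps = add.assoc diff_conv_add_uminus minus_add minus_minus minus_zero add_0 add_0_right add_minus_cancel minus_add_cancel left_minus right_minus

definition subgrp :: "'g::group_add set => bool" where
 "subgrp H \<equiv> 0 \<in> H & (\<forall>x\<in>H. \<forall>y\<in>H. x + y \<in> H) & (\<forall>x\<in>H. - x \<in> H)"

lemma subgrpD:
 assumes "subgrp H"
 shows "0 \<in> H" "x \<in> H ==> y \<in> H ==> x + y \<in> H" "x \<in> H ==> - x \<in> H" "x \<in> H ==> y \<in> H ==> x - y \<in> H"
 using assms by (auto simp: subgrp_def simp del: add_uminus_conv_diff simp: diff_conv_add_uminus)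

inductive_set gen :: "'g::group_add set => 'g set" for A where
 gen_zero: "0 \<in> gen A"
| gen_base: "x \<in> A ==> x \<in> gen A"
| gen_add: "x \<in> gen A ==> y \<in> gen A ==> x + y \<in> gen A"
| gen_minus: "x \<in> gen A ==> - x \<in> gen A"

lemma subgrp_gen: "subgrp (gen A)"
 by (auto simp: subgrp_def intro: gen.intros)

lemma gen_least: "subgrp H ==> A \<subseteq> H ==> gen A \<subseteq> H"
proof
 fix x assume H: "subgrp H" "A \<subseteq> H" and "x \<in> gen A"
 from this(3) show "x \<in> H" by (induction rule: gen.induct) (use H in "auto dest: subgrpD")
qed

definition com :: "'g::group_add => 'g => 'g" where
 "com x y = x + y - x - y"

lemma com_zero [simp]: "com 0 u = 0" "com g 0 = 0"
 by (simp_all add: com_def)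

lemma com_add_left: "com (g + h) u = (g + com h u - g) + com g u"
 by (simp only: com_def group_simps)

lemma com_add_right: "com g (u + v) = com g u + (u + com g v - u)"
 by (simp only: com_def group_simps)

lemma conj_eq_com: "g + u - g = com g u + u"
 by (simp only: com_def group_simps)

lemma com_conj: "g + com u v - g = com (g + u - g) (g + v - g)"
 by (simp only: com_def group_simps)

primrec nmul :: "nat => 'g::group_add => 'g" where
 "nmul 0 x = 0"
| "nmul (Suc n) x = x + nmul n x"

lemma nmul_add: "nmul (m + n) x = nmul m x + nmul n x"
 by (induction m) (auto simp: add.assoc)

lemma nmul_mult: "nmul (m * n) x = nmul m (nmul n x)"
 by (induction m) (auto simp: nmul_add)

lemma nmul_mem: "subgrp H ==> x \<in> H ==> nmul n x \<in> H"
 by (induction n) (auto dest: subgrpD)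

lemma nmul_one [simp]: "nmul (Suc 0) x = x" by simp

lemma nmul_prod: "nmul n z = (nmul n (fst z), nmul n (snd z))"
 by (induction n) (auto simp: zero_prod_def plus_prod_def)

definition unit_hom :: "'g::group_add set => ('g => complex) => bool" where
 "unit_hom H c \<equiv> (\<forall>x\<in>H. \<forall>y\<in>H. c (x + y) = c x * c y) & (\<forall>x\<in>H. norm (c x) = 1)"

lemma unit_hom_simps:
 assumes "unit_hom H c" "subgrp H"
 shows "c 0 = 1" "x \<in> H ==> c (nmul n x) = c x ^ n" "x \<in> H ==> c (- x) = cnj (c x)"
proof -
 show 0: "c 0 = 1" using assms unfolding unit_hom_def subgrp_def
  by (metis add_0 mult_cancel_right1 norm_zero zero_neq_one)
 show "x \<in> H ==> c (nmul n x) = c x ^ n"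
  using assms 0 nmul_mem[OF assms(2)] by (induction n) (auto simp: unit_hom_def)
 assume x: "x \<in> H"
 hence "c x * c (- x) = 1" using assms 0 by (metis add.right_inverse subgrpD(3) unit_hom_def)
 moreover have "cnj (c x) * c x = 1" using unit_mult_cnj[of "c x"] assms(1) x by (simp add: unit_hom_def mult.commute)
 ultimately show "c (- x) = cnj (c x)" by (metis mult.assoc mult.left_neutral mult.right_neutral)
qed

lemma unit_hom_kernel: "unit_hom H c ==> subgrp H ==> subgrp {x\<in>H. c x = 1}"
 using unit_hom_simps[of H c] by (auto simp: subgrp_def unit_hom_def)

lemma unit_hom_trivial:
 assumes "unit_hom H c" "subgrp H" "!!x. x \<in> H ==> norm (c x - 1) <= 3/4" "x \<in> H"
 shows "c x = 1"
 by (rule no_small_powers) (metis assms nmul_mem unit_hom_simps(2))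

lemma norm_power_diff_one: "norm (z :: complex) = 1 ==> norm (z ^ n - 1) <= real n * norm (z - 1)"
proof (induction n)
 case (Suc n)
 have "z ^ Suc n - 1 = z * (z ^ n - 1) + (z - 1)" by (simp add: algebra_simps)
 also have "norm ... <= norm (z ^ n - 1) + norm (z - 1)"
  by (rule order_trans[OF norm_triangle_ineq]) (simp add: norm_mult Suc)
 finally show ?case using Suc by (simp add: algebra_simps)
qed simp

lemma root_of_unity_gap:
 assumes "z ^ D = (1 :: complex)" "norm z = 1" "D >= 1" "real D * norm (z - 1) <= 3/4"
 shows "z = 1"
proof (rule no_small_powers)
 fix n
 have "z ^ n = (z ^ D) ^ (n div D) * z ^ (n mod D)"
  by (metis div_mult_mod_eq mult.commute power_add power_mult)
 hence "norm (z ^ n - 1) = norm (z ^ (n mod D) - 1)" using assms(1) by simp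
 also have "... <= real (n mod D) * norm (z - 1)" by (rule norm_power_diff_one[OF assms(2)])
 also have "... <= real D * norm (z - 1)" using assms(3) by (intro mult_right_mono) (auto simp: less_imp_le)
 finally show "norm (z ^ n - 1) <= 3/4" using assms(4) by linarith
qed

text \<open>\<open>nu\<close> enters only through the sets \<open>nu u < d\<close>, which act as
  neighbourhoods of 0. \<open>gen_small\<close> stands in for connectedness of \<open>N\<close>,
  \<open>cocompact\<close> for compactness of \<open>N\<close> modulo \<open>Gam\<close>, and
  \<open>terminal\<close> excludes the abelian obstructions to equidistribution. Nilpotency enters
  at the end as \<open>Lc s = {0}\<close>.\<close>

locale nil_core =
 fixes nu :: "'g::group_add => real" and K N Gam :: "'g set" and a :: 'g
 assumes K: "subgrp K" and N: "subgrp N" "N \<subseteq> K" and Gam: "subgrp Gam" "Gam \<subseteq> K"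
  and normal: "g \<in> K ==> n \<in> N ==> g + n - g \<in> N"
  and K_eq: "g \<in> K ==> \<exists>n\<in>N. \<exists>gamma\<in>Gam. g = n + gamma"
  and a: "a \<in> K" and K_gen: "subgrp H ==> N \<subseteq> H ==> a \<in> H ==> K \<subseteq> H"
  and nu_zero: "nu 0 = 0"
  and small_add: "e > 0 ==> \<exists>d>0. \<forall>u\<in>K. \<forall>v\<in>K. nu u < d --> nu v < d --> nu (u + v) < e"
  and small_minus: "e > 0 ==> \<exists>d>0. \<forall>u\<in>K. nu u < d --> nu (- u) < e"
  and small_conj: "e > 0 ==> g \<in> K ==> \<exists>d>0. \<forall>u\<in>K. nu u < d --> nu (g + u - g) < e"
  and gen_small: "d > 0 ==> subgrp H ==> {n\<in>N. nu n < d} \<subseteq> H ==> N \<subseteq> H"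
  and cocompact: "d > 0 ==> \<exists>C\<subseteq>N. finite C & (\<forall>n\<in>N. \<exists>b\<in>N. \<exists>c\<in>C. \<exists>gamma\<in>Gam \<inter> N. nu b < d & n = b + c + gamma)"
  and terminal: "unit_hom K c ==> (!!e. e > 0 ==> \<exists>d>0. \<forall>v\<in>K. nu v < d --> norm (c v - 1) < e) ==>
   (!!gamma. gamma \<in> Gam ==> c gamma = 1) ==> c a = 1 ==> n \<in> N ==> c n = 1"
begin

text \<open>The series starts at \<open>N\<close> but uses commutators with all of \<open>K\<close>,
  so that commutators with \<open>a\<close>, which need not lie in \<open>N\<close>, go down a level
  as well.\<close>

primrec Lc :: "nat => 'g set" where
 "Lc 0 = N"
| "Lc (Suc j) = gen {com g u | g u. g \<in> K & u \<in> Lc j}"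

lemma Lc_props: "subgrp (Lc j) & Lc j \<subseteq> K & (\<forall>g\<in>K. \<forall>u\<in>Lc j. g + u - g \<in> Lc j)"
proof (induction j)
 case 0 thus ?case using N normal by auto
next
 case (Suc j)
 have base: "{com g u | g u. g \<in> K & u \<in> Lc j} \<subseteq> Lc j"
 proof clarify
  fix g u assume gu: "g \<in> K" "u \<in> Lc j"
  hence "(g + u - g) - u \<in> Lc j" using Suc subgrpD(4) by blast
  thus "com g u \<in> Lc j" by (simp add: com_def)
 qed
 have "g + u - g \<in> Lc (Suc j)" if g: "g \<in> K" and u: "u \<in> Lc (Suc j)" for g u
  using u unfolding Lc.simps
 proof (induction rule: gen.induct)
  case (gen_base x)
  then obtain h v where hv: "x = com h v" "h \<in> K" "v \<in> Lc j" by blast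
  hence "g + x - g = com (g + h - g) (g + v - g)" using com_conj by blast
  moreover have "g + h - g \<in> K" using hv(2) g subgrpD(2,4)[OF K] by blast
  moreover have "g + v - g \<in> Lc j" using hv(3) g Suc by blast
  ultimately show ?case by (intro gen.gen_base) blast
 next
  case (gen_add x y)
  have "g + (x + y) - g = (g + x - g) + (g + y - g)" by (simp only: group_simps)
  thus ?case using gen.gen_add[OF gen_add.IH] by simp
 next
  case (gen_minus x)
  have "g + - x - g = - (g + x - g)" by (simp only: group_simps)
  thus ?case using gen.gen_minus[OF gen_minus.IH] by simp
 qed (simp add: gen.gen_zero)
 moreover have "Lc (Suc j) \<subseteq> Lc j" using gen_least[OF _ base] Suc by simp
 ultimately show ?case using Suc subgrp_gen by auto
qed

declare Lc.simps(2) [simp del]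

lemma Lc_subgrp: "subgrp (Lc j)" and Lc_K: "u \<in> Lc j ==> u \<in> K"
 and Lc_conj: "g \<in> K ==> u \<in> Lc j ==> g + u - g \<in> Lc j"
 using Lc_props by blast+

lemma com_Lc: "g \<in> K ==> u \<in> Lc j ==> com g u \<in> Lc (Suc j)"
 by (auto simp: Lc.simps(2) intro: gen.gen_base)

lemma Lc_Suc: "u \<in> Lc (Suc j) ==> u \<in> Lc j"
proof -
 have "com g u \<in> Lc j" if "g \<in> K" "u \<in> Lc j" for g u
  using subgrpD(4)[OF Lc_subgrp Lc_conj[OF that] that(2)] by (simp add: com_def)
 hence "gen {com g u | g u. g \<in> K & u \<in> Lc j} \<subseteq> Lc j" by (intro gen_least Lc_subgrp) auto
 thus "u \<in> Lc (Suc j) ==> u \<in> Lc j" by (auto simp: Lc.simps(2))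
qed

lemma com_Gam: "g \<in> Gam ==> u \<in> Gam ==> com g u \<in> Gam"
 by (simp add: com_def subgrpD[OF Gam(1)])

definition cont :: "'g set => ('g => complex) => bool" where
 "cont H c \<equiv> (\<forall>e>0. \<exists>d>0. \<forall>v\<in>H. nu v < d --> norm (c v - 1) < e)"

lemma small_com_right:
 assumes "e > 0" "g \<in> K" shows "\<exists>d>0. \<forall>u\<in>K. nu u < d --> nu (com g u) < e"
proof -
 obtain d1 where d1: "d1 > 0" "!!u v. u \<in> K ==> v \<in> K ==> nu u < d1 ==> nu v < d1 ==> nu (u + v) < e"
  using small_add[OF assms(1)] by blast
 obtain d2 where d2: "d2 > 0" "!!u. u \<in> K ==> nu u < d2 ==> nu (g + u - g) < d1" using small_conj[OF d1(1) assms(2)] by blast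
 obtain d3 where d3: "d3 > 0" "!!u. u \<in> K ==> nu u < d3 ==> nu (- u) < d1" using small_minus[OF d1(1)] by blast
 have "nu (com g u) < e" if "u \<in> K" "nu u < min d2 d3" for u
  using d1(2)[of "g + u - g" "- u"] d2(2)[of u] d3(2)[of u] that assms(2) subgrpD[OF K] by (simp add: com_def)
 thus ?thesis using d2 d3 by (intro exI[of _ "min d2 d3"]) auto
qed

lemma small_com_left:
 assumes "e > 0" "u \<in> K" shows "\<exists>d>0. \<forall>g\<in>K. nu g < d --> nu (com g u) < e"
proof -
 obtain d1 where d1: "d1 > 0" "!!u. u \<in> K ==> nu u < d1 ==> nu (- u) < e" using small_minus[OF assms(1)] by blast
 obtain d2 where d2: "d2 > 0" "!!g. g \<in> K ==> nu g < d2 ==> nu (com u g) < d1"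
  using small_com_right[OF d1(1) assms(2)] by blast
 have "com g u = - com u g" for g by (simp only: com_def group_simps)
 moreover have "com u g \<in> K" if "g \<in> K" for g using that assms(2) by (simp add: com_def subgrpD[OF K])
 ultimately show ?thesis using d1(2) d2 by metis
qed

lemma small_com:
 assumes "e > 0" shows "\<exists>d>0. \<forall>g\<in>K. \<forall>u\<in>K. nu g < d --> nu u < d --> nu (com g u) < e"
proof -
 obtain d1 where d1: "d1 > 0" "!!u v. u \<in> K ==> v \<in> K ==> nu u < d1 ==> nu v < d1 ==> nu (u + v) < e"
  using small_add[OF assms(1)] by blast
 obtain d2 where d2: "d2 > 0" "!!u v. u \<in> K ==> v \<in> K ==> nu u < d2 ==> nu v < d2 ==> nu (u + v) < d1"
  using small_add[OF d1(1)] by blast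
 obtain d3 where d3: "d3 > 0" "!!u. u \<in> K ==> nu u < d3 ==> nu (- u) < d2" using small_minus[OF d2(1)] by blast
 have "nu (com g u) < e" if gu: "g \<in> K" "u \<in> K" and s: "nu g < min d2 d3" "nu u < min d2 d3" for g u
 proof -
  have m: "- g \<in> K" "- u \<in> K" "g + u \<in> K" "- g + - u \<in> K" using gu subgrpD[OF K] by blast+
  have "nu (g + u) < d1" using d2(2)[OF gu] s by simp
  moreover have "nu (- g + - u) < d1" by (rule d2(2)[OF m(1,2)]) (use d3(2) gu s in auto)
  ultimately have "nu ((g + u) + (- g + - u)) < e" using d1(2) m by blast
  thus ?thesis by (simp only: com_def group_simps)
 qed
 thus ?thesis using d2 d3 by (intro exI[of _ "min d2 d3"]) auto
qed

section \<open>Characters of the central series and commutator pairings\<close>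

definition vchar :: "nat => ('g => complex) => bool" where
 "vchar j psi \<equiv> unit_hom (Lc j) psi & (\<forall>u\<in>Lc (Suc j). psi u = 1)"

lemma vchar_conj:
 assumes "vchar j psi" "g \<in> K" "u \<in> Lc j" shows "psi (g + u - g) = psi u"
proof -
 have "com g u \<in> Lc (Suc j)" using assms com_Lc by blast
 thus ?thesis unfolding conj_eq_com using assms Lc_Suc by (auto simp: vchar_def unit_hom_def)
qed

text \<open>\<open>psi\<close> does not see conjugation by \<open>K\<close>, which turns the
  commutator identities into multiplicativity in each entry.\<close>

lemma vchar_com:
 assumes psi: "vchar (Suc j) psi"
 shows "g \<in> K ==> h \<in> K ==> u \<in> Lc j ==> psi (com (g + h) u) = psi (com g u) * psi (com h u)"
  "g \<in> K ==> u \<in> Lc j ==> v \<in> Lc j ==> psi (com g (u + v)) = psi (com g u) * psi (com g v)"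
  "g \<in> K ==> u \<in> Lc j ==> norm (psi (com g u)) = 1"
  "g \<in> K ==> u \<in> Lc (Suc j) ==> psi (com g u) = 1"
proof -
 have h: "psi (x + y) = psi x * psi y" if "x \<in> Lc (Suc j)" "y \<in> Lc (Suc j)" for x y
  using psi that by (auto simp: vchar_def unit_hom_def)
 show "psi (com (g + h) u) = psi (com g u) * psi (com h u)" if "g \<in> K" "h \<in> K" "u \<in> Lc j"
  unfolding com_add_left using that com_Lc Lc_conj vchar_conj[OF psi] by (subst h) (auto simp: mult.commute)
 show "psi (com g (u + v)) = psi (com g u) * psi (com g v)" if "g \<in> K" "u \<in> Lc j" "v \<in> Lc j"
  unfolding com_add_right using that com_Lc Lc_conj Lc_K vchar_conj[OF psi] by (subst h) auto
 show "norm (psi (com g u)) = 1" if "g \<in> K" "u \<in> Lc j" using psi com_Lc[OF that] by (auto simp: vchar_def unit_hom_def)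
 show "psi (com g u) = 1" if "g \<in> K" "u \<in> Lc (Suc j)" using psi com_Lc[OF that] by (auto simp: vchar_def)
qed

lemma vchar_dch: "vchar (Suc j) psi ==> g \<in> K ==> vchar j (\<lambda>u. psi (com g u))"
 using vchar_com[of j psi] unfolding vchar_def[of j] unit_hom_def by blast

lemma vchar_trivialI:
 assumes psi: "vchar (Suc j) psi" and "!!g u. g \<in> K ==> u \<in> Lc j ==> psi (com g u) = 1" and "y \<in> Lc (Suc j)"
 shows "psi y = 1"
proof -
 have "gen {com g u | g u. g \<in> K & u \<in> Lc j} \<subseteq> {x\<in>Lc (Suc j). psi x = 1}"
  by (rule gen_least[OF unit_hom_kernel[OF _ Lc_subgrp]]) (use assms com_Lc in "auto simp: vchar_def")
 hence "Lc (Suc j) \<subseteq> {x\<in>Lc (Suc j). psi x = 1}" by (simp only: Lc.simps(2))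
 with assms(3) show ?thesis by blast
qed

text \<open>Generation by small elements is known for \<open>N\<close>. It passes down the series
  because, for fixed \<open>g\<close>, a small \<open>u\<close> makes \<open>com g u\<close> small,
  so the character \<open>psi (com g u)\<close> of \<open>u\<close> satisfies the hypothesis for
  \<open>Lc j\<close>.\<close>

lemma vchar_trivial_if_small:
 assumes "vchar j psi" "d > 0" "!!v. v \<in> Lc j ==> nu v < d ==> psi v = 1" "y \<in> Lc j"
 shows "psi y = 1"
 using assms
proof (induction j arbitrary: psi d y)
 case 0
 have "subgrp {x\<in>N. psi x = 1}" using 0 unit_hom_kernel N by (auto simp: vchar_def)
 from gen_small[OF 0(2) this] 0 show ?case by auto
next
 case (Suc j)
 show ?case
 proof (rule vchar_trivialI[OF Suc.prems(1) _ Suc.prems(4)])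
  fix g u assume gu: "g \<in> K" "u \<in> Lc j"
  obtain d' where "d' > 0" "!!u. u \<in> K ==> nu u < d' ==> nu (com g u) < d"
   using small_com_right[OF Suc.prems(2) gu(1)] by blast
  thus "psi (com g u) = 1"
   using Suc.IH[OF vchar_dch[OF Suc.prems(1) gu(1)], of d' u] Suc.prems(3) com_Lc gu Lc_K by blast
 qed
qed

text \<open>The values are \<open>D\<close>-th roots of unity; near 0 continuity brings them within
  \<open>3 / (4 * D)\<close> of 1, and then they equal 1.\<close>

lemma vchar_torsion_free:
 assumes "vchar j psi" "cont (Lc j) psi" "D >= 1" "!!x. x \<in> Lc j ==> psi x ^ D = 1" "y \<in> Lc j"
 shows "psi y = 1"
proof -
 obtain d where d: "d > 0" "!!v. v \<in> Lc j ==> nu v < d ==> norm (psi v - 1) < 3 / (4 * real D)"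
 proof -
  have "3 / (4 * real D) > 0" using assms(3) by simp
  thus ?thesis using assms(2) that unfolding cont_def by blast
 qed
 have "psi v = 1" if "v \<in> Lc j" "nu v < d" for v
 proof (rule root_of_unity_gap[of _ D])
  show "real D * norm (psi v - 1) <= 3 / 4" using d(2)[OF that] assms(3) by (simp add: field_simps)
 qed (use assms that in "auto simp: vchar_def unit_hom_def")
 with vchar_trivial_if_small[OF assms(1) d(1)] assms(5) show ?thesis by blast
qed

definition bichar :: "nat => ('g => 'g => complex) => bool" where
 "bichar j E \<equiv> (\<forall>n\<in>N. unit_hom (Lc j) (E n)) & (\<forall>y\<in>Lc j. unit_hom N (\<lambda>n. E n y)) &
   (\<forall>e>0. \<exists>d>0. \<forall>n\<in>N. \<forall>y\<in>Lc j. nu n < d --> nu y < d --> norm (E n y - 1) < e) &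
   (\<forall>y\<in>Lc j. cont N (\<lambda>n. E n y)) & (\<forall>n\<in>N. cont (Lc j) (E n)) & (\<forall>n\<in>N. \<forall>y\<in>Lc j \<inter> Gam. E n y = 1)"

text \<open>For small \<open>n\<close> the character \<open>E n\<close> stays within
  \<open>3/4\<close> of 1 on all of \<open>N\<close>: a small summand and one of finitely many
  representatives cost at most \<open>1/4\<close> each, and \<open>Gam\<close> costs nothing. So
  \<open>E n\<close> is trivial, and such \<open>n\<close> generate \<open>N\<close>.\<close>

lemma bichar_N:
 assumes E: "bichar 0 E" and ny: "n \<in> N" "y \<in> N"
 shows "E n y = 1"
proof -
 obtain d1 where d1: "d1 > 0" "!!n y. n \<in> N ==> y \<in> N ==> nu n < d1 ==> nu y < d1 ==> norm (E n y - 1) < 1/4"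
  using E unfolding bichar_def Lc.simps by (metis zero_less_divide_1_iff zero_less_numeral)
 obtain C where C: "C \<subseteq> N" "finite C" "!!n. n \<in> N ==> \<exists>b\<in>N. \<exists>c\<in>C. \<exists>gamma\<in>Gam \<inter> N. nu b < d1 & n = b + c + gamma"
  using cocompact[OF d1(1)] by blast
 have "\<exists>d>0. \<forall>c\<in>C. \<forall>n\<in>N. nu n < d --> norm (E n c - 1) < 1/4"
  using C(2,1)
 proof (induction C rule: finite_induct)
  case (insert c C)
  then obtain d where d: "d > 0" "\<forall>c\<in>C. \<forall>n\<in>N. nu n < d --> norm (E n c - 1) < 1/4" by auto
  obtain d' where d': "d' > 0" "\<forall>n\<in>N. nu n < d' --> norm (E n c - 1) < 1/4"
   using E insert.prems unfolding bichar_def cont_def Lc.simps by (metis insert_subset zero_less_divide_1_iff zero_less_numeral)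
  show ?case using d d' by (intro exI[of _ "min d d'"]) auto
 qed (auto intro: exI[of _ 1])
 then obtain d2 where d2: "d2 > 0" "!!c n. c \<in> C ==> n \<in> N ==> nu n < d2 ==> norm (E n c - 1) < 1/4" by blast
 have one: "E n y = 1" if n: "n \<in> N" "nu n < min d1 d2" and y: "y \<in> N" for n y
 proof (rule unit_hom_trivial[OF _ N(1) _ y])
  show u: "unit_hom N (E n)" using E n by (auto simp: bichar_def)
  fix y assume "y \<in> N"
  then obtain b c gamma where y: "b \<in> N" "c \<in> C" "gamma \<in> Gam" "gamma \<in> N" "nu b < d1" "y = b + c + gamma" using C(3) by blast
  have "b + c \<in> N" "c \<in> N" using y C(1) subgrpD[OF N(1)] by blast+
  hence "E n y = E n b * E n c" using u y E n by (auto simp: unit_hom_def bichar_def)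
  hence "E n y - 1 = (E n b - 1) * E n c + (E n c - 1)" by (simp add: algebra_simps)
  also have "norm ... <= norm (E n b - 1) + norm (E n c - 1)"
   by (rule order_trans[OF norm_triangle_ineq]) (use u \<open>c \<in> N\<close> in "simp add: norm_mult unit_hom_def")
  also have "... <= 3/4" using d1(2)[of n b] d2(2)[of c n] n y by auto
  finally show "norm (E n y - 1) <= 3/4" .
 qed
 have "N \<subseteq> {n\<in>N. E n y = 1}"
  by (rule gen_small[OF _ unit_hom_kernel[OF _ N(1)], of "min d1 d2"])
   (use one ny E d1(1) d2(1) in "auto simp: bichar_def")
 with ny show ?thesis by blast
qed

text \<open>In the inductive step \<open>E n\<close> is determined by its values at commutators
  \<open>com g u\<close>, and these are multiplicative in \<open>g\<close>. Every \<open>g\<close>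
  in \<open>K\<close> is a sum of elements of \<open>N\<close> and \<open>Gam\<close>, so the two
  kinds of \<open>g\<close> are treated separately, each by a pairing with
  \<open>Lc j\<close>.\<close>

lemma bichar_trivial:
 assumes "bichar j E" "!!n y. n \<in> N ==> y \<in> Lc (Suc j) ==> E n y = 1" "n \<in> N" "y \<in> Lc j"
 shows "E n y = 1"
 using assms
proof (induction j arbitrary: E n y)
 case 0 thus ?case using bichar_N by simp
next
 case (Suc j)
 note E = Suc.prems(1)
 have v: "vchar (Suc j) (E n)" if "n \<in> N" for n using Suc.prems(1,2) that by (auto simp: vchar_def bichar_def)
 have cE: "\<exists>d>0. \<forall>y\<in>Lc (Suc j). nu y < d --> norm (E n y - 1) < e" if "n \<in> N" "e > 0" for n e
  using E that unfolding bichar_def cont_def by blast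
 have cE2: "\<exists>d>0. \<forall>n\<in>N. nu n < d --> norm (E n y - 1) < e" if "y \<in> Lc (Suc j)" "e > 0" for y e
  using E that unfolding bichar_def cont_def by blast
 have cE3: "\<exists>d>0. \<forall>n\<in>N. \<forall>y\<in>Lc (Suc j). nu n < d --> nu y < d --> norm (E n y - 1) < e" if "e > 0" for e
  using E that unfolding bichar_def by blast
 have hN: "unit_hom N (\<lambda>n. E n y)" if "y \<in> Lc (Suc j)" for y using E that by (auto simp: bichar_def)
 have NK: "n \<in> K" if "n \<in> N" for n using that N by blast
 have GamE: "E n (com g u) = 1" if "n \<in> N" "g \<in> Gam" "g \<in> K" "u \<in> Lc j" "u \<in> Gam" for n g u
  using E that com_Lc com_Gam by (auto simp: bichar_def)
 have 1: "E n (com g u) = 1" if g: "g \<in> Gam" and nu: "n \<in> N" "u \<in> Lc j" for g n u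
 proof (rule Suc.IH[of "\<lambda>n u. E n (com g u)", OF _ _ nu])
  have gK: "g \<in> K" using g Gam by blast
  show "bichar j (\<lambda>n u. E n (com g u))"
   unfolding bichar_def
  proof (intro conjI ballI allI impI)
   show "unit_hom (Lc j) (\<lambda>u. E n (com g u))" if "n \<in> N" for n using vchar_dch[OF v[OF that] gK] by (simp add: vchar_def)
   show "unit_hom N (\<lambda>n. E n (com g u))" if "u \<in> Lc j" for u by (rule hN[OF com_Lc[OF gK that]])
   show "cont N (\<lambda>n. E n (com g u))" if "u \<in> Lc j" for u using cE2[OF com_Lc[OF gK that]] by (simp add: cont_def)
   show "E n (com g u) = 1" if "n \<in> N" "u \<in> Lc j \<inter> Gam" for n u using GamE that g gK by blast
  next
   fix n assume n: "n \<in> N"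
   show "cont (Lc j) (\<lambda>u. E n (com g u))" unfolding cont_def
   proof (intro allI impI)
    fix e :: real assume "e > 0"
    then obtain d where d: "d > 0" "!!y. y \<in> Lc (Suc j) ==> nu y < d ==> norm (E n y - 1) < e" using cE[OF n] by blast
    obtain d' where "d' > 0" "!!u. u \<in> K ==> nu u < d' ==> nu (com g u) < d" using small_com_right[OF d(1) gK] by blast
    thus "\<exists>d>0. \<forall>v\<in>Lc j. nu v < d --> norm (E n (com g v) - 1) < e" using d com_Lc[OF gK] Lc_K by metis
   qed
  next
   fix e :: real assume "e > 0"
   then obtain d where d: "d > 0" "!!n y. n \<in> N ==> y \<in> Lc (Suc j) ==> nu n < d ==> nu y < d ==> norm (E n y - 1) < e"
    using cE3 by blast
   obtain d' where "d' > 0" "!!u. u \<in> K ==> nu u < d' ==> nu (com g u) < d" using small_com_right[OF d(1) gK] by blast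
   thus "\<exists>d>0. \<forall>n\<in>N. \<forall>u\<in>Lc j. nu n < d --> nu u < d --> norm (E n (com g u) - 1) < e"
    using d com_Lc[OF gK] Lc_K by (intro exI[of _ "min d d'"]) auto
  qed
  show "E n (com g u) = 1" if "n \<in> N" "u \<in> Lc (Suc j)" for n u using vchar_com(4)[OF v[OF that(1)] gK that(2)] .
 qed
 have 2: "E n (com m u) = 1" if n: "n \<in> N" and mu: "m \<in> N" "u \<in> Lc j" for n m u
 proof (rule Suc.IH[of "\<lambda>m u. E n (com m u)", OF _ _ mu])
  have hm: "unit_hom N (\<lambda>m. E n (com m u))" if "u \<in> Lc j" "n \<in> N" for u n
   using vchar_com[OF v[OF that(2)] NK] NK that(1) unfolding unit_hom_def by blast
  have cm: "cont N (\<lambda>m. E n (com m u))" if n: "n \<in> N" and u: "u \<in> Lc j" for u n unfolding cont_def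
  proof (intro allI impI)
   fix e :: real assume "e > 0"
   then obtain d where d: "d > 0" "!!y. y \<in> Lc (Suc j) ==> nu y < d ==> norm (E n y - 1) < e" using cE[OF n] by blast
   obtain d' where "d' > 0" "!!m. m \<in> K ==> nu m < d' ==> nu (com m u) < d" using small_com_left[OF d(1) Lc_K[OF u]] by blast
   thus "\<exists>d>0. \<forall>m\<in>N. nu m < d --> norm (E n (com m u) - 1) < e" using d com_Lc[OF NK u] NK by metis
  qed
  show "bichar j (\<lambda>m u. E n (com m u))"
   unfolding bichar_def
  proof (intro conjI ballI allI impI)
   show "unit_hom (Lc j) (\<lambda>u. E n (com m u))" if "m \<in> N" for m using vchar_dch[OF v[OF n] NK[OF that]] by (simp add: vchar_def)
   show "unit_hom N (\<lambda>m. E n (com m u))" if "u \<in> Lc j" for u by (rule hm[OF that n])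
   show "cont N (\<lambda>m. E n (com m u))" if "u \<in> Lc j" for u by (rule cm[OF n that])
  next
   fix m assume m: "m \<in> N"
   show "cont (Lc j) (\<lambda>u. E n (com m u))" unfolding cont_def
   proof (intro allI impI)
    fix e :: real assume "e > 0"
    then obtain d where d: "d > 0" "!!y. y \<in> Lc (Suc j) ==> nu y < d ==> norm (E n y - 1) < e" using cE[OF n] by blast
    obtain d' where "d' > 0" "!!u. u \<in> K ==> nu u < d' ==> nu (com m u) < d" using small_com_right[OF d(1) NK[OF m]] by blast
    thus "\<exists>d>0. \<forall>v\<in>Lc j. nu v < d --> norm (E n (com m v) - 1) < e" using d com_Lc[OF NK[OF m]] Lc_K by metis
   qed
  next
   fix e :: real assume "e > 0"
   then obtain d where d: "d > 0" "!!y. y \<in> Lc (Suc j) ==> nu y < d ==> norm (E n y - 1) < e" using cE[OF n] by blast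
   obtain d' where "d' > 0" "!!m u. m \<in> K ==> u \<in> K ==> nu m < d' ==> nu u < d' ==> nu (com m u) < d" using small_com[OF d(1)] by blast
   thus "\<exists>d>0. \<forall>m\<in>N. \<forall>u\<in>Lc j. nu m < d --> nu u < d --> norm (E n (com m u) - 1) < e"
    using d com_Lc[OF NK] Lc_K NK by metis
  next
   fix m u assume mu: "m \<in> N" "u \<in> Lc j \<inter> Gam"
   have u: "u \<in> Lc j" "u \<in> K" "u \<in> Gam" using mu Lc_K by auto
   \<comment> \<open>For \<open>u\<close> in \<open>Gam\<close> but \<open>m\<close> in
     \<open>N\<close> the commutator need not lie in \<open>Gam\<close>. With \<open>u\<close>
     fixed, however, \<open>n\<close> and \<open>m\<close> themselves form a pairing of level 0, to
     which the base case applies.\<close>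
   have "bichar 0 (\<lambda>n m. E n (com m u))"
    unfolding bichar_def Lc.simps
   proof (intro conjI ballI allI impI)
    show "unit_hom N (\<lambda>m. E n (com m u))" if "n \<in> N" for n by (rule hm[OF u(1) that])
    show "unit_hom N (\<lambda>n. E n (com m u))" if "m \<in> N" for m by (rule hN[OF com_Lc[OF NK[OF that] u(1)]])
    show "cont N (\<lambda>n. E n (com m u))" if "m \<in> N" for m using cE2[OF com_Lc[OF NK[OF that] u(1)]] by (simp add: cont_def)
    show "cont N (\<lambda>m. E n (com m u))" if "n \<in> N" for n by (rule cm[OF that u(1)])
    show "E n (com m u) = 1" if "n \<in> N" "m \<in> N \<inter> Gam" for n m using GamE that u NK by blast
    fix e :: real assume "e > 0"
    then obtain d where d: "d > 0" "!!n y. n \<in> N ==> y \<in> Lc (Suc j) ==> nu n < d ==> nu y < d ==> norm (E n y - 1) < e"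
     using cE3 by blast
    obtain d' where "d' > 0" "!!m. m \<in> K ==> nu m < d' ==> nu (com m u) < d" using small_com_left[OF d(1) u(2)] by blast
    thus "\<exists>d>0. \<forall>n\<in>N. \<forall>m\<in>N. nu n < d --> nu m < d --> norm (E n (com m u) - 1) < e"
     using d com_Lc[OF NK u(1)] NK by (intro exI[of _ "min d d'"]) auto
   qed
   thus "E n (com m u) = 1" using bichar_N n mu by blast
  qed
  show "E n (com m u) = 1" if "m \<in> N" "u \<in> Lc (Suc j)" for m u using vchar_com(4)[OF v[OF n] NK[OF that(1)] that(2)] .
 qed
 show ?case
 proof (rule vchar_trivialI[OF v[OF Suc.prems(3)] _ Suc.prems(4)])
  fix g u assume gu: "g \<in> K" "u \<in> Lc j"
  then obtain m gamma where g: "m \<in> N" "gamma \<in> Gam" "g = m + gamma" using K_eq by blast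
  thus "E n (com g u) = 1"
   using vchar_com(1)[OF v[OF Suc.prems(3)], of m gamma u] 1[of gamma n u] 2[of n m u] gu Suc.prems(3) NK Gam by auto
 qed
qed

text \<open>Suppose \<open>psi (com a u)\<close> is always 1. For \<open>u\<close> in
  \<open>Gam\<close> the character \<open>psi (com g u)\<close> of \<open>g\<close> is trivial on
  \<open>Gam\<close> and at \<open>a\<close>, hence on \<open>N\<close> by \<open>terminal\<close>.
  So the pairing of \<open>N\<close> with \<open>Lc j\<close> is trivial on \<open>Gam\<close>,
  therefore trivial by \<open>bichar_trivial\<close>; as \<open>N\<close> and \<open>a\<close>
  generate \<open>K\<close>, \<open>psi\<close> is trivial.\<close>

lemma vchar_nontrivial_com:
 assumes psi: "vchar (Suc j) psi" "cont (Lc (Suc j)) psi" "!!y. y \<in> Lc (Suc j) ==> y \<in> Gam ==> psi y = 1"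
  and y: "y \<in> Lc (Suc j)" "psi y ~= 1"
 shows "\<exists>u\<in>Lc j. psi (com a u) ~= 1"
proof (rule ccontr)
 assume "\<not> ?thesis"
 hence au: "psi (com a u) = 1" if "u \<in> Lc j" for u using that by blast
 have NK: "n \<in> K" if "n \<in> N" for n using that N by blast
 have hK: "unit_hom K (\<lambda>g. psi (com g u))" if "u \<in> Lc j" for u
  using vchar_com[OF psi(1)] that unfolding unit_hom_def by blast
 have cpsi: "\<exists>d>0. \<forall>y\<in>Lc (Suc j). nu y < d --> norm (psi y - 1) < e" if "e > 0" for e
  using psi(2) that by (auto simp: cont_def)
 have cK: "\<exists>d>0. \<forall>g\<in>K. nu g < d --> norm (psi (com g u) - 1) < e" if u: "u \<in> Lc j" and "e > 0" for u e
 proof -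
  obtain d where d: "d > 0" "!!y. y \<in> Lc (Suc j) ==> nu y < d ==> norm (psi y - 1) < e" using cpsi[OF \<open>e > 0\<close>] by blast
  obtain d' where "d' > 0" "!!m. m \<in> K ==> nu m < d' ==> nu (com m u) < d" using small_com_left[OF d(1) Lc_K[OF u]] by blast
  thus ?thesis using d com_Lc u by metis
 qed
 have "bichar j (\<lambda>n u. psi (com n u))"
  unfolding bichar_def
 proof (intro conjI ballI allI impI)
  show "unit_hom (Lc j) (\<lambda>u. psi (com n u))" if "n \<in> N" for n using vchar_dch[OF psi(1) NK[OF that]] by (simp add: vchar_def)
  show "unit_hom N (\<lambda>n. psi (com n u))" if "u \<in> Lc j" for u using hK[OF that] NK by (auto simp: unit_hom_def)
  show "cont N (\<lambda>n. psi (com n u))" if "u \<in> Lc j" for u unfolding cont_def using cK[OF that] NK by metis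
  show "psi (com n u) = 1" if "n \<in> N" "u \<in> Lc j \<inter> Gam" for n u
   by (rule terminal[OF hK cK]) (use that au psi(3) com_Lc com_Gam Gam in auto)
 next
  fix n assume n: "n \<in> N"
  show "cont (Lc j) (\<lambda>u. psi (com n u))" unfolding cont_def
  proof (intro allI impI)
   fix e :: real assume "e > 0"
   then obtain d where d: "d > 0" "!!y. y \<in> Lc (Suc j) ==> nu y < d ==> norm (psi y - 1) < e" using cpsi by blast
   obtain d' where "d' > 0" "!!u. u \<in> K ==> nu u < d' ==> nu (com n u) < d" using small_com_right[OF d(1) NK[OF n]] by blast
   thus "\<exists>d>0. \<forall>v\<in>Lc j. nu v < d --> norm (psi (com n v) - 1) < e" using d com_Lc[OF NK[OF n]] Lc_K by metis
  qed
 next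
  fix e :: real assume "e > 0"
  then obtain d where d: "d > 0" "!!y. y \<in> Lc (Suc j) ==> nu y < d ==> norm (psi y - 1) < e" using cpsi by blast
  obtain d' where "d' > 0" "!!m u. m \<in> K ==> u \<in> K ==> nu m < d' ==> nu u < d' ==> nu (com m u) < d" using small_com[OF d(1)] by blast
  thus "\<exists>d>0. \<forall>n\<in>N. \<forall>u\<in>Lc j. nu n < d --> nu u < d --> norm (psi (com n u) - 1) < e"
   using d com_Lc[OF NK] Lc_K NK by metis
 qed
 hence Nu: "psi (com n u) = 1" if "n \<in> N" "u \<in> Lc j" for n u
  by (rule bichar_trivial) (use that vchar_com(4)[OF psi(1) NK] in auto)
 have "psi (com g u) = 1" if "g \<in> K" "u \<in> Lc j" for g u
  using K_gen[OF unit_hom_kernel[OF hK[OF that(2)] K]] that Nu NK a au by blast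
 from vchar_trivialI[OF psi(1) this y(1)] y(2) show False by simp
qed

end

text \<open>An invariant mean needs an abelian group type, whereas \<open>D\<close> modulo
  \<open>L\<close> is only a set of cosets. The free abelian group on the elements is such a type
  and maps onto the quotient; \<open>rep\<close> chooses coset representatives and is additive
  modulo \<open>L\<close>.\<close>

lemma abelianization:
 fixes D L :: "'b::group_add set"
 assumes D: "subgrp D" and L: "subgrp L" "L \<subseteq> D" and conj: "!!d l. d \<in> D ==> l \<in> L ==> d + l - d \<in> L"
  and com: "!!x y. x \<in> D ==> y \<in> D ==> com x y \<in> L"
 obtains rep :: "('b \<Rightarrow>\<^sub>0 int) => 'b" where "!!p. rep p \<in> D" "!!p q. \<exists>l\<in>L. rep (p + q) = l + (rep p + rep q)"
  "!!d. d \<in> D ==> \<exists>l\<in>L. rep (frag_of d) = l + d"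
proof -
 define H :: "'b monoid" where "H = \<lparr>carrier = D, monoid.mult = (+), one = 0\<rparr>"
 have H [simp]: "carrier H = D" "x \<otimes>\<^bsub>H\<^esub> y = x + y" "\<one>\<^bsub>H\<^esub> = 0" for x y by (simp_all add: H_def)
 interpret H: group H
 proof (rule groupI)
  fix x assume "x \<in> carrier H"
  thus "\<exists>y\<in>carrier H. y \<otimes>\<^bsub>H\<^esub> x = \<one>\<^bsub>H\<^esub>" by (intro bexI[of _ "- x"]) (simp_all add: subgrpD[OF D])
 qed (simp_all add: subgrpD[OF D] add.assoc)
 have inv: "inv\<^bsub>H\<^esub> x = - x" if "x \<in> D" for x
  using that by (intro H.inv_equality) (auto simp: subgrpD[OF D])
 interpret LH: normal L H
  using L subgrpD[OF L(1)] conj inv by (auto simp: H.normal_inv_iff intro!: H.subgroupI simp flip: diff_conv_add_uminus)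
 define Q where "Q = H Mod L"
 have cos: "L #>\<^bsub>H\<^esub> x = (\<lambda>l. l + x) ` L" for x by (auto simp: r_coset_def)
 have carQ: "X \<in> carrier Q \<longleftrightarrow> (\<exists>x\<in>D. X = L #>\<^bsub>H\<^esub> x)" for X by (auto simp: Q_def FactGroup_def RCOSETS_def)
 have multQ: "(L #>\<^bsub>H\<^esub> x) \<otimes>\<^bsub>Q\<^esub> (L #>\<^bsub>H\<^esub> y) = L #>\<^bsub>H\<^esub> (x + y)" if "x \<in> D" "y \<in> D" for x y
  using LH.rcos_sum[of x y] that by (simp add: Q_def FactGroup_def)
 have swap: "L #>\<^bsub>H\<^esub> (x + y) \<subseteq> L #>\<^bsub>H\<^esub> (y + x)" if "x \<in> D" "y \<in> D" for x y
 proof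
  fix w assume "w \<in> L #>\<^bsub>H\<^esub> (x + y)"
  then obtain l where l: "l \<in> L" "w = l + (x + y)" by (auto simp: cos)
  have "w = (l + com x y) + (y + x)" unfolding l com_def by (simp only: group_simps)
  moreover have "l + com x y \<in> L" using subgrpD(2)[OF L(1) l(1) com[OF that]] .
  ultimately show "w \<in> L #>\<^bsub>H\<^esub> (y + x)" by (auto simp: cos)
 qed
 interpret Q: comm_group Q
 proof (rule group.group_comm_groupI)
  show "Group.group Q" unfolding Q_def by (rule LH.factorgroup_is_group)
  show "X \<otimes>\<^bsub>Q\<^esub> Y = Y \<otimes>\<^bsub>Q\<^esub> X" if "X \<in> carrier Q" "Y \<in> carrier Q" for X Y
   using that swap multQ unfolding carQ by (metis subset_antisym)
 qed
 \<comment> \<open>Generators outside \<open>D\<close> are sent to the trivial coset.\<close>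
 have "(\<lambda>d. L #>\<^bsub>H\<^esub> (if d \<in> D then d else 0)) ` UNIV \<subseteq> carrier Q" using carQ subgrpD(1)[OF D] by auto
 then obtain h where h: "h \<in> hom (free_Abelian_group UNIV) Q" "!!d. d \<in> UNIV ==> h (frag_of d) = L #>\<^bsub>H\<^esub> (if d \<in> D then d else 0)"
  by (rule Q.free_Abelian_group_universal) blast
 have car: "carrier (free_Abelian_group UNIV) = UNIV" "p \<otimes>\<^bsub>free_Abelian_group UNIV\<^esub> q = p + q" for p q :: "'b \<Rightarrow>\<^sub>0 int"
  by (auto simp: free_Abelian_group_def)
 have "h p \<in> carrier Q" for p using h(1) car by (auto simp: hom_def)
 hence "\<exists>d\<in>D. h p = L #>\<^bsub>H\<^esub> d" for p using carQ by blast
 then obtain rep where rep: "!!p. rep p \<in> D" "!!p. h p = L #>\<^bsub>H\<^esub> rep p" by metis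
 have coset_eq: "\<exists>l\<in>L. x = l + y" if "L #>\<^bsub>H\<^esub> x = L #>\<^bsub>H\<^esub> y" for x y
 proof -
  have "0 + x \<in> L #>\<^bsub>H\<^esub> x" unfolding cos using subgrpD(1)[OF L(1)] by blast
  thus ?thesis unfolding that by (auto simp: cos)
 qed
 show ?thesis
 proof (rule that[OF rep(1)])
  fix p q
  have "h (p + q) = h p \<otimes>\<^bsub>Q\<^esub> h q" using h(1) car unfolding hom_def by (metis (mono_tags, lifting) UNIV_I mem_Collect_eq)
  hence "L #>\<^bsub>H\<^esub> rep (p + q) = L #>\<^bsub>H\<^esub> (rep p + rep q)" unfolding rep(2) using multQ[OF rep(1) rep(1)] by simp
  thus "\<exists>l\<in>L. rep (p + q) = l + (rep p + rep q)" by (rule coset_eq)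
 next
  fix d assume "d \<in> D"
  hence "L #>\<^bsub>H\<^esub> rep (frag_of d) = L #>\<^bsub>H\<^esub> d" using h(2)[of d] rep(2) by simp
  thus "\<exists>l\<in>L. rep (frag_of d) = l + d" by (rule coset_eq)
 qed
qed

lemma subgrp_prod: "subgrp H ==> subgrp (H \<times> H)"
 by (auto simp: subgrp_def zero_prod_def plus_prod_def)

section \<open>Functions on K x K and their decomposition by characters of one level\<close>

context nil_core
begin

abbreviation "K2 \<equiv> K \<times> K"
abbreviation "G2 \<equiv> Gam \<times> Gam"
abbreviation "L2 j \<equiv> Lc j \<times> Lc j"

lemma KK: "subgrp (K2)" and LL: "subgrp (L2 j)"
 using K Lc_subgrp by (auto intro: subgrp_prod)

lemma LL_KK: "y \<in> L2 j ==> y \<in> K2"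
 using Lc_K by auto

lemma LL_conj: "z \<in> K2 ==> y \<in> L2 j ==> z + y - z \<in> L2 j"
 using Lc_conj by (auto simp: plus_prod_def minus_prod_def)

lemma LL_com: "z \<in> K2 ==> y \<in> L2 j ==> com z y \<in> Lc (Suc j) \<times> Lc (Suc j)"
 using com_Lc by (auto simp: plus_prod_def minus_prod_def com_def)

text \<open>These are the continuous functions on the product nilmanifold, lifted to
  \<open>K2\<close>. Small translations act from the left, on the side on which the orbit moves, and
  \<open>Gam\<close> from the right. Two coordinates are needed to follow \<open>w(pn)\<close> and
  \<open>w(qn)\<close> together.\<close>

definition pgood :: "('g \<times> 'g => complex) => bool" where
 "pgood F \<equiv> (\<exists>B. \<forall>z\<in>K2. norm (F z) <= B) & (\<forall>z\<in>K2. \<forall>gamma\<in>G2. F (z + gamma) = F z) &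
  (\<forall>e>0. \<exists>d>0. \<forall>v\<in>K2. \<forall>z\<in>K2. nu (fst v) < d --> nu (snd v) < d --> norm (F (v + z) - F z) < e)"

lemma pgoodD:
 assumes "pgood F"
 obtains B where "B >= 0" "!!z. z \<in> K2 ==> norm (F z) <= B"
  and "!!z gamma. z \<in> K2 ==> gamma \<in> G2 ==> F (z + gamma) = F z"
  and "!!e. e > 0 ==> \<exists>d>0. \<forall>v\<in>K2. \<forall>z\<in>K2. nu (fst v) < d --> nu (snd v) < d --> norm (F (v + z) - F z) < e"
proof -
 obtain B where B: "!!z. z \<in> K2 ==> norm (F z) <= B" using assms by (auto simp: pgood_def)
 have "B >= 0" using B[OF subgrpD(1)[OF KK]] norm_ge_zero order_trans by blast
 with B assms show ?thesis by (intro that[of B]) (auto simp: pgood_def)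
qed

lemma pgood_uc:
 assumes "pgood F" "e > 0"
 obtains d where "d > 0"
  "!!v z. v \<in> K2 ==> z \<in> K2 ==> nu (fst v) < d ==> nu (snd v) < d ==> norm (F (v + z) - F z) < e"
 using assms unfolding pgood_def by blast

definition linv :: "nat => ('g \<times> 'g => complex) => bool" where
 "linv j F \<equiv> (\<forall>y\<in>L2 j. \<forall>z\<in>K2. F (y + z) = F z)"

lemma linvD: "linv j F ==> y \<in> L2 j ==> z \<in> K2 ==> F (y + z) = F z"
 unfolding linv_def by blast

lemma linv_mid:
 assumes "linv j F" "x \<in> K2" "y \<in> L2 j" "z \<in> K2"
 shows "F (x + y + z) = F (x + z)"
proof -
 have "x + y + z = (x + y - x) + (x + z)" by (simp only: group_simps)
 thus ?thesis using linvD[OF assms(1) LL_conj[OF assms(2,3)] subgrpD(2)[OF KK assms(2,4)]] by simp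
qed

definition vert :: "nat => ('g => complex) => ('g => complex) => ('g \<times> 'g => complex) => bool" where
 "vert j psi1 psi2 F \<equiv> (\<forall>y\<in>L2 j. \<forall>z\<in>K2. F (y + z) = psi1 (fst y) * psi2 (snd y) * F z)"

definition gchar :: "nat => ('g => complex) => bool" where
 "gchar j psi \<equiv> vchar j psi & cont (Lc j) psi & (\<forall>y\<in>Lc j \<inter> Gam. psi y = 1)"

lemma cocompact_K:
 assumes "d > 0"
 shows "\<exists>C\<subseteq>K. finite C & (\<forall>k\<in>K. \<exists>b\<in>K. \<exists>c\<in>C. \<exists>gamma\<in>Gam. nu b < d & k = b + c + gamma)"
proof -
 obtain C where C: "C \<subseteq> N" "finite C" "!!n. n \<in> N ==> \<exists>b\<in>N. \<exists>c\<in>C. \<exists>gamma\<in>Gam \<inter> N. nu b < d & n = b + c + gamma"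
  using cocompact[OF assms] by blast
 have "\<exists>b\<in>K. \<exists>c\<in>C. \<exists>gamma\<in>Gam. nu b < d & k = b + c + gamma" if k: "k \<in> K" for k
 proof -
  obtain n gamma' where n: "n \<in> N" "gamma' \<in> Gam" "k = n + gamma'" using K_eq[OF k] by blast
  obtain b c gamma where b: "b \<in> N" "c \<in> C" "gamma \<in> Gam" "nu b < d" "n = b + c + gamma" using C(3)[OF n(1)] by blast
  hence "k = b + c + (gamma + gamma')" using n by (simp add: add.assoc)
  thus ?thesis using b n N subgrpD(2)[OF Gam(1)] by blast
 qed
 thus ?thesis using C(1,2) N by blast
qed

text \<open>Write \<open>z\<close> as a small element plus one of finitely many representatives plus
  an element of \<open>Gam\<close>. The small summand can be moved to the left of
  \<open>rep p\<close>, since the commutator lies in the next level, under which \<open>F\<close> is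
  invariant. So a translate is controlled by its values at finitely many points.\<close>

lemma finite_net_translates:
 assumes F: "pgood F" "linv (Suc j) F" and r: "!!p. rep p \<in> L2 j" and e: "e > 0"
 shows "\<exists>J. finite J & (\<forall>p. \<exists>q\<in>J. \<forall>z\<in>K2. norm (F (rep p + z) - F (rep q + z)) <= e)"
proof -
 obtain B where B: "B >= 0" "!!z. z \<in> K2 ==> norm (F z) <= B" "!!z gamma. z \<in> K2 ==> gamma \<in> G2 ==> F (z + gamma) = F z"
  "!!e. e > 0 ==> \<exists>d>0. \<forall>v\<in>K2. \<forall>z\<in>K2. nu (fst v) < d --> nu (snd v) < d --> norm (F (v + z) - F z) < e"
  by (rule pgoodD[OF F(1)]) blast
 obtain d where d: "d > 0" "!!v z. v \<in> K2 ==> z \<in> K2 ==> nu (fst v) < d ==> nu (snd v) < d ==> norm (F (v + z) - F z) < e / 3"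
  using B(4)[of "e/3"] e by auto
 obtain C where C: "C \<subseteq> K" "finite C" "!!k. k \<in> K ==> \<exists>b\<in>K. \<exists>c\<in>C. \<exists>gamma\<in>Gam. nu b < d & k = b + c + gamma"
  using cocompact_K[OF d(1)] by blast
 have rK: "rep p \<in> K2" for p using r LL_KK by blast
 have CK: "c \<in> K2" if "c \<in> C\<times>C" for c using that C(1) by auto
 obtain J where J: "finite J" "!!p. \<exists>q\<in>J. \<forall>c\<in>C\<times>C. norm (F (rep p + c) - F (rep q + c)) < e / 3"
  by (rule finite_evaluation_net[of "C \<times> C" UNIV "\<lambda>p c. F (rep p + c)" B "e / 3"])
   (use C(2) e CK rK subgrpD(2)[OF KK] B(2) in auto)
 have "norm (F (rep p + z) - F (rep q + z)) <= e"
  if q: "\<forall>c\<in>C\<times>C. norm (F (rep p + c) - F (rep q + c)) < e / 3" and z: "z \<in> K2" for p q z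
 proof -
  obtain b1 c1 g1 where 1: "b1 \<in> K" "c1 \<in> C" "g1 \<in> Gam" "nu b1 < d" "fst z = b1 + c1 + g1" using C(3)[of "fst z"] z by auto
  obtain b2 c2 g2 where 2: "b2 \<in> K" "c2 \<in> C" "g2 \<in> Gam" "nu b2 < d" "snd z = b2 + c2 + g2" using C(3)[of "snd z"] z by auto
  define b c g where "b = (b1, b2)" and "c = (c1, c2)" and "g = (g1, g2)"
  have bcg: "b \<in> K2" "c \<in> C\<times>C" "g \<in> G2" "nu (fst b) < d" "nu (snd b) < d" "z = b + c + g"
   using 1 2 by (auto simp: b_def c_def g_def plus_prod_def prod_eq_iff)
  have cK: "c \<in> K2" using CK bcg by blast
  have near: "norm (F (rep p + z) - F (rep p + c)) < e / 3" for p
  proof -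
   have m: "- b + rep p + b \<in> L2 j"
    using LL_conj[OF subgrpD(3)[OF KK bcg(1)] r[of p]] by simp
   have "F (rep p + z) = F (rep p + b + c + g)" using bcg by (simp add: add.assoc)
   also have "... = F (rep p + b + c)" by (rule B(3)) (use bcg rK cK subgrpD(2)[OF KK] in auto)
   also have "rep p + b + c = b + com (- b) (rep p) + (rep p + c)"
    by (simp only: com_def group_simps)
   also have "F ... = F (b + (rep p + c))"
    by (rule linv_mid[OF F(2) bcg(1) LL_com[OF _ r]]) (use bcg rK cK subgrpD[OF KK] in auto)
   finally show ?thesis using d(2)[OF bcg(1) _ bcg(4,5), of "rep p + c"] rK cK subgrpD(2)[OF KK] by simp
  qed
  have "norm (F (rep p + c) - F (rep q + c)) < e / 3" using q bcg by blast
  hence "dist (F (rep p + z)) (F (rep q + z)) < e"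
   using near[of p] near[of q] dist_triangle_third[of "F (rep p + z)" "F (rep p + c)" e "F (rep q + c)" "F (rep q + z)"]
   by (simp add: dist_norm norm_minus_commute)
  thus ?thesis by (simp add: dist_norm)
 qed
 thus ?thesis using J by meson
qed

text \<open>Everything about \<open>xi\<close> is read off at one point \<open>z0\<close> where
  \<open>G\<close> does not vanish. Moving an element of \<open>Gam\<close> past \<open>z0\<close>
  costs a commutator of the next level, which \<open>G\<close> ignores.\<close>

lemma vertical_chars:
 assumes G: "pgood G" "linv (Suc j) G" and eig: "!!y z. y \<in> L2 j ==> z \<in> K2 ==> G (y + z) = xi y * G z"
  and xi: "!!y. norm (xi y) = 1" and z0: "z0 \<in> K2" "G z0 ~= 0"
 shows "gchar j (\<lambda>y. xi (y, 0))" "gchar j (\<lambda>y. xi (0, y))" "vert j (\<lambda>y. xi (y, 0)) (\<lambda>y. xi (0, y)) G"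
proof -
 have ze: "0 \<in> Lc k" for k by (rule subgrpD(1)[OF Lc_subgrp])
 have mul: "xi (x + y) = xi x * xi y" if "x \<in> L2 j" "y \<in> L2 j" for x y
 proof -
  have "xi (x + y) * G z0 = G (x + (y + z0))" using eig[OF subgrpD(2)[OF LL that] z0(1)] by (simp add: add.assoc)
  also have "... = xi x * (xi y * G z0)" using eig that z0 subgrpD(2)[OF KK LL_KK z0(1)] by simp
  finally show ?thesis using z0(2) by simp
 qed
 have inv: "xi y = 1" if "y \<in> Lc (Suc j) \<times> Lc (Suc j)" for y
 proof -
  have "G (y + z0) = G z0" by (rule linvD[OF G(2) that z0(1)])
  moreover have "y \<in> L2 j" using that Lc_Suc by auto
  ultimately show ?thesis using eig[of y z0] z0 by simp
 qed
 have gam: "xi y = 1" if y: "y \<in> L2 j" "y \<in> G2" for y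
 proof -
  have "y + z0 = com y z0 + z0 + y" by (simp only: com_def group_simps)
  moreover have "com y z0 \<in> Lc (Suc j) \<times> Lc (Suc j)"
  proof -
   have "com y z0 = - com z0 y" by (simp only: com_def group_simps)
   thus ?thesis using subgrpD(3)[OF LL LL_com[OF z0(1) y(1)]] by simp
  qed
  ultimately have "G (y + z0) = G (com y z0 + z0)"
   using G(1) y(2) z0(1) subgrpD(2)[OF KK LL_KK] unfolding pgood_def by metis
  also have "... = G z0" by (rule linvD[OF G(2) \<open>com y z0 \<in> _\<close> z0(1)])
  finally show ?thesis using eig[OF y(1) z0(1)] z0 by simp
 qed
 have small: "\<exists>d>0. \<forall>y\<in>L2 j. nu (fst y) < d --> nu (snd y) < d --> norm (xi y - 1) < e" if "e > 0" for e
 proof -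
  have "e * norm (G z0) > 0" using that z0(2) by simp
  then obtain d where d: "d > 0" "!!v z. v \<in> K2 ==> z \<in> K2 ==> nu (fst v) < d ==> nu (snd v) < d ==> norm (G (v + z) - G z) < e * norm (G z0)"
   by (rule pgood_uc[OF G(1)]) blast
  have "norm (xi y - 1) < e" if y: "y \<in> L2 j" "nu (fst y) < d" "nu (snd y) < d" for y
  proof -
   have "norm ((xi y - 1) * G z0) < e * norm (G z0)"
    using d(2)[OF LL_KK[OF y(1)] z0(1) y(2,3)] eig[OF y(1) z0(1)] by (simp add: left_diff_distrib)
   thus ?thesis using z0(2) by (simp add: norm_mult)
  qed
  thus ?thesis using d(1) by blast
 qed
 have Gam0: "0 \<in> Gam" using subgrpD(1)[OF Gam(1)] .
 have gch: "gchar j (\<lambda>y. xi (\<iota> y))" if \<iota>: "!!x y. \<iota> (x + y) = \<iota> x + \<iota> y" "!!k y. y \<in> Lc k ==> \<iota> y \<in> Lc k \<times> Lc k"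
  "!!y. y \<in> Gam ==> \<iota> y \<in> G2" "!!y d. d > 0 ==> nu y < d ==> nu (fst (\<iota> y)) < d & nu (snd (\<iota> y)) < d" for \<iota>
  unfolding gchar_def vchar_def unit_hom_def cont_def
 proof (intro conjI ballI allI impI)
  fix e :: real assume "e > 0"
  then obtain d where d: "d > 0" "!!y. y \<in> L2 j ==> nu (fst y) < d ==> nu (snd y) < d ==> norm (xi y - 1) < e"
   using small by meson
  thus "\<exists>d>0. \<forall>v\<in>Lc j. nu v < d --> norm (xi (\<iota> v) - 1) < e"
   using \<iota>(2)[of _ j] \<iota>(4)[OF d(1)] by (intro exI[of _ d]) simp
 qed (simp_all add: \<iota>(1) mul \<iota>(2) inv gam \<iota>(3) xi)
 show "gchar j (\<lambda>y. xi (y, 0))" by (rule gch) (auto simp: ze Gam0 nu_zero plus_prod_def)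
 show "gchar j (\<lambda>y. xi (0, y))" by (rule gch) (auto simp: ze Gam0 nu_zero plus_prod_def)
 show "vert j (\<lambda>y. xi (y, 0)) (\<lambda>y. xi (0, y)) G"
  unfolding vert_def
 proof (intro ballI)
  fix y z assume y: "y \<in> L2 j" and z: "z \<in> K2"
  have "xi y = xi (fst y, 0) * xi (0, snd y)"
   using mul[of "(fst y, 0)" "(0, snd y)"] y ze by (auto simp: plus_prod_def)
  thus "G (y + z) = xi (fst y, 0) * xi (0, snd y) * G z" using eig[OF y z] by simp
 qed
qed

text \<open>For each \<open>z\<close> the function \<open>F (rep p + z)\<close> of \<open>p\<close>
  is almost periodic. Its Fourier component at \<open>xi\<close>, as a function of \<open>z\<close>,
  is multiplied by \<open>xi (frag_of y)\<close> when \<open>z\<close> is translated by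
  \<open>y\<close>, because this translation amounts to a shift of \<open>p\<close>.\<close>

lemma vertical_decomposition:
 assumes F: "pgood F" "linv (Suc j) F" and e: "e > 0"
 shows "\<exists>(I :: nat set) psi1 psi2 G. finite I & (\<forall>i\<in>I. pgood (G i) & gchar j (psi1 i) & gchar j (psi2 i) & vert j (psi1 i) (psi2 i) (G i)) &
  (\<forall>z\<in>K2. norm (F z - (\<Sum>i\<in>I. G i z)) <= e)"
proof -
 let ?D = "L2 j" and ?L = "Lc (Suc j) \<times> Lc (Suc j)"
 obtain B where B: "B >= 0" "!!z. z \<in> K2 ==> norm (F z) <= B" "!!z gamma. z \<in> K2 ==> gamma \<in> G2 ==> F (z + gamma) = F z"
  "!!e. e > 0 ==> \<exists>d>0. \<forall>v\<in>K2. \<forall>z\<in>K2. nu (fst v) < d --> nu (snd v) < d --> norm (F (v + z) - F z) < e"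
  by (rule pgoodD[OF F(1)]) blast
 have sub: "?L \<subseteq> ?D" using Lc_Suc by auto
 have c: "d + l - d \<in> ?L" "com d x \<in> ?L" if "d \<in> ?D" "l \<in> ?L" "x \<in> ?D" for d l x
  by (rule LL_conj[OF LL_KK[OF that(1)] that(2)], rule LL_com[OF LL_KK[OF that(1)] that(3)])
 have L0: "0 \<in> ?L" by (rule subgrpD(1)[OF LL])
 obtain rep :: "('g \<times> 'g \<Rightarrow>\<^sub>0 int) => 'g \<times> 'g" where rep: "!!p. rep p \<in> ?D" "!!p q. \<exists>l\<in>?L. rep (p + q) = l + (rep p + rep q)"
  "!!d. d \<in> ?D ==> \<exists>l\<in>?L. rep (frag_of d) = l + d"
  by (rule abelianization[OF LL LL sub c(1) c(2)[OF _ L0]]) blast+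
 have rK: "rep p \<in> K2" for p using rep(1) LL_KK by blast
 have Fl: "F (l + x + z) = F (x + z)" if "l \<in> ?L" "x \<in> K2" "z \<in> K2" for l x z
  using linvD[OF F(2) that(1) subgrpD(2)[OF KK that(2,3)]] by (simp add: add.assoc)
 have Fadd: "F (rep (p + q) + z) = F (rep p + (rep q + z))" if z: "z \<in> K2" for p q z
 proof -
  obtain l where "l \<in> ?L" "rep (p + q) = l + (rep p + rep q)" using rep(2) by blast
  thus ?thesis using Fl[of l "rep p + rep q" z] rK subgrpD(2)[OF KK] z by (simp add: add.assoc)
 qed
 obtain M :: "(('g \<times> 'g \<Rightarrow>\<^sub>0 int) => complex) => complex" where "invariant_mean M" using invariant_mean_exists by blast
 then interpret invariant_mean M .
 have "K2 ~= {}" using subgrpD(1)[OF KK] by blast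
 have tr: "\<exists>z'\<in>K2. (\<lambda>p. F (rep p + z')) = (\<lambda>x. F (rep (d + x) + z))" if z: "z \<in> K2" for z d
  using Fadd[OF z, of _ d] rK subgrpD(2)[OF KK _ z] by (intro bexI[of _ "rep d + z"]) (auto simp: add.commute)
 have "norm (F (rep d + z)) <= B" if "z \<in> K2" for z d by (rule B(2)[OF subgrpD(2)[OF KK rK that]])
 from almost_periodic_approximation[of "K2" "\<lambda>z p. F (rep p + z)" B, OF this \<open>K2 ~= {}\<close> tr finite_net_translates[OF F rep(1)] e]
 obtain X w where X: "finite X" "!!xi. xi \<in> X ==> character xi"
  "!!z. z \<in> K2 ==> norm (F (rep 0 + z) - (\<Sum>xi\<in>X. w xi * M (\<lambda>p. cnj (xi p) * F (rep p + z)))) <= e"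
  by blast
 have F0: "F (rep 0 + z) = F z" if z: "z \<in> K2" for z
 proof -
  obtain l where l: "l \<in> ?L" "rep (0 + 0) = l + (rep 0 + rep 0)" using rep(2) by blast
  hence "0 + rep 0 = (l + rep 0) + rep 0" by (simp add: add.assoc)
  hence "0 = l + rep 0" by (simp only: add_right_cancel)
  hence "rep 0 = - l" by (metis add_eq_0_iff)
  thus ?thesis using linvD[OF F(2) subgrpD(3)[OF LL l(1)] z] by simp
 qed
 define G where "G xi z = w xi * M (\<lambda>p. cnj (xi p) * F (rep p + z))" for xi z
 have bF: "bdd_fun (\<lambda>p. cnj (xi p) * F (rep p + z))" if "xi \<in> X" "z \<in> K2" for xi z
  by (rule bdd_funI[of _ B]) (use X(2)[OF that(1)] B(2) rK that subgrpD(2)[OF KK] in "auto simp: norm_mult character_def")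
 have Gdiff: "norm (G xi z - G xi z') <= norm (w xi) * k"
  if xi: "xi \<in> X" and z: "z \<in> K2" "z' \<in> K2" and k: "!!p. norm (F (rep p + z) - F (rep p + z')) <= k" for xi z z' k
 proof -
  have "M (\<lambda>p. cnj (xi p) * F (rep p + z)) - M (\<lambda>p. cnj (xi p) * F (rep p + z')) = M (\<lambda>p. cnj (xi p) * (F (rep p + z) - F (rep p + z')))"
   using mean_diff[OF bF[OF xi z(1)] bF[OF xi z(2)]] by (simp add: right_diff_distrib)
  moreover have "norm (M (\<lambda>p. cnj (xi p) * (F (rep p + z) - F (rep p + z')))) <= k"
   by (rule mean_bound) (use X(2)[OF xi] k in "simp add: norm_mult character_def")
  ultimately show ?thesis by (simp add: G_def norm_mult mult_left_mono flip: right_diff_distrib)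
 qed
 have Ggood: "pgood (G xi)" if xi: "xi \<in> X" for xi
  unfolding pgood_def
 proof (intro conjI allI impI ballI)
  have "norm (G xi z) <= norm (w xi) * B" if z: "z \<in> K2" for z
   unfolding G_def norm_mult
   by (intro mult_left_mono mean_bound) (use X(2)[OF xi] B(2) rK z subgrpD(2)[OF KK] in "auto simp: norm_mult character_def")
  thus "\<exists>B. \<forall>z\<in>K2. norm (G xi z) <= B" by blast
  show "G xi (z + gamma) = G xi z" if "z \<in> K2" "gamma \<in> G2" for z gamma
   unfolding G_def using B(3)[OF subgrpD(2)[OF KK rK that(1)] that(2)] by (simp add: add.assoc)
  fix e :: real assume e: "e > 0"
  define k where "k = e / (2 * (norm (w xi) + 1))"
  have k: "k > 0" "norm (w xi) * k < e"
  proof -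
   show "k > 0" using e by (simp add: k_def add_nonneg_pos)
   have "norm (w xi) * k <= (norm (w xi) + 1) * k" using \<open>k > 0\<close> by (intro mult_right_mono) auto
   also have "... = e / 2"
   proof -
    have "c * (e / (2 * c)) = e / 2" if "c ~= 0" for c using that by simp
    moreover have "norm (w xi) + 1 ~= 0" using norm_ge_zero[of "w xi"] by linarith
    ultimately show ?thesis unfolding k_def .
   qed
   finally show "norm (w xi) * k < e" using e by linarith
  qed
  obtain d where d: "d > 0" "!!v z. v \<in> K2 ==> z \<in> K2 ==> nu (fst v) < d ==> nu (snd v) < d ==> norm (F (v + z) - F z) < k"
   using B(4)[OF k(1)] by blast
  have "norm (G xi (v + z) - G xi z) < e" if v: "v \<in> K2" "nu (fst v) < d" "nu (snd v) < d" and z: "z \<in> K2" for v z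
  proof -
   have "norm (F (rep p + (v + z)) - F (rep p + z)) <= k" for p
   proof -
    have "rep p + (v + z) = v + com (- v) (rep p) + (rep p + z)" by (simp only: com_def group_simps)
    hence "F (rep p + (v + z)) = F (v + (rep p + z))"
     using linv_mid[OF F(2) v(1) LL_com[OF subgrpD(3)[OF KK v(1)] rep(1)]] rK z subgrpD(2)[OF KK] by simp
    thus ?thesis using d(2)[OF v(1) subgrpD(2)[OF KK rK z] v(2,3)] by (simp add: less_imp_le)
   qed
   from Gdiff[OF xi subgrpD(2)[OF KK v(1) z] z this] k(2) show ?thesis by linarith
  qed
  thus "\<exists>d>0. \<forall>v\<in>K2. \<forall>z\<in>K2. nu (fst v) < d --> nu (snd v) < d --> norm (G xi (v + z) - G xi z) < e"
   using d(1) by blast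
 qed
 have Glinv: "linv (Suc j) (G xi)" for xi
  unfolding linv_def
 proof (intro ballI)
  fix y z assume y: "y \<in> ?L" and z: "z \<in> K2"
  have "F (rep p + (y + z)) = F (rep p + z)" for p using linv_mid[OF F(2) rK y z] by (simp add: add.assoc)
  thus "G xi (y + z) = G xi z" by (simp add: G_def)
 qed
 have Geig: "G xi (y + z) = xi (frag_of y) * G xi z" if xi: "xi \<in> X" and y: "y \<in> ?D" and z: "z \<in> K2" for xi y z
 proof -
  have ch: "xi (p + q) = xi p * xi q" "norm (xi p) = 1" for p q using X(2)[OF xi] by (auto simp: character_def)
  obtain l where l: "l \<in> ?L" "rep (frag_of y) = l + y" using rep(3)[OF y] by blast
  have Fp: "F (rep p + (y + z)) = F (rep (frag_of y + p) + z)" for p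
  proof -
   have "F (rep (p + frag_of y) + z) = F (rep p + l + (y + z))" using Fadd[OF z, of p "frag_of y"] l(2) by (simp add: add.assoc)
   also have "... = F (rep p + (y + z))" by (rule linv_mid[OF F(2) rK l(1) subgrpD(2)[OF KK LL_KK[OF y] z]])
   finally show ?thesis by (simp add: add.commute)
  qed
  have "M (\<lambda>p. cnj (xi p) * F (rep p + (y + z))) = M (\<lambda>p. xi (frag_of y) * (cnj (xi (frag_of y + p)) * F (rep (frag_of y + p) + z)))"
  proof -
   have "xi (frag_of y) * cnj (xi (frag_of y)) = 1" by (rule unit_mult_cnj) (rule ch)
   hence "cnj (xi p) = xi (frag_of y) * cnj (xi (frag_of y + p))" for p
    unfolding ch(1) complex_cnj_mult mult.assoc[symmetric] by simp
   hence "cnj (xi p) * F (rep p + (y + z)) = xi (frag_of y) * (cnj (xi (frag_of y + p)) * F (rep (frag_of y + p) + z))" for p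
    unfolding Fp by (metis mult.assoc)
   thus ?thesis by (simp only:)
  qed
  also have "... = xi (frag_of y) * M (\<lambda>p. cnj (xi p) * F (rep p + z))"
   using mean_scale[OF bdd_fun_shift[OF bF[OF xi z]]] mean_shift[OF bF[OF xi z]] by simp
  finally show ?thesis by (simp add: G_def)
 qed
 \<comment> \<open>Continuity of \<open>xi\<close> and triviality on \<open>Gam\<close> can be
   deduced only from a component that is not identically 0; the others are dropped.\<close>
 define Y where "Y = {xi\<in>X. \<exists>z\<in>K2. G xi z ~= 0}"
 have Y: "gchar j (\<lambda>y. xi (frag_of (y, 0)))" "gchar j (\<lambda>y. xi (frag_of (0, y)))"
   "vert j (\<lambda>y. xi (frag_of (y, 0))) (\<lambda>y. xi (frag_of (0, y))) (G xi)" if Yx: "xi \<in> Y" for xi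
 proof -
  obtain z0 where z0: "xi \<in> X" "z0 \<in> K2" "G xi z0 ~= 0" using Yx unfolding Y_def by blast
  have "norm (xi (frag_of y)) = 1" for y using X(2)[OF z0(1)] by (simp add: character_def)
  from vertical_chars[OF Ggood[OF z0(1)] Glinv Geig[OF z0(1)] this z0(2,3)]
  show "gchar j (\<lambda>y. xi (frag_of (y, 0)))" "gchar j (\<lambda>y. xi (frag_of (0, y)))"
   "vert j (\<lambda>y. xi (frag_of (y, 0))) (\<lambda>y. xi (frag_of (0, y))) (G xi)" by blast+
 qed
 have "finite Y" using X(1) by (simp add: Y_def)
 then obtain f :: "nat => _" and n where f: "bij_betw f {..<n} Y" using ex_bij_betw_nat_finite[of Y] by (auto simp: atLeast0LessThan)
 have approx: "norm (F z - (\<Sum>i<n. G (f i) z)) <= e" if z: "z \<in> K2" for z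
 proof -
  have "(\<Sum>i<n. G (f i) z) = (\<Sum>xi\<in>Y. G xi z)" using f by (rule sum.reindex_bij_betw)
  also have "... = (\<Sum>xi\<in>X. G xi z)" by (rule sum.mono_neutral_left[OF X(1)]) (use z in "auto simp: Y_def")
  finally show ?thesis using X(3)[OF z] F0[OF z] by (simp add: G_def)
 qed
 have fY: "f i \<in> Y" if "i < n" for i using f that by (auto simp: bij_betw_def)
 show ?thesis
 proof (intro exI conjI ballI)
  show "finite {..<n}" by simp
  fix i assume "i \<in> {..<n}"
  hence fi: "f i \<in> Y" "f i \<in> X" using fY by (auto simp: Y_def)
  show "pgood (G (f i))" "gchar j (\<lambda>y. f i (frag_of (y, 0)))" "gchar j (\<lambda>y. f i (frag_of (0, y)))"
   "vert j (\<lambda>y. f i (frag_of (y, 0))) (\<lambda>y. f i (frag_of (0, y))) (G (f i))" using Ggood Y fi by blast+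
 qed (use approx in simp)
qed

end

lemma norm_geometric_sum_le:
 fixes w :: complex
 assumes "norm w = 1" "w ~= 1"
 shows "norm (\<Sum>d<n. w ^ d) <= 2 / norm (w - 1)"
proof -
 have "(\<Sum>d<n. w ^ d) = (w ^ n - 1) / (w - 1)" using assms(2) by (rule geometric_sum)
 moreover have "norm (w ^ n - 1) <= 2" using norm_triangle_ineq4[of "w ^ n" 1] assms(1) by (simp add: norm_power)
 ultimately show ?thesis by (simp add: norm_divide divide_right_mono)
qed

text \<open>Expanding the square leaves \<open>M\<close> diagonal terms for each \<open>d\<close>.
  The other pairs give geometric sums in \<open>d\<close> with ratio different from 1, bounded
  independently of \<open>H\<close>.\<close>

lemma average_powers_small:
 fixes theta :: complex
 assumes theta: "norm theta = 1" "!!k. 1 <= k ==> k < M ==> theta ^ k ~= 1" and M: "M >= 1"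
 shows "\<exists>H0. \<forall>H\<ge>H0. (\<Sum>d<H. (norm ((\<Sum>m<M. theta ^ (d * m)) / of_nat M))^2) <= 2 * real H / real M"
proof -
 define w where "w m m' = theta ^ m * cnj (theta ^ m')" for m m'
 have w1: "norm (w m m') = 1" for m m' by (simp add: w_def norm_mult norm_power theta)
 have wne: "w m m' ~= 1" if mm: "m < M" "m' < M" "m ~= m'" for m m'
 proof
  assume "w m m' = 1"
  have "theta ^ m' * cnj (theta ^ m') = 1" by (rule unit_mult_cnj) (simp add: norm_power theta)
  moreover have "w m m' * theta ^ m' = theta ^ m * (theta ^ m' * cnj (theta ^ m'))" by (simp add: w_def mult_ac)
  ultimately have eq: "theta ^ m' = theta ^ m" using \<open>w m m' = 1\<close> by simp
  have nz: "theta ^ k ~= 0" for k using theta(1) by auto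
  have no: "theta ^ a ~= theta ^ b" if "a < b" "b < M" for a b
  proof
   assume "theta ^ a = theta ^ b"
   moreover have "theta ^ b = theta ^ a * theta ^ (b - a)" using that by (simp flip: power_add)
   ultimately have "theta ^ a * theta ^ (b - a) = theta ^ a * 1" by (simp only: mult_1_right)
   hence "theta ^ (b - a) = 1" using nz[of a] mult_left_cancel by blast
   thus False using theta(2)[of "b - a"] that by simp
  qed
  show False using no[of m m'] no[of m' m] eq mm by (metis nat_neq_iff)
 qed
 define C where "C = (\<Sum>m<M. \<Sum>m'<M. if m = m' then 0 else 2 / norm (w m m' - 1))"
 have bound: "(\<Sum>d<H. (norm ((\<Sum>m<M. theta ^ (d * m)) / of_nat M))^2) <= (real M * real H + C) / (real M)^2" for H
 proof -
  define s where "s d = (\<Sum>m<M. theta ^ (d * m))" for d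
  have "complex_of_real ((norm (s d))^2) = (\<Sum>m<M. \<Sum>m'<M. w m m' ^ d)" for d
   unfolding complex_norm_square s_def cnj_sum sum_product w_def
   by (simp add: power_mult_distrib mult.commute[of d] power_mult)
  hence "complex_of_real (\<Sum>d<H. (norm (s d))^2) = (\<Sum>d<H. \<Sum>m<M. \<Sum>m'<M. w m m' ^ d)" by simp
  also have "... = (\<Sum>m<M. \<Sum>m'<M. \<Sum>d<H. w m m' ^ d)" by (rule sum_swap3)
  finally have eq: "complex_of_real (\<Sum>d<H. (norm (s d))^2) = (\<Sum>m<M. \<Sum>m'<M. \<Sum>d<H. w m m' ^ d)" .
  have "(\<Sum>d<H. (norm (s d))^2) = norm (complex_of_real (\<Sum>d<H. (norm (s d))^2))"
   unfolding norm_of_real by (simp add: sum_nonneg)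
  also have "... <= (\<Sum>m<M. \<Sum>m'<M. norm (\<Sum>d<H. w m m' ^ d))"
   unfolding eq by (intro order_trans[OF norm_sum] sum_mono norm_sum)
  also have "... <= (\<Sum>m<M. \<Sum>m'<M. (if m = m' then real H else 0) + (if m = m' then 0 else 2 / norm (w m m' - 1)))"
  proof (intro sum_mono)
   fix m m' assume mm: "m \<in> {..<M}" "m' \<in> {..<M}"
   show "norm (\<Sum>d<H. w m m' ^ d) <= (if m = m' then real H else 0) + (if m = m' then 0 else 2 / norm (w m m' - 1))"
   proof (cases "m = m'")
    case True
    have "norm (\<Sum>d<H. w m m' ^ d) <= of_nat (card {..<H}) * 1"
     by (rule sum_norm_bound) (simp add: norm_power w1)
    thus ?thesis using True by simp
   next
    case False
    thus ?thesis using norm_geometric_sum_le[OF w1 wne, of m m'] mm by simp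
   qed
  qed
  also have "... = real M * real H + C" by (simp add: sum.distrib C_def)
  finally show ?thesis unfolding s_def by (simp add: norm_divide power_divide divide_right_mono flip: sum_divide_distrib)
 qed
 show ?thesis
 proof (intro exI allI impI)
  fix H assume H: "H >= nat \<lceil>C\<rceil>"
  hence "C <= real H" by linarith
  also have "... <= real M * real H" using mult_right_mono[of 1 "real M" "real H"] M by simp
  finally have "(real M * real H + C) / (real M)^2 <= (real M * real H + real M * real H) / (real M)^2"
   by (intro divide_right_mono add_left_mono) auto
  also have "... = 2 * real H / real M" using M by (simp add: power2_eq_square field_simps)
  finally show "(\<Sum>d<H. (norm ((\<Sum>m<M. theta ^ (d * m)) / of_nat M))^2) <= 2 * real H / real M"
   using bound[of H] by linarith
 qed
qed

lemma norm_mult_diff_one: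
 assumes "norm x = 1" "norm y = 1"
 shows "norm (x * y - 1) <= norm (x - 1) + norm (y - (1 :: complex))"
proof -
 have "norm (x * y - 1) = norm ((x - 1) * y + (y - 1))" by (simp add: algebra_simps)
 also have "... <= norm ((x - 1) * y) + norm (y - 1)" by (rule norm_triangle_ineq)
 finally show ?thesis using assms by (simp add: norm_mult)
qed

context nil_core
begin

lemma cont_mult:
 assumes c: "cont H psi" "cont H phi" and n: "!!v. v \<in> H ==> norm (psi v) = 1" "!!v. v \<in> H ==> norm (phi v) = 1"
 shows "cont H (\<lambda>y. psi y * phi y)"
 unfolding cont_def
proof (intro allI impI)
 fix e :: real assume "e > 0"
 hence e2: "e / 2 > 0" by simp
 obtain d1 where d1: "d1 > 0" "!!v. v \<in> H ==> nu v < d1 ==> norm (psi v - 1) < e / 2" using c(1) e2 unfolding cont_def by blast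
 obtain d2 where d2: "d2 > 0" "!!v. v \<in> H ==> nu v < d2 ==> norm (phi v - 1) < e / 2" using c(2) e2 unfolding cont_def by blast
 have "norm (psi v * phi v - 1) < e" if "v \<in> H" "nu v < min d1 d2" for v
  using norm_mult_diff_one[OF n[OF that(1) ]] d1(2)[of v] d2(2)[of v] that by simp
 thus "\<exists>d>0. \<forall>v\<in>H. nu v < d --> norm (psi v * phi v - 1) < e" using d1(1) d2(1) by (intro exI[of _ "min d1 d2"]) auto
qed

lemma cont_power: "cont H psi ==> (!!v. v \<in> H ==> norm (psi v) = 1) ==> cont H (\<lambda>y. psi y ^ n)"
proof (induction n)
 case 0 show ?case by (auto simp: cont_def intro: exI[of _ 1])
next
 case (Suc n) thus ?case using cont_mult[of H psi "\<lambda>y. psi y ^ n"] by (simp add: norm_power)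
qed

lemma gchar_norm: "gchar j psi ==> y \<in> Lc j ==> norm (psi y) = 1"
 by (auto simp: gchar_def vchar_def unit_hom_def)

lemma gchar_powers: "gchar j psi ==> gchar j phi ==> gchar j (\<lambda>y. psi y ^ m * phi y ^ n)"
 using cont_mult[OF cont_power cont_power, of "Lc j" psi phi m n]
 by (auto simp: gchar_def vchar_def unit_hom_def norm_mult norm_power power_mult_distrib)

lemma small_nmul_le: "e > 0 ==> \<exists>d>0. \<forall>u\<in>K. nu u < d --> (\<forall>k\<le>n. nu (nmul k u) < e)"
proof (induction n arbitrary: e)
 case 0 thus ?case by (auto simp: nu_zero intro: exI[of _ 1])
next
 case (Suc n)
 obtain d1 where d1: "d1 > 0" "!!u v. u \<in> K ==> v \<in> K ==> nu u < d1 ==> nu v < d1 ==> nu (u + v) < e"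
  using small_add[OF Suc.prems] by blast
 obtain d2 where d2: "d2 > 0" "!!u k. u \<in> K ==> nu u < d2 ==> k <= n ==> nu (nmul k u) < min e d1"
  using Suc.IH[of "min e d1"] Suc.prems d1(1) by auto
 have "nu (nmul k u) < e" if u: "u \<in> K" "nu u < min d1 d2" and k: "k <= Suc n" for u k
 proof (cases "k <= n")
  case True thus ?thesis using d2(2)[of u k] u by simp
 next
  case False
  hence "k = Suc n" using k by simp
  thus ?thesis using d1(2)[OF u(1) nmul_mem[OF K u(1)], of n] d2(2)[of u n] u by simp
 qed
 thus ?case using d1 d2 by (intro exI[of _ "min d1 d2"]) auto
qed

section \<open>Averages along an element of K x K, uniform in the starting point\<close>

abbreviation "av b F n z \<equiv> cesaro (\<lambda>i. F (nmul i b + z)) n"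
abbreviation "ev_small b F e \<equiv> \<forall>\<^sub>F n in sequentially. \<forall>z\<in>K2. norm (av b F n z) <= e"

definition uzero :: "'g \<times> 'g => ('g \<times> 'g => complex) => bool" where
 "uzero b F \<equiv> (\<forall>e>0. ev_small b F e)"

lemma uzero_approx:
 assumes b: "b \<in> K2" and "!!e. e > 0 ==> \<exists>G. uzero b G & (\<forall>z\<in>K2. norm (F z - G z) <= e)"
 shows "uzero b F"
 unfolding uzero_def
proof (intro allI impI)
 fix e :: real assume e: "e > 0"
 then obtain G where G: "uzero b G" "!!z. z \<in> K2 ==> norm (F z - G z) <= e / 2" using assms(2)[of "e/2"] by auto
 have "ev_small b G (e / 2)"
  using G(1) half_gt_zero[OF e] unfolding uzero_def by blast
 thus "ev_small b F e"
 proof eventually_elim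
  case (elim n)
  show ?case
  proof
   fix z assume z: "z \<in> K2"
   have "norm (av b F n z - av b G n z) <= e / 2"
    by (rule norm_cesaro_diff_le) (use G(2) e subgrpD(2)[OF KK nmul_mem[OF KK b] z] in auto)
   moreover have "norm (av b G n z) <= e / 2" using elim z by blast
   ultimately show "norm (av b F n z) <= e"
    using norm_triangle_ineq2[of "av b F n z" "av b G n z"] by linarith
  qed
 qed
qed

lemma uzero_add: "uzero b F ==> uzero b G ==> uzero b (\<lambda>z. F z + G z)"
 unfolding uzero_def
proof (intro allI impI)
 fix e :: real
 assume F: "\<forall>e>0. ev_small b F e"
  and G: "\<forall>e>0. ev_small b G e" and "e > 0"
 hence "e / 2 > 0" by simp
 from eventually_conj[OF F[rule_format, OF this] G[rule_format, OF this]]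
 show "\<forall>\<^sub>F n in sequentially. \<forall>z\<in>K2. norm (cesaro (\<lambda>i. F (nmul i b + z) + G (nmul i b + z)) n) <= e"
  unfolding cesaro_add
 proof eventually_elim
  case (elim n)
  show ?case
  proof
   fix z assume z: "z \<in> K2"
   have "norm (av b F n z) <= e / 2" "norm (av b G n z) <= e / 2"
    using elim z by blast+
   thus "norm (av b F n z + av b G n z) <= e"
    using norm_triangle_ineq[of "av b F n z"] by (smt (verit) field_sum_of_halves)
  qed
 qed
qed

lemma uzero_zero: "(!!z. z \<in> K2 ==> F z = 0) ==> b \<in> K2 ==> uzero b F"
 unfolding uzero_def using subgrpD(2)[OF KK nmul_mem[OF KK]] by (simp add: cesaro_def)

lemma uzero_cmult: assumes "uzero b F" shows "uzero b (\<lambda>z. c * F z)"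
 unfolding uzero_def
proof (intro allI impI)
 fix e :: real assume e: "e > 0"
 define k where "k = e / (norm c + 1)"
 have c0: "norm c + 1 > 0" by (simp add: add_nonneg_pos)
 hence k: "k > 0" "norm c * k <= e"
  using e mult_right_mono[of "norm c" "norm c + 1" k] by (auto simp: k_def)
 from assms k(1) have "ev_small b F k" unfolding uzero_def by blast
 thus "\<forall>\<^sub>F n in sequentially. \<forall>z\<in>K2. norm (cesaro (\<lambda>i. c * F (nmul i b + z)) n) <= e"
  unfolding cesaro_cmult norm_mult
  by eventually_elim (meson k(2) mult_left_mono norm_ge_zero order_trans)
qed

lemma uzero_sum: "finite I ==> b \<in> K2 ==> (!!i. i \<in> I ==> uzero b (F i)) ==> uzero b (\<lambda>z. \<Sum>i\<in>I. F i z)"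
 by (induction I rule: finite_induct) (auto intro: uzero_zero uzero_add)

lemma pgood_shift:
 assumes F: "pgood F" and b: "b \<in> K2" shows "pgood (\<lambda>z. F (b + z))"
 unfolding pgood_def
proof (intro conjI ballI allI impI)
 have bz: "b + z \<in> K2" if "z \<in> K2" for z by (rule subgrpD(2)[OF KK b that])
 obtain B where "!!z. z \<in> K2 ==> norm (F z) <= B" using F unfolding pgood_def by blast
 thus "\<exists>B. \<forall>z\<in>K2. norm (F (b + z)) <= B" using bz by blast
 show "F (b + (z + gamma)) = F (b + z)" if "z \<in> K2" "gamma \<in> G2" for z gamma
  using F bz that unfolding pgood_def by (metis add.assoc)
 fix e :: real assume "e > 0"
 then obtain d where d: "d > 0" "!!v z. v \<in> K2 ==> z \<in> K2 ==> nu (fst v) < d ==> nu (snd v) < d ==> norm (F (v + z) - F z) < e"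
  by (rule pgood_uc[OF F]) blast
 obtain d1 where d1: "d1 > 0" "!!u. u \<in> K ==> nu u < d1 ==> nu (fst b + u - fst b) < d" using small_conj[OF d(1), of "fst b"] b by auto
 obtain d2 where d2: "d2 > 0" "!!u. u \<in> K ==> nu u < d2 ==> nu (snd b + u - snd b) < d" using small_conj[OF d(1), of "snd b"] b by auto
 have "norm (F (b + (v + z)) - F (b + z)) < e" if v: "v \<in> K2" "nu (fst v) < min d1 d2" "nu (snd v) < min d1 d2" and z: "z \<in> K2" for v z
 proof -
  have "b + (v + z) = (b + v - b) + (b + z)" by (simp only: group_simps)
  moreover have "b + v - b \<in> K2" by (rule subgrpD(4)[OF KK subgrpD(2)[OF KK b v(1)] b])
  moreover have "nu (fst (b + v - b)) < d" "nu (snd (b + v - b)) < d"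
   using d1(2)[of "fst v"] d2(2)[of "snd v"] v by auto
  ultimately show ?thesis using d(2)[OF _ bz[OF z]] by metis
 qed
 thus "\<exists>d>0. \<forall>v\<in>K2. \<forall>z\<in>K2. nu (fst v) < d --> nu (snd v) < d --> norm (F (b + (v + z)) - F (b + z)) < e"
  using d1(1) d2(1) by (intro exI[of _ "min d1 d2"]) auto
qed

lemma pgood_Gam: "pgood F ==> z \<in> K2 ==> gamma \<in> G2 ==> F (z + gamma) = F z"
 unfolding pgood_def by blast

lemma pgood_mult_cnj:
 assumes F: "pgood F" and G: "pgood G" shows "pgood (\<lambda>z. F z * cnj (G z))"
 unfolding pgood_def
proof (intro conjI ballI allI impI)
 obtain B where B: "B >= 0" "!!z. z \<in> K2 ==> norm (F z) <= B" by (rule pgoodD[OF F]) blast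
 obtain C where C: "C >= 0" "!!z. z \<in> K2 ==> norm (G z) <= C" by (rule pgoodD[OF G]) blast
 have "norm (F z * cnj (G z)) <= B * C" if "z \<in> K2" for z
  using mult_mono[OF B(2)[OF that] C(2)[OF that] B(1)] by (simp add: norm_mult)
 thus "\<exists>B. \<forall>z\<in>K2. norm (F z * cnj (G z)) <= B" by blast
 show "F (z + gamma) * cnj (G (z + gamma)) = F z * cnj (G z)" if "z \<in> K2" "gamma \<in> G2" for z gamma
  using F G that unfolding pgood_def by metis
 fix e :: real assume e: "e > 0"
 define k where "k = e / (2 * (B + C + 1))"
 have k: "k > 0" using e B(1) C(1) by (simp add: k_def)
 have "c * (e / (2 * c)) = e / 2" if "c ~= 0" for c using that by simp
 from this[of "B + C + 1"] have "(B + C + 1) * k = e / 2" using B(1) C(1) unfolding k_def by linarith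
 hence kb: "k * C + B * k < e" using k e by (simp add: algebra_simps)
 obtain d1 where d1: "d1 > 0" "!!v z. v \<in> K2 ==> z \<in> K2 ==> nu (fst v) < d1 ==> nu (snd v) < d1 ==> norm (F (v + z) - F z) < k"
  by (rule pgood_uc[OF F k]) blast
 obtain d2 where d2: "d2 > 0" "!!v z. v \<in> K2 ==> z \<in> K2 ==> nu (fst v) < d2 ==> nu (snd v) < d2 ==> norm (G (v + z) - G z) < k"
  by (rule pgood_uc[OF G k]) blast
 have "norm (F (v + z) * cnj (G (v + z)) - F z * cnj (G z)) < e"
  if v: "v \<in> K2" "nu (fst v) < min d1 d2" "nu (snd v) < min d1 d2" and z: "z \<in> K2" for v z
 proof -
  have "F (v + z) * cnj (G (v + z)) - F z * cnj (G z) = (F (v + z) - F z) * cnj (G (v + z)) + F z * cnj (G (v + z) - G z)"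
   by (simp add: algebra_simps)
  also have "norm ... <= k * C + B * k"
  proof (intro norm_triangle_le add_mono)
   have "norm (F (v + z) - F z) * norm (G (v + z)) <= k * C"
    using d1(2)[OF v(1) z] v k by (intro mult_mono C(2) subgrpD(2)[OF KK v(1) z]) auto
   thus "norm ((F (v + z) - F z) * cnj (G (v + z))) <= k * C" by (simp add: norm_mult)
   have "norm (F z) * norm (G (v + z) - G z) <= B * k"
    using d2(2)[OF v(1) z] v B by (intro mult_mono B(2) z) auto
   thus "norm (F z * cnj (G (v + z) - G z)) <= B * k" unfolding norm_mult complex_mod_cnj .
  qed
  finally show ?thesis using kb by linarith
 qed
 thus "\<exists>d>0. \<forall>v\<in>K2. \<forall>z\<in>K2. nu (fst v) < d --> nu (snd v) < d --> norm (F (v + z) * cnj (G (v + z)) - F z * cnj (G z)) < e"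
  using d1(1) d2(1) by (intro exI[of _ "min d1 d2"]) auto
qed

lemma vertD: "vert j psi1 psi2 F ==> y \<in> L2 j ==> z \<in> K2 ==> F (y + z) = psi1 (fst y) * psi2 (snd y) * F z"
 unfolding vert_def by blast

text \<open>A vertical function for the first level transforms under all of \<open>K2\<close> by characters of
 \<open>K\<close>, because \<open>K = N Gam\<close>.\<close>

lemma vertical_base:
 assumes F: "pgood F" "vert 0 psi1 psi2 F" and psi: "gchar 0 psi1" "gchar 0 psi2" and F0: "F 0 ~= 0"
 obtains c1 c2 where "unit_hom K c1" "unit_hom K c2" "!!n. n \<in> N ==> c1 n = psi1 n & c2 n = psi2 n"
  "!!g. g \<in> Gam ==> c1 g = 1 & c2 g = 1" "cont K c1" "cont K c2"
  "!!k z. k \<in> K2 ==> z \<in> K2 ==> F (k + z) = c1 (fst k) * c2 (snd k) * F z"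
proof -
 define n where "n k = (SOME n. n \<in> N & (\<exists>g\<in>Gam. k = n + g))" for k
 have n: "n k \<in> N" "\<exists>g\<in>Gam. k = n k + g" if "k \<in> K" for k
  using someI_ex[of "\<lambda>n. n \<in> N & (\<exists>g\<in>Gam. k = n + g)"] K_eq[OF that] unfolding n_def by blast+
 have NK: "x \<in> K" if "x \<in> N" for x using that N by blast
 have GK: "x \<in> K" if "x \<in> Gam" for x using that Gam by blast
 have ext: "unit_hom K (\<lambda>k. psi (n k)) & (\<forall>m\<in>N. \<forall>g\<in>Gam. psi (n (m + g)) = psi m)" if psi: "gchar 0 psi" for psi
 proof -
  have h: "unit_hom N psi" "!!y. y \<in> N ==> y \<in> Gam ==> psi y = 1" "vchar 0 psi" using psi by (auto simp: gchar_def vchar_def)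
  have wd: "psi (n (m + g)) = psi m" if m: "m \<in> N" "g \<in> Gam" for m g
  proof -
   have mg: "m + g \<in> K" using m NK GK subgrpD(2)[OF K] by blast
   obtain g' where g': "g' \<in> Gam" "m + g = n (m + g) + g'" using n(2)[OF mg] by blast
   have e: "- m + n (m + g) = g - g'"
   proof -
    have "n (m + g) = m + g - g'" using g'(2) by (simp add: eq_diff_eq)
    thus ?thesis by (simp only: group_simps)
   qed
   have "g - g' \<in> Gam" using m g' subgrpD(4)[OF Gam(1)] by blast
   moreover have "- m + n (m + g) \<in> N" using m n(1)[OF mg] subgrpD[OF N(1)] by blast
   ultimately have "psi (- m + n (m + g)) = 1" using h(2) e by simp
   moreover have "psi (m + (- m + n (m + g))) = psi m * psi (- m + n (m + g))"
    using h(1) m \<open>- m + n (m + g) \<in> N\<close> unfolding unit_hom_def by blast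
   moreover have "m + (- m + n (m + g)) = n (m + g)" by (rule add_minus_cancel)
   ultimately show ?thesis by (simp only: mult_1_right)
  qed
  have "psi (n (k + l)) = psi (n k) * psi (n l)" if kl: "k \<in> K" "l \<in> K" for k l
  proof -
   obtain g where g: "g \<in> Gam" "k = n k + g" using n(2)[OF kl(1)] by blast
   obtain g' where g': "g' \<in> Gam" "l = n l + g'" using n(2)[OF kl(2)] by blast
   have gl: "g + n l - g \<in> N" by (rule normal[OF GK[OF g(1)] n(1)[OF kl(2)]])
   have "k + l = (n k + (g + n l - g)) + (g + g')"
    by (subst g(2), subst g'(2)) (simp only: group_simps)
   hence "psi (n (k + l)) = psi (n k + (g + n l - g))"
    using wd[OF subgrpD(2)[OF N(1) n(1)[OF kl(1)] gl] subgrpD(2)[OF Gam(1) g(1) g'(1)]] by simp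
   also have "... = psi (n k) * psi (g + n l - g)" using h(1) n(1)[OF kl(1)] gl by (simp add: unit_hom_def)
   also have "psi (g + n l - g) = psi (n l)" using vchar_conj[OF h(3) GK[OF g(1)]] n(1)[OF kl(2)] by simp
   finally show ?thesis .
  qed
  thus ?thesis using wd h(1) n(1) by (auto simp: unit_hom_def)
 qed
 define c1 c2 where "c1 k = psi1 (n k)" and "c2 k = psi2 (n k)" for k
 have hom: "unit_hom K c1" "unit_hom K c2" and wd: "!!m g. m \<in> N ==> g \<in> Gam ==> c1 (m + g) = psi1 m & c2 (m + g) = psi2 m"
  using ext[OF psi(1)] ext[OF psi(2)] by (auto simp: c1_def[abs_def] c2_def[abs_def])
 have cN: "c1 m = psi1 m & c2 m = psi2 m" if "m \<in> N" for m using wd[OF that subgrpD(1)[OF Gam(1)]] by simp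
 have p0: "psi1 0 = 1" "psi2 0 = 1" using unit_hom_simps(1)[OF _ N(1)] psi by (auto simp: gchar_def vchar_def)
 have cGam: "c1 g = 1 & c2 g = 1" if "g \<in> Gam" for g using wd[OF subgrpD(1)[OF N(1)] that] p0 by simp
 have Fz: "F z = c1 (fst z) * c2 (snd z) * F 0" if z: "z \<in> K2" for z
 proof -
  obtain g where g: "g \<in> Gam" "fst z = n (fst z) + g" using n(2) z by (metis mem_Times_iff)
  obtain g' where g': "g' \<in> Gam" "snd z = n (snd z) + g'" using n(2) z by (metis mem_Times_iff)
  have m: "(n (fst z), n (snd z)) \<in> Lc 0 \<times> Lc 0" using n(1) z by auto
  have "z = (n (fst z), n (snd z)) + 0 + (g, g')" using g g' by (simp add: plus_prod_def prod_eq_iff)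
  moreover have "F ((n (fst z), n (snd z)) + 0 + (g, g')) = F ((n (fst z), n (snd z)) + 0)"
   by (rule pgood_Gam[OF F(1)]) (use g g' LL_KK[OF m] in auto)
  moreover have "... = psi1 (n (fst z)) * psi2 (n (snd z)) * F 0"
   using vertD[OF F(2) m subgrpD(1)[OF KK]] by simp
  ultimately show ?thesis by (simp add: c1_def c2_def)
 qed
 have Fk: "F (k + z) = c1 (fst k) * c2 (snd k) * F z" if k: "k \<in> K2" and z: "z \<in> K2" for k z
  using Fz[OF subgrpD(2)[OF KK k z]] Fz[OF z] hom k z by (auto simp: unit_hom_def)
 have c0: "c1 0 = 1" "c2 0 = 1" using unit_hom_simps(1)[OF _ K] hom by auto
 have ct: "\<exists>d>0. \<forall>v\<in>K. nu v < d --> norm (c1 v - 1) < e & norm (c2 v - 1) < e" if "e > 0" for e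
 proof -
  have "e * norm (F 0) > 0" using that F0 by simp
  then obtain d where d: "d > 0" "!!v z. v \<in> K2 ==> z \<in> K2 ==> nu (fst v) < d ==> nu (snd v) < d ==> norm (F (v + z) - F z) < e * norm (F 0)"
   by (rule pgood_uc[OF F(1)]) blast
  have "norm (c1 v - 1) < e & norm (c2 v - 1) < e" if v: "v \<in> K" "nu v < d" for v
  proof -
   have m: "(v, 0) \<in> K2" "(0, v) \<in> K2" "0 \<in> K2" using v subgrpD(1)[OF K] subgrpD(1)[OF KK] by auto
   have "norm ((c1 v - 1) * F 0) < e * norm (F 0)" "norm ((c2 v - 1) * F 0) < e * norm (F 0)"
    using d(2)[OF m(1,3)] d(2)[OF m(2,3)] Fk[OF m(1,3)] Fk[OF m(2,3)] v(2) d(1) nu_zero c0 by (auto simp: left_diff_distrib)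
   thus ?thesis using F0 by (simp add: norm_mult)
  qed
  thus ?thesis using d(1) by blast
 qed
 hence "cont K c1" "cont K c2" unfolding cont_def by meson+
 with hom cN cGam Fk show ?thesis by (intro that)
qed

end

context nil_core
begin

text \<open>If \<open>F 0\<close> is not 0, \<open>F\<close> is a constant times a product of
  characters of \<open>K\<close>, and the average is a geometric sum with ratio
  \<open>theta\<close>. If \<open>theta\<close> were 1, \<open>terminal\<close> would make the
  combined character trivial at \<open>y\<close>.\<close>

lemma vertical_mean_base:
 assumes F: "pgood F" "vert 0 psi1 psi2 F" and psi: "gchar 0 psi1" "gchar 0 psi2"
  and y: "y \<in> N" "psi1 y ^ p * psi2 y ^ q ~= 1"
 shows "uzero (nmul p a, nmul q a) F"
proof (cases "F 0 = 0")
 case True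
 have "F z = 0" if z: "z \<in> K2" for z
 proof -
  obtain n g where 1: "n \<in> N" "g \<in> Gam" "fst z = n + g" using K_eq[of "fst z"] z by auto
  obtain n' g' where 2: "n' \<in> N" "g' \<in> Gam" "snd z = n' + g'" using K_eq[of "snd z"] z by auto
  have m: "(n, n') \<in> Lc 0 \<times> Lc 0" using 1 2 by auto
  have "z = (n, n') + 0 + (g, g')" using 1 2 by (simp add: plus_prod_def prod_eq_iff)
  moreover have "F ((n, n') + 0 + (g, g')) = F ((n, n') + 0)"
   by (rule pgood_Gam[OF F(1)]) (use 1 2 LL_KK[OF m] in auto)
  ultimately show ?thesis using vertD[OF F(2) m subgrpD(1)[OF KK]] True by simp
 qed
 thus ?thesis by (rule uzero_zero) (use nmul_mem[OF K a] in auto)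
next
 case False
 obtain c1 c2 where c: "unit_hom K c1" "unit_hom K c2" "!!n. n \<in> N ==> c1 n = psi1 n & c2 n = psi2 n"
  "!!g. g \<in> Gam ==> c1 g = 1 & c2 g = 1" "cont K c1" "cont K c2"
  "!!k z. k \<in> K2 ==> z \<in> K2 ==> F (k + z) = c1 (fst k) * c2 (snd k) * F z"
  by (rule vertical_base[OF F psi False]) blast
 define theta where "theta = c1 a ^ p * c2 a ^ q"
 have n1: "norm (c1 v) = 1" "norm (c2 v) = 1" if "v \<in> K" for v using c(1,2) that by (auto simp: unit_hom_def)
 have "cont K (\<lambda>v. c1 v ^ p * c2 v ^ q)"
  by (rule cont_mult[OF cont_power[OF c(5)] cont_power[OF c(6)]]) (simp_all add: n1 norm_power)
 hence ct: "\<exists>d>0. \<forall>v\<in>K. nu v < d --> norm (c1 v ^ p * c2 v ^ q - 1) < e" if "e > 0" for e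
  using that unfolding cont_def by blast
 have "theta ~= 1"
 proof
  assume "theta = 1"
  have "c1 y ^ p * c2 y ^ q = 1"
   by (rule terminal[of "\<lambda>v. c1 v ^ p * c2 v ^ q", OF _ ct])
    (use c(1,2,4) y(1) \<open>theta = 1\<close> in "auto simp: theta_def unit_hom_def norm_mult norm_power power_mult_distrib")
  thus False using y c(3) by simp
 qed
 have theta1: "norm theta = 1" by (simp add: theta_def norm_mult norm_power n1[OF a])
 obtain B where B: "B >= 0" "!!z. z \<in> K2 ==> norm (F z) <= B" by (rule pgoodD[OF F(1)]) blast
 define b where "b = (nmul p a, nmul q a)"
 have b: "b \<in> K2" using nmul_mem[OF K a] by (simp add: b_def)
 have Fi: "F (nmul i b + z) = theta ^ i * F z" if z: "z \<in> K2" for i z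
  using c(7)[OF nmul_mem[OF KK b] z, of i] unit_hom_simps(2)[OF c(1) K] unit_hom_simps(2)[OF c(2) K] nmul_mem[OF K a] a
  by (simp add: nmul_prod[of i] b_def theta_def power_mult_distrib)
 have bound: "norm (av b F n z) <= 2 / norm (theta - 1) * B / real n" if z: "z \<in> K2" for z n
 proof -
  have "(\<Sum>i=1..n. theta ^ i) = theta * (\<Sum>i<n. theta ^ i)"
   unfolding sum_distrib_left by (rule sum.reindex_bij_witness[of _ Suc "\<lambda>i. i - 1"]) (auto simp flip: power_Suc)
  hence "norm (\<Sum>i=1..n. theta ^ i) <= 2 / norm (theta - 1)"
   using norm_geometric_sum_le[OF theta1 \<open>theta ~= 1\<close>] theta1 by (simp add: norm_mult)
  hence "norm (\<Sum>i=1..n. theta ^ i) * norm (F z) <= 2 / norm (theta - 1) * B"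
   by (intro mult_mono B(2)[OF z]) auto
  hence "norm (\<Sum>i=1..n. theta ^ i) * norm (F z) / real n <= 2 / norm (theta - 1) * B / real n" by (intro divide_right_mono) auto
  thus ?thesis by (simp add: cesaro_def Fi[OF z] norm_divide norm_mult flip: sum_distrib_right)
 qed
 show ?thesis
  unfolding uzero_def b_def[symmetric]
 proof (intro allI impI)
  fix e :: real assume e: "e > 0"
  have "(\<lambda>n. 2 / norm (theta - 1) * B / real n) \<longlonglongrightarrow> 0" by (rule lim_const_over_n)
  hence "\<forall>\<^sub>F n in sequentially. 2 / norm (theta - 1) * B / real n < e" using e by (rule order_tendstoD)
  thus "ev_small b F e"
  proof eventually_elim
   case (elim n) thus ?case using bound[of _ n] less_imp_le order_trans by blast
  qed
 qed
qed

text \<open>Consecutive levels: a function invariant under level \<open>j + 1\<close> decomposes into vertical functions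
 of level \<open>j\<close>; those that do not average out are fixed by the translations below.\<close>

lemma level_invariance:
 assumes IH: "!!F psi1 psi2 y. pgood F ==> gchar j psi1 ==> gchar j psi2 ==> vert j psi1 psi2 F ==> y \<in> Lc j ==>
   psi1 y ^ P * psi2 y ^ Q ~= 1 ==> uzero b F"
  and b: "b \<in> K2" and \<Phi>: "pgood \<Phi>" "linv (Suc j) \<Phi>" and u: "u \<in> Lc j"
 shows "uzero b (\<lambda>z. \<Phi> ((nmul P u, nmul Q u) + z) - \<Phi> z)"
proof (rule uzero_approx[OF b])
 fix e :: real assume e: "e > 0"
 define w where "w = (nmul P u, nmul Q u)"
 have w: "w \<in> L2 j" using nmul_mem[OF Lc_subgrp u] by (simp add: w_def)
 obtain I :: "nat set" and psi1 psi2 G where I: "finite I" "!!z. z \<in> K2 ==> norm (\<Phi> z - (\<Sum>i\<in>I. G i z)) <= e / 2"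
  "!!i. i \<in> I ==> pgood (G i) & gchar j (psi1 i) & gchar j (psi2 i) & vert j (psi1 i) (psi2 i) (G i)"
  using vertical_decomposition[OF \<Phi>, of "e/2"] e by (metis half_gt_zero)
 define k where "k i = psi1 i u ^ P * psi2 i u ^ Q" for i
 have Gw: "G i (w + z) = k i * G i z" if "i \<in> I" "z \<in> K2" for i z
  using vertD[OF _ w that(2)] I(3)[OF that(1)] unit_hom_simps(2)[OF _ Lc_subgrp u]
  by (auto simp: w_def k_def gchar_def vchar_def)
 have "uzero b (\<lambda>z. \<Sum>i\<in>I. (k i - 1) * G i z)"
 proof (rule uzero_sum[OF I(1) b])
  fix i assume i: "i \<in> I"
  show "uzero b (\<lambda>z. (k i - 1) * G i z)"
  proof (cases "k i = 1")
   case True show ?thesis by (rule uzero_zero[OF _ b]) (simp add: True)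
  next
   case False
   hence "uzero b (G i)" using IH[of "G i" "psi1 i" "psi2 i" u] I(3)[OF i] u by (simp add: k_def)
   thus ?thesis by (rule uzero_cmult)
  qed
 qed
 moreover have "norm ((\<Phi> (w + z) - \<Phi> z) - (\<Sum>i\<in>I. (k i - 1) * G i z)) <= e" if z: "z \<in> K2" for z
 proof -
  have "(\<Phi> (w + z) - \<Phi> z) - (\<Sum>i\<in>I. (k i - 1) * G i z) = (\<Phi> (w + z) - (\<Sum>i\<in>I. G i (w + z))) - (\<Phi> z - (\<Sum>i\<in>I. G i z))"
   using Gw z by (simp add: left_diff_distrib sum_subtractf)
  also have "norm ... <= e / 2 + e / 2"
   by (intro order_trans[OF norm_triangle_ineq4] add_mono I(2) z subgrpD(2)[OF KK LL_KK[OF w]])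
  finally show ?thesis by simp
 qed
 ultimately show "\<exists>G. uzero b G & (\<forall>z\<in>K2. norm (\<Phi> ((nmul P u, nmul Q u) + z) - \<Phi> z - G z) <= e)"
  unfolding w_def by blast
qed

lemma gchar_com_nmul:
 assumes psi: "gchar (Suc j) psi" and u: "u \<in> Lc j"
 shows "psi (com (nmul x a) (nmul y u)) = psi (com a u) ^ (x * y)"
proof -
 have v: "vchar (Suc j) psi" using psi by (simp add: gchar_def)
 have "unit_hom K (\<lambda>g. psi (com g u'))" if "u' \<in> Lc j" for u'
  using vchar_com[OF v] that unfolding unit_hom_def by blast
 from unit_hom_simps(2)[OF this[OF nmul_mem[OF Lc_subgrp u]] K a]
 have "psi (com (nmul x a) (nmul y u)) = psi (com a (nmul y u)) ^ x" .
 also have "unit_hom (Lc j) (\<lambda>u. psi (com a u))" using vchar_com[OF v] a unfolding unit_hom_def by blast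
 from unit_hom_simps(2)[OF this Lc_subgrp u]
 have "psi (com a (nmul y u)) = psi (com a u) ^ y" .
 finally show ?thesis by (simp add: power_mult[symmetric] mult.commute)
qed

text \<open>Characters of level \<open>j\<close> are invariant under conjugation by
  \<open>b\<close>, so a translation by \<open>y\<close> multiplies both factors by the same unit
  number, which the conjugation cancels.\<close>

lemma derivative_linv:
 assumes v: "vert j psi1 psi2 F" and psi: "gchar j psi1" "gchar j psi2" and b: "b \<in> K2"
 shows "linv j (\<lambda>z. F (b + z) * cnj (F z))"
 unfolding linv_def
proof (intro ballI)
 fix y z assume y: "y \<in> L2 j" and z: "z \<in> K2"
 have "psi1 (fst (b + y - b)) = psi1 (fst y)" "psi2 (snd (b + y - b)) = psi2 (snd y)"
  using vchar_conj[of j psi1 "fst b" "fst y"] vchar_conj[of j psi2 "snd b" "snd y"] psi b y by (auto simp: gchar_def)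
 moreover have "b + (y + z) = (b + y - b) + (b + z)" by (simp only: group_simps)
 ultimately have 1: "F (b + (y + z)) = psi1 (fst y) * psi2 (snd y) * F (b + z)"
  using vertD[OF v LL_conj[OF b y] subgrpD(2)[OF KK b z]] by simp
 have "norm (psi1 (fst y) * psi2 (snd y)) = 1" using gchar_norm psi y by (auto simp: norm_mult)
 from unit_mult_cnj[OF this] have "(k * A) * cnj (k * B) = A * cnj B" if "k = psi1 (fst y) * psi2 (snd y)" for k A B
  unfolding that complex_cnj_mult by (metis (no_types, lifting) mult.assoc mult.left_commute mult.right_neutral)
 from this[OF refl] show "F (b + (y + z)) * cnj (F (y + z)) = F (b + z) * cnj (F z)"
  unfolding 1 vertD[OF v y z] .
qed

text \<open>Moving \<open>w\<close> past \<open>nmul d b\<close> produces a commutator of level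
  \<open>Suc j\<close>, where multiplicativity in both entries reduces the characters to powers of
  their values at \<open>com a u\<close>.\<close>

lemma derivative_twist:
 fixes p q x y :: nat
 assumes v: "vert (Suc j) psi1 psi2 F" and psi: "gchar (Suc j) psi1" "gchar (Suc j) psi2" and u: "u \<in> Lc j" and z: "z \<in> K2"
 defines "b \<equiv> (nmul p a, nmul q a)" and "w \<equiv> (nmul x u, nmul y u)"
 shows "F (nmul d b + (w + z)) = psi1 (com a u) ^ (d * p * x) * psi2 (com a u) ^ (d * q * y) * F (w + (nmul d b + z))"
proof -
 have b: "b \<in> K2" using nmul_mem[OF K a] by (simp add: b_def)
 have w: "w \<in> L2 j" using nmul_mem[OF Lc_subgrp u] by (simp add: w_def)
 have "nmul d b + (w + z) = com (nmul d b) w + (w + (nmul d b + z))"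
  by (simp only: com_def group_simps)
 moreover have "F (com (nmul d b) w + (w + (nmul d b + z))) =
   psi1 (fst (com (nmul d b) w)) * psi2 (snd (com (nmul d b) w)) * F (w + (nmul d b + z))"
  by (rule vertD[OF v LL_com[OF nmul_mem[OF KK b] w] subgrpD(2)[OF KK LL_KK[OF w] subgrpD(2)[OF KK nmul_mem[OF KK b] z]]])
 moreover have "com (nmul d b) w = (com (nmul (d * p) a) (nmul x u), com (nmul (d * q) a) (nmul y u))"
  by (simp add: com_def nmul_prod[of d] b_def w_def nmul_mult)
 ultimately show ?thesis using gchar_com_nmul[OF psi(1) u, of "d * p" x] gchar_com_nmul[OF psi(2) u, of "d * q" y] by simp
qed

end

context nil_core
begin

text \<open>By \<open>level_invariance\<close> the translations \<open>w m\<close> do not change the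
  averages of the derivative \<open>D\<close> in the limit. Yet each multiplies \<open>D\<close> by
  \<open>theta ^ (d * m)\<close> up to \<open>2 * B * eta\<close>, since \<open>F\<close> hardly
  changes under \<open>w m\<close>. Averaging over \<open>m < M\<close> replaces \<open>D\<close> by
  \<open>sigma * D\<close>.\<close>

lemma derivative_mean:
 fixes p q :: nat
 defines "b \<equiv> (nmul p a, nmul q a)"
 assumes IH: "!!F psi1 psi2 y. pgood F ==> gchar j psi1 ==> gchar j psi2 ==> vert j psi1 psi2 F ==> y \<in> Lc j ==>
   psi1 y ^ P * psi2 y ^ Q ~= 1 ==> uzero b F"
  and F: "pgood F" "vert (Suc j) psi1 psi2 F" and psi: "gchar (Suc j) psi1" "gchar (Suc j) psi2"
  and B: "B >= 0" "!!z. z \<in> K2 ==> norm (F z) <= B" and u: "u \<in> Lc j" and M: "M >= 1" and eta: "eta > 0"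
  and near: "!!m z. m < M ==> z \<in> K2 ==> norm (F ((nmul (P * m) u, nmul (Q * m) u) + z) - F z) <= eta"
 defines "theta \<equiv> psi1 (com a u) ^ (p * P) * psi2 (com a u) ^ (q * Q)"
 shows "\<forall>\<^sub>F n in sequentially. \<forall>z\<in>K2. norm (cesaro (\<lambda>i. F (nmul d b + (nmul i b + z)) * cnj (F (nmul i b + z))) n)
  <= B\<^sup>2 * norm ((\<Sum>m<M. theta ^ (d * m)) / of_nat M) + (2 * B + 1) * eta"
proof -
 have b: "b \<in> K2" using nmul_mem[OF K a] by (simp add: b_def)
 define D where "D z = F (nmul d b + z) * cnj (F z)" for z
 define w where "w m = (nmul (P * m) u, nmul (Q * m) u)" for m
 define sigma where "sigma = (\<Sum>m<M. theta ^ (d * m)) / of_nat M"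
 have w: "w m \<in> K2" for m using nmul_mem[OF K Lc_K[OF u]] by (simp add: w_def)
 have Db: "nmul d b \<in> K2" by (rule nmul_mem[OF KK b])
 have D: "pgood D" "linv (Suc j) D"
  unfolding D_def[abs_def] by (rule pgood_mult_cnj[OF pgood_shift[OF F(1) Db] F(1)], rule derivative_linv[OF F(2) psi Db])
 have "theta ^ k = psi1 (com a u) ^ (p * P * k) * psi2 (com a u) ^ (q * Q * k)" for k
  by (simp add: theta_def power_mult power_mult_distrib)
 hence twist: "F (nmul d b + (w m + z)) = theta ^ (d * m) * F (w m + (nmul d b + z))" if "z \<in> K2" for m z
  using derivative_twist[OF F(2) psi u that, of d p q "P * m" "Q * m"] by (simp add: b_def w_def mult_ac)
 have c1: "norm (psi1 (com a u)) = 1" "norm (psi2 (com a u)) = 1" using gchar_norm psi com_Lc[OF a u] by auto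
 hence theta1: "norm (theta ^ k) = 1" for k by (simp add: theta_def norm_mult norm_power)
 have Dw: "norm (D (w m + z) - theta ^ (d * m) * D z) <= 2 * B * eta" if m: "m < M" and z: "z \<in> K2" for m z
 proof -
  have zz: "nmul d b + z \<in> K2" "w m + (nmul d b + z) \<in> K2" "w m + z \<in> K2" using subgrpD(2)[OF KK] w Db z by metis+
  define x y x' y' where "x = F (w m + (nmul d b + z))" and "y = F (w m + z)" and "x' = F (nmul d b + z)" and "y' = F z"
  have n: "norm (x - x') <= eta" "norm (y - y') <= eta" "norm x <= B" "norm y' <= B"
   using near[OF m zz(1)] near[OF m z] B(2) zz z by (simp_all add: x_def y_def x'_def y'_def w_def)
  have "D (w m + z) - theta ^ (d * m) * D z = theta ^ (d * m) * (x * cnj (y - y') + (x - x') * cnj y')"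
   unfolding D_def twist[OF z] x_def y_def x'_def y'_def by (simp add: algebra_simps)
  also have "norm ... = norm (x * cnj (y - y') + (x - x') * cnj y')" unfolding norm_mult theta1 by simp
  also have "... <= norm (x * cnj (y - y')) + norm ((x - x') * cnj y')" by (rule norm_triangle_ineq)
  also have "... <= B * eta + eta * B"
   unfolding norm_mult complex_mod_cnj using n B(1) eta by (intro add_mono mult_mono) auto
  finally show ?thesis by simp
 qed
 define E where "E z = (\<Sum>m<M. D (w m + z) - D z) / of_nat M" for z
 have uE: "uzero b E"
 proof -
  have "uzero b (\<lambda>z. D (w m + z) - D z)" for m
   using level_invariance[where P = P and Q = Q and u = "nmul m u", OF IH b D nmul_mem[OF Lc_subgrp u]] by (simp add: w_def nmul_mult)
  hence "uzero b (\<lambda>z. \<Sum>m<M. D (w m + z) - D z)" by (intro uzero_sum b) auto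
  from uzero_cmult[OF this, of "1 / of_nat M"] show ?thesis by (simp add: E_def[abs_def])
 qed
 have DE: "norm (D z + E z) <= B\<^sup>2 * norm sigma + 2 * B * eta" if z: "z \<in> K2" for z
 proof -
  have M0: "of_nat M ~= (0 :: complex)" using M by simp
  have "D z + E z = (\<Sum>m<M. D (w m + z)) / of_nat M"
   using M0 by (simp add: E_def sum_subtractf diff_divide_distrib)
  also have "... = sigma * D z + (\<Sum>m<M. D (w m + z) - theta ^ (d * m) * D z) / of_nat M"
   by (simp add: sigma_def sum_subtractf diff_divide_distrib sum_distrib_right)
  also have "norm ... <= norm (sigma * D z) + norm ((\<Sum>m<M. D (w m + z) - theta ^ (d * m) * D z) / of_nat M)"
   by (rule norm_triangle_ineq)
  also have "... <= B\<^sup>2 * norm sigma + 2 * B * eta"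
  proof (rule add_mono)
   have "norm (F (nmul d b + z)) * norm (F z) <= B * B"
    using B(2)[OF subgrpD(2)[OF KK Db z]] B(2)[OF z] B(1) by (intro mult_mono) auto
   hence "norm (D z) * norm sigma <= B\<^sup>2 * norm sigma" by (intro mult_right_mono) (auto simp: D_def norm_mult power2_eq_square)
   thus "norm (sigma * D z) <= B\<^sup>2 * norm sigma" by (simp add: norm_mult mult.commute)
   have "norm (\<Sum>m<M. D (w m + z) - theta ^ (d * m) * D z) <= of_nat (card {..<M}) * (2 * B * eta)"
    by (rule sum_norm_bound) (use Dw z in auto)
   thus "norm ((\<Sum>m<M. D (w m + z) - theta ^ (d * m) * D z) / of_nat M) <= 2 * B * eta"
    using M by (simp add: norm_divide divide_le_eq mult.commute)
  qed
  finally show ?thesis .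
 qed
 have "ev_small b E eta" using uE eta unfolding uzero_def by blast
 hence "\<forall>\<^sub>F n in sequentially. \<forall>z\<in>K2. norm (av b D n z) <= B\<^sup>2 * norm sigma + (2 * B + 1) * eta"
 proof eventually_elim
  case (elim n)
  show ?case
  proof
   fix z assume z: "z \<in> K2"
   have bz: "nmul i b + z \<in> K2" for i by (rule subgrpD(2)[OF KK nmul_mem[OF KK b] z])
   have "norm (cesaro (\<lambda>i. D (nmul i b + z) + E (nmul i b + z)) n) <= B\<^sup>2 * norm sigma + 2 * B * eta"
    using DE[OF bz] B(1) eta by (intro norm_cesaro_le) auto
   moreover have "norm (av b E n z) <= eta" using elim z by blast
   ultimately show "norm (av b D n z) <= B\<^sup>2 * norm sigma + (2 * B + 1) * eta"
    unfolding cesaro_add using norm_diff_ineq[of "av b D n z" "av b E n z"]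
    by (simp add: algebra_simps)
  qed
 qed
 thus ?thesis by (simp add: D_def sigma_def)
qed

text \<open>Van der Corput reduces the claim to the mean of \<open>sigma d\<close> over
  \<open>d\<close>. Some small \<open>u\<close> has \<open>theta = \<chi>' (com a u)\<close>
  different from 1 but so close to it that no power below \<open>M\<close> returns to 1, and then
  \<open>average_powers_small\<close> applies. The commutator with \<open>a\<close> is what raises
  the exponents \<open>P\<close>, \<open>Q\<close> to \<open>p * P\<close>,
  \<open>q * Q\<close>.\<close>

lemma vertical_mean_step:
 fixes p q :: nat
 defines "b \<equiv> (nmul p a, nmul q a)"
 assumes IH: "!!F psi1 psi2 y. pgood F ==> gchar j psi1 ==> gchar j psi2 ==> vert j psi1 psi2 F ==> y \<in> Lc j ==>
   psi1 y ^ P * psi2 y ^ Q ~= 1 ==> uzero b F"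
  and F: "pgood F" and psi: "gchar (Suc j) psi1" "gchar (Suc j) psi2" and v: "vert (Suc j) psi1 psi2 F"
  and y: "y \<in> Lc (Suc j)" "psi1 y ^ (p * P) * psi2 y ^ (q * Q) ~= 1"
 shows "uzero b F"
 unfolding uzero_def
proof (intro allI impI)
 fix e :: real assume e: "e > 0"
 have b: "b \<in> K2" using nmul_mem[OF K a] by (simp add: b_def)
 obtain B where B: "B >= 0" "!!z. z \<in> K2 ==> norm (F z) <= B" by (rule pgoodD[OF F]) blast
 define \<chi>' where "\<chi>' y = psi1 y ^ (p * P) * psi2 y ^ (q * Q)" for y
 have \<chi>': "gchar (Suc j) \<chi>'" unfolding \<chi>'_def[abs_def] by (rule gchar_powers[OF psi])
 have vc: "vchar (Suc j) \<chi>'" using \<chi>' by (simp add: gchar_def)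
 obtain u0 where u0: "u0 \<in> Lc j" "\<chi>' (com a u0) ~= 1"
  using vchar_nontrivial_com[OF vc, of y] \<chi>' y by (auto simp: gchar_def \<chi>'_def)
 \<comment> \<open>\<open>s\<close> balances the inequality
   \<open>sigma d <= 1 / (2 * s) + s * (sigma d)^2 / 2\<close>; with \<open>M = s * s\<close> both
   parts contribute order \<open>1 / s\<close> on average.\<close>
 define s where "s = nat \<lceil>16 * B^2 / e^2\<rceil> + 1"
 have s: "s >= 1" "4 * B^2 / real s <= e\<^sup>2 / 4"
 proof -
  have "16 * B^2 / e^2 <= real s" unfolding s_def by linarith
  hence "16 * B^2 <= real s * e^2" using e by (simp add: divide_le_eq)
  moreover show "s >= 1" by (simp add: s_def)
  ultimately show "4 * B^2 / real s <= e\<^sup>2 / 4" by (simp add: divide_le_eq mult.commute)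
 qed
 define M where "M = s * s"
 have M: "M >= 1" "real M > 0" using s by (simp_all add: M_def)
 define eta where "eta = e^2 / (16 * (2 * B + 1))"
 have eta: "eta > 0" "(2 * B + 1) * eta = e^2 / 16"
 proof -
  have "c * (x / (16 * c)) = x / 16" if "c ~= 0" for c x :: real using that by simp
  thus "(2 * B + 1) * eta = e^2 / 16" unfolding eta_def by this (use B(1) in linarith)
  show "eta > 0" using e B(1) by (simp add: eta_def)
 qed
 obtain d1 where d1: "d1 > 0" "!!v z. v \<in> K2 ==> z \<in> K2 ==> nu (fst v) < d1 ==> nu (snd v) < d1 ==> norm (F (v + z) - F z) < eta"
  by (rule pgood_uc[OF F eta(1)]) blast
 obtain d2 where d2: "d2 > 0" "!!u k. u \<in> K ==> nu u < d2 ==> k <= (P + Q) * M ==> nu (nmul k u) < d1"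
  using small_nmul_le[OF d1(1), of "(P + Q) * M"] by blast
 \<comment> \<open>This is the radius at which \<open>root_of_unity_gap\<close> keeps the powers of
   \<open>theta\<close> below \<open>M\<close> away from 1.\<close>
 have M3: "3 / (4 * real M) > 0" using M by simp
 then obtain d3 where d3: "d3 > 0" "!!v. v \<in> Lc (Suc j) ==> nu v < d3 ==> norm (\<chi>' v - 1) < 3 / (4 * real M)"
  using \<chi>' unfolding gchar_def cont_def by blast
 obtain d4 where d4: "d4 > 0" "!!u. u \<in> K ==> nu u < d4 ==> nu (com a u) < d3" using small_com_right[OF d3(1) a] by blast
 have "\<exists>u\<in>Lc j. nu u < min d2 d4 & \<chi>' (com a u) ~= 1"
  using vchar_trivial_if_small[OF vchar_dch[OF vc a], of "min d2 d4" u0] d2(1) d4(1) u0 by auto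
 then obtain u where u: "u \<in> Lc j" "nu u < d2" "nu u < d4" "\<chi>' (com a u) ~= 1" by auto
 define theta where "theta = \<chi>' (com a u)"
 have theta1: "norm theta = 1" unfolding theta_def by (rule gchar_norm[OF \<chi>' com_Lc[OF a u(1)]])
 have "norm (theta - 1) < 3 / (4 * real M)" unfolding theta_def using d3(2)[OF com_Lc[OF a u(1)] d4(2)[OF Lc_K[OF u(1)] u(3)]] .
 hence gap: "real M * norm (theta - 1) <= 3 / 4" using M(2) by (simp add: field_simps)
 have thetak: "theta ^ k ~= 1" if "1 <= k" "k < M" for k
 proof
  assume "theta ^ k = 1"
  moreover have "real k * norm (theta - 1) <= real M * norm (theta - 1)" using that by (intro mult_right_mono) auto
  ultimately have "theta = 1" using root_of_unity_gap[of theta k] theta1 that gap by linarith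
  thus False using u(4) by (simp add: theta_def)
 qed
 obtain H0 where H0: "!!H. H >= H0 ==> (\<Sum>d<H. (norm ((\<Sum>m<M. theta ^ (d * m)) / of_nat M))^2) <= 2 * real H / real M"
  using average_powers_small[OF theta1 thetak M(1)] by blast
 define sigma where "sigma d = norm ((\<Sum>m<M. theta ^ (d * m)) / of_nat M)" for d
 define H where "H = max H0 (nat \<lceil>4 * B^2 / e^2\<rceil> + 1)"
 have H: "H >= 1" "H >= H0" "B^2 / real H <= e\<^sup>2 / 4"
 proof -
  have "4 * B^2 / e^2 <= real H" unfolding H_def by linarith
  hence "4 * B^2 <= real H * e^2" using e by (simp add: divide_le_eq)
  moreover show "H >= 1" by (simp add: H_def)
  ultimately show "B^2 / real H <= e\<^sup>2 / 4" by (simp add: divide_le_eq mult.commute)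
 qed (simp add: H_def)
 have near: "norm (F ((nmul (P * m) u, nmul (Q * m) u) + z) - F z) <= eta" if m: "m < M" and z: "z \<in> K2" for m z
 proof -
  have uK: "u \<in> K" by (rule Lc_K[OF u(1)])
  have "P * m <= (P + Q) * M" "Q * m <= (P + Q) * M" using m by (intro mult_le_mono; simp)+
  hence "nu (nmul (P * m) u) < d1" "nu (nmul (Q * m) u) < d1" using d2(2)[OF uK u(2)] by blast+
  thus ?thesis using d1(2)[of "(nmul (P * m) u, nmul (Q * m) u)" z] z nmul_mem[OF K uK] by (simp add: less_imp_le)
 qed
 have der: "\<forall>\<^sub>F n in sequentially. \<forall>z\<in>K2. norm (cesaro (\<lambda>i. F (nmul d b + (nmul i b + z)) * cnj (F (nmul i b + z))) n)
   <= B\<^sup>2 * sigma d + e^2 / 16" for d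
  using derivative_mean[where p = p and q = q and P = P and Q = Q and d = d, OF IH[unfolded b_def] F v psi B u(1) M(1) eta(1) near]
  unfolding eta(2) sigma_def theta_def \<chi>'_def b_def .
 have "(\<Sum>d=1..<H. B^2 * sigma d + e^2 / 16) <= (\<Sum>d<H. B^2 * (1 / (2 * real s) + real s * (sigma d)^2 / 2) + e^2 / 16)"
 proof -
  have "sigma d <= 1 / (2 * real s) + real s * (sigma d)^2 / 2" for d
  proof -
   have "0 <= (1 - real s * sigma d)\<^sup>2 / (2 * real s)" by simp
   also have "... = 1 / (2 * real s) + real s * (sigma d)^2 / 2 - sigma d"
    using s(1) by (simp add: power2_eq_square field_simps)
   finally show ?thesis by simp
  qed
  hence "(\<Sum>d=1..<H. B^2 * sigma d + e^2 / 16) <= (\<Sum>d=1..<H. B^2 * (1 / (2 * real s) + real s * (sigma d)^2 / 2) + e^2 / 16)"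
   by (intro sum_mono add_mono mult_left_mono) auto
  also have "... <= (\<Sum>d<H. B^2 * (1 / (2 * real s) + real s * (sigma d)^2 / 2) + e^2 / 16)"
   by (intro sum_mono2) auto
  finally show ?thesis .
 qed
 also have "... = real H * (B^2 / (2 * real s)) + B^2 * real s / 2 * (\<Sum>d<H. (sigma d)^2) + real H * (e^2 / 16)"
  by (simp add: sum.distrib distrib_left sum_distrib_left mult.assoc)
 also have "... <= real H * (B^2 / (2 * real s)) + B^2 * real s / 2 * (2 * real H / real M) + real H * (e^2 / 16)"
  using H0[OF H(2)] by (intro add_mono mult_left_mono) (auto simp: sigma_def)
 also have "... = real H * (3 * B^2 / (2 * real s) + e^2 / 16)" using s(1) by (simp add: M_def field_simps)
 finally have sum: "2 / real H * (\<Sum>d=1..<H. B^2 * sigma d + e^2 / 16) <= 2 / real H * (real H * (3 * B^2 / (2 * real s) + e^2 / 16))"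
  by (intro mult_left_mono) auto
 have "2 / real H * (real H * (3 * B^2 / (2 * real s) + e^2 / 16)) = 3 * B^2 / real s + e^2 / 8" using H(1) by simp
 moreover have "3 * B^2 / real s <= 4 * B^2 / real s" by (intro divide_right_mono) auto
 moreover have "x + t + z / 8 <= z" if "r = k + z / 8" "k <= l" "t <= r" "x <= z / 4" "l <= z / 4" "0 <= z" for x t z r k l :: real
  using that by linarith
 ultimately have fin: "B^2 / real H + 2 / real H * (\<Sum>d=1..<H. B^2 * sigma d + e^2 / 16) + e^2 / 8 <= e\<^sup>2"
  using sum H(3) s(2) zero_le_power2[of e] by blast
 have "\<forall>\<^sub>F n in sequentially. \<forall>z\<in>K2. (norm (av b F n z))^2 <=
   B\<^sup>2 / real H + 2 / real H * (\<Sum>d=1..<H. B^2 * sigma d + e^2 / 16) + e^2 / 8"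
 proof (rule van_der_corput_uniform)
  show "norm (F (nmul i b + z)) <= B" if "z \<in> K2" for z i by (rule B(2)[OF subgrpD(2)[OF KK nmul_mem[OF KK b] that]])
  show "\<forall>\<^sub>F N in sequentially. \<forall>z\<in>K2. norm (cesaro (\<lambda>n. F (nmul (n + d) b + z) * cnj (F (nmul n b + z))) N) <= B\<^sup>2 * sigma d + e^2 / 16" for d
   using der[of d] by (simp add: nmul_add[of d, symmetric] add.commute[of _ d] flip: add.assoc)
 qed (use H e in auto)
 thus "ev_small b F e"
 proof eventually_elim
  case (elim n)
  show ?case
  proof
   fix z assume "z \<in> K2"
   hence "(norm (av b F n z))^2 <= e\<^sup>2" using elim fin order_trans by blast
   thus "norm (av b F n z) <= e" using e by (simp add: power2_le_iff_abs_le)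
  qed
 qed
qed

theorem vertical_mean_zero:
 assumes "pgood F" "gchar j psi1" "gchar j psi2" "vert j psi1 psi2 F" "y \<in> Lc j" "psi1 y ^ p ^ Suc j * psi2 y ^ q ^ Suc j ~= 1"
 shows "uzero (nmul p a, nmul q a) F"
 using assms
proof (induction j arbitrary: F psi1 psi2 y)
 case 0 thus ?case using vertical_mean_base[of F psi1 psi2 y p q] by simp
next
 case (Suc j)
 show ?case
  by (rule vertical_mean_step[where P = "p ^ Suc j" and Q = "q ^ Suc j", OF Suc.IH Suc.prems(1-5)])
   (use Suc.prems(6) in simp_all)
qed

end

text \<open>The shifts \<open>s\<close> and \<open>t\<close> prepare for the restriction to residue
  classes, where dilates of the index become affine functions.\<close>

definition oscillating :: "(nat => complex) => bool" where
 "oscillating u \<equiv> (\<exists>B. \<forall>n. norm (u n) <= B) & (\<forall>p q s t. p ~= q --> p >= 1 --> q >= 1 -->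
   (cesaro (\<lambda>n. u (p * n + s) * cnj (u (q * n + t))) \<longlonglongrightarrow> 0))"

inductive oscillating_sum :: "(nat => complex) => bool" where
 const: "oscillating_sum (\<lambda>_. c)"
| base: "oscillating u ==> oscillating_sum u"
| add: "oscillating_sum u ==> oscillating_sum v ==> oscillating_sum (\<lambda>n. u n + v n)"

section \<open>Orbits as limits of sums of constants and oscillating sequences\<close>

context nil_core
begin

definition approximable :: "('g => complex) => bool" where
 "approximable f \<equiv> (\<forall>e>0. \<exists>w. oscillating_sum w & (\<forall>n. norm (f (nmul n a) - w n) <= e))"

lemma approximable_add: "approximable f ==> approximable g ==> approximable (\<lambda>x. f x + g x)"
 unfolding approximable_def
proof (intro allI impI)
 fix e :: real
 assume f: "\<forall>e>0. \<exists>w. oscillating_sum w & (\<forall>n. norm (f (nmul n a) - w n) <= e)"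
  and g: "\<forall>e>0. \<exists>w. oscillating_sum w & (\<forall>n. norm (g (nmul n a) - w n) <= e)" and "e > 0"
 hence "e / 2 > 0" by simp
 with f g obtain v w where w: "oscillating_sum v" "oscillating_sum w"
  "!!n. norm (f (nmul n a) - v n) <= e / 2" "!!n. norm (g (nmul n a) - w n) <= e / 2" by meson
 have "norm ((f (nmul n a) + g (nmul n a)) - (v n + w n)) <= e" for n
  using w(3,4)[of n] norm_diff_triangle_ineq[of "f (nmul n a)" "g (nmul n a)" "v n" "w n"] by linarith
 thus "\<exists>w. oscillating_sum w & (\<forall>n. norm ((f (nmul n a) + g (nmul n a)) - w n) <= e)" using oscillating_sum.add[OF w(1,2)] by blast
qed

lemma approximable_sum:
 "finite I ==> (!!i. i \<in> I ==> approximable (f i)) ==> approximable (\<lambda>x. \<Sum>i\<in>I. f i x)"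
proof (induction I rule: finite_induct)
 case empty
 show ?case unfolding approximable_def by (auto intro!: exI[of _ "\<lambda>_. 0"] oscillating_sum.const)
qed (auto intro: approximable_add)

lemma approximable_approx:
 assumes "!!e. e > 0 ==> \<exists>g. approximable g & (\<forall>x\<in>K. norm (f x - g x) <= e)"
 shows "approximable f"
 unfolding approximable_def
proof (intro allI impI)
 fix e :: real assume "e > 0"
 hence e2: "e / 2 > 0" by simp
 obtain g where g: "approximable g" "!!x. x \<in> K ==> norm (f x - g x) <= e / 2" using assms[OF e2] by blast
 obtain w where w: "oscillating_sum w" "!!n. norm (g (nmul n a) - w n) <= e / 2" using g(1) e2 unfolding approximable_def by blast
 have "norm (f (nmul n a) - w n) <= e" for n
  using g(2)[OF nmul_mem[OF K a]] w(2)[of n] norm_triangle_ineq[of "f (nmul n a) - g (nmul n a)" "g (nmul n a) - w n"] by (smt (verit) diff_add_cancel add_diff_eq field_sum_of_halves)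
 thus "\<exists>w. oscillating_sum w & (\<forall>n. norm (f (nmul n a) - w n) <= e)" using w(1) by blast
qed

lemma pgood_coordinate:
 assumes "pgood (\<lambda>z. f (fst z))" shows "pgood (\<lambda>z. f (snd z))"
 unfolding pgood_def
proof (intro conjI allI impI ballI)
 obtain B where B: "B >= 0" "!!z. z \<in> K2 ==> norm (f (fst z)) <= B"
  "!!z gamma. z \<in> K2 ==> gamma \<in> G2 ==> f (fst (z + gamma)) = f (fst z)" by (rule pgoodD[OF assms]) blast
 have sw: "z \<in> A \<times> A ==> prod.swap z \<in> A \<times> A" for z :: "'g \<times> 'g" and A by auto
 show "\<exists>B. \<forall>z\<in>K2. norm (f (snd z)) <= B" using B(2)[OF sw] by (intro exI[of _ B]) auto
 show "f (snd (z + gamma)) = f (snd z)" if "z \<in> K2" "gamma \<in> G2" for z gamma using B(3)[OF sw[OF that(1)] sw[OF that(2)]] by simp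
 fix e :: real assume "e > 0"
 then obtain d where d: "d > 0" "!!v z. v \<in> K2 ==> z \<in> K2 ==> nu (fst v) < d ==> nu (snd v) < d ==> norm (f (fst (v + z)) - f (fst z)) < e"
  by (rule pgood_uc[OF assms]) blast
 show "\<exists>d>0. \<forall>v\<in>K2. \<forall>z\<in>K2. nu (fst v) < d --> nu (snd v) < d --> norm (f (snd (v + z)) - f (snd z)) < e"
 proof (intro exI[of _ d] conjI ballI impI d(1))
  fix v z assume "v \<in> K2" "z \<in> K2" "nu (fst v) < d" "nu (snd v) < d"
  thus "norm (f (snd (v + z)) - f (snd z)) < e" using d(2)[OF sw sw, of v z] by simp
 qed
qed

lemma pgood_section:
 assumes "pgood G" shows "pgood (\<lambda>z. G (fst z, 0))"
 unfolding pgood_def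
proof (intro conjI allI impI ballI)
 obtain B where B: "B >= 0" "!!z. z \<in> K2 ==> norm (G z) <= B"
  "!!z gamma. z \<in> K2 ==> gamma \<in> G2 ==> G (z + gamma) = G z" by (rule pgoodD[OF assms]) blast
 have s: "(fst z, 0) \<in> K2" if "z \<in> K2" for z :: "'g \<times> 'g" using that subgrpD(1)[OF K] by auto
 have sGam: "(fst z, 0) \<in> G2" if "z \<in> G2" for z :: "'g \<times> 'g" using that subgrpD(1)[OF Gam(1)] by auto
 show "\<exists>B. \<forall>z\<in>K2. norm (G (fst z, 0)) <= B" using B(2)[OF s] by blast
 show "G (fst (z + gamma), 0) = G (fst z, 0)" if "z \<in> K2" "gamma \<in> G2" for z gamma
  using B(3)[OF s[OF that(1)] sGam[OF that(2)]] by (simp add: plus_prod_def)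
 fix e :: real assume "e > 0"
 then obtain d where d: "d > 0" "!!v z. v \<in> K2 ==> z \<in> K2 ==> nu (fst v) < d ==> nu (snd v) < d ==> norm (G (v + z) - G z) < e"
  by (rule pgood_uc[OF assms]) blast
 show "\<exists>d>0. \<forall>v\<in>K2. \<forall>z\<in>K2. nu (fst v) < d --> nu (snd v) < d --> norm (G (fst (v + z), 0) - G (fst z, 0)) < e"
 proof (intro exI[of _ d] conjI ballI impI d(1))
  fix v z assume vz: "v \<in> K2" "z \<in> K2" "nu (fst v) < d"
  thus "norm (G (fst (v + z), 0) - G (fst z, 0)) < e" using d(2)[OF s[OF vz(1)] s[OF vz(2)]] d(1) nu_zero by (simp add: plus_prod_def)
 qed
qed

text \<open>On \<open>K2\<close> the product of \<open>f\<close> with a conjugated copy has the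
  characters \<open>psi\<close> and its conjugate. The obstruction in
  \<open>vertical_mean_zero\<close> is then a power of \<open>psi\<close> whose exponent is, up to
  sign, \<open>p ^ Suc j - q ^ Suc j\<close>, and \<open>vchar_torsion_free\<close> excludes that it
  is trivial.\<close>

lemma vertical_oscillating:
 assumes f: "pgood (\<lambda>z. f (fst z))" and psi: "gchar j psi" and v: "!!y x. y \<in> Lc j ==> x \<in> K ==> f (y + x) = psi y * f x"
  and y: "y \<in> Lc j" "psi y ~= 1"
 shows "oscillating (\<lambda>n. f (nmul n a))"
 unfolding oscillating_def
proof (intro conjI allI impI)
 obtain B where "!!z. z \<in> K2 ==> norm (f (fst z)) <= B" by (rule pgoodD[OF f]) blast
 thus "\<exists>B. \<forall>n. norm (f (nmul n a)) <= B" using nmul_mem[OF K a] by (metis fst_conv mem_Sigma_iff)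
 fix p q s t assume pq: "p ~= (q :: nat)" "p >= 1" "q >= 1"
 define x x' where "x = nmul s a" and "x' = nmul t a"
 have x: "x \<in> K" "x' \<in> K" using nmul_mem[OF K a] by (auto simp: x_def x'_def)
 have c: "gchar j (\<lambda>y. cnj (psi y))"
 proof -
  have "cont (Lc j) (\<lambda>y. cnj (psi y))" using psi unfolding gchar_def cont_def by (metis complex_cnj_diff complex_cnj_one complex_mod_cnj)
  thus ?thesis using psi by (auto simp: gchar_def vchar_def unit_hom_def)
 qed
 have "\<exists>y\<in>Lc j. psi y ^ p ^ Suc j * cnj (psi y) ^ q ^ Suc j ~= 1"
 proof (rule ccontr)
  assume "\<not> ?thesis"
  hence 1: "psi y ^ p ^ Suc j * cnj (psi y) ^ q ^ Suc j = 1" if "y \<in> Lc j" for y using that by blast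
  define m n where "m = min (p ^ Suc j) (q ^ Suc j)" and "n = max (p ^ Suc j) (q ^ Suc j)"
  have "p ^ Suc j ~= q ^ Suc j" using pq power_eq_imp_eq_base[of p "Suc j" q] by auto
  hence mn: "m < n" by (auto simp: m_def n_def)
  have "psi y ^ (n - m) = 1" if y: "y \<in> Lc j" for y
  proof -
   have u: "psi y * cnj (psi y) = 1" by (rule unit_mult_cnj[OF gchar_norm[OF psi y]])
   have "psi y ^ q ^ Suc j = (psi y ^ p ^ Suc j * cnj (psi y) ^ q ^ Suc j) * psi y ^ q ^ Suc j" using 1[OF y] by simp
   also have "... = psi y ^ p ^ Suc j * (psi y * cnj (psi y)) ^ q ^ Suc j" by (simp only: power_mult_distrib mult_ac)
   finally have "psi y ^ q ^ Suc j = psi y ^ p ^ Suc j" using u by simp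
   hence "psi y ^ n = psi y ^ m" by (auto simp: m_def n_def max_def min_def)
   moreover have "psi y ^ n = psi y ^ (n - m) * psi y ^ m" using mn by (simp flip: power_add)
   moreover have "psi y ~= 0" using u by auto
   ultimately show ?thesis by simp
  qed
  moreover have "n - m >= 1" using mn by linarith
  ultimately show False using vchar_torsion_free[of j psi "n - m" y] psi y unfolding gchar_def by blast
 qed
 then obtain y where y: "y \<in> Lc j" "psi y ^ p ^ Suc j * cnj (psi y) ^ q ^ Suc j ~= 1" by blast
 define F where "F z = f (fst z) * cnj (f (snd z))" for z
 have "pgood F" unfolding F_def[abs_def] by (rule pgood_mult_cnj[OF f pgood_coordinate[OF f]])
 moreover have "vert j psi (\<lambda>y. cnj (psi y)) F" unfolding vert_def F_def using v by (auto simp: mult_ac)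
 ultimately have uz: "uzero (nmul p a, nmul q a) F" by (rule vertical_mean_zero[OF _ psi c _ y])
 have eq: "F (nmul n (nmul p a, nmul q a) + (x, x')) = f (nmul (p * n) a + x) * cnj (f (nmul (q * n) a + x'))" for n
  by (simp add: F_def nmul_prod[of n] mult.commute[of _ n] nmul_mult)
 show "cesaro (\<lambda>n. f (nmul (p * n + s) a) * cnj (f (nmul (q * n + t) a))) \<longlonglongrightarrow> 0"
  unfolding tendsto_iff nmul_add x_def[symmetric] x'_def[symmetric]
 proof (intro allI impI)
  fix e :: real assume "e > 0"
  hence "\<forall>\<^sub>F n in sequentially. \<forall>z\<in>K2. norm (cesaro (\<lambda>i. F (nmul i (nmul p a, nmul q a) + z)) n) <= e / 2"
   using uz half_gt_zero unfolding uzero_def by blast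
  thus "\<forall>\<^sub>F n in sequentially. dist (cesaro (\<lambda>n. f (nmul (p * n) a + x) * cnj (f (nmul (q * n) a + x'))) n) 0 < e"
  proof eventually_elim
   case (elim n)
   hence "norm (cesaro (\<lambda>i. F (nmul i (nmul p a, nmul q a) + (x, x'))) n) <= e / 2" using x by blast
   thus ?case using \<open>e > 0\<close> by (simp add: eq)
  qed
 qed
qed

text \<open>A component with nontrivial character oscillates; one with trivial character is
  invariant under the larger group \<open>Lc j\<close>, where induction applies. Invariance under
  \<open>N\<close> and \<open>Gam\<close> finally leaves a constant. A function of one variable is
  treated as one of the first coordinate, with the second set to 0 in the components.\<close>

lemma level_approximable:
 assumes "pgood (\<lambda>z. f (fst z))" "linv j (\<lambda>z. f (fst z))"
 shows "approximable f"
 using assms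
proof (induction j arbitrary: f)
 case 0
 have "f x = f 0" if x: "x \<in> K" for x
 proof -
  obtain n g where n: "n \<in> N" "g \<in> Gam" "x = n + g" using K_eq[OF x] by blast
  have g: "(g, 0) \<in> G2" "(g, 0) \<in> K2" using n Gam subgrpD(1)[OF Gam(1)] by auto
  have "(n, 0) \<in> Lc 0 \<times> Lc 0" using n subgrpD(1)[OF N(1)] by auto
  from linvD[OF 0(2) this g(2)] have "f x = f g" by (simp add: n)
  also have "... = f 0" using pgood_Gam[OF 0(1) subgrpD(1)[OF KK] g(1)] by simp
  finally show ?thesis .
 qed
 thus ?case unfolding approximable_def using oscillating_sum.const nmul_mem[OF K a] by (metis diff_self less_imp_le norm_zero)
next
 case (Suc j)
 show ?case
 proof (rule approximable_approx)
  fix e :: real assume e: "e > 0"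
  obtain I :: "nat set" and psi1 psi2 G where I: "finite I" "!!z. z \<in> K2 ==> norm (f (fst z) - (\<Sum>i\<in>I. G i z)) <= e"
   "!!i. i \<in> I ==> pgood (G i) & gchar j (psi1 i) & gchar j (psi2 i) & vert j (psi1 i) (psi2 i) (G i)"
   using vertical_decomposition[OF Suc.prems e] by metis
  have z0: "0 \<in> K" "0 \<in> Lc j" using subgrpD(1) K Lc_subgrp by blast+
  have "approximable (\<lambda>x. G i (x, 0))" if i: "i \<in> I" for i
  proof -
   have good: "pgood (\<lambda>z. G i (fst z, 0))" using pgood_section I(3)[OF i] by blast
   have v: "G i (y + x, 0) = psi1 i y * G i (x, 0)" if yx: "y \<in> Lc j" "x \<in> K" for y x
   proof -
    have "psi2 i 0 = 1" using I(3)[OF i] unit_hom_simps(1)[OF _ Lc_subgrp] by (auto simp: gchar_def vchar_def)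
    thus ?thesis using vertD[of j "psi1 i" "psi2 i" "G i" "(y, 0)" "(x, 0)"] I(3)[OF i] yx z0 by (simp add: plus_prod_def)
   qed
   show ?thesis
   proof (cases "\<forall>y\<in>Lc j. psi1 i y = 1")
    case True
    thus ?thesis using v by (intro Suc.IH good) (auto simp: linv_def)
   next
    case False
    hence "oscillating (\<lambda>n. G i (nmul n a, 0))" using vertical_oscillating[OF good, of j "psi1 i"] I(3)[OF i] v by blast
    from oscillating_sum.base[OF this] show ?thesis unfolding approximable_def by (metis diff_self less_imp_le norm_zero)
   qed
  qed
  from approximable_sum[OF I(1) this] have "approximable (\<lambda>x. \<Sum>i\<in>I. G i (x, 0))" .
  moreover have "norm (f x - (\<Sum>i\<in>I. G i (x, 0))) <= e" if "x \<in> K" for x using I(2)[of "(x, 0)"] that z0 by simp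
  ultimately show "\<exists>g. approximable g & (\<forall>x\<in>K. norm (f x - g x) <= e)" by blast
 qed
qed

theorem oscillating_approximation:
 assumes "Lc s = {0}" "pgood (\<lambda>z. f (fst z))"
 shows "approximable f"
 by (rule level_approximable[OF assms(2), of s]) (auto simp: linv_def assms(1))

end

section \<open>Groups with square roots near the identity\<close>

lemma no_small_powers_root:
 fixes z :: complex
 assumes "z * z = 1" "norm (z - 1) < 1" shows "z = 1"
 using assms by (auto simp: square_eq_1_iff)

text \<open>The powers have real part at least \<open>1/2\<close>, so the geometric sum has modulus
  at least \<open>n / 2\<close>.\<close>

lemma norm_power_diff_one_ge:
 fixes z :: complex
 assumes "!!i. i < n ==> norm (z ^ i - 1) <= 1/2" "n >= 1"
 shows "norm (z - 1) / 2 <= norm (z ^ n - 1)"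
proof -
 have "1 / 2 <= Re (z ^ i)" if "i < n" for i
  using assms(1)[OF that] abs_Re_le_cmod[of "z ^ i - 1"] by simp
 hence "real n * (1/2) <= (\<Sum>i<n. Re (z ^ i))" using sum_bounded_below[of "{..<n}" "1/2" "\<lambda>i. Re (z ^ i)"] by simp
 also have "... <= norm (\<Sum>i<n. z ^ i)" using complex_Re_le_cmod[of "\<Sum>i<n. z ^ i"] by simp
 finally have "1 / 2 <= norm (\<Sum>i<n. z ^ i)" using assms(2) by linarith
 hence "norm (z - 1) * (1/2) <= norm (z - 1) * norm (\<Sum>i<n. z ^ i)" by (intro mult_left_mono) auto
 also have "... = norm (z ^ n - 1)" by (simp add: power_diff_1_eq norm_mult)
 finally show ?thesis by simp
qed

text \<open>\<open>nu\<close> will be the distance to the identity in a chart, hence only locally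
  and almost subadditive. The factors \<open>9/8\<close> and \<open>2/3\<close> are matched so that
  iterated square roots stay under control, and \<open>packing\<close> is the form in which the
  dimension is used.\<close>

locale root_norm =
 fixes nu :: "'g::group_add => real" and G :: "'g set" and r0 :: real and D :: nat
 assumes G: "subgrp G" and r0: "r0 > 0" and nu_zero: "nu 0 = 0" and nu_nonneg: "nu x >= 0"
  and nu_add: "x \<in> G ==> y \<in> G ==> nu x < r0 ==> nu y < r0 ==> nu (x + y) <= 9/8 * (nu x + nu y)"
  and nu_minus: "x \<in> G ==> nu x < r0 ==> nu (- x) <= 2 * nu x"
  and nu_conj: "e > 0 ==> g \<in> G ==> \<exists>d>0. \<forall>u\<in>G. nu u < d --> nu (g + u - g) < e"
  and root: "x \<in> G ==> nu x < r0 ==> \<exists>r\<in>G. r + r = x & nu r <= 2/3 * nu x"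
  and packing: "\<exists>C. \<forall>rho W. 0 < rho --> rho <= 1 --> finite W --> W \<subseteq> G --> (\<forall>w\<in>W. nu w < r0) -->
   (\<forall>w\<in>W. \<forall>w'\<in>W. w ~= w' --> rho <= nu (- w + w')) --> real (card W) <= C * (1 / rho) ^ D"
begin

definition rooted :: "'g set => bool" where
 "rooted H \<equiv> subgrp H & H \<subseteq> G & (\<exists>d>0. \<forall>x\<in>H. nu x < d --> (\<exists>r\<in>H. r + r = x & nu r <= 2/3 * nu x))"

definition contin :: "'g set => ('g => complex) => bool" where
 "contin H c \<equiv> (\<forall>e>0. \<exists>d>0. \<forall>v\<in>H. nu v < d --> norm (c v - 1) < e)"

lemma iterated_roots:
 assumes H: "rooted H"
 shows "\<exists>d>0. \<forall>m. \<forall>x\<in>H. nu x < d --> (\<exists>r\<in>H. nmul (2 ^ m) r = x & (\<forall>B<2 ^ m. nu (nmul B r) <= 3 * nu x))"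
proof -
 obtain d where d: "d > 0" "!!x. x \<in> H ==> nu x < d ==> \<exists>r\<in>H. r + r = x & nu r <= 2/3 * nu x"
  using H unfolding rooted_def by blast
 have HG: "subgrp H" "H \<subseteq> G" using H by (auto simp: rooted_def)
 have "\<exists>r\<in>H. nmul (2 ^ m) r = x & (\<forall>B<2 ^ m. nu (nmul B r) <= 3 * nu x)" if "x \<in> H" "nu x < min d (r0 / 3)" for m x
  using that
 proof (induction m arbitrary: x)
  case 0 thus ?case by (intro bexI[of _ x]) (auto simp: nu_zero nu_nonneg)
 next
  case (Suc m)
  obtain s where s: "s \<in> H" "s + s = x" "nu s <= 2/3 * nu x" using d(2)[OF Suc.prems(1)] Suc.prems(2) by auto
  have sx: "nu s <= nu x" using s(3) nu_nonneg[of x] by linarith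
  obtain r where r: "r \<in> H" "nmul (2 ^ m) r = s" "!!B. B < 2 ^ m ==> nu (nmul B r) <= 3 * nu s"
   using Suc.IH[OF s(1)] sx Suc.prems(2) by auto
  have "nu (nmul B r) <= 3 * nu x" if B: "B < 2 ^ Suc m" for B
  proof (cases "B < 2 ^ m")
   case True thus ?thesis using r(3)[of B] sx by linarith
  next
   case False
   hence B': "B = 2 ^ m + (B - 2 ^ m)" "B - 2 ^ m < 2 ^ m" using B by auto
   have small: "nu s < r0" "nu (nmul (B - 2 ^ m) r) < r0" using r(3)[OF B'(2)] sx Suc.prems(2) nu_nonneg[of s] by auto
   have "nu (s + nmul (B - 2 ^ m) r) <= 9/8 * (nu s + nu (nmul (B - 2 ^ m) r))"
    by (rule nu_add[OF _ _ small]) (use s(1) HG(2) nmul_mem[OF HG(1) r(1)] in blast)+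
   \<comment> \<open>The constant 3 reproduces itself because
     \<open>9/8 * (2/3 + 3 * 2/3) = 3\<close>.\<close>
   also have "... <= 9/8 * (2/3 * nu x + 3 * (2/3 * nu x))" using r(3)[OF B'(2)] s(3) by (intro mult_left_mono) auto
   finally show ?thesis using B'(1) r(2) nmul_add[of "2 ^ m" "B - 2 ^ m" r] by simp
  qed
  moreover have "nmul (2 ^ Suc m) r = x" using s(2) r(2) by (simp add: mult_2 nmul_add)
  ultimately show ?case using r(1) by blast
 qed
 thus ?thesis using d(1) r0 by (intro exI[of _ "min d (r0 / 3)"]) auto
qed

text \<open>Doubling \<open>u\<close> enlarges \<open>nu\<close> by at most \<open>9/4 < 3\<close>,
  but moves \<open>c u\<close> away from 1 by a factor of at least \<open>3/2\<close>. So a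
  character is Hoelder continuous at 0.\<close>

lemma character_decay:
 assumes H: "subgrp H" "H \<subseteq> G" and c: "unit_hom H c" and d: "d <= r0" "!!v. v \<in> H ==> nu v < d ==> norm (c v - 1) <= 1/2"
  and u: "u \<in> H" "3 ^ n * nu u < d"
 shows "norm (c u - 1) <= (2/3) ^ n / 2"
 using u
proof (induction n arbitrary: u)
 case 0 thus ?case using d(2)[of u] by simp
next
 case (Suc n)
 have "nu u <= 3 ^ Suc n * nu u" using mult_right_mono[of 1 "3 ^ Suc n" "nu u"] nu_nonneg[of u] one_le_power[of "3 :: real" "Suc n"] by simp
 hence ud: "nu u < d" using Suc.prems by linarith
 hence "nu (u + u) <= 9/8 * (nu u + nu u)" using Suc.prems(1) H(2) d(1) by (intro nu_add) auto
 hence "3 ^ n * nu (u + u) <= 3 ^ n * (3 * nu u)" using nu_nonneg[of u] by (intro mult_left_mono) auto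
 also have "... < d" using Suc.prems(2) by (simp add: mult_ac)
 finally have "3 ^ n * nu (u + u) < d" .
 hence "norm (c (u + u) - 1) <= (2/3) ^ n / 2"
  by (rule Suc.IH[OF subgrpD(2)[OF H(1) Suc.prems(1) Suc.prems(1)]])
 moreover have "c (u + u) - 1 = (c u - 1) * (c u + 1)" using c Suc.prems(1) by (simp add: unit_hom_def algebra_simps)
 moreover have "3/2 <= norm (c u + 1)"
  using d(2)[OF Suc.prems(1) ud] norm_triangle_ineq2[of 2 "1 - c u"] norm_minus_commute[of "c u" 1] by (simp add: add.commute)
 hence "norm (c u - 1) * (3/2) <= norm (c u - 1) * norm (c u + 1)" by (intro mult_left_mono) auto
 ultimately show ?case by (simp add: norm_mult)
qed

text \<open>Indices increase from left to right: along a decreasing chain the leftmost factor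
  belongs to the largest group, and a character killing the next group sees this factor
  only.\<close>

primrec lprod :: "(nat => 'g) => nat => nat => 'g" where
 "lprod x i 0 = 0"
| "lprod x i (Suc n) = x i + lprod x (Suc i) n"

lemma lprod_small:
 assumes "e > 0"
 shows "\<exists>d>0. \<forall>i x. (\<forall>i. x i \<in> G & nu (x i) < d) --> nu (lprod x i n) < e"
 using assms
proof (induction n arbitrary: e)
 case 0 thus ?case by (auto simp: nu_zero intro: exI[of _ 1])
next
 case (Suc n)
 define e' where "e' = min r0 (e / 4)"
 have e': "e' > 0" "e' <= r0" "e' <= e / 4" using Suc.prems r0 by (auto simp: e'_def)
 obtain d where d: "d > 0" "!!i x. \<forall>i. x i \<in> G & nu (x i) < d ==> nu (lprod x i n) < e'" using Suc.IH[OF e'(1)] by blast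
 have "nu (lprod x i (Suc n)) < e" if x: "\<forall>i. x i \<in> G & nu (x i) < min d e'" for i x
 proof -
  have m: "lprod x i n \<in> G" for i n by (induction n arbitrary: i) (use x subgrpD[OF G] in auto)
  have "nu (x i) < e'" "nu (lprod x (Suc i) n) < e'" using x d(2)[of x "Suc i"] by auto
  moreover from this have "nu (x i + lprod x (Suc i) n) <= 9/8 * (nu (x i) + nu (lprod x (Suc i) n))"
   using x m e'(2) by (intro nu_add) (auto intro: less_le_trans)
  ultimately show ?thesis using e'(3) Suc.prems unfolding lprod.simps by argo
 qed
 thus ?case using d(1) e'(1) by (intro exI[of _ "min d e'"]) auto
qed

text \<open>A chain of \<open>S\<close> subgroups, each lying in the kernel of a character of the previous one, yields
 \<open>2\<^sup>m\<^sup>S\<close> points near \<open>0\<close>, products of powers of \<open>2\<^sup>m\<close>-th roots, whose mutual distances are at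
 least of order \<open>9\<^sup>-\<^sup>m\<close>; this contradicts the packing bound when \<open>S > 4 D\<close>.\<close>

lemma no_long_chain:
 assumes H: "!!i. rooted (H i)" and dec: "!!i. H (Suc i) \<subseteq> H i"
  and c: "!!i. unit_hom (H i) (c i)" "!!i. contin (H i) (c i)" "!!i x. x \<in> H (Suc i) ==> c i x = 1"
  and nontriv: "!!i e. e > 0 ==> \<exists>x\<in>H i. nu x < e & c i x ~= 1"
 shows False
proof -
 \<comment> \<open>With this \<open>S\<close> there are \<open>2 ^ m * 16 ^ (D * m)\<close> points,
   while packing allows only a constant times \<open>9 ^ (D * m)\<close>.\<close>
 define S where "S = 4 * D + 1"
 have HG: "subgrp (H i)" "H i \<subseteq> G" for i using H by (auto simp: rooted_def)
 have dec': "H j \<subseteq> H i" if "i <= j" for i j using lift_Suc_antimono_le[of H i j] dec that by auto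
 define R where "R i m x \<longleftrightarrow> (\<exists>r\<in>H i. nmul (2 ^ m) r = x & (\<forall>B<2 ^ m. nu (nmul B r) <= 3 * nu x))" for i m x
 have "\<exists>d>0. d <= r0 & (\<forall>i<S. \<forall>v\<in>H i. nu v < d --> norm (c i v - 1) <= 1/2 & (\<forall>m. R i m v))" for S
 proof (induction S)
  case 0 thus ?case using r0 by auto
 next
  case (Suc S)
  then obtain d where d: "d > 0" "d <= r0" "!!i v. i < S ==> v \<in> H i ==> nu v < d ==> norm (c i v - 1) <= 1/2 & (\<forall>m. R i m v)" by blast
  obtain d1 where d1: "d1 > 0" "!!v. v \<in> H S ==> nu v < d1 ==> norm (c S v - 1) < 1/2"
   using c(2)[of S] unfolding contin_def by (meson half_gt_zero zero_less_one)
  obtain d2 where d2: "d2 > 0" "!!m x. x \<in> H S ==> nu x < d2 ==> R S m x"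
   using iterated_roots[OF H, of S] unfolding R_def[symmetric] by blast
  have "norm (c i v - 1) <= 1/2 & (\<forall>m. R i m v)" if "i < Suc S" "v \<in> H i" "nu v < min d (min d1 d2)" for i v
  proof (cases "i = S")
   case True
   thus ?thesis using that d1(2)[of v] d2(2)[of v] by (simp add: less_imp_le)
  next
   case False
   thus ?thesis using that by (intro d(3)) auto
  qed
  moreover have "min d (min d1 d2) > 0" "min d (min d1 d2) <= r0" using d(1,2) d1(1) d2(1) by auto
  ultimately show ?case by blast
 qed
 from this[of S] obtain d where d: "d > 0" "d <= r0"
  and "\<forall>i<S. \<forall>v\<in>H i. nu v < d --> norm (c i v - 1) <= 1/2 & (\<forall>m. R i m v)" by (elim exE conjE)
 note d = d this(3)[rule_format, THEN conjunct1] and d' = this(3)[rule_format, THEN conjunct2, rule_format]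
 obtain e where e: "e > 0" "!!i x. \<forall>i. x i \<in> G & nu (x i) < e ==> nu (lprod x i S) < r0" using lprod_small[OF r0] by blast
 define t where "t = min d e / 4"
 have t: "t > 0" using d(1) e(1) by (simp add: t_def)
 have "\<exists>x. \<forall>i. x i \<in> H i & nu (x i) < t & c i (x i) ~= 1" using nontriv[OF t] by (intro choice) blast
 then obtain x where x: "!!i. x i \<in> H i" "!!i. nu (x i) < t" "!!i. c i (x i) ~= 1" by blast
 define kappa where "kappa = Min ((\<lambda>i. norm (c i (x i) - 1) / 2) ` {..<S})"
 have "kappa > 0" unfolding kappa_def by (subst Min_gr_iff) (use x(3) in "auto simp: S_def")
 moreover have "kappa <= norm (c i (x i) - 1) / 2" if "i < S" for i unfolding kappa_def using that by (intro Min_le) auto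
 ultimately have kappa: "kappa > 0" "!!i. i < S ==> kappa <= norm (c i (x i) - 1) / 2" by blast+
 \<comment> \<open>\<open>n0\<close> absorbs \<open>kappa\<close>: at \<open>2 * m + n0\<close>
   doublings the decay \<open>(2/3) ^ (2 * m + n0)\<close> falls below \<open>kappa / 2 ^ m\<close>,
   since \<open>(2/3)^2 < 1/2\<close>.\<close>
 obtain n0 where n0: "(2/3) ^ n0 < kappa" using real_arch_pow_inv[OF kappa(1), of "2/3"] by auto
 obtain C where C: "!!rho W. 0 < rho ==> rho <= 1 ==> finite W ==> W \<subseteq> G ==> (\<forall>w\<in>W. nu w < r0) ==>
   (\<forall>w\<in>W. \<forall>w'\<in>W. w ~= w' --> rho <= nu (- w + w')) ==> real (card W) <= C * (1 / rho) ^ D"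
  using packing by blast
 define d0 where "d0 = min d 1"
 have d0: "d0 > 0" "d0 <= 1" "d0 <= d" using d(1) by (auto simp: d0_def)
 have count: "2 ^ m <= C * (3 ^ n0 / d0) ^ D" for m
 proof -
  have "\<exists>r. i < S --> r \<in> H i & nmul (2 ^ m) r = x i & (\<forall>B<2 ^ m. nu (nmul B r) <= 3 * nu (x i))" for i
   using d'[of i "x i" m] x(1,2)[of i] t_def d(1) e(1) unfolding R_def by force
  then obtain r where r: "!!i. i < S ==> r i \<in> H i" "!!i. i < S ==> nmul (2 ^ m) (r i) = x i"
   "!!i B. i < S ==> B < 2 ^ m ==> nu (nmul B (r i)) <= 3 * nu (x i)" by metis
  have gap: "kappa / 2 ^ m <= norm (c i (r i) ^ B - 1)" if i: "i < S" and B: "1 <= B" "B < 2 ^ m" for i B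
  proof -
   have p: "c i (nmul B (r i)) = c i (r i) ^ B" for B by (rule unit_hom_simps(2)[OF c(1) HG(1) r(1)[OF i]])
   have "norm (c i (r i) ^ B' - 1) <= 1/2" if "B' < B" for B'
    unfolding p[symmetric]
    by (rule d(3)[OF i nmul_mem[OF HG(1) r(1)[OF i]]])
     (use r(3)[OF i, of B'] x(2)[of i] that B(2) t_def d(1) e(1) in linarith)
   from norm_power_diff_one_ge[OF this B(1)] have 1: "norm (c i (r i) - 1) / 2 <= norm (c i (r i) ^ B - 1)" by blast
   have "norm (c i (x i) - 1) <= real (2 ^ m) * norm (c i (r i) - 1)"
    using norm_power_diff_one[of "c i (r i)" "2 ^ m"] p[of "2 ^ m"] r(1,2)[OF i] c(1)[of i] by (simp add: unit_hom_def)
   hence "2 * kappa <= 2 ^ m * norm (c i (r i) - 1)" using kappa(2)[OF i] by simp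
   hence "kappa / 2 ^ m <= norm (c i (r i) - 1) / 2" by (simp add: field_simps)
   with 1 show ?thesis by linarith
  qed
  define y where "y B i = (if i < S then nmul (B i) (r i) else 0)" for B :: "nat => nat" and i
  define \<B> where "\<B> = PiE {..<S} (\<lambda>_. {..<2 ^ m :: nat})"
  have yH: "y B i \<in> H i" for B i using r(1) nmul_mem[OF HG(1)] subgrpD(1)[OF HG(1)] by (auto simp: y_def)
  have lH: "lprod (y B) i n \<in> H i" for B i n
  proof (induction n arbitrary: i)
   case (Suc n)
   have "lprod (y B) (Suc i) n \<in> H i" using Suc dec by blast
   thus ?case using subgrpD(2)[OF HG(1) yH] by simp
  qed (simp add: subgrpD(1)[OF HG(1)])
  define rho where "rho = d0 / 3 ^ (2 * m + n0)"
  \<comment> \<open>Equal leading factors cancel. At the first difference \<open>c i\<close> ignores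
    the later factors, which lie in \<open>H (Suc i)\<close>, and \<open>gap\<close> tells the two
    powers of \<open>r i\<close> apart; \<open>character_decay\<close> turns this into a
    distance.\<close>
  have sep: "rho <= nu (- lprod (y B) i n + lprod (y B') i n)"
   if B: "B \<in> \<B>" "B' \<in> \<B>" and "i + n <= S" "\<exists>j. i <= j & j < i + n & B j ~= B' j" for B B' i n
   using that(3,4)
  proof (induction n arbitrary: i)
   case (Suc n)
   let ?Q = "lprod (y B) (Suc i) n" and ?Q' = "lprod (y B') (Suc i) n"
   have i: "i < S" using Suc.prems by simp
   show ?case
   proof (cases "B i = B' i")
    case True
    hence "- lprod (y B) i (Suc n) + lprod (y B') i (Suc n) = - ?Q + ?Q'"
     by (simp only: y_def lprod.simps True group_simps)
    moreover have "\<exists>j. Suc i <= j & j < Suc i + n & B j ~= B' j"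
     using Suc.prems(2) True by (metis Suc_leI add_Suc_shift le_neq_implies_less)
    ultimately show ?thesis using Suc.IH[of "Suc i"] Suc.prems(1) by simp
   next
    case False
    define u where "u = - lprod (y B) i (Suc n) + lprod (y B') i (Suc n)"
    have u: "u \<in> H i" unfolding u_def by (intro subgrpD(2,3)[OF HG(1)] lH)
    have uu: "lprod (y B) i (Suc n) + u = lprod (y B') i (Suc n)" unfolding u_def by (rule add_minus_cancel)
    have cl: "c i (lprod (y B) i (Suc n)) = c i (r i) ^ B i" for B
    proof -
     have "?thesis \<longleftrightarrow> c i (y B i) * c i (lprod (y B) (Suc i) n) = c i (r i) ^ B i"
      using c(1)[of i] yH[of B i] lH[of B "Suc i" n] dec[of i] by (auto simp: unit_hom_def)
     thus ?thesis using c(3)[OF lH] unit_hom_simps(2)[OF c(1) HG(1) r(1)[OF i]] i by (simp add: y_def)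
    qed
    have ci: "c i (r i) ^ B i * c i u = c i (r i) ^ B' i"
     using c(1)[of i] u lH[of B i "Suc n"] unfolding unit_hom_def cl[symmetric] by (metis uu)
    have n1: "norm (c i (r i)) = 1" "norm (c i u) = 1" using c(1)[of i] r(1)[OF i] u by (auto simp: unit_hom_def)
    have "kappa / 2 ^ m <= norm (c i u - 1)"
    proof -
     have *: "norm (c i u - 1) = norm (c i (r i) ^ B' i - c i (r i) ^ B i)"
     proof -
      have "c i (r i) ^ B' i - c i (r i) ^ B i = c i (r i) ^ B i * (c i u - 1)" unfolding ci[symmetric] by (simp add: algebra_simps)
      thus ?thesis using n1(1) by (simp add: norm_mult norm_power)
     qed
     have **: "norm (z ^ p - z ^ q) = norm (z ^ (p - q) - 1)" if "norm z = 1" "q < p" for z :: complex and p q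
     proof -
      have "z ^ p - z ^ q = z ^ q * (z ^ (p - q) - 1)" using that(2) by (simp add: right_diff_distrib flip: power_add)
      thus ?thesis using that(1) by (simp add: norm_mult norm_power)
     qed
     have lt: "B i < 2 ^ m" "B' i < 2 ^ m" using B i by (auto simp: \<B>_def)
     show ?thesis
     proof (cases "B i < B' i")
      case True thus ?thesis using gap[OF i, of "B' i - B i"] **[OF n1(1) True] * lt by simp
     next
      case False
      hence "B' i < B i" using \<open>B i ~= B' i\<close> by simp
      thus ?thesis using gap[OF i, of "B i - B' i"] **[OF n1(1), of "B' i" "B i"] * lt by (simp add: norm_minus_commute)
     qed
    qed
    moreover have "(2/3 :: real) ^ (2 * m + n0) / 2 < kappa / 2 ^ m"
    proof -
     have "(2/3 :: real) ^ (2 * m) <= (1/2) ^ m" unfolding power_mult by (intro power_mono) (auto simp: power2_eq_square)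
     hence "(2/3 :: real) ^ (2 * m) * (2/3) ^ n0 <= (1/2) ^ m * (2/3) ^ n0" by (intro mult_right_mono) auto
     also have "... < (1/2) ^ m * kappa" using n0 by (intro mult_strict_left_mono) auto
     finally have "(2/3 :: real) ^ (2 * m + n0) < kappa / 2 ^ m" by (simp add: power_add power_divide mult.commute)
     moreover have "0 <= (2/3 :: real) ^ (2 * m + n0)" by simp
     ultimately show ?thesis by linarith
    qed
    ultimately have "\<not> 3 ^ (2 * m + n0) * nu u < d"
     using character_decay[OF HG c(1) d(2) d(3)[OF i] u, of "2 * m + n0"] by fastforce
    hence "d0 <= nu u * 3 ^ (2 * m + n0)" using d0(3) by (simp add: mult.commute)
    thus ?thesis unfolding u_def[symmetric] rho_def by (simp add: pos_divide_le_eq)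
   qed
  qed (metis add_0_right leD)
  have rho: "rho > 0" "rho <= 1"
  proof -
   show "rho > 0" using d0 by (simp add: rho_def)
   have "1 <= (3 :: real) ^ (2 * m + n0)" by (rule one_le_power) simp
   hence "d0 <= 3 ^ (2 * m + n0)" using d0(2) by linarith
   thus "rho <= 1" unfolding rho_def by (simp add: pos_divide_le_eq)
  qed
  let ?w = "\<lambda>B. lprod (y B) 0 S"
  have diff: "\<exists>j. 0 <= j & j < 0 + S & B j ~= B' j" if "B \<in> \<B>" "B' \<in> \<B>" "B ~= B'" for B B'
   using PiE_ext[of B "{..<S}" _ B'] that unfolding \<B>_def by (metis add_0 lessThan_iff zero_le)
  have sep': "rho <= nu (- ?w B + ?w B')" if "B \<in> \<B>" "B' \<in> \<B>" "B ~= B'" for B B'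
   using sep[OF that(1,2), of 0 S] diff[OF that] by simp
  have inj: "inj_on ?w \<B>"
  proof (rule inj_onI, rule ccontr)
   fix B B' assume "B \<in> \<B>" "B' \<in> \<B>" "?w B = ?w B'" "B ~= B'"
   thus False using sep'[of B B'] rho(1) nu_zero by simp
  qed
  have "real (card (?w ` \<B>)) <= C * (1 / rho) ^ D"
  proof (rule C[OF rho])
   show "finite (?w ` \<B>)" by (auto simp: \<B>_def intro: finite_PiE)
   show "?w ` \<B> \<subseteq> G" using lH HG(2) by blast
   show "\<forall>w\<in>?w ` \<B>. nu w < r0"
   proof
    fix w assume "w \<in> ?w ` \<B>"
    then obtain B where B: "B \<in> \<B>" "w = ?w B" by blast
    have "y B i \<in> G & nu (y B i) < e" for i
    proof
     show "y B i \<in> G" using yH HG(2) by blast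
     have "nu (nmul (B i) (r i)) < e" if "i < S"
      using r(3)[OF that, of "B i"] x(2)[of i] B(1) that t_def e(1) d(1) by (force simp: \<B>_def PiE_iff)
     thus "nu (y B i) < e" using e(1) by (simp add: y_def nu_zero)
    qed
    thus "nu w < r0" using e(2)[of "y B"] B(2) by blast
   qed
   show "\<forall>w\<in>?w ` \<B>. \<forall>w'\<in>?w ` \<B>. w ~= w' --> rho <= nu (- w + w')" using sep' by blast
  qed
  also have "card (?w ` \<B>) = (2 ^ m) ^ S" using inj by (simp add: card_image \<B>_def card_PiE)
  also have "(1 / rho) ^ D = (3 ^ n0 / d0) ^ D * 9 ^ (D * m)"
  proof -
   have "1 / rho = 3 ^ n0 / d0 * 9 ^ m" by (simp add: rho_def power_add power_mult)
   thus ?thesis by (simp only: power_mult_distrib mult.commute[of D] power_mult)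
  qed
  finally have *: "real ((2 ^ m) ^ S) <= C * (3 ^ n0 / d0) ^ D * 9 ^ (D * m)" by simp
  have "real ((2 ^ m) ^ S) = 2 ^ m * 16 ^ (D * m)"
  proof -
   have "(2 ^ m) ^ S = 2 ^ (4 * (D * m)) * (2 ^ m :: real)" by (simp add: S_def algebra_simps flip: power_add power_mult)
   also have "2 ^ (4 * (D * m)) = (16 :: real) ^ (D * m)" by (simp add: power_mult)
   finally show ?thesis by simp
  qed
  with * have **: "2 ^ m * 16 ^ (D * m) <= C * (3 ^ n0 / d0) ^ D * 9 ^ (D * m)" by simp
  have "2 ^ m * 9 ^ (D * m) <= (2 ^ m * 16 ^ (D * m) :: real)" by (intro mult_left_mono power_mono) auto
  with ** have "2 ^ m * 9 ^ (D * m) <= C * (3 ^ n0 / d0) ^ D * 9 ^ (D * m)" by linarith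
  thus ?thesis by (simp only: mult_le_cancel_right_pos zero_less_power zero_less_numeral)
 qed
 obtain m where "C * (3 ^ n0 / d0) ^ D < 2 ^ m" using real_arch_pow[of 2] by fastforce
 with count[of m] show False by linarith
qed

end

section \<open>Cocompact subgroups and the descent to kernels of characters\<close>

locale cocompact_root_norm = root_norm +
 fixes Gam :: "'a set" and a :: 'a
 assumes Gam: "subgrp Gam" "Gam \<subseteq> G" and a: "a \<in> G"
  and cocompact: "d > 0 ==> \<exists>C. finite C & C \<subseteq> G & (\<forall>g\<in>G. \<exists>b\<in>G. \<exists>c\<in>C. \<exists>gamma\<in>Gam. nu b < d & g = b + c + gamma)"
begin

definition cocomp :: "'a set => bool" where
 "cocomp H \<equiv> (\<forall>d>0. \<exists>C. finite C & C \<subseteq> H & (\<forall>h\<in>H. \<exists>b\<in>H. \<exists>c\<in>C. \<exists>gamma\<in>Gam \<inter> H. nu b < d & h = b + c + gamma))"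

text \<open>\<open>nmul k a\<close> has to lie in \<open>H\<close> up to \<open>Gam\<close> so that
  the group \<open>ext H k\<close> generated by both is still \<open>H\<close> times a part of
  \<open>Gam\<close>, as \<open>K_eq\<close> in \<open>nil_core\<close> demands.\<close>

definition admissible :: "'a set => nat => bool" where
 "admissible H k \<equiv> rooted H & k >= 1 & (\<forall>h\<in>H. nmul k a + h - nmul k a \<in> H & - nmul k a + h + nmul k a \<in> H) &
   (\<exists>h\<in>H. \<exists>gamma\<in>Gam. nmul k a = h + gamma) & cocomp H"

definition ext :: "'a set => nat => 'a set" where
 "ext H k = gen (insert (nmul k a) H)"

lemma small_add: "e > 0 ==> \<exists>d>0. \<forall>u\<in>G. \<forall>v\<in>G. nu u < d --> nu v < d --> nu (u + v) < e"
 using r0 by (intro exI[of _ "min r0 (e / 4)"]) (auto intro!: le_less_trans[OF nu_add])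

lemma small_minus: "e > 0 ==> \<exists>d>0. \<forall>u\<in>G. nu u < d --> nu (- u) < e"
 using r0 by (intro exI[of _ "min r0 (e / 2)"]) (auto intro!: le_less_trans[OF nu_minus])

lemma small_diffs: 
 assumes "e > 0" shows "\<exists>d>0. \<forall>u\<in>G. \<forall>v\<in>G. nu u < d --> nu v < d --> nu (u - v) < e & nu (- u + v) < e"
proof -
 obtain d where d: "d > 0" "!!u v. u \<in> G ==> v \<in> G ==> nu u < d ==> nu v < d ==> nu (u + v) < e" using small_add[OF assms] by blast
 obtain d' where d': "d' > 0" "!!u. u \<in> G ==> nu u < d' ==> nu (- u) < d" using small_minus[OF d(1)] by blast
 have "nu (u + - v) < e & nu (- u + v) < e" if "u \<in> G" "v \<in> G" "nu u < min d d'" "nu v < min d d'" for u v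
  using that d(2)[of u "- v"] d(2)[of "- u" v] d'(2)[of u] d'(2)[of v] subgrpD(3)[OF G] by (simp del: add_uminus_conv_diff)
 thus ?thesis using d(1) d'(1) by (intro exI[of _ "min d d'"]) auto
qed

lemma ext_props:
 assumes "admissible H k"
 shows "subgrp (ext H k)" "ext H k \<subseteq> G" "H \<subseteq> ext H k" "nmul k a \<in> ext H k"
  "g \<in> ext H k ==> h \<in> H ==> g + h - g \<in> H"
proof -
 have H: "subgrp H" "H \<subseteq> G" using assms by (auto simp: admissible_def rooted_def)
 show "subgrp (ext H k)" "H \<subseteq> ext H k" "nmul k a \<in> ext H k" by (auto simp: ext_def subgrp_gen intro: gen_base)
 show "ext H k \<subseteq> G" unfolding ext_def by (rule gen_least[OF G]) (use H nmul_mem[OF G a] in auto)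
 define Z where "Z = {g. \<forall>h\<in>H. g + h - g \<in> H & - g + h + g \<in> H}"
 have "subgrp Z"
  unfolding subgrp_def
 proof (intro conjI ballI)
  show "0 \<in> Z" by (simp add: Z_def)
  show "- x \<in> Z" if "x \<in> Z" for x using that by (simp add: Z_def)
  fix x y assume xy: "x \<in> Z" "y \<in> Z"
  show "x + y \<in> Z" unfolding Z_def
  proof safe
   fix h assume h: "h \<in> H"
   have "x + (y + h - y) - x \<in> H" "- y + (- x + h + x) + y \<in> H" using xy h unfolding Z_def by blast+
   thus "x + y + h - (x + y) \<in> H" "- (x + y) + h + (x + y) \<in> H"
    by (simp_all only: group_simps)
  qed
 qed
 moreover have "insert (nmul k a) H \<subseteq> Z"
  using assms subgrpD[OF H(1)] by (auto simp: Z_def admissible_def)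
 ultimately have "ext H k \<subseteq> Z" unfolding ext_def by (rule gen_least)
 thus "g \<in> ext H k ==> h \<in> H ==> g + h - g \<in> H" by (auto simp: Z_def)
qed

text \<open>Passing to the identity component of the kernel of a character: cocompactness survives because
 two elements of the kernel whose decompositions share the same representative differ, up to
 \<open>Gam\<close>, by a small element of the kernel; for the same reason a power of \<open>a\<close> still lies in
 \<open>H' Gam\<close>.\<close>

lemma kernel_step:
 assumes H: "admissible H k" and c: "unit_hom (ext H k) c" "contin (ext H k) c"
  and cGam: "!!gamma. gamma \<in> Gam ==> gamma \<in> ext H k ==> c gamma = 1" and ca: "c (nmul k a) = 1"
 shows "\<exists>H' k'. admissible H' k' & (\<forall>d>0. H' \<subseteq> gen {h\<in>H'. nu h < d}) & H' \<subseteq> {h\<in>H. c h = 1}"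
proof -
 define K where "K = ext H k"
 have K: "subgrp K" "K \<subseteq> G" "H \<subseteq> K" and aK: "nmul k a \<in> K" and nH: "!!g h. g \<in> K ==> h \<in> H ==> g + h - g \<in> H"
  using ext_props[OF H] unfolding K_def by blast+
 have Hs: "subgrp H" "H \<subseteq> G" and k: "k >= 1" and cH: "cocomp H" using H by (auto simp: admissible_def rooted_def)
 have cadd: "c (x + y) = c x * c y" if "x \<in> K" "y \<in> K" for x y using c(1) that by (auto simp: unit_hom_def K_def)
 have cminus: "c (- x) * c x = 1" if "x \<in> K" for x
  using cadd[OF subgrpD(3)[OF K(1) that] that] unit_hom_simps(1)[OF c(1)] K(1) by (simp add: K_def)
 have ceq: "c (x - y) = 1 & c (- x + y) = 1" if "x \<in> K" "y \<in> K" "c x * w = 1" "c y * w = 1" for x y w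
 proof -
  have "c x = c y" using that(3,4) by (metis mult.commute mult.assoc mult_1_right)
  thus ?thesis using cadd[OF that(1) subgrpD(3)[OF K(1) that(2)]] cadd[OF subgrpD(3)[OF K(1) that(1)] that(2)]
   cminus[OF that(1)] cminus[OF that(2)] by (simp add: mult.commute)
 qed
 define H1 where "H1 = {h\<in>H. c h = 1}"
 have "unit_hom H c" using c(1) K(3) by (auto simp: unit_hom_def K_def)
 hence H1: "subgrp H1" "H1 \<subseteq> H" using unit_hom_kernel Hs(1) by (auto simp: H1_def)
 have n1: "g + h - g \<in> H1" if "g \<in> K" "h \<in> H1" for g h
 proof -
  have h: "h \<in> K" "h \<in> H" "c h = 1" using that K H1 by (auto simp: H1_def)
  have "c (g + h - g) = c g * c h * c (- g)"
   using cadd[OF subgrpD(2)[OF K(1) that(1) h(1)] subgrpD(3)[OF K(1) that(1)]] cadd[OF that(1) h(1)] by simp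
  thus ?thesis using nH[OF that(1) h(2)] h(3) cminus[OF that(1)] by (simp add: H1_def mult.commute)
 qed
 obtain d1 where d1: "d1 > 0" "!!x. x \<in> H ==> nu x < d1 ==> \<exists>r\<in>H. r + r = x & nu r <= 2/3 * nu x"
  using H unfolding admissible_def rooted_def by blast
 obtain d2 where d2: "d2 > 0" "!!v. v \<in> K ==> nu v < d2 ==> norm (c v - 1) < 1" using c(2) unfolding contin_def K_def by (metis zero_less_one)
 define delta where "delta = min d1 d2"
 have delta: "delta > 0" using d1 d2 by (simp add: delta_def)
 have rt: "\<exists>r\<in>H1. r + r = x & nu r <= 2/3 * nu x" if x: "x \<in> H1" "nu x < delta" for x
 proof -
  obtain r where r: "r \<in> H" "r + r = x" "nu r <= 2/3 * nu x" using d1(2)[of x] x H1 by (auto simp: delta_def)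
  \<comment> \<open>A square root of a kernel element has value 1 or -1 under \<open>c\<close>, and
    a small one is too close to 1 for the latter.\<close>
  have "c r = 1"
  proof (rule no_small_powers_root)
   show "c r * c r = 1" using cadd[of r r] r K(3) x(1) by (auto simp: H1_def)
   show "norm (c r - 1) < 1" using r K(3) x(2) nu_nonneg[of x] by (intro d2(2)) (auto simp: delta_def)
  qed
  thus ?thesis using r by (auto simp: H1_def)
 qed
 \<comment> \<open>A smaller radius would generate the same group, since \<open>rtn\<close> writes a
   small element of the kernel as a multiple of a much smaller one.\<close>
 define H' where "H' = gen {h\<in>H1. nu h < delta}"
 have H': "subgrp H'" "H' \<subseteq> H1" using gen_least[OF H1(1)] by (auto simp: H'_def subgrp_gen)
 have small: "h \<in> H'" if "h \<in> H1" "nu h < delta" for h using that by (auto simp: H'_def intro: gen_base)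
 have rtn: "\<exists>r\<in>H1. nmul (2 ^ n) r = x & nu r <= (2/3) ^ n * nu x" if "x \<in> H1" "nu x < delta" for x n
  using that
 proof (induction n arbitrary: x)
  case 0 thus ?case by (auto intro!: bexI[of _ x])
 next
  case (Suc n)
  obtain r where r: "r \<in> H1" "r + r = x" "nu r <= 2/3 * nu x" using rt[OF Suc.prems] by blast
  hence "nu r < delta" using Suc.prems(2) nu_nonneg[of x] by linarith
  then obtain s where s: "s \<in> H1" "nmul (2 ^ n) s = r" "nu s <= (2/3) ^ n * nu r" using Suc.IH[OF r(1)] by blast
  have "(2/3) ^ n * nu r <= (2/3) ^ n * (2/3 * nu x)" by (intro mult_left_mono r(3)) auto
  hence "nu s <= (2/3) ^ Suc n * nu x" using s(3) unfolding power_Suc2 mult.assoc by linarith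
  moreover have "nmul (2 ^ Suc n) s = x" using s(2) r(2) by (simp add: mult_2 nmul_add)
  ultimately show ?case using s(1) by blast
 qed
 have conn: "H' \<subseteq> gen {h\<in>H'. nu h < d}" if d: "d > 0" for d
  unfolding H'_def
 proof (rule gen_least[OF subgrp_gen], clarify)
  fix x assume x: "x \<in> H1" "nu x < delta"
  obtain n where n: "(2/3) ^ n < min d delta / delta" using real_arch_pow_inv[of "min d delta / delta" "2/3"] d delta by auto
  obtain r where r: "r \<in> H1" "nmul (2 ^ n) r = x" "nu r <= (2/3) ^ n * nu x" using rtn[OF x] by blast
  have "(2/3) ^ n * nu x <= (2/3) ^ n * delta" using x by (intro mult_left_mono) auto
  also have "... < min d delta" using n delta by (simp add: pos_less_divide_eq)
  finally have "nu r < d" "nu r < delta" using r(3) by auto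
  hence "r \<in> gen {h \<in> gen {h \<in> H1. nu h < delta}. nu h < d}" using small[OF r(1)] by (intro gen_base) (auto simp: H'_def)
  thus "x \<in> gen {h \<in> gen {h \<in> H1. nu h < delta}. nu h < d}" using nmul_mem[OF subgrp_gen] r(2) by blast
 qed
 have n': "g + h - g \<in> H'" if g: "g \<in> K" and h: "h \<in> H'" for g h
 proof -
  obtain d where d: "d > 0" "!!u. u \<in> G ==> nu u < d ==> nu (g + u - g) < delta" using nu_conj[OF delta, of g] g K by blast
  define Z where "Z = {h. g + h - g \<in> H'}"
  have "subgrp Z"
   unfolding subgrp_def
  proof (intro conjI ballI)
   show "0 \<in> Z" using subgrpD(1)[OF H'(1)] by (simp add: Z_def)
   fix x assume x: "x \<in> Z"
   have "- (g + x - g) \<in> H'" using subgrpD(3)[OF H'(1)] x unfolding Z_def by blast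
   thus "- x \<in> Z" unfolding Z_def by (simp only: mem_Collect_eq group_simps)
   fix y assume "y \<in> Z"
   hence "(g + x - g) + (g + y - g) \<in> H'" using subgrpD(2)[OF H'(1)] x unfolding Z_def by blast
   thus "x + y \<in> Z" unfolding Z_def by (simp only: mem_Collect_eq group_simps)
  qed
  hence "gen {h\<in>H'. nu h < d} \<subseteq> {h. g + h - g \<in> H'}" unfolding Z_def[symmetric]
  proof (rule gen_least, unfold Z_def, clarify)
   fix x assume "x \<in> H'" "nu x < d"
   thus "g + x - g \<in> H'" using H' H1 Hs d(2) by (intro small n1[OF g]) auto
  qed
  thus ?thesis using conn[OF d(1)] h by blast
 qed
 have rooted': "rooted H'"
  unfolding rooted_def
 proof (intro conjI exI[of _ delta] ballI impI delta H'(1))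
  show "H' \<subseteq> G" using H' H1 Hs by blast
  fix x assume x: "x \<in> H'" "nu x < delta"
  then obtain r where r: "r \<in> H1" "r + r = x" "nu r <= 2/3 * nu x" using rt H'(2) by blast
  moreover have "nu r < delta" using r(3) x(2) nu_nonneg[of x] by linarith
  ultimately show "\<exists>r\<in>H'. r + r = x & nu r <= 2/3 * nu x" using small by blast
 qed
 have cdec: "c b * c v = 1" if "b \<in> H" "v \<in> H" "gamma \<in> Gam" "gamma \<in> H" "h \<in> H1" "h = b + v + gamma" for b v gamma h
 proof -
  have "c h = c b * c v * c gamma" using that K(3) subgrpD(2)[OF K(1)] by (simp add: cadd subset_iff)
  thus ?thesis using that cGam[of gamma] K(3) by (auto simp: H1_def K_def)
 qed
 have coco': "cocomp H'"
  unfolding cocomp_def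
 proof (intro allI impI)
  fix d :: real assume "d > 0"
  hence "min d delta > 0" using delta by simp
  from small_diffs[OF this] obtain d3 where d3: "d3 > 0" "!!u v. u \<in> G ==> v \<in> G ==> nu u < d3 ==> nu v < d3 ==> nu (u - v) < min d delta" by blast
  obtain C where C: "finite C" "C \<subseteq> H" "!!h. h \<in> H ==> \<exists>b\<in>H. \<exists>v\<in>C. \<exists>gamma\<in>Gam \<inter> H. nu b < d3 & h = b + v + gamma"
   using cH d3(1) unfolding cocomp_def by meson
  define P where "P v h \<longleftrightarrow> h \<in> H' & (\<exists>b\<in>H. \<exists>gamma\<in>Gam \<inter> H. nu b < d3 & h = b + v + gamma)" for v h
  define s where "s v = (SOME h. P v h)" for v
  have s: "P v (s v)" if "P v h" for v h unfolding s_def using that by (rule someI)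
  define C' where "C' = s ` {v\<in>C. \<exists>h. P v h}"
  have "\<exists>b\<in>H'. \<exists>c\<in>C'. \<exists>gamma\<in>Gam \<inter> H'. nu b < d & h = b + c + gamma" if h: "h \<in> H'" for h
  proof -
   have hH: "h \<in> H" "h \<in> H1" using h H' H1 by auto
   obtain b v gamma where 1: "b \<in> H" "v \<in> C" "gamma \<in> Gam" "gamma \<in> H" "nu b < d3" "h = b + v + gamma" using C(3)[OF hH(1)] by blast
   hence "P v h" using h by (auto simp: P_def)
   from s[OF this] obtain b' gamma' where 2: "s v \<in> H'" "b' \<in> H" "gamma' \<in> Gam" "gamma' \<in> H" "nu b' < d3" "s v = b' + v + gamma'" by (auto simp: P_def)
   have vH: "v \<in> H" using 1 C by blast
   have "c (b - b') = 1" using ceq[of b b' "c v"] cdec[OF 1(1) vH 1(3,4) hH(2) 1(6)] cdec[OF 2(2) vH 2(3,4) _ 2(6)] 2(1) H'(2) 1(1) 2(2) K(3) by blast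
   hence q: "b - b' \<in> H1" "nu (b - b') < d" "nu (b - b') < delta"
    using subgrpD(4)[OF Hs(1) 1(1) 2(2)] d3(2)[of b b'] 1(1,5) 2(2,5) Hs(2) by (auto simp: H1_def)
   hence qH: "b - b' \<in> H'" using small by blast
   have eq: "h = (b - b') + s v + (- gamma' + gamma)" using 1(6) 2(6) by (simp only: group_simps)
   hence "- gamma' + gamma = - s v + (- (b - b') + h)" by (simp only: group_simps)
   hence "- gamma' + gamma \<in> H'" using h qH 2(1) subgrpD(2,3)[OF H'(1)] by metis
   moreover have "- gamma' + gamma \<in> Gam" using 1 2 subgrpD[OF Gam(1)] by blast
   moreover have "s v \<in> C'" using 1(2) \<open>P v h\<close> by (auto simp: C'_def)
   ultimately show ?thesis using eq qH q(2) by blast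
  qed
  moreover have "C' \<subseteq> H'" using s by (auto simp: C'_def P_def)
  ultimately show "\<exists>C. finite C & C \<subseteq> H' & (\<forall>h\<in>H'. \<exists>b\<in>H'. \<exists>c\<in>C. \<exists>gamma\<in>Gam \<inter> H'. nu b < d & h = b + c + gamma)"
   using C(1) by (intro exI[of _ C']) (auto simp: C'_def)
 qed
 obtain h0 gamma0 where 0: "h0 \<in> H" "gamma0 \<in> Gam" "nmul k a = h0 + gamma0" using H by (auto simp: admissible_def)
 have gamma0K: "gamma0 \<in> K"
 proof -
  have "gamma0 = - h0 + nmul k a" using 0(3) by simp
  thus ?thesis using 0(1) aK K(3) subgrpD[OF K(1)] by (metis subsetD)
 qed
 have h0: "h0 \<in> H1" using cadd[of h0 gamma0] 0 gamma0K K(3) ca cGam[of gamma0] by (auto simp: H1_def K_def)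
 have "\<exists>h\<in>H1. \<exists>gamma\<in>Gam \<inter> K. nmul n (nmul k a) = h + gamma" for n
 proof (induction n)
  case 0 show ?case using subgrpD(1) H1(1) Gam(1) K(1) by (intro bexI[of _ 0]) auto
 next
  case (Suc n)
  then obtain h gamma where h: "h \<in> H1" "gamma \<in> Gam" "gamma \<in> K" "nmul n (nmul k a) = h + gamma" by blast
  have "nmul (Suc n) (nmul k a) = (h0 + (gamma0 + h - gamma0)) + (gamma0 + gamma)"
   unfolding nmul.simps h(4) unfolding 0(3) by (simp only: group_simps)
  moreover have "h0 + (gamma0 + h - gamma0) \<in> H1" by (rule subgrpD(2)[OF H1(1) h0 n1[OF gamma0K h(1)]])
  moreover have "gamma0 + gamma \<in> Gam \<inter> K" using subgrpD(2)[OF Gam(1) 0(2) h(2)] subgrpD(2)[OF K(1) gamma0K h(3)] by blast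
  ultimately show ?case by blast
 qed
 hence "\<forall>n. \<exists>p. fst p \<in> H1 & snd p \<in> Gam \<inter> K & nmul n (nmul k a) = fst p + snd p" by (metis fst_conv snd_conv)
 then obtain p where p: "!!n. fst (p n) \<in> H1" "!!n. snd (p n) \<in> Gam \<inter> K" "!!n. nmul n (nmul k a) = fst (p n) + snd (p n)" by metis
 obtain d3 where d3: "d3 > 0" "!!u v. u \<in> G ==> v \<in> G ==> nu u < d3 ==> nu v < d3 ==> nu (- u + v) < delta" using small_diffs[OF delta] by blast
 obtain C where C: "finite C" "C \<subseteq> H" "!!h. h \<in> H ==> \<exists>b\<in>H. \<exists>v\<in>C. \<exists>gamma\<in>Gam \<inter> H. nu b < d3 & h = b + v + gamma"
  using cH d3(1) unfolding cocomp_def by meson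
 have "\<exists>v. v \<in> C & (\<exists>b\<in>H. \<exists>gamma\<in>Gam \<inter> H. nu b < d3 & fst (p n) = b + v + gamma)" for n using C(3)[of "fst (p n)"] p(1)[of n] H1(2) by blast
 then obtain v where v: "!!n. v n \<in> C" "!!n. \<exists>b\<in>H. \<exists>gamma\<in>Gam \<inter> H. nu b < d3 & fst (p n) = b + v n + gamma" by metis
 have "\<not> inj v" using C(1) v(1) finite_subset[of "range v" C] finite_imageD[of v UNIV] by auto
 then obtain n m where nm: "n < m" "v n = v m" unfolding inj_def by (metis nat_neq_iff)
 obtain b gamma where 1: "b \<in> H" "gamma \<in> Gam" "gamma \<in> H" "nu b < d3" "fst (p n) = b + v n + gamma" using v(2)[of n] by blast
 obtain b' gamma' where 2: "b' \<in> H" "gamma' \<in> Gam" "gamma' \<in> H" "nu b' < d3" "fst (p m) = b' + v n + gamma'" using v(2)[of m] nm(2) by auto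
 have vH: "v n \<in> H" using v(1) C(2) by blast
 have "c (- b + b') = 1"
  using ceq[of b b' "c (v n)"] cdec[OF 1(1) vH 1(2,3) p(1) 1(5)] cdec[OF 2(1) vH 2(2,3) p(1) 2(5)] K(3) 1(1) 2(1) by blast
 hence "- b + b' \<in> H1" using subgrpD(2)[OF Hs(1) subgrpD(3)[OF Hs(1) 1(1)] 2(1)] by (simp add: H1_def)
 hence q: "- b + b' \<in> H'" using d3(2)[of b b'] 1 2 Hs(2) by (intro small) auto
 \<comment> \<open>Conjugation by \<open>s\<close> collects the parts in \<open>Gam\<close> on the
   right; what remains is a conjugate of the small kernel element \<open>- b + b'\<close>.\<close>
 define s where "s = - snd (p n) - gamma"
 have gammaK: "gamma \<in> K" "gamma' \<in> K" "v n \<in> K" using 1 2 vH K(3) by auto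
 have s: "s \<in> K" "s \<in> Gam" unfolding s_def
  using p(2)[of n] 1(2) gammaK by (auto intro!: subgrpD(3,4)[OF K(1)] subgrpD(3,4)[OF Gam(1)])
 define k' where "k' = (m - n) * k"
 have "nmul m (nmul k a) = nmul n (nmul k a) + nmul (m - n) (nmul k a)" using nm(1) by (simp flip: nmul_add)
 hence "nmul k' a = - nmul n (nmul k a) + nmul m (nmul k a)" unfolding k'_def nmul_mult by simp
 also have "... = (s + (- v n + (- b + b') - - v n) - s) + (s + (gamma' + snd (p m)))"
  unfolding p(3) 1(5) 2(5) s_def by (simp only: group_simps)
 finally have eq: "nmul k' a = (s + (- v n + (- b + b') - - v n) - s) + (s + (gamma' + snd (p m)))" .
 have "s + (- v n + (- b + b') - - v n) - s \<in> H'" by (intro n' s(1) q subgrpD(3)[OF K(1)] gammaK(3))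
 moreover have "s + (gamma' + snd (p m)) \<in> Gam" by (intro subgrpD(2)[OF Gam(1)] s(2) 2(2)) (use p(2) in blast)
 ultimately have "\<exists>h\<in>H'. \<exists>gamma\<in>Gam. nmul k' a = h + gamma" using eq by blast
 moreover have "nmul k' a \<in> K" unfolding k'_def nmul_mult by (rule nmul_mem[OF K(1) aK])
 hence "\<forall>h\<in>H'. nmul k' a + h - nmul k' a \<in> H' & - nmul k' a + h + nmul k' a \<in> H'"
  using n' n'[OF subgrpD(3)[OF K(1)]] by simp
 moreover have "k' >= 1" using nm(1) k by (simp add: k'_def)
 ultimately have "admissible H' k'" using rooted' coco' by (simp add: admissible_def)
 thus ?thesis using conn H'(2) by (intro exI[of _ H'] exI[of _ k']) (auto simp: H1_def)
qed

text \<open>If every suitable \<open>H\<close> had a character violating \<open>terminal\<close>,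
  \<open>kernel_step\<close> could be repeated for ever by dependent choice, against
  \<open>no_long_chain\<close>. That each character is nontrivial arbitrarily near 0 follows from
  generation by small elements.\<close>

theorem nil_core_exists:
 "\<exists>k K N. k >= 1 & K \<subseteq> G & nil_core nu K N (Gam \<inter> K) (nmul k a)"
proof (rule ccontr)
 assume no: "\<not> ?thesis"
 define good where "good x \<longleftrightarrow> admissible (fst x) (snd x) & (\<forall>d>0. fst x \<subseteq> gen {h\<in>fst x. nu h < d})" for x
 define Q where "Q x y \<longleftrightarrow> (\<exists>c. unit_hom (fst x) c & contin (fst x) c & (\<exists>h\<in>fst x. c h ~= 1) & fst y \<subseteq> {h\<in>fst x. c h = 1})"
  for x y :: "'a set \<times> nat"
 have step: "\<exists>y. good y & Q x y" if x: "good x" for x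
 proof -
  obtain H k where xk: "x = (H, k)" by force
  have H: "admissible H k" and conn: "!!d. d > 0 ==> H \<subseteq> gen {h\<in>H. nu h < d}" using x by (auto simp: good_def xk)
  have Hs: "subgrp H" "H \<subseteq> G" "cocomp H" "k >= 1" using H by (auto simp: admissible_def rooted_def)
  define K where "K = ext H k"
  note E = ext_props[OF H, folded K_def]
  have GamK: "subgrp (Gam \<inter> K)" using subgrpD[OF Gam(1)] subgrpD[OF E(1)] by (auto simp: subgrp_def)
  have KH: "\<exists>n\<in>H. \<exists>gamma\<in>Gam \<inter> K. g = n + gamma" if g: "g \<in> K" for g
  proof -
   define Z where "Z = {n + gamma | n gamma. n \<in> H & gamma \<in> Gam \<inter> K}"
   have "subgrp Z"
    unfolding subgrp_def
   proof (intro conjI ballI)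
    show "0 \<in> Z" using subgrpD(1)[OF Hs(1)] subgrpD(1)[OF GamK] unfolding Z_def by force
    fix x assume "x \<in> Z"
    then obtain n gamma where x: "x = n + gamma" "n \<in> H" "gamma \<in> Gam \<inter> K" by (auto simp: Z_def)
    have "- x = (- gamma + - n - - gamma) + - gamma" unfolding x(1) by (simp only: group_simps)
    moreover have "- gamma \<in> Gam \<inter> K" by (rule subgrpD(3)[OF GamK x(3)])
    moreover from this have "- gamma + - n - - gamma \<in> H" by (intro E(5) subgrpD(3)[OF Hs(1) x(2)]) blast
    ultimately show "- x \<in> Z" unfolding Z_def by blast
    fix y assume "y \<in> Z"
    then obtain m gamma' where y: "y = m + gamma'" "m \<in> H" "gamma' \<in> Gam \<inter> K" by (auto simp: Z_def)
    have "x + y = (n + (gamma + m - gamma)) + (gamma + gamma')" unfolding x(1) y(1) by (simp only: group_simps)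
    moreover have "n + (gamma + m - gamma) \<in> H" using x y E(5) subgrpD(2)[OF Hs(1)] by blast
    moreover have "gamma + gamma' \<in> Gam \<inter> K" by (rule subgrpD(2)[OF GamK x(3) y(3)])
    ultimately show "x + y \<in> Z" unfolding Z_def by blast
   qed
   moreover have "nmul k a \<in> Z"
   proof -
    obtain h gamma where h: "h \<in> H" "gamma \<in> Gam" "nmul k a = h + gamma" using H by (auto simp: admissible_def)
    hence "gamma = - h + nmul k a" by simp
    hence "gamma \<in> K" using h(1) E subgrpD[OF E(1)] by (metis subsetD)
    thus ?thesis using h by (auto simp: Z_def)
   qed
   moreover have "h \<in> Z" if "h \<in> H" for h
    using that subgrpD(1)[OF GamK] unfolding Z_def by (metis (mono_tags, lifting) add.right_neutral mem_Collect_eq)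
   ultimately have "K \<subseteq> Z" unfolding K_def ext_def by (intro gen_least) auto
   thus ?thesis using g unfolding Z_def by blast
  qed
  have "\<not> nil_core nu K H (Gam \<inter> K) (nmul k a)" using no Hs(4) E(2) by blast
  moreover have "nil_core nu K H (Gam \<inter> K) (nmul k a)" if trm: "!!c n. unit_hom K c ==> contin K c ==>
   (!!gamma. gamma \<in> Gam \<inter> K ==> c gamma = 1) ==> c (nmul k a) = 1 ==> n \<in> H ==> c n = 1"
  proof
   show "K \<subseteq> H'" if "subgrp H'" "H \<subseteq> H'" "nmul k a \<in> H'" for H'
    unfolding K_def ext_def by (rule gen_least) (use that in auto)
   show "\<exists>d>0. \<forall>u\<in>K. \<forall>v\<in>K. nu u < d --> nu v < d --> nu (u + v) < e" if "e > 0" for e using small_add[OF that] E(2) by blast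
   show "\<exists>d>0. \<forall>u\<in>K. nu u < d --> nu (- u) < e" if "e > 0" for e using small_minus[OF that] E(2) by blast
   show "\<exists>d>0. \<forall>u\<in>K. nu u < d --> nu (g + u - g) < e" if "e > 0" "g \<in> K" for e g using nu_conj[OF that(1), of g] that(2) E(2) by blast
   show "H \<subseteq> H'" if "d > 0" "subgrp H'" "{n\<in>H. nu n < d} \<subseteq> H'" for d H' using conn[OF that(1)] gen_least[OF that(2,3)] by blast
   show "\<exists>C\<subseteq>H. finite C & (\<forall>n\<in>H. \<exists>b\<in>H. \<exists>c\<in>C. \<exists>gamma\<in>Gam \<inter> K \<inter> H. nu b < d & n = b + c + gamma)" if d: "d > 0" for d
   proof -
    have "Gam \<inter> K \<inter> H = Gam \<inter> H" using E(3) by blast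
    thus ?thesis using Hs(3) d unfolding cocomp_def by metis
   qed
   show "c n = 1" if "unit_hom K c" "!!e. e > 0 ==> \<exists>d>0. \<forall>v\<in>K. nu v < d --> norm (c v - 1) < e"
    "!!gamma. gamma \<in> Gam \<inter> K ==> c gamma = 1" "c (nmul k a) = 1" "n \<in> H" for c n
    by (rule trm[OF that(1) _ that(3-5)]) (use that(2) in "auto simp: contin_def")
  qed (use E Hs GamK KH nu_zero in auto)
  ultimately obtain c h where c: "unit_hom K c" "contin K c" "!!gamma. gamma \<in> Gam \<inter> K ==> c gamma = 1" "c (nmul k a) = 1" "h \<in> H" "c h ~= 1"
   by blast
  obtain H' k' where H': "admissible H' k'" "\<forall>d>0. H' \<subseteq> gen {h\<in>H'. nu h < d}" "H' \<subseteq> {h\<in>H. c h = 1}"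
   using kernel_step[OF H, of c] c unfolding K_def by blast
  have "unit_hom H c" "contin H c" using c(1,2) E(3) unfolding unit_hom_def contin_def by blast+
  hence "good (H', k') & Q x (H', k')" using H' c(5,6) by (auto simp: good_def Q_def xk)
  thus ?thesis by blast
 qed
 have "admissible G 1"
  unfolding admissible_def rooted_def
 proof (intro conjI)
  show "\<exists>d>0. \<forall>x\<in>G. nu x < d --> (\<exists>r\<in>G. r + r = x & nu r <= 2 / 3 * nu x)" using root r0 by blast
  show "\<exists>h\<in>G. \<exists>gamma\<in>Gam. nmul 1 a = h + gamma" using a subgrpD(1)[OF Gam(1)] by (intro bexI[of _ a] bexI[of _ 0]) auto
  have "Gam \<inter> G = Gam" using Gam by blast
  thus "cocomp G" using cocompact unfolding cocomp_def by simp
 qed (use G a subgrpD[OF G] in auto)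
 \<comment> \<open>The trivial character serves to replace \<open>G\<close> by a subgroup generated
   by small elements, the start of the chain.\<close>
 from kernel_step[OF this, of "\<lambda>_. 1"] obtain x0 where x0: "good x0"
  by (auto simp: unit_hom_def contin_def good_def intro: exI[of _ 1])
 have "\<exists>f. \<forall>n. good (f n) & Q (f n) (f (Suc n))"
  by (rule dependent_nat_choice) (use x0 step in blast)+
 then obtain f where f: "!!n. good (f n)" "!!n. Q (f n) (f (Suc n))" by blast
 have "\<forall>n. \<exists>c. unit_hom (fst (f n)) c & contin (fst (f n)) c & (\<exists>h\<in>fst (f n). c h ~= 1) & fst (f (Suc n)) \<subseteq> {h\<in>fst (f n). c h = 1}"
  using f(2) unfolding Q_def ..
 from choice[OF this] obtain c where c: "!!n. unit_hom (fst (f n)) (c n)" "!!n. contin (fst (f n)) (c n)" "!!n. \<exists>h\<in>fst (f n). c n h ~= 1"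
  "!!n. fst (f (Suc n)) \<subseteq> {h\<in>fst (f n). c n h = 1}" by blast
 have Hs: "rooted (fst (f n))" for n using f(1) by (auto simp: good_def admissible_def)
 show False
 proof (rule no_long_chain[of "\<lambda>n. fst (f n)" c, OF Hs _ c(1,2)])
  show "\<exists>x\<in>fst (f i). nu x < e & c i x ~= 1" if e: "e > 0" for i e
  proof (rule ccontr)
   assume "\<not> ?thesis"
   hence "{h\<in>fst (f i). nu h < e} \<subseteq> {h\<in>fst (f i). c i h = 1}" by blast
   hence "gen {h\<in>fst (f i). nu h < e} \<subseteq> {h\<in>fst (f i). c i h = 1}"
    using Hs by (intro gen_least unit_hom_kernel c(1)) (auto simp: rooted_def)
   thus False using f(1)[of i] e c(3)[of i] unfolding good_def by blast
  qed
 qed (use c(4) in blast)+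
qed

end

section \<open>Finite-dimensional normed spaces\<close>

lemma compact_box: "compact {f :: 'b => real. \<forall>b. f b \<in> {- R..R}}"
proof -
 have "compactin (product_topology (\<lambda>_. euclidean) UNIV) (PiE UNIV (\<lambda>_ :: 'b. {- R..R}))"
  unfolding compactin_PiE by simp
 moreover have "PiE UNIV (\<lambda>_ :: 'b. {- R..R}) = {f. \<forall>b. f b \<in> {- R..R}}" by (auto simp: PiE_iff)
 ultimately show ?thesis unfolding euclidean_product_topology by simp
qed

lemma continuous_on_combination: "continuous_on S (\<lambda>f :: 'e::real_normed_vector => real. \<Sum>b\<in>B. f b *\<^sub>R b)"
 by (intro continuous_on_sum continuous_on_scaleR continuous_on_subset[OF continuous_on_product_coordinates] continuous_on_const) auto

text \<open>Equivalence of norms: a combination of independent vectors does not vanish on the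
  compact unit sphere of the coordinates. The model space is only a normed space with a finite
  spanning set, so its coordinates are constructed here.\<close>

lemma bounded_coordinates:
 fixes A :: "'e::real_normed_vector set"
 assumes "finite A" "span A = UNIV"
 obtains B :: "'e set" and c C where "finite B" "C > 0" "!!x. x = (\<Sum>b\<in>B. c x b *\<^sub>R b)" "!!x b. \<bar>c x b\<bar> <= C * norm x"
proof -
 obtain B where B: "B \<subseteq> A" "independent B" "A \<subseteq> span B" using maximal_independent_subset[of A] by blast
 have fB: "finite B" using B(1) assms(1) finite_subset by blast
 have sB: "span B = UNIV" using span_minimal[OF B(3) subspace_span] assms(2) by blast
 define S where "S = {f :: 'e => real. \<forall>b. f b \<in> {- 1..1}} \<inter> {f. (\<Sum>b\<in>B. \<bar>f b\<bar>) = 1}"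
 have "closed {f :: 'e => real. (\<Sum>b\<in>B. \<bar>f b\<bar>) = 1}"
  by (intro closed_Collect_eq continuous_on_sum continuous_on_rabs continuous_on_product_coordinates continuous_on_const)
 hence cS: "compact S" unfolding S_def by (rule compact_Int_closed[OF compact_box])
 have "\<exists>\<mu>>0. \<forall>f\<in>S. \<mu> <= norm (\<Sum>b\<in>B. f b *\<^sub>R b)"
 proof (cases "S = {}")
  case False
  obtain f where f: "f \<in> S" "!!g. g \<in> S ==> norm (\<Sum>b\<in>B. f b *\<^sub>R b) <= norm (\<Sum>b\<in>B. g b *\<^sub>R b)"
   using continuous_attains_inf[OF cS False, of "\<lambda>f. norm (\<Sum>b\<in>B. f b *\<^sub>R b)"] continuous_on_norm[OF continuous_on_combination[of S B]] by blast
  have "(\<Sum>b\<in>B. f b *\<^sub>R b) ~= 0"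
  proof
   assume "(\<Sum>b\<in>B. f b *\<^sub>R b) = 0"
   hence "f b = 0" if "b \<in> B" for b using independentD[OF B(2) fB subset_refl] that by blast
   thus False using f(1) by (simp add: S_def)
  qed
  thus ?thesis using f(2) by (intro exI[of _ "norm (\<Sum>b\<in>B. f b *\<^sub>R b)"]) auto
 qed (auto intro: exI[of _ 1])
 then obtain \<mu> where \<mu>: "\<mu> > 0" "!!f. f \<in> S ==> \<mu> <= norm (\<Sum>b\<in>B. f b *\<^sub>R b)" by blast
 have "\<exists>f. x = (\<Sum>b\<in>B. f b *\<^sub>R b) & (\<forall>b. \<bar>f b\<bar> <= 1 / \<mu> * norm x)" for x
 proof -
  obtain f where f: "x = (\<Sum>b\<in>B. f b *\<^sub>R b)" using sB unfolding span_finite[OF fB] by blast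
  define g where "g b = (if b \<in> B then f b else 0)" for b
  define s where "s = (\<Sum>b\<in>B. \<bar>f b\<bar>)"
  have gs: "\<bar>g b\<bar> <= s" for b unfolding g_def s_def using member_le_sum[of b B "\<lambda>b. \<bar>f b\<bar>"] fB by (auto intro: sum_nonneg)
  have xg: "x = (\<Sum>b\<in>B. g b *\<^sub>R b)" using f by (simp add: g_def)
  have "s * \<mu> <= norm x"
  proof (cases "s = 0")
   case False
   hence s: "s > 0" using gs[of 0] by (smt (verit) abs_ge_zero)
   have "(\<lambda>b. g b / s) \<in> S"
   proof -
    have "- 1 <= g b / s & g b / s <= 1" for b using gs[of b] s by (simp add: pos_le_divide_eq pos_divide_le_eq abs_le_iff)
    moreover have "(\<Sum>b\<in>B. \<bar>g b / s\<bar>) = 1" using s by (simp add: g_def s_def flip: sum_divide_distrib)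
    ultimately show ?thesis by (simp add: S_def)
   qed
   from \<mu>(2)[OF this] have "\<mu> <= norm (x /\<^sub>R s)" unfolding xg by (simp add: scaleR_sum_right divide_inverse mult.commute)
   thus ?thesis using s by (simp add: field_simps)
  qed simp
  hence "\<bar>g b\<bar> <= 1 / \<mu> * norm x" for b
   using order_trans[OF mult_right_mono[OF gs[of b], of \<mu>]] \<mu>(1) by (simp add: pos_le_divide_eq)
  with xg show ?thesis by blast
 qed
 then obtain c where "!!x. x = (\<Sum>b\<in>B. c x b *\<^sub>R b)" "!!x b. \<bar>c x b\<bar> <= 1 / \<mu> * norm x" by metis
 thus ?thesis using that[OF fB, of "1 / \<mu>" c] \<mu>(1) by simp
qed

lemma finite_dim_compact_cball:
 fixes A :: "'e::real_normed_vector set" and a :: 'e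
 assumes "finite A" "span A = UNIV"
 shows "compact (cball a r)"
proof -
 obtain B :: "'e set" and c C where c: "finite B" "C > 0" "!!x. x = (\<Sum>b\<in>B. c x b *\<^sub>R b)" "!!x b. \<bar>c x b\<bar> <= C * norm x"
  by (rule bounded_coordinates[OF assms]) blast
 define R where "R = C * (norm a + r)"
 have "cball a r \<subseteq> (\<lambda>f. \<Sum>b\<in>B. f b *\<^sub>R b) ` {f. \<forall>b. f b \<in> {- R..R}}"
 proof
  fix x assume "x \<in> cball a r"
  hence "norm x <= norm a + r" using norm_triangle_ineq4[of a "a - x"] by (simp add: dist_norm)
  hence "C * norm x <= R" unfolding R_def using c(2) by (intro mult_left_mono) auto
  hence "\<bar>c x b\<bar> <= R" for b using c(4)[of x b] by linarith
  hence "c x b \<in> {- R..R}" for b by (simp add: abs_le_iff minus_le_iff)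
  thus "x \<in> (\<lambda>f. \<Sum>b\<in>B. f b *\<^sub>R b) ` {f. \<forall>b. f b \<in> {- R..R}}" using c(3)[of x] by blast
 qed
 moreover have "compact ((\<lambda>f. \<Sum>b\<in>B. f b *\<^sub>R b) ` {f. \<forall>b. f b \<in> {- R..R}})"
  by (rule compact_continuous_image[OF continuous_on_combination compact_box])
 from compact_Int_closed[OF this closed_cball[of a r]] calculation show ?thesis by (simp add: inf.absorb2)
qed

text \<open>Coordinates are rounded to a grid of mesh \<open>rho / s\<close>. Separated points fall
  into different cells, whose number is polynomial in \<open>1 / rho\<close>.\<close>

lemma finite_dim_packing:
 fixes A :: "'e::real_normed_vector set"
 assumes "finite A" "span A = UNIV"
 shows "\<exists>D C. C >= 0 & (\<forall>rho W. 0 < rho --> rho <= 1 --> W \<subseteq> ball (a :: 'e) r -->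
  (\<forall>w\<in>W. \<forall>w'\<in>W. w ~= w' --> rho <= norm (w - w')) --> real (card W) <= C * (1 / rho) ^ D)"
proof -
 obtain B :: "'e set" and c C where c: "finite B" "C > 0" "!!x. x = (\<Sum>b\<in>B. c x b *\<^sub>R b)" "!!x b. \<bar>c x b\<bar> <= C * norm x"
  by (rule bounded_coordinates[OF assms]) blast
 define s where "s = (\<Sum>b\<in>B. norm b) + 1"
 define M where "M = C * (norm a + \<bar>r\<bar>)"
 have s: "s >= 1" and M: "M >= 0" using c(2) by (auto simp: s_def M_def sum_nonneg)
 have "real (card W) <= (2 * M * s + 2) ^ card B * (1 / rho) ^ card B"
  if rho: "0 < rho" "rho <= 1" and W: "W \<subseteq> ball a r" and sep: "!!w w'. w \<in> W ==> w' \<in> W ==> w ~= w' ==> rho <= norm (w - w')" for rho W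
 proof -
  define n where "n = s / rho"
  have n: "n > 0" using s rho by (simp add: n_def)
  define \<Phi> where "\<Phi> w = (\<lambda>b\<in>B. \<lfloor>c w b * n\<rfloor>)" for w
  define I where "I = {\<lfloor>- (M * n)\<rfloor>..\<lfloor>M * n\<rfloor>}"
  have "inj_on \<Phi> W"
  proof (rule inj_onI, rule ccontr)
   fix w w' assume w: "w \<in> W" "w' \<in> W" and eq: "\<Phi> w = \<Phi> w'" and ne: "w ~= w'"
   have near: "\<bar>c w b - c w' b\<bar> <= 1 / n" if "b \<in> B" for b
   proof -
    have "\<lfloor>c w b * n\<rfloor> = \<lfloor>c w' b * n\<rfloor>" using fun_cong[OF eq, of b] that by (simp add: \<Phi>_def)
    hence "\<bar>c w b * n - c w' b * n\<bar> < 1" by linarith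
    hence "\<bar>c w b - c w' b\<bar> * n < 1" using n by (simp add: abs_mult flip: left_diff_distrib)
    thus ?thesis using n by (simp add: pos_le_divide_eq)
   qed
   have "norm (w - w') = norm (\<Sum>b\<in>B. (c w b - c w' b) *\<^sub>R b)"
    by (subst c(3)[of w], subst c(3)[of w']) (simp add: sum_subtractf scaleR_diff_left)
   also have "... <= (\<Sum>b\<in>B. 1 / n * norm b)" using near by (intro order_trans[OF norm_sum] sum_mono) (simp only: norm_scaleR mult_right_mono norm_ge_zero real_norm_def)
   also have "... = (s - 1) / n" by (simp add: s_def sum_divide_distrib)
   also have "... < rho" using s rho by (simp add: n_def field_simps)
   finally show False using sep[OF w ne] by simp
  qed
  moreover have "\<Phi> ` W \<subseteq> PiE B (\<lambda>_. I)"
  proof clarify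
   fix w assume "w \<in> W"
   hence "norm w <= norm a + \<bar>r\<bar>" using W norm_triangle_ineq4[of a "a - w"] by (auto simp: dist_norm subset_iff)
   hence "C * norm w <= M" unfolding M_def using c(2) by (intro mult_left_mono) auto
   hence "\<bar>c w b\<bar> <= M" for b using c(4)[of w b] by linarith
   hence "\<bar>c w b * n\<bar> <= M * n" for b using n by (simp add: abs_mult)
   hence "\<lfloor>- (M * n)\<rfloor> <= \<lfloor>c w b * n\<rfloor>" "\<lfloor>c w b * n\<rfloor> <= \<lfloor>M * n\<rfloor>" for b by (intro floor_mono; simp add: abs_le_iff minus_le_iff)+
   thus "\<Phi> w \<in> PiE B (\<lambda>_. I)" unfolding \<Phi>_def I_def by simp
  qed
  ultimately have "card W <= card (PiE B (\<lambda>_. I))" by (metis card_image card_mono c(1) finite_PiE finite_atLeastAtMost_int I_def)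
  also have "... = card I ^ card B" using c(1) by (simp add: card_PiE)
  finally have "real (card W) <= real (card I) ^ card B" by (metis of_nat_le_iff of_nat_power)
  also have "real (nat (\<lfloor>t\<rfloor> - \<lfloor>- t\<rfloor> + 1)) <= 2 * t + 2" if "t >= 0" for t :: real using that by linarith
  from this[of "M * n"] have "real (card I) <= 2 * M * n + 2" using M n by (simp add: I_def mult.assoc)
  hence "real (card I) ^ card B <= (2 * M * n + 2) ^ card B" by (intro power_mono) auto
  also have "2 * M * n + 2 <= (2 * M * s + 2) * (1 / rho)" using rho by (simp add: n_def field_simps)
  hence "(2 * M * n + 2) ^ card B <= ((2 * M * s + 2) * (1 / rho)) ^ card B" using M n by (intro power_mono) auto
  finally show ?thesis by (simp only: power_mult_distrib)
 qed
 moreover have "(2 * M * s + 2) ^ card B >= 0" using M s by simp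
 ultimately show ?thesis by meson
qed

text \<open>Continuity of finitely many directional derivatives that span gives continuity of the
  derivative in operator norm; the mean value inequality on a ball does the rest.\<close>

lemma strict_derivative:
 fixes f :: "'a::real_normed_vector => 'b::real_normed_vector" and A :: "'a set"
 assumes A: "finite A" "span A = UNIV" and \<Omega>: "open \<Omega>" "x0 \<in> \<Omega>" and f: "C_k_on 1 \<Omega> f" and e: "e > 0"
 shows "\<exists>d>0. ball x0 d \<subseteq> \<Omega> & (\<forall>x\<in>ball x0 d. \<forall>y\<in>ball x0 d. norm (f x - f y - frechet_derivative f (at x0) (x - y)) <= e * norm (x - y))"
proof -
 obtain B :: "'a set" and c C where c: "finite B" "C > 0" "!!x. x = (\<Sum>b\<in>B. c x b *\<^sub>R b)" "!!x b. \<bar>c x b\<bar> <= C * norm x"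
  by (rule bounded_coordinates[OF A]) blast
 define f' where "f' x = frechet_derivative f (at x)" for x
 have der: "(f has_derivative f' x) (at x)" if "x \<in> \<Omega>" for x
  using f that frechet_derivative_works[of f "at x"] by (simp add: f'_def)
 have cont: "continuous_on \<Omega> (\<lambda>x. f' x v)" for v using f by (simp add: f'_def)
 have lin: "bounded_linear (f' x)" if "x \<in> \<Omega>" for x by (rule has_derivative_bounded_linear[OF der[OF that]])
 have "isCont (\<lambda>x. \<Sum>b\<in>B. norm (f' x b - f' x0 b)) x0"
  by (intro continuous_intros) (use cont \<Omega> continuous_on_eq_continuous_at in blast)
 hence "((\<lambda>x. \<Sum>b\<in>B. norm (f' x b - f' x0 b)) \<longlongrightarrow> 0) (at x0)" by (simp add: isCont_def)
 moreover have "e / C > 0" using e c(2) by simp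
 ultimately have "\<forall>\<^sub>F x in at x0. (\<Sum>b\<in>B. norm (f' x b - f' x0 b)) < e / C" by (rule order_tendstoD)
 then obtain d1 where d1: "d1 > 0" "!!x. x ~= x0 ==> dist x x0 < d1 ==> (\<Sum>b\<in>B. norm (f' x b - f' x0 b)) < e / C"
  by (auto simp: eventually_at)
 obtain d2 where d2: "d2 > 0" "ball x0 d2 \<subseteq> \<Omega>" using \<Omega> open_contains_ball by blast
 define d where "d = min d1 d2"
 have d: "d > 0" "ball x0 d \<subseteq> \<Omega>" using d1(1) d2 by (auto simp: d_def)
 have on: "onorm (\<lambda>v. f' x v - f' x0 v) <= e" if x: "x \<in> ball x0 d" for x
 proof (rule onorm_bound)
  fix v
  have xO: "x \<in> \<Omega>" using x d by blast
  have s: "(\<Sum>b\<in>B. norm (f' x b - f' x0 b)) <= e / C"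
  proof (cases "x = x0")
   case True thus ?thesis using e c(2) by simp
  next
   case False thus ?thesis using d1(2)[of x] x by (simp add: d_def dist_commute less_imp_le)
  qed
  have ex: "f' x v = (\<Sum>b\<in>B. c v b *\<^sub>R f' x b)" if "x \<in> \<Omega>" for x
   by (subst c(3)[of v]) (simp add: linear_sum linear_scale bounded_linear.linear[OF lin[OF that]])
  have "f' x v - f' x0 v = (\<Sum>b\<in>B. c v b *\<^sub>R (f' x b - f' x0 b))"
   unfolding ex[OF xO] ex[OF \<Omega>(2)] by (simp add: sum_subtractf scaleR_diff_right)
  also have "norm ... <= (\<Sum>b\<in>B. C * norm v * norm (f' x b - f' x0 b))"
   by (intro order_trans[OF norm_sum] sum_mono) (simp only: norm_scaleR mult_right_mono norm_ge_zero real_norm_def c(4))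
  also have "... = C * norm v * (\<Sum>b\<in>B. norm (f' x b - f' x0 b))" by (simp add: sum_distrib_left)
  also have "... <= C * norm v * (e / C)" using c(2) by (intro mult_left_mono s) auto
  finally show "norm (f' x v - f' x0 v) <= e * norm v" using c(2) by (simp add: mult.commute)
 qed (use e in simp)
 have "norm (f x - f y - f' x0 (x - y)) <= e * norm (x - y)" if xy: "x \<in> ball x0 d" "y \<in> ball x0 d" for x y
 proof -
  have "norm (f x - f y - f' x0 (x - y)) <= norm (x - y) * e"
  proof (rule differentiable_bound_linearization[where S = "ball x0 d"])
   show "y + t *\<^sub>R (x - y) \<in> ball x0 d" if "t \<in> {0..1}" for t
    using convexD_alt[OF convex_ball xy(2,1), of t] that by (simp add: algebra_simps)
   show "onorm (f' x - f' x0) <= e" if "x \<in> ball x0 d" for x using on[OF that] by (simp add: fun_diff_def)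
   show "(f has_derivative f' x) (at x within ball x0 d)" if "x \<in> ball x0 d" for x
    by (rule has_derivative_at_withinI[OF der]) (use that d in blast)
  qed (use d in auto)
  thus ?thesis by (simp add: mult.commute)
 qed
 thus ?thesis using d unfolding f'_def by blast
qed

lemma product_span:
 fixes A :: "'e::real_normed_vector set"
 assumes "finite A" "span A = UNIV"
 shows "\<exists>A'. finite A' & span A' = (UNIV :: ('e \<times> 'e) set)"
proof (intro exI conjI)
 let ?A = "(\<lambda>x. (x, 0)) ` A \<union> (\<lambda>x. (0, x)) ` A"
 have l: "linear (\<lambda>x. (x, 0 :: 'e))" "linear (\<lambda>x. (0 :: 'e, x))" by (auto intro!: linearI)
 have "(x, y) \<in> span ?A" for x y
  unfolding span_Un linear_span_image[OF l(1)] linear_span_image[OF l(2)] assms(2) by force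
 thus "span ?A = UNIV" by auto
qed (use assms in auto)

section \<open>The norm of a Lie group given by a chart\<close>

locale lie_chart = lie_group G T \<A>
 for G :: "('g, 'm) monoid_scheme" (structure) and T
  and \<A> :: "('g set \<times> ('g => 'e::real_normed_vector)) set" +
 fixes U :: "'g set" and phi :: "'g => 'e"
 assumes chart_in: "(U, phi) \<in> \<A>" and one_U: "\<one> \<in> U"
begin

text \<open>The default 1 outside the chart makes \<open>cnorm x < d\<close> with
  \<open>d <= 1\<close> force \<open>x\<close> into \<open>U\<close>; this is the reason for capping
  radii by 1.\<close>

definition cnorm :: "'g => real" where
 "cnorm x = (if x \<in> U then norm (phi x - phi \<one>) else 1)"

definition psi :: "'e => 'g" where "psi = inv_into U phi"

lemma chartD: "openin T U" "open (phi ` U)" "homeomorphic_map (subtopology T U) (top_of_set (phi ` U)) phi"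
 using atlas chart_in unfolding smooth_atlas_def chart_def by auto

lemma U_carrier: "U \<subseteq> carrier G"
 using openin_subset[OF chartD(1)] by (simp add: topspace_eq)

lemma top_U: "topspace (subtopology T U) = U"
 using openin_subset[OF chartD(1)] by (simp add: inf.absorb2)

lemma inj_chart: "inj_on phi U"
 using homeomorphic_imp_injective_map[OF chartD(3)] by (simp only: top_U)

lemma psi: "u \<in> phi ` U ==> psi u \<in> U" "u \<in> phi ` U ==> phi (psi u) = u" "x \<in> U ==> psi (phi x) = x"
 by (simp_all add: psi_def inv_into_into f_inv_into_f inj_chart)

lemma continuous_psi: "continuous_map (top_of_set (phi ` U)) T psi"
proof -
 obtain g where g: "homeomorphic_maps (subtopology T U) (top_of_set (phi ` U)) phi g"
  using chartD(3) homeomorphic_map_maps by blast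
 hence "continuous_map (top_of_set (phi ` U)) T g" unfolding homeomorphic_maps_def using continuous_map_in_subtopology by blast
 moreover have "g u = psi u" if "u \<in> phi ` U" for u using g that psi(3) unfolding homeomorphic_maps_def top_U by force
 ultimately show ?thesis by (rule continuous_map_eq) simp
qed

lemma small_in_open:
 assumes "openin T W" "\<one> \<in> W"
 shows "\<exists>d>0. d <= 1 & (\<forall>x. cnorm x < d --> x \<in> W)"
proof -
 have "openin (subtopology T U) (U \<inter> W)" using assms(1) by (auto simp: openin_subtopology)
 hence "openin (top_of_set (phi ` U)) (phi ` (U \<inter> W))" using homeomorphic_imp_open_map[OF chartD(3)] by (simp add: open_map_def)
 hence "open (phi ` (U \<inter> W))" using chartD(2) by (simp add: openin_open_eq)
 then obtain d where d: "d > 0" "ball (phi \<one>) d \<subseteq> phi ` (U \<inter> W)" using assms(2) one_U open_contains_ball by (metis IntI imageI)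
 have "x \<in> W" if "cnorm x < min d 1" for x
 proof -
  have x: "x \<in> U" "phi x \<in> ball (phi \<one>) d" using that by (auto simp: cnorm_def dist_norm norm_minus_commute split: if_splits)
  then obtain y where "y \<in> U" "y \<in> W" "phi x = phi y" using d(2) by blast
  thus ?thesis using inj_onD[OF inj_chart] x(1) by metis
 qed
 thus ?thesis using d(1) by (intro exI[of _ "min d 1"]) auto
qed

lemma open_small: 
 assumes "d <= 1" shows "openin T {x \<in> carrier G. cnorm x < d}"
proof -
 have "openin (subtopology T U) {x \<in> topspace (subtopology T U). phi x \<in> ball (phi \<one>) d}"
  by (rule openin_continuous_map_preimage[of _ euclidean])
   (use homeomorphic_imp_continuous_map[OF chartD(3)] continuous_map_in_subtopology in auto)
 hence "openin T {x \<in> U. dist (phi \<one>) (phi x) < d}" by (simp only: top_U openin_open_subtopology[OF chartD(1)] mem_ball)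
 moreover have "{x \<in> U. dist (phi \<one>) (phi x) < d} = {x \<in> carrier G. cnorm x < d}"
  using U_carrier assms by (auto simp: cnorm_def dist_norm norm_minus_commute split: if_splits)
 ultimately show ?thesis by simp
qed

lemma cnorm_one: "cnorm \<one> = 0"
 using one_U by (simp add: cnorm_def)

lemma small_continuous:
 assumes "continuous_map T T h" "h \<one> = \<one>" "e > 0"
 shows "\<exists>d>0. d <= 1 & (\<forall>x\<in>carrier G. cnorm x < d --> cnorm (h x) < e)"
proof -
 have "openin T {x \<in> topspace T. h x \<in> {x \<in> carrier G. cnorm x < min e 1}}"
  by (rule openin_continuous_map_preimage[OF assms(1) open_small]) simp
 moreover have "\<one> \<in> {x \<in> topspace T. h x \<in> {x \<in> carrier G. cnorm x < min e 1}}"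
  using assms by (simp add: topspace_eq cnorm_one)
 ultimately show ?thesis using small_in_open by fastforce
qed

lemma continuous_mult_const:
 assumes "a \<in> carrier G" "b \<in> carrier G" shows "continuous_map T T (\<lambda>x. a \<otimes> x \<otimes> b)"
proof -
 have "continuous_map T T (\<lambda>x. (\<lambda>(x, y). x \<otimes> y) ((\<lambda>x. (\<lambda>(x, y). x \<otimes> y) (a, x)) x, b))"
  by (intro continuous_map_compose[OF _ continuous_mult, unfolded o_def] continuous_map_pairedI)
   (use assms in "auto simp: topspace_eq")
 thus ?thesis by simp
qed

lemma small_conj: "e > 0 ==> g \<in> carrier G ==> \<exists>d>0. \<forall>u\<in>carrier G. cnorm u < d --> cnorm (g \<otimes> u \<otimes> inv g) < e"
 using small_continuous[OF continuous_mult_const[of g "inv g"]] by fastforce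

definition m :: "'e \<times> 'e => 'e" where "m = (\<lambda>(u, v). phi (psi u \<otimes> psi v))"

text \<open>Multiplication by the identity fixes either coordinate, so the derivative of the product
  at the identity is addition, and strict differentiability bounds the deviation from it. The margin
  \<open>1/8\<close> yields the factors \<open>9/8\<close>, \<open>2\<close> and \<open>2/3\<close>
  of \<open>root_norm\<close>.\<close>

lemma strict_mult:
 obtains r where "r > 0" "ball (phi \<one>) r \<subseteq> phi ` U"
  "!!u v. u \<in> ball (phi \<one>) r ==> v \<in> ball (phi \<one>) r ==> psi u \<otimes> psi v \<in> U"
  "!!u v u' v'. u \<in> ball (phi \<one>) r ==> v \<in> ball (phi \<one>) r ==> u' \<in> ball (phi \<one>) r ==> v' \<in> ball (phi \<one>) r ==>
    norm (m (u, v) - m (u', v') - ((u - u') + (v - v'))) <= 1/8 * (norm (u - u') + norm (v - v'))"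
proof -
 define p where "p = phi \<one>"
 let ?P = "phi ` U"
 define \<Omega> where "\<Omega> = {(u, v). u \<in> ?P & v \<in> ?P & psi u \<otimes> psi v \<in> U}"
 have "continuous_map (top_of_set (?P \<times> ?P)) T (\<lambda>z. (\<lambda>(x, y). x \<otimes> y) (psi (fst z), psi (snd z)))"
  by (intro continuous_map_compose[OF _ continuous_mult, unfolded o_def] continuous_map_pairedI
     continuous_map_compose[OF _ continuous_psi, unfolded o_def])
   (auto simp: continuous_map_in_subtopology continuous_on_fst continuous_on_snd continuous_on_id)
 from openin_continuous_map_preimage[OF this chartD(1)]
 have "openin (top_of_set (?P \<times> ?P)) {z \<in> ?P \<times> ?P. psi (fst z) \<otimes> psi (snd z) \<in> U}" by simp
 moreover have "{z \<in> ?P \<times> ?P. psi (fst z) \<otimes> psi (snd z) \<in> U} = \<Omega>" by (auto simp: \<Omega>_def)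
 ultimately have op: "open \<Omega>" using chartD(2) by (simp add: openin_open_eq open_Times)
 have p: "p \<in> ?P" "psi p = \<one>" using one_U psi by (auto simp: p_def)
 have p\<Omega>: "(p, p) \<in> \<Omega>" using p one_U by (simp add: \<Omega>_def)
 have "smooth_on \<Omega> m" using smooth_mult[OF chart_in chart_in chart_in] by (simp add: \<Omega>_def m_def psi_def)
 hence sm: "C_k_on 1 \<Omega> m" by (simp add: smooth_on_def)
 obtain A where A: "finite A" "span A = (UNIV :: ('e \<times> 'e) set)" using finite_dim product_span by blast
 obtain d where d: "d > 0" "ball (p, p) d \<subseteq> \<Omega>"
  "!!x y. x \<in> ball (p, p) d ==> y \<in> ball (p, p) d ==> norm (m x - m y - frechet_derivative m (at (p, p)) (x - y)) <= 1/8 * norm (x - y)"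
  using strict_derivative[OF A op p\<Omega> sm, of "1/8"] zero_less_divide_1_iff[of "8 :: real"] zero_less_numeral by blast
 define D where "D = frechet_derivative m (at (p, p))"
 have D: "(m has_derivative D) (at (p, p))" using sm p\<Omega> frechet_derivative_works by (auto simp: D_def)
 have slice: "D (\<iota> h) = h" if \<iota>: "bounded_linear \<iota>" and q: "!!u. u \<in> ?P ==> m (q + \<iota> u) = u" and pq: "q + \<iota> p = (p, p)" for \<iota> q h
 proof -
  have "((\<lambda>u. q + \<iota> u) has_derivative (\<lambda>h. \<iota> h)) (at p)"
   using has_derivative_add[OF has_derivative_const bounded_linear.has_derivative[OF \<iota> has_derivative_ident]] by simp
  from has_derivative_compose[OF this, of m D] have 1: "((\<lambda>u. m (q + \<iota> u)) has_derivative (\<lambda>h. D (\<iota> h))) (at p)"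
   using D by (simp add: pq)
  have "((\<lambda>u. m (q + \<iota> u)) has_derivative (\<lambda>h. h)) (at p)"
   by (rule has_derivative_transform_within_open[OF has_derivative_ident chartD(2) p(1)]) (simp add: q)
  from has_derivative_unique[OF 1 this] show ?thesis by metis
 qed
 have m0: "m (u, p) = u" "m (p, u) = u" if "u \<in> ?P" for u
  using psi(1,2)[OF that] p(2) U_carrier by (auto simp: m_def)
 have "D (h, 0) = h" for h by (rule slice[of "\<lambda>h. (h, 0)" "(0, p)"]) (auto simp: m0 intro!: bounded_linear_intros)
 moreover have "D (0, h) = h" for h by (rule slice[of "\<lambda>h. (0, h)" "(p, 0)"]) (auto simp: m0 intro!: bounded_linear_intros)
 moreover have "D ((h, 0) + (0, k)) = D (h, 0) + D (0, k)" for h k by (rule linear_add[OF has_derivative_linear[OF D]])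
 ultimately have D_eq: "D (h, k) = h + k" for h k by (metis add_Pair add.right_neutral add.left_neutral)
 have b: "(u, v) \<in> ball (p, p) d" if "u \<in> ball p (d / 2)" "v \<in> ball p (d / 2)" for u v
  using that norm_Pair_le[of "p - u" "p - v"] by (simp add: dist_norm)
 show ?thesis
 proof (rule that[of "d / 2"])
  show "d / 2 > 0" using d(1) by simp
  show "ball (phi \<one>) (d / 2) \<subseteq> ?P"
  proof
   fix u assume "u \<in> ball (phi \<one>) (d / 2)"
   hence "(u, u) \<in> \<Omega>" using b[of u u] d(2) by (auto simp: p_def)
   thus "u \<in> ?P" by (simp add: \<Omega>_def)
  qed
  show "psi u \<otimes> psi v \<in> U" if "u \<in> ball (phi \<one>) (d / 2)" "v \<in> ball (phi \<one>) (d / 2)" for u v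
   using b[of u v] d(2) that by (auto simp: \<Omega>_def p_def[symmetric])
  fix u v u' v' assume "u \<in> ball (phi \<one>) (d / 2)" "v \<in> ball (phi \<one>) (d / 2)" "u' \<in> ball (phi \<one>) (d / 2)" "v' \<in> ball (phi \<one>) (d / 2)"
  hence "norm (m (u, v) - m (u', v') - ((u - u') + (v - v'))) <= 1/8 * norm (u - u', v - v')"
   using d(3)[OF b b, of u v u' v'] by (simp add: p_def[symmetric] D_def[symmetric] D_eq)
  also have "... <= 1/8 * (norm (u - u') + norm (v - v'))" using norm_Pair_le by (intro mult_left_mono) auto
  finally show "norm (m (u, v) - m (u', v') - ((u - u') + (v - v'))) <= 1/8 * (norm (u - u') + norm (v - v'))" .
 qed
qed

lemma root_norm_properties:
 obtains r0 D C where "r0 > 0" "r0 <= 1"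
  "!!x y. x \<in> carrier G ==> y \<in> carrier G ==> cnorm x < r0 ==> cnorm y < r0 ==> cnorm (x \<otimes> y) <= 9/8 * (cnorm x + cnorm y)"
  "!!x. x \<in> carrier G ==> cnorm x < r0 ==> cnorm (inv x) <= 2 * cnorm x"
  "!!x. x \<in> carrier G ==> cnorm x < r0 ==> \<exists>r\<in>carrier G. r \<otimes> r = x & cnorm r <= 2/3 * cnorm x"
  "!!rho W. 0 < rho ==> rho <= 1 ==> finite W ==> W \<subseteq> carrier G ==> (\<forall>w\<in>W. cnorm w < r0) ==>
   (\<forall>w\<in>W. \<forall>w'\<in>W. w ~= w' --> rho <= cnorm (inv w \<otimes> w')) ==> real (card W) <= C * (1 / rho) ^ D"
proof -
 define p where "p = phi \<one>"
 obtain r where r: "r > 0" "ball p r \<subseteq> phi ` U" "!!u v. u \<in> ball p r ==> v \<in> ball p r ==> psi u \<otimes> psi v \<in> U"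
  "!!u v u' v'. u \<in> ball p r ==> v \<in> ball p r ==> u' \<in> ball p r ==> v' \<in> ball p r ==>
    norm (m (u, v) - m (u', v') - ((u - u') + (v - v'))) <= 1/8 * (norm (u - u') + norm (v - v'))"
  unfolding p_def by (rule strict_mult) blast
 define r1 where "r1 = min r 1"
 have r1: "r1 > 0" "r1 <= 1" using r(1) by (auto simp: r1_def)
 obtain d where d: "d > 0" "d <= 1" "!!x. x \<in> carrier G ==> cnorm x < d ==> cnorm (inv x) < r1"
  using small_continuous[OF continuous_inv _ r1(1)] by auto
 define r0 where "r0 = min d r1"
 have r0: "r0 > 0" "r0 <= 1" using d r1 by (auto simp: r0_def)
 have loc: "x \<in> U & phi x \<in> ball p r & cnorm x = norm (phi x - p)" if "cnorm x < r1" for x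
  using that by (auto simp: cnorm_def r1_def p_def dist_norm norm_minus_commute split: if_splits)
 have loc': "cnorm (psi u) = norm (u - p) & psi u \<in> U & phi (psi u) = u" if "u \<in> ball p r" for u
  using psi(1,2)[of u] r(2) that by (auto simp: cnorm_def p_def)
 have pr: "p \<in> ball p r" using r(1) by simp
 have pp: "psi p = \<one>" using psi(3)[OF one_U] by (simp add: p_def)
 have m1: "m (p, p) = p" using pp by (simp add: m_def p_def)
 have mm: "x \<otimes> y \<in> U & cnorm (x \<otimes> y) = norm (m (phi x, phi y) - p)" if "cnorm x < r1" "cnorm y < r1" for x y
  using r(3)[of "phi x" "phi y"] loc[OF that(1)] loc[OF that(2)] psi(3) by (simp add: m_def cnorm_def p_def)
 show ?thesis
 proof -
  obtain A where A: "finite A" "span A = (UNIV :: 'e set)" using finite_dim by blast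
  obtain D C where C: "C >= 0" "!!rho W. 0 < rho ==> rho <= 1 ==> W \<subseteq> ball p 1 ==>
   (\<forall>w\<in>W. \<forall>w'\<in>W. w ~= w' --> rho <= norm (w - w')) ==> real (card W) <= C * (1 / rho) ^ D"
   using finite_dim_packing[OF A, of p 1] by blast
  have sum_le: "norm (m (u, v) - p) <= 9/8 * (norm (u - p) + norm (v - p))" if "u \<in> ball p r" "v \<in> ball p r" for u v
   using r(4)[OF that pr pr] norm_triangle_ineq2[of "m (u, v) - p" "(u - p) + (v - p)"] norm_triangle_ineq[of "u - p" "v - p"]
   unfolding m1 by argo
  show ?thesis
  proof (rule that[of r0 "C * 2 ^ D" D, OF r0])
   fix x assume x: "x \<in> carrier G" "cnorm x < r0"
   have x1: "cnorm x < r1" using x by (simp add: r0_def)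
   have i1: "cnorm (inv x) < r1" using d(3) x by (simp add: r0_def)
   show "cnorm (inv x) <= 2 * cnorm x"
   proof -
    have "m (phi x, phi (inv x)) = p" using psi(3) loc[OF x1] loc[OF i1] x by (simp add: m_def p_def)
    hence "norm ((phi x - p) + (phi (inv x) - p)) <= 1/8 * (cnorm x + cnorm (inv x))"
     using r(4)[of "phi x" "phi (inv x)" p p] loc[OF x1] loc[OF i1] pr m1
     by (metis diff_self norm_minus_cancel diff_0)
    moreover have "norm (phi (inv x) - p) <= norm ((phi x - p) + (phi (inv x) - p)) + norm (phi x - p)"
     using norm_triangle_ineq4[of "(phi x - p) + (phi (inv x) - p)" "phi x - p"] by simp
    ultimately have "cnorm (inv x) <= 1/8 * (cnorm x + cnorm (inv x)) + cnorm x" using loc[OF x1] loc[OF i1] by linarith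
    moreover have "0 <= cnorm x" by (simp add: cnorm_def)
    ultimately show ?thesis by argo
   qed
   show "\<exists>s\<in>carrier G. s \<otimes> s = x & cnorm s <= 2/3 * cnorm x"
   proof -
    define R where "R = 2/3 * cnorm x"
    define u where "u = phi x"
    have u: "norm (u - p) = cnorm x" "u \<in> ball p r" using loc[OF x1] by (auto simp: u_def)
    have Rr: "cball p R \<subseteq> ball p r" using x1 loc[OF x1] by (auto simp: R_def r1_def) (smt (verit) norm_ge_zero)
    \<comment> \<open>A simplified Newton iteration for \<open>m (s, s) = u\<close>. Squaring is
      nearly doubling, so \<open>F\<close> contracts by \<open>1/8\<close>; it preserves the ball of
      radius \<open>R\<close> since \<open>cnorm x = 3/2 * R\<close> and
      \<open>1/8 + 3/4 < 1\<close>.\<close>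
    define F where "F s = s + (1/2) *\<^sub>R (u - m (s, s))" for s
    have "\<exists>!s\<in>cball p R. F s = s"
    proof (rule Banach_fix[OF compact_imp_complete[OF finite_dim_compact_cball[OF A, of p R]], where c = "1/8"])
     show "cball p R ~= {}" using loc[OF x1] by (simp add: R_def)
     have key: "norm (m (s, s) - m (t, t) - 2 *\<^sub>R (s - t)) <= 1/4 * norm (s - t)" if "s \<in> cball p R" "t \<in> cball p R" for s t
      using r(4)[of s s t t] that Rr by (simp add: subset_iff scaleR_2)
     show "dist (F s) (F t) <= 1/8 * dist s t" if "s \<in> cball p R" "t \<in> cball p R" for s t
     proof -
      have "F s - F t = (- 1/2) *\<^sub>R (m (s, s) - m (t, t) - 2 *\<^sub>R (s - t))" by (simp add: F_def algebra_simps)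
      hence "norm (F s - F t) = 1/2 * norm (m (s, s) - m (t, t) - 2 *\<^sub>R (s - t))" by simp
      thus ?thesis using key[OF that] by (simp add: dist_norm)
     qed
     show "F ` cball p R \<subseteq> cball p R"
     proof clarify
      fix s assume s: "s \<in> cball p R"
      have pR: "p \<in> cball p R" using loc[OF x1] by (simp add: R_def)
      have "F s - p = (- 1/2) *\<^sub>R (m (s, s) - m (p, p) - 2 *\<^sub>R (s - p)) + (1/2) *\<^sub>R (u - p)"
       unfolding F_def m1 by (simp add: algebra_simps flip: scaleR_2)
      hence "norm (F s - p) <= norm ((- 1/2) *\<^sub>R (m (s, s) - m (p, p) - 2 *\<^sub>R (s - p))) + norm ((1/2) *\<^sub>R (u - p))"
       by (simp only: norm_triangle_ineq)
      also have "... <= 1/8 * norm (s - p) + 1/2 * norm (u - p)" using key[OF s pR] by simp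
      also have "... <= 1/8 * R + 1/2 * cnorm x" using s u(1) by (simp add: dist_norm norm_minus_commute)
      also have "... <= R" using loc[OF x1] by (simp add: R_def)
      finally show "F s \<in> cball p R" by (simp add: dist_norm norm_minus_commute)
     qed
    qed auto
    then obtain s where s: "s \<in> cball p R" "F s = s" by (elim ex1E) blast
    have sr: "s \<in> ball p r" using s Rr by blast
    have "m (s, s) = u" using s(2) by (simp add: F_def)
    hence "phi (psi s \<otimes> psi s) = phi x" by (simp add: m_def u_def)
    hence "psi s \<otimes> psi s = x" using inj_onD[OF inj_chart] r(3)[OF sr sr] loc[OF x1] by blast
    moreover have "cnorm (psi s) <= 2/3 * cnorm x" using loc'[OF sr] s(1) by (simp add: R_def dist_norm norm_minus_commute)
    moreover have "psi s \<in> carrier G" using loc'[OF sr] U_carrier by blast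
    ultimately show ?thesis by blast
   qed
   fix y assume "y \<in> carrier G" "cnorm y < r0"
   hence y1: "cnorm y < r1" by (simp add: r0_def)
   show "cnorm (x \<otimes> y) <= 9/8 * (cnorm x + cnorm y)"
    using mm[OF x1 y1] loc[OF x1] loc[OF y1] sum_le[of "phi x" "phi y"] by simp
  next
   fix rho W assume rho: "0 < rho" "rho <= 1" and W: "finite W" "W \<subseteq> carrier G" "\<forall>w\<in>W. cnorm w < r0"
    and sep: "\<forall>w\<in>W. \<forall>w'\<in>W. w ~= w' --> rho <= cnorm (inv w \<otimes> w')"
   have W1: "cnorm w < r1" "cnorm (inv w) < r1" if "w \<in> W" for w using W that d(3)[of w] by (auto simp: r0_def)
   \<comment> \<open>Left translation by \<open>inv w\<close> changes differences in the chart by at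
     most \<open>1/8\<close> of their length, so separation in the group gives separation in the
     chart.\<close>
   have far: "rho / 2 <= norm (phi w - phi w')" if w: "w \<in> W" "w' \<in> W" "w ~= w'" for w w'
   proof -
    have "m (phi (inv w), phi w) = p" using psi(3) loc[OF W1(1)[OF w(1)]] loc[OF W1(2)[OF w(1)]] w(1) W(2) by (auto simp: m_def p_def)
    hence "norm (m (phi (inv w), phi w') - p - (phi w' - phi w)) <= 1/8 * norm (phi w' - phi w)"
     using r(4)[of "phi (inv w)" "phi w'" "phi (inv w)" "phi w"] loc W1 w by simp
    moreover have "rho <= norm (m (phi (inv w), phi w') - p)" using sep[rule_format, OF w] mm[OF W1(2)[OF w(1)] W1(1)[OF w(2)]] by simp
    ultimately show ?thesis
     using norm_triangle_ineq2[of "m (phi (inv w), phi w') - p" "phi w' - phi w"] norm_minus_commute[of "phi w" "phi w'"] rho(1)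
      norm_ge_zero[of "phi w' - phi w"] by argo
   qed
   have "inj_on phi W" using inj_on_subset[OF inj_chart] loc W1(1) by blast
   hence "real (card W) = real (card (phi ` W))" by (simp add: card_image)
   also have "... <= C * (1 / (rho / 2)) ^ D"
   proof (rule C(2))
    show "phi ` W \<subseteq> ball p 1"
    proof clarify
     fix w assume "w \<in> W"
     thus "phi w \<in> ball p 1" using loc[OF W1(1)] W1(1)[of w] r1(2) by (simp add: dist_norm norm_minus_commute)
    qed
    show "\<forall>w\<in>phi ` W. \<forall>w'\<in>phi ` W. w ~= w' --> rho / 2 <= norm (w - w')" using far by auto
   qed (use rho in auto)
   also have "... = C * 2 ^ D * (1 / rho) ^ D" by (simp add: power_divide)
   finally show "real (card W) <= C * 2 ^ D * (1 / rho) ^ D" .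
  qed
 qed
qed

end

section \<open>Nilsequences\<close>

text \<open>The permutations of a type form an additively written group that contains, by left
 translation, every group carried by a subset of the type.\<close>

typedef 'a sym = "{f :: 'a => 'a. bij f}" by (rule exI[of _ id]) simp

instantiation sym :: (type) group_add
begin

definition zero_sym :: "'a sym" where "0 = Abs_sym id"
definition plus_sym :: "'a sym => 'a sym => 'a sym" where "f + g = Abs_sym (Rep_sym f \<circ> Rep_sym g)"
definition uminus_sym :: "'a sym => 'a sym" where "- f = Abs_sym (inv_into UNIV (Rep_sym f))"
definition minus_sym :: "'a sym => 'a sym => 'a sym" where "f - g = f + - (g :: 'a sym)"

lemma Rep_sym_bij: "bij (Rep_sym f)" using Rep_sym[of f] by simp

lemma Rep_sym_simps: "Rep_sym (f + g) = Rep_sym f \<circ> Rep_sym g" "Rep_sym 0 = id" "Rep_sym (- f) = inv_into UNIV (Rep_sym f)"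
 by (simp_all add: plus_sym_def zero_sym_def uminus_sym_def Abs_sym_inverse bij_comp bij_imp_bij_inv Rep_sym_bij)

instance
 by standard (simp_all add: Rep_sym_inject[symmetric] Rep_sym_simps minus_sym_def o_assoc bij_is_inj Rep_sym_bij)

end

section \<open>Transfer of a nilsystem to the additive setting\<close>

locale nil_chart = nilsystem G T \<A> \<Gamma> a + lie_chart G T \<A> U phi
 for G :: "('g, 'm) monoid_scheme" (structure) and T
  and \<A> :: "('g set \<times> ('g => 'e::real_normed_vector)) set" and \<Gamma> a U phi
begin

text \<open>Points outside the carrier are left fixed, so that left translation becomes a
  permutation of the whole type.\<close>

definition emb :: "'g => 'g sym" where "emb x = Abs_sym (\<lambda>y. if y \<in> carrier G then x \<otimes> y else y)"
definition dec :: "'g sym => 'g" where "dec s = Rep_sym s \<one>"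

lemma Rep_emb: "x \<in> carrier G ==> Rep_sym (emb x) = (\<lambda>y. if y \<in> carrier G then x \<otimes> y else y)"
 unfolding emb_def by (rule Abs_sym_inverse, simp, rule o_bij[where g = "\<lambda>y. if y \<in> carrier G then inv x \<otimes> y else y"])
  (auto simp: fun_eq_iff inv_solve_left m_assoc[symmetric])

lemma dec_emb [simp]: "x \<in> carrier G ==> dec (emb x) = x"
 by (simp add: dec_def Rep_emb)

lemma emb_hom: "x \<in> carrier G ==> y \<in> carrier G ==> emb x + emb y = emb (x \<otimes> y)" "0 = emb \<one>"
 "x \<in> carrier G ==> - emb x = emb (inv x)"
proof -
 show 1: "emb x + emb y = emb (x \<otimes> y)" if "x \<in> carrier G" "y \<in> carrier G" for x y
  using that by (auto simp: Rep_sym_inject[symmetric] Rep_sym_simps Rep_emb fun_eq_iff m_assoc)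
 show 0: "0 = emb \<one>" by (auto simp: Rep_sym_inject[symmetric] Rep_sym_simps Rep_emb fun_eq_iff)
 show "- emb x = emb (inv x)" if "x \<in> carrier G"
  using 1[of x "inv x"] 0 that by (simp add: minus_unique)
qed

lemma nmul_emb: "x \<in> carrier G ==> nmul n (emb x) = emb (x [^] n)"
proof (induction n)
 case (Suc n) thus ?case using emb_hom(1)[of x "x [^] n"] nat_pow_Suc2[of x n] by simp
qed (simp add: emb_hom(2))

lemma subgrp_emb: "subgroup H G ==> subgrp (emb ` H)"
 unfolding subgrp_def
 by (auto simp: emb_hom subgroup.mem_carrier intro!: imageI subgroup.one_closed subgroup.m_closed subgroup.m_inv_closed)

lemma coset_eq_iff:
 assumes "x \<in> carrier G" "y \<in> carrier G"
 shows "x <# \<Gamma> = y <# \<Gamma> \<longleftrightarrow> (\<exists>gamma\<in>\<Gamma>. y = x \<otimes> gamma)"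
proof
 assume "x <# \<Gamma> = y <# \<Gamma>"
 moreover have "y \<in> y <# \<Gamma>" using subgroup.one_closed[OF subgroup] assms by (force simp: l_coset_def)
 ultimately show "\<exists>gamma\<in>\<Gamma>. y = x \<otimes> gamma" by (auto simp: l_coset_def)
next
 assume "\<exists>gamma\<in>\<Gamma>. y = x \<otimes> gamma"
 hence "y \<in> x <# \<Gamma>" by (auto simp: l_coset_def)
 thus "x <# \<Gamma> = y <# \<Gamma>" using l_repr_independence[OF _ assms(1) subgroup] by blast
qed

text \<open>The sets \<open>V c\<close> are open in the quotient, because their preimages are unions
  of translates of small neighbourhoods by \<open>\<Gamma>\<close>, and compactness selects finitely
  many. The radius may depend on the centre \<open>c\<close>, as the proof of uniform continuity
  requires.\<close>

lemma cover:
 assumes d: "!!c. c \<in> carrier G ==> 0 < d c & d c <= 1"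
 shows "\<exists>C. finite C & C \<subseteq> carrier G & (\<forall>h\<in>carrier G. \<exists>v\<in>carrier G. \<exists>c\<in>C. \<exists>gamma\<in>\<Gamma>. cnorm v < d c & h = v \<otimes> c \<otimes> gamma)"
proof -
 have \<Gamma>: "gamma \<in> carrier G" if "gamma \<in> \<Gamma>" for gamma by (rule subgroup.mem_carrier[OF subgroup that])
 let ?q = "\<lambda>x. x <# \<Gamma>"
 define V where "V c = ?q ` {v \<otimes> c | v. v \<in> carrier G & cnorm v < d c}" for c
 have qV: "?q x \<in> V c \<longleftrightarrow> (\<exists>gamma\<in>\<Gamma>. cnorm (x \<otimes> gamma \<otimes> inv c) < d c)" if x: "x \<in> carrier G" and c: "c \<in> carrier G" for x c
 proof
  assume "?q x \<in> V c"
  then obtain v where v: "v \<in> carrier G" "cnorm v < d c" "?q x = ?q (v \<otimes> c)" by (auto simp: V_def)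
  then obtain gamma where "gamma \<in> \<Gamma>" "v \<otimes> c = x \<otimes> gamma" using coset_eq_iff[OF x, of "v \<otimes> c"] c by auto
  thus "\<exists>gamma\<in>\<Gamma>. cnorm (x \<otimes> gamma \<otimes> inv c) < d c" using v c by (metis inv_solve_right m_closed)
 next
  assume "\<exists>gamma\<in>\<Gamma>. cnorm (x \<otimes> gamma \<otimes> inv c) < d c"
  then obtain gamma where gamma: "gamma \<in> \<Gamma>" "cnorm (x \<otimes> gamma \<otimes> inv c) < d c" by blast
  have "x \<otimes> gamma \<otimes> inv c \<otimes> c = x \<otimes> gamma" using x c \<Gamma>[OF gamma(1)] by (simp add: m_assoc)
  hence "x \<otimes> gamma \<in> {v \<otimes> c | v. v \<in> carrier G & cnorm v < d c}"
   using x c \<Gamma>[OF gamma(1)] gamma(2) by (intro CollectI exI[of _ "x \<otimes> gamma \<otimes> inv c"]) simp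
  moreover have "?q x = ?q (x \<otimes> gamma)" using coset_eq_iff x \<Gamma>[OF gamma(1)] gamma(1) by auto
  ultimately show "?q x \<in> V c" unfolding V_def by blast
 qed
 have "openin (coset_space G T \<Gamma>) (V c)" if c: "c \<in> carrier G" for c
  unfolding coset_space_def openin_quotient_topology
 proof
  show "V c \<subseteq> ?q ` topspace T" using c by (auto simp: V_def topspace_eq)
  have "openin T {x \<in> topspace T. \<one> \<otimes> x \<otimes> (gamma \<otimes> inv c) \<in> {x \<in> carrier G. cnorm x < d c}}" if "gamma \<in> \<Gamma>" for gamma
   by (rule openin_continuous_map_preimage[OF continuous_mult_const open_small]) (use that \<Gamma> c d in auto)
  hence "openin T (\<Union>gamma\<in>\<Gamma>. {x \<in> topspace T. \<one> \<otimes> x \<otimes> (gamma \<otimes> inv c) \<in> {x \<in> carrier G. cnorm x < d c}})" by blast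
  also have "(\<Union>gamma\<in>\<Gamma>. {x \<in> topspace T. \<one> \<otimes> x \<otimes> (gamma \<otimes> inv c) \<in> {x \<in> carrier G. cnorm x < d c}}) = {x \<in> topspace T. ?q x \<in> V c}"
   using qV[OF _ c] \<Gamma> c by (auto simp: topspace_eq m_assoc)
  finally show "openin T {x \<in> topspace T. ?q x \<in> V c}" .
 qed
 moreover have "c <# \<Gamma> \<in> V c" if c: "c \<in> carrier G" for c
  using qV[OF c c] subgroup.one_closed[OF subgroup] c d[OF c] by (intro iffD2[OF qV[OF c c]] bexI[of _ \<one>]) (auto simp: cnorm_one)
 hence "(\<Union>c\<in>carrier G. V c) = topspace (coset_space G T \<Gamma>)"
  by (auto simp: V_def coset_space_def topspace_eq)
 ultimately have "(\<forall>W\<in>V ` carrier G. openin (coset_space G T \<Gamma>) W) & \<Union>(V ` carrier G) = topspace (coset_space G T \<Gamma>)" by blast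
 from cocompact[unfolded compact_space, rule_format, OF this]
 obtain F where F: "finite F" "F \<subseteq> V ` carrier G" "\<Union>F = topspace (coset_space G T \<Gamma>)" by (elim exE conjE)
 obtain C where C: "C \<subseteq> carrier G" "finite C" "F = V ` C" using finite_subset_image[OF F(1,2)] by blast
 have "\<exists>v\<in>carrier G. \<exists>c\<in>C. \<exists>gamma\<in>\<Gamma>. cnorm v < d c & h = v \<otimes> c \<otimes> gamma" if h: "h \<in> carrier G" for h
 proof -
  have "?q h \<in> \<Union>F" unfolding F(3) using h by (simp add: coset_space_def topspace_eq)
  then obtain c where c: "c \<in> C" "?q h \<in> V c" using C(3) by blast
  then obtain v where v: "v \<in> carrier G" "cnorm v < d c" "?q (v \<otimes> c) = ?q h" by (auto simp: V_def)
  thus ?thesis using coset_eq_iff[of "v \<otimes> c" h] c C(1) h by blast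
 qed
 thus ?thesis using C(1,2) by blast
qed

text \<open>A Lebesgue number argument for left translations: at each centre \<open>c\<close>
  continuity gives a radius that leaves room for two small factors, and finitely many centres
  suffice modulo \<open>\<Gamma>\<close>.\<close>

lemma uniformly_continuous:
 assumes f: "continuous_map (coset_space G T \<Gamma>) euclidean f" and e: "e > (0::real)"
 shows "\<exists>d>0. \<forall>v\<in>carrier G. \<forall>g\<in>carrier G. cnorm v < d --> norm (f ((v \<otimes> g) <# \<Gamma>) - f (g <# \<Gamma>) :: complex) < e"
proof -
 obtain r0 where r0: "r0 > 0" "r0 <= 1" "!!x y. x \<in> carrier G ==> y \<in> carrier G ==> cnorm x < r0 ==> cnorm y < r0 ==> cnorm (x \<otimes> y) <= 9/8 * (cnorm x + cnorm y)"
  by (rule root_norm_properties) blast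
 define f0 where "f0 x = f (x <# \<Gamma>)" for x
 have f0\<Gamma>: "f0 (x \<otimes> gamma) = f0 x" if "x \<in> carrier G" "gamma \<in> \<Gamma>" for x gamma
  using coset_eq_iff[of x "x \<otimes> gamma"] that subgroup.mem_carrier[OF subgroup that(2)] by (auto simp: f0_def)
 have cf: "continuous_map T euclidean f0"
  using continuous_map_compose[OF quotient_imp_continuous_map[OF quotient_map_quotient_topology] f[unfolded coset_space_def]]
  by (simp add: o_def f0_def[abs_def])
 have "\<exists>d>0. d <= r0 & (\<forall>v\<in>carrier G. \<forall>w\<in>carrier G. cnorm v < d --> cnorm w < d --> norm (f0 (v \<otimes> (w \<otimes> c)) - f0 (w \<otimes> c)) < e)"
  if c: "c \<in> carrier G" for c
 proof -
  have "openin T {x \<in> topspace T. (f0 \<circ> (\<lambda>x. \<one> \<otimes> x \<otimes> c)) x \<in> ball (f0 c) (e / 2)}"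
   by (rule openin_continuous_map_preimage[OF continuous_map_compose[OF continuous_mult_const cf]]) (use c in auto)
  from small_in_open[OF this] obtain d where d: "d > 0" "!!x. cnorm x < d ==> x \<in> {x \<in> topspace T. (f0 \<circ> (\<lambda>x. \<one> \<otimes> x \<otimes> c)) x \<in> ball (f0 c) (e / 2)}"
   using c e by (auto simp: topspace_eq)
  have near: "norm (f0 c - f0 (x \<otimes> c)) < e / 2" if "x \<in> carrier G" "cnorm x < d" for x using d(2)[OF that(2)] that(1) by (simp add: dist_norm)
  define d' where "d' = min r0 (d / 4)"
  have "norm (f0 (v \<otimes> (w \<otimes> c)) - f0 (w \<otimes> c)) < e" if vw: "v \<in> carrier G" "w \<in> carrier G" "cnorm v < d'" "cnorm w < d'" for v w
  proof -
   have "cnorm (v \<otimes> w) < d" using r0(3)[OF vw(1,2)] vw(3,4) d(1) by (simp add: d'_def)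
   moreover have "cnorm w < d" using vw(4) d(1) by (simp add: d'_def)
   ultimately have "norm (f0 c - f0 (v \<otimes> w \<otimes> c)) < e / 2" "norm (f0 c - f0 (w \<otimes> c)) < e / 2" using near vw by auto
   hence "norm ((f0 c - f0 (w \<otimes> c)) - (f0 c - f0 (v \<otimes> w \<otimes> c))) < e"
    using norm_triangle_ineq4[of "f0 c - f0 (w \<otimes> c)" "f0 c - f0 (v \<otimes> w \<otimes> c)"] by linarith
   thus ?thesis using vw c by (simp add: m_assoc)
  qed
  thus ?thesis using r0(1) d(1) by (intro exI[of _ d']) (auto simp: d'_def)
 qed
 then obtain D where D: "!!c. c \<in> carrier G ==> 0 < D c & D c <= r0"
  "!!c v w. c \<in> carrier G ==> v \<in> carrier G ==> w \<in> carrier G ==> cnorm v < D c ==> cnorm w < D c ==> norm (f0 (v \<otimes> (w \<otimes> c)) - f0 (w \<otimes> c)) < e"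
  by metis
 have "\<exists>C. finite C & C \<subseteq> carrier G & (\<forall>h\<in>carrier G. \<exists>v\<in>carrier G. \<exists>c\<in>C. \<exists>gamma\<in>\<Gamma>. cnorm v < D c & h = v \<otimes> c \<otimes> gamma)"
  by (rule cover) (use D(1) r0(2) in force)
 then obtain C where C: "finite C" "C \<subseteq> carrier G"
  "\<forall>h\<in>carrier G. \<exists>v\<in>carrier G. \<exists>c\<in>C. \<exists>gamma\<in>\<Gamma>. cnorm v < D c & h = v \<otimes> c \<otimes> gamma" by (elim exE conjE)
 define delta where "delta = Min (insert 1 (D ` C))"
 have delta: "delta > 0" "!!c. c \<in> C ==> delta <= D c" using C(1,2) D(1) by (auto simp: delta_def)
 have "norm (f0 (v \<otimes> g) - f0 g) < e" if v: "v \<in> carrier G" "cnorm v < delta" and g: "g \<in> carrier G" for v g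
 proof -
  obtain w c gamma where w: "w \<in> carrier G" "c \<in> C" "gamma \<in> \<Gamma>" "cnorm w < D c" "g = w \<otimes> c \<otimes> gamma" using C(3)[rule_format, OF g] by blast
  have c: "c \<in> carrier G" "gamma \<in> carrier G" using w C(2) subgroup.mem_carrier[OF subgroup] by auto
  have "f0 (v \<otimes> g) = f0 (v \<otimes> (w \<otimes> c))" using f0\<Gamma>[of "v \<otimes> (w \<otimes> c)" gamma] v w c by (simp add: m_assoc)
  moreover have "f0 g = f0 (w \<otimes> c)" using f0\<Gamma>[of "w \<otimes> c" gamma] w c by simp
  ultimately show ?thesis using D(2)[OF c(1) v(1) w(1) _ w(4)] v(2) delta(2)[OF w(2)] by simp
 qed
 thus ?thesis using delta(1) unfolding f0_def by blast
qed

lemma lower_central_bound: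
 assumes "nil_core nu K N L b" "K \<subseteq> emb ` carrier G"
 shows "nil_core.Lc K N j \<subseteq> emb ` lower_central G j"
proof -
 interpret nil_core nu K N L b by fact
 have sub: "subgroup (lower_central G j) G" for j
 proof (induction j)
  case (Suc j)
  thus ?case unfolding lower_central.simps
   by (intro generate_is_subgroup) (auto dest: subgroup.mem_carrier)
 qed (simp add: subgroup_self)
 show ?thesis
 proof (induction j)
  case 0 show ?case using assms(2) N(2) by auto
 next
  case (Suc j)
  show ?case unfolding Lc.simps(2)
  proof (rule gen_least[OF subgrp_emb[OF sub]], clarify)
   fix g u assume g: "g \<in> K" "u \<in> Lc j"
   obtain x where x: "x \<in> carrier G" "g = emb x" using g(1) assms(2) by blast
   obtain y where y: "y \<in> lower_central G j" "u = emb y" using g(2) Suc by blast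
   have yG: "y \<in> carrier G" by (rule subgroup.mem_carrier[OF sub y(1)])
   have "y \<otimes> x \<otimes> inv y \<otimes> inv x \<in> lower_central G (Suc j)" unfolding lower_central.simps using x(1) y(1) by (blast intro: generate.incl)
   hence "inv (y \<otimes> x \<otimes> inv y \<otimes> inv x) \<in> lower_central G (Suc j)" by (rule subgroup.m_inv_closed[OF sub])
   \<comment> \<open>The lower central series takes the entries in the other order, so
     \<open>com g u\<close> is the inverse of one of its generators.\<close>
   moreover have "com g u = emb (inv (y \<otimes> x \<otimes> inv y \<otimes> inv x))"
    using x y yG by (simp add: com_def emb_hom diff_conv_add_uminus inv_mult_group m_assoc del: add_uminus_conv_diff)
   ultimately show "com g u \<in> emb ` lower_central G (Suc j)" by blast
  qed
 qed
qed

text \<open>The exponent \<open>k\<close> comes from the group and \<open>b\<close> alone, so it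
  serves all base points \<open>t\<close> and all \<open>f\<close>. The base point is put into the
  function \<open>F\<close>, whose uniform continuity follows through conjugation by
  \<open>t\<close>.\<close>

theorem orbit_approximation:
 assumes b: "b \<in> carrier G"
 shows "\<exists>k\<ge>1. \<forall>t\<in>carrier G. \<forall>f e. continuous_map (coset_space G T \<Gamma>) euclidean f --> e > 0 -->
  (\<exists>w. oscillating_sum w & (\<forall>n. norm (f ((t \<otimes> b [^] (n * k)) <# \<Gamma>) - w n) <= e))"
proof -
 obtain r0 D C where r: "r0 > 0" "r0 <= 1"
  "!!x y. x \<in> carrier G ==> y \<in> carrier G ==> cnorm x < r0 ==> cnorm y < r0 ==> cnorm (x \<otimes> y) <= 9/8 * (cnorm x + cnorm y)"
  "!!x. x \<in> carrier G ==> cnorm x < r0 ==> cnorm (inv x) <= 2 * cnorm x"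
  "!!x. x \<in> carrier G ==> cnorm x < r0 ==> \<exists>r\<in>carrier G. r \<otimes> r = x & cnorm r <= 2/3 * cnorm x"
  "!!rho W. 0 < rho ==> rho <= 1 ==> finite W ==> W \<subseteq> carrier G ==> (\<forall>w\<in>W. cnorm w < r0) ==>
   (\<forall>w\<in>W. \<forall>w'\<in>W. w ~= w' --> rho <= cnorm (inv w \<otimes> w')) ==> real (card W) <= C * (1 / rho) ^ D"
  by (rule root_norm_properties) blast
 define nu where "nu s = cnorm (dec s)" for s
 have nu: "nu (emb x) = cnorm x" if "x \<in> carrier G" for x using that by (simp add: nu_def)
 have \<Gamma>G: "gamma \<in> carrier G" if "gamma \<in> \<Gamma>" for gamma by (rule subgroup.mem_carrier[OF subgroup that])
 interpret R: cocompact_root_norm nu "emb ` carrier G" r0 D "emb ` \<Gamma>" "emb b"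
 proof
  show "\<exists>C. \<forall>rho W. 0 < rho --> rho <= 1 --> finite W --> W \<subseteq> emb ` carrier G --> (\<forall>w\<in>W. nu w < r0) -->
   (\<forall>w\<in>W. \<forall>w'\<in>W. w ~= w' --> rho <= nu (- w + w')) --> real (card W) <= C * (1 / rho) ^ D"
  proof (intro exI[of _ C] allI impI)
   fix rho :: real and W assume rho: "0 < rho" "rho <= 1" and W: "finite W" "W \<subseteq> emb ` carrier G" "\<forall>w\<in>W. nu w < r0"
    and sep: "\<forall>w\<in>W. \<forall>w'\<in>W. w ~= w' --> rho <= nu (- w + w')"
   obtain V where V: "V \<subseteq> carrier G" "finite V" "W = emb ` V" using W finite_subset_image by metis
   have inj: "inj_on emb V" by (rule inj_on_inverseI[of _ dec]) (use V in auto)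
   have "rho <= cnorm (inv v \<otimes> v')" if "v \<in> V" "v' \<in> V" "v ~= v'" for v v'
   proof -
    have "emb v ~= emb v'" using inj_onD[OF inj] that by blast
    moreover have "v \<in> carrier G" "v' \<in> carrier G" using that V(1) by auto
    ultimately show ?thesis using sep[rule_format, of "emb v" "emb v'"] that V(3) by (simp add: emb_hom nu)
   qed
   hence "real (card V) <= C * (1 / rho) ^ D" using W(3) V nu by (intro r(6) rho) (auto simp: subset_iff)
   thus "real (card W) <= C * (1 / rho) ^ D" using card_image[OF inj] V(3) by simp
  qed
  show "\<exists>d>0. \<forall>u\<in>emb ` carrier G. nu u < d --> nu (g + u - g) < e" if e: "e > 0" and g: "g \<in> emb ` carrier G" for e g
  proof -
   obtain x where x: "x \<in> carrier G" "g = emb x" using g by blast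
   obtain d where d: "d > 0" "!!u. u \<in> carrier G ==> cnorm u < d ==> cnorm (x \<otimes> u \<otimes> inv x) < e" using small_conj[OF e x(1)] by blast
   have "g + emb u - g = emb (x \<otimes> u \<otimes> inv x)" if "u \<in> carrier G" for u
    using x that by (simp add: emb_hom diff_conv_add_uminus del: add_uminus_conv_diff)
   thus ?thesis using d x(1) by (intro exI[of _ d]) (auto simp: nu)
  qed
  show "\<exists>C. finite C & C \<subseteq> emb ` carrier G & (\<forall>g\<in>emb ` carrier G. \<exists>b\<in>emb ` carrier G. \<exists>c\<in>C. \<exists>gamma\<in>emb ` \<Gamma>. nu b < d & g = b + c + gamma)"
   if d: "d > 0" for d
  proof -
   from cover[of "\<lambda>_. min d 1"] d obtain C where C: "finite C" "C \<subseteq> carrier G"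
    "\<forall>h\<in>carrier G. \<exists>v\<in>carrier G. \<exists>c\<in>C. \<exists>gamma\<in>\<Gamma>. cnorm v < min d 1 & h = v \<otimes> c \<otimes> gamma" by force
   show ?thesis
   proof (intro exI[of _ "emb ` C"] conjI ballI)
    fix g assume "g \<in> emb ` carrier G"
    then obtain h where h: "h \<in> carrier G" "g = emb h" by blast
    then obtain v c gamma where v: "v \<in> carrier G" "c \<in> C" "gamma \<in> \<Gamma>" "cnorm v < d" "h = v \<otimes> c \<otimes> gamma" using C(3)[rule_format, OF h(1)] by auto
    hence "g = emb v + emb c + emb gamma" using C(2) \<Gamma>G h(2) by (auto simp: emb_hom subset_iff)
    thus "\<exists>b\<in>emb ` carrier G. \<exists>c\<in>emb ` C. \<exists>gamma\<in>emb ` \<Gamma>. nu b < d & g = b + c + gamma"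
     using v by (intro bexI[of _ "emb v"] bexI[of _ "emb c"] bexI[of _ "emb gamma"]) (auto simp: nu)
   qed (use C in auto)
  qed
  show "\<exists>r\<in>emb ` carrier G. r + r = x & nu r <= 2/3 * nu x" if "x \<in> emb ` carrier G" "nu x < r0" for x
   using that r(5) by (auto simp: nu emb_hom) (metis emb_hom(1) nu imageI)
 qed (use b r \<Gamma>G in "auto simp: nu emb_hom subgrp_emb subgroup_self subgroup cnorm_one", simp_all add: nu_def cnorm_def)
 obtain k K N where k: "k >= 1" "K \<subseteq> emb ` carrier G" and nc: "nil_core nu K N (emb ` \<Gamma> \<inter> K) (nmul k (emb b))"
  using R.nil_core_exists by blast
 interpret N: nil_core nu K N "emb ` \<Gamma> \<inter> K" "nmul k (emb b)" by (rule nc)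
 obtain s where s: "lower_central G s = {\<one>}" using nilpotent unfolding nilpotent_def by blast
 have Ls: "N.Lc s = {0}" using lower_central_bound[OF nc k(2), of s] subgrpD(1)[OF N.Lc_subgrp[of s]] by (auto simp: s emb_hom(2))
 have "\<exists>w. oscillating_sum w & (\<forall>n. norm (f ((t \<otimes> b [^] (n * k)) <# \<Gamma>) - w n) <= e)"
  if t: "t \<in> carrier G" and f: "continuous_map (coset_space G T \<Gamma>) euclidean f" and e: "e > 0" for t f and e :: real
 proof -
  define F where "F s = f ((t \<otimes> dec s) <# \<Gamma>)" for s
  have "N.pgood (\<lambda>z. F (fst z))"
   unfolding N.pgood_def
  proof (intro conjI ballI allI impI)
   have "compactin euclidean (f ` topspace (coset_space G T \<Gamma>))"
    using image_compactin[OF _ f] cocompact by (simp add: compact_space_def)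
   hence "bounded (f ` topspace (coset_space G T \<Gamma>))" by (simp add: compact_imp_bounded)
   then obtain B where B: "!!z. z \<in> topspace (coset_space G T \<Gamma>) ==> norm (f z) <= B" by (auto simp: bounded_iff)
   have "norm (F x) <= B" if "x \<in> K" for x
    unfolding F_def by (rule B) (use that k(2) t in "auto simp: coset_space_def topspace_eq")
   thus "\<exists>B. \<forall>z\<in>K \<times> K. norm (F (fst z)) <= B" by auto
   show "F (fst (z + gamma)) = F (fst z)" if z: "z \<in> K \<times> K" and gamma: "gamma \<in> (emb ` \<Gamma> \<inter> K) \<times> (emb ` \<Gamma> \<inter> K)" for z gamma
   proof -
    obtain x where x: "x \<in> carrier G" "fst z = emb x" using z k(2) by force
    obtain y where y: "y \<in> \<Gamma>" "fst gamma = emb y" using gamma by force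
    have "t \<otimes> (x \<otimes> y) = (t \<otimes> x) \<otimes> y" using t x \<Gamma>G[OF y(1)] by (simp add: m_assoc)
    hence "(t \<otimes> x) <# \<Gamma> = (t \<otimes> (x \<otimes> y)) <# \<Gamma>" using coset_eq_iff[of "t \<otimes> x" "t \<otimes> (x \<otimes> y)"] t x y \<Gamma>G[OF y(1)] by auto
    thus ?thesis using x y \<Gamma>G[OF y(1)] by (simp add: F_def emb_hom)
   qed
   fix e :: real assume "e > 0"
   then obtain d where d: "d > 0" "!!v g. v \<in> carrier G ==> g \<in> carrier G ==> cnorm v < d ==> norm (f ((v \<otimes> g) <# \<Gamma>) - f (g <# \<Gamma>)) < e"
    using uniformly_continuous[OF f] by blast
   obtain d' where d': "d' > 0" "!!u. u \<in> carrier G ==> cnorm u < d' ==> cnorm (t \<otimes> u \<otimes> inv t) < d" using small_conj[OF d(1) t] by blast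
   have "norm (F (fst (v + z)) - F (fst z)) < e" if v: "v \<in> K \<times> K" "nu (fst v) < d'" and z: "z \<in> K \<times> K" for v z
   proof -
    obtain x where x: "x \<in> carrier G" "fst z = emb x" using z k(2) by force
    obtain y where y: "y \<in> carrier G" "fst v = emb y" using v(1) k(2) by force
    have "inv t \<otimes> (t \<otimes> x) = x" using t x by (simp flip: m_assoc)
    hence "(t \<otimes> y \<otimes> inv t) \<otimes> (t \<otimes> x) = t \<otimes> (y \<otimes> x)" using t x y by (simp add: m_assoc)
    moreover have "cnorm (t \<otimes> y \<otimes> inv t) < d" using d'(2)[OF y(1)] v(2) y nu by simp
    ultimately show ?thesis using d(2)[of "t \<otimes> y \<otimes> inv t" "t \<otimes> x"] t x y by (simp add: F_def emb_hom)
   qed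
   thus "\<exists>d>0. \<forall>v\<in>K \<times> K. \<forall>z\<in>K \<times> K. nu (fst v) < d --> nu (snd v) < d --> norm (F (fst (v + z)) - F (fst z)) < e"
    using d'(1) by blast
  qed
  from N.oscillating_approximation[OF Ls this] obtain w where w: "oscillating_sum w" "!!n. norm (F (nmul n (nmul k (emb b))) - w n) <= e"
   using e unfolding N.approximable_def by blast
  moreover have "F (nmul n (nmul k (emb b))) = f ((t \<otimes> b [^] (n * k)) <# \<Gamma>)" for n
   by (simp add: F_def nmul_emb b nat_pow_pow mult.commute)
  ultimately show ?thesis by auto
 qed
 thus ?thesis using k(1) by blast
qed

end

text \<open>The condition \<open>n * k + r >= 1\<close> leaves out index 0, at which a nilsequence
  is unconstrained.\<close>

theorem nilsequence_approximation:
 assumes "nilsequence TYPE('g) TYPE('e::real_normed_vector) eta"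
 shows "\<exists>k\<ge>1. \<forall>r. \<forall>e>0. \<exists>w. oscillating_sum w & (\<forall>n. n * k + r >= 1 --> norm (eta (n * k + r) - w n) <= e)"
proof -
 from assms[unfolded nilsequence_def]
 obtain G :: "'g monoid" and T \<A> \<Gamma> a x f where nil: "nilsystem G T (\<A> :: ('g set \<times> ('g => 'e)) set) \<Gamma> a"
  and x: "x \<in> lcosets\<^bsub>G\<^esub> \<Gamma>" and f: "continuous_map (coset_space G T \<Gamma>) euclidean f"
  and eta: "\<forall>n\<ge>1. eta n = f (((\<lambda>z. a <#\<^bsub>G\<^esub> z) ^^ n) x)"
  by (elim exE conjE)
 interpret nilsystem G T \<A> \<Gamma> a by (rule nil)
 have "\<one>\<^bsub>G\<^esub> \<in> (\<Union>(U, phi)\<in>\<A>. U)" using atlas topspace_eq by (simp add: smooth_atlas_def)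
 then obtain U phi where U: "(U, phi) \<in> \<A>" "\<one>\<^bsub>G\<^esub> \<in> U" by auto
 interpret nil_chart G T \<A> \<Gamma> a U phi by unfold_locales (fact U)+
 obtain x0 where x0: "x0 \<in> carrier G" "x = x0 <#\<^bsub>G\<^esub> \<Gamma>" using x by (auto simp: LCOSETS_def)
 have \<Gamma>G: "\<Gamma> \<subseteq> carrier G" by (rule subgroup.subset[OF subgroup])
 have it: "((\<lambda>z. a <#\<^bsub>G\<^esub> z) ^^ n) x = (a [^]\<^bsub>G\<^esub> n \<otimes>\<^bsub>G\<^esub> x0) <#\<^bsub>G\<^esub> \<Gamma>" for n
 proof (induction n)
  case 0 thus ?case by (simp add: x0)
 next
  case (Suc n)
  thus ?case using lcos_m_assoc[OF \<Gamma>G, of a "a [^]\<^bsub>G\<^esub> n \<otimes>\<^bsub>G\<^esub> x0"] translation x0(1) nat_pow_Suc2[of a n] by (simp add: m_assoc del: nat_pow_Suc)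
 qed
 \<comment> \<open>Conjugation by the base point moves it to the left:
   \<open>a^n x0 = x0 b^n\<close>. A residue \<open>r\<close> then only changes the left
   factor.\<close>
 define b where "b = inv\<^bsub>G\<^esub> x0 \<otimes>\<^bsub>G\<^esub> a \<otimes>\<^bsub>G\<^esub> x0"
 have b: "b \<in> carrier G" using translation x0 by (simp add: b_def)
 have bn: "x0 \<otimes>\<^bsub>G\<^esub> b [^]\<^bsub>G\<^esub> n = a [^]\<^bsub>G\<^esub> n \<otimes>\<^bsub>G\<^esub> x0" for n :: nat
 proof (induction n)
  case (Suc n)
  have "x0 \<otimes>\<^bsub>G\<^esub> b [^]\<^bsub>G\<^esub> Suc n = (x0 \<otimes>\<^bsub>G\<^esub> b [^]\<^bsub>G\<^esub> n) \<otimes>\<^bsub>G\<^esub> b" using x0 b by (simp add: m_assoc)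
  also have "... = a [^]\<^bsub>G\<^esub> n \<otimes>\<^bsub>G\<^esub> (x0 \<otimes>\<^bsub>G\<^esub> b)" unfolding Suc using x0 b translation by (simp add: m_assoc)
  also have "x0 \<otimes>\<^bsub>G\<^esub> b = a \<otimes>\<^bsub>G\<^esub> x0" using x0 translation by (simp add: b_def m_assoc[symmetric])
  finally show ?case using x0 translation by (simp add: m_assoc)
 qed (use x0 in simp)
 from orbit_approximation[OF b] obtain k where k: "k >= 1"
  "\<forall>t\<in>carrier G. \<forall>f e. continuous_map (coset_space G T \<Gamma>) euclidean f --> e > 0 -->
  (\<exists>w. oscillating_sum w & (\<forall>n. norm (f ((t \<otimes>\<^bsub>G\<^esub> b [^]\<^bsub>G\<^esub> (n * k)) <#\<^bsub>G\<^esub> \<Gamma>) - w n) <= e))" by (elim exE conjE)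
 have "\<exists>w. oscillating_sum w & (\<forall>n. n * k + r >= 1 --> norm (eta (n * k + r) - w n) <= e)" if e: "e > 0" for r e
 proof -
  have "(x0 \<otimes>\<^bsub>G\<^esub> b [^]\<^bsub>G\<^esub> r) \<otimes>\<^bsub>G\<^esub> b [^]\<^bsub>G\<^esub> (n * k) = a [^]\<^bsub>G\<^esub> (n * k + r) \<otimes>\<^bsub>G\<^esub> x0" for n
   using bn[of "n * k + r"] x0 b by (simp add: m_assoc nat_pow_mult add.commute)
  moreover have "x0 \<otimes>\<^bsub>G\<^esub> b [^]\<^bsub>G\<^esub> r \<in> carrier G" using x0 b by simp
  from k(2)[rule_format, OF this f e] obtain w where w: "oscillating_sum w"
   "!!n. norm (f (((x0 \<otimes>\<^bsub>G\<^esub> b [^]\<^bsub>G\<^esub> r) \<otimes>\<^bsub>G\<^esub> b [^]\<^bsub>G\<^esub> (n * k)) <#\<^bsub>G\<^esub> \<Gamma>) - w n) <= e" by blast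
  moreover have "eta (n * k + r) = f ((a [^]\<^bsub>G\<^esub> (n * k + r) \<otimes>\<^bsub>G\<^esub> x0) <#\<^bsub>G\<^esub> \<Gamma>)" if "n * k + r >= 1" for n
   using eta[rule_format, OF that] unfolding it .
  ultimately show ?thesis by (intro exI[of _ w]) simp
 qed
 thus ?thesis using k(1) by blast
qed

section \<open>Correlation with multiplicative orbits\<close>

text \<open>A shift by \<open>r\<close> turns the residue class into the multiples of
  \<open>k\<close>, which have density \<open>1 / k\<close>, and does not affect the limit of
  averages.\<close>

lemma residue_mean:
 assumes v: "cesaro v \<longlonglongrightarrow> L" "!!n. norm (v n) <= B" and r: "r < k"
 shows "cesaro (\<lambda>n. if n mod k = r then v (n div k) else 0) \<longlonglongrightarrow> L / of_nat k"
proof -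
 have k: "k > 0" using r by simp
 have B: "B >= 0" using v(2)[of 0] norm_ge_zero order_trans by blast
 define w where "w n = (if n mod k = r then v (n div k) else 0)" for n
 have shift: "w (n + r) = (if k dvd n then v (n div k) else 0)" for n
 proof (cases "k dvd n")
  case True
  then obtain i where "n = k * i" by blast
  thus ?thesis using r by (simp add: w_def)
 next
  case False
  have "(n + r) mod k ~= r"
  proof
   assume "(n + r) mod k = r"
   hence "(n + r) mod k = (0 + r) mod k" using r by simp
   hence "n mod k = 0" using mod_add_right_eq nat_mod_eq_iff by (metis add_right_cancel add.assoc cong_add_rcancel_nat cong_def mod_0)
   thus False using False by (simp add: dvd_eq_mod_eq_0)
  qed
  thus ?thesis using False by (simp add: w_def)
 qed
 have eq: "cesaro (\<lambda>n. w (n + r)) = (\<lambda>N. of_real (real (N div k) / real N) * cesaro v (N div k))"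
 proof
  show "cesaro (\<lambda>n. w (n + r)) N = of_real (real (N div k) / real N) * cesaro v (N div k)" for N
   unfolding shift cesaro_def sum_multiples[OF k] using k by (cases "N div k = 0") auto
 qed
 have "(\<lambda>N. of_real (real (N div k) / real N) * cesaro v (N div k)) \<longlonglongrightarrow> of_real (1 / real k) * L"
  by (intro tendsto_mult tendsto_of_real div_over_n_tendsto k filterlim_compose[OF v(1) filterlim_div_at_top])
 moreover have "of_real (1 / real k) * L = L / of_nat k" by simp
 ultimately have 1: "cesaro (\<lambda>n. w (n + r)) \<longlonglongrightarrow> L / of_nat k" unfolding eq by (simp only:)
 have "norm (w n) <= B" for n using v(2) B by (simp add: w_def)
 from norm_cesaro_shift[OF this] have "norm (cesaro (\<lambda>n. w (n + r)) N - cesaro w N) <= 2 * B * real r / real N" for N .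
 hence "(\<lambda>N. cesaro (\<lambda>n. w (n + r)) N - cesaro w N) \<longlonglongrightarrow> 0"
  by (intro Lim_null_comparison[OF always_eventually lim_const_over_n[of "2 * B * real r"]]) auto
 from tendsto_diff[OF 1 this] show ?thesis by (simp add: w_def[abs_def])
qed

text \<open>\<open>p\<close> and \<open>q\<close> agree modulo \<open>k\<close> and are invertible
  there, so \<open>p * n\<close> and \<open>q * n\<close> lie in class \<open>r\<close> for the same
  class \<open>s\<close> of \<open>n\<close>. With \<open>n = k * i + s\<close> the quotients by
  \<open>k\<close> are \<open>p * i\<close> and \<open>q * i\<close> plus constants, which are the
  shifts in \<open>oscillating\<close>.\<close>

lemma oscillating_residue:
 fixes r :: nat
 assumes w: "oscillating w" and pq: "p ~= q" "p >= 1" "q >= 1" "p mod k = q mod k" "coprime p k" and k: "k > 0"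
 defines "theta \<equiv> \<lambda>n. if n mod k = r then w (n div k) else 0"
 shows "cesaro (\<lambda>n. theta (p * n) * cnj (theta (q * n))) \<longlonglongrightarrow> 0"
proof -
 have pm: "(p * n) mod k = (p * (n mod k)) mod k" "(q * n) mod k = (p * (n mod k)) mod k" for n
  using pq(4) by (metis mod_mult_right_eq, metis mod_mult_eq mod_mult_right_eq mod_mult_left_eq)
 have div: "(c * n) div k = c * (n div k) + (c * (n mod k)) div k" for c n
 proof -
  have "c * n = c * (n mod k) + k * (c * (n div k))"
   by (metis add.commute distrib_left mod_mult_div_eq mult.left_commute mult_div_mod_eq)
  thus ?thesis using k by simp
 qed
 show ?thesis
 proof (cases "\<exists>s<k. (p * s) mod k = r")
  case True
  then obtain s where s: "s < k" "(p * s) mod k = r" by blast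
  have iff: "(p * (n mod k)) mod k = r \<longleftrightarrow> n mod k = s" for n
  proof
   assume "(p * (n mod k)) mod k = r"
   hence "[p * (n mod k) = p * s] (mod k)" using s(2) by (simp add: cong_def)
   hence "[n mod k = s] (mod k)" using pq(5) by (simp add: cong_mult_lcancel_nat)
   thus "n mod k = s" using s(1) by (simp add: cong_def)
  qed (use s in simp)
  define v where "v i = w (p * i + (p * s) div k) * cnj (w (q * i + (q * s) div k))" for i
  obtain B where B: "!!n. norm (w n) <= B" using w by (auto simp: oscillating_def)
  have vB: "norm (v i) <= B * B" for i
   unfolding v_def norm_mult complex_mod_cnj using B order_trans[OF norm_ge_zero B] by (intro mult_mono) auto
  have "cesaro v \<longlonglongrightarrow> 0" using w pq(1-3) unfolding oscillating_def v_def[abs_def] by blast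
  from residue_mean[OF this vB s(1)]
  have "cesaro (\<lambda>n. if n mod k = s then v (n div k) else 0) \<longlonglongrightarrow> 0 / of_nat k" .
  moreover have "theta (p * n) * cnj (theta (q * n)) = (if n mod k = s then v (n div k) else 0)" for n
  proof -
   have "(p * n) mod k = r \<longleftrightarrow> n mod k = s" "(q * n) mod k = r \<longleftrightarrow> n mod k = s" using iff[of n] pm[of n] by metis+
   thus ?thesis unfolding theta_def using div[of p n] div[of q n] by (simp add: v_def)
  qed
  ultimately show ?thesis by simp
 next
  case False
  hence "theta (p * n) = 0" for n unfolding theta_def using pm(1)[of n] k mod_less_divisor by metis
  thus ?thesis by (simp add: cesaro_def[abs_def])
 qed
qed

text \<open>Convergence of the averages of \<open>theta\<close> is carried along, so that existence
  of the mean value of the nilsequence comes out of the same approximation.\<close>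

definition decorrelated :: "complex => (nat => complex) => (nat => complex) => bool" where
 "decorrelated alpha a theta \<equiv> convergent (cesaro theta) & (\<lambda>N. cesaro (\<lambda>n. theta n * a n) N - alpha * cesaro theta N) \<longlonglongrightarrow> 0"

lemma decorrelated_add:
 assumes "decorrelated alpha a theta" "decorrelated alpha a \<zeta>"
 shows "decorrelated alpha a (\<lambda>n. theta n + \<zeta> n)"
proof -
 have "(\<lambda>N. (cesaro (\<lambda>n. theta n * a n) N - alpha * cesaro theta N) + (cesaro (\<lambda>n. \<zeta> n * a n) N - alpha * cesaro \<zeta> N)) \<longlonglongrightarrow> 0 + 0"
  by (intro tendsto_add) (use assms in "auto simp: decorrelated_def")
 moreover have "convergent (cesaro (\<lambda>n. theta n + \<zeta> n))"
  using convergent_add[of "cesaro theta" "cesaro \<zeta>"] assms by (simp add: decorrelated_def cesaro_add[abs_def])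
 ultimately show ?thesis by (simp add: decorrelated_def cesaro_add distrib_left distrib_right algebra_simps)
qed

lemma decorrelated_sum:
 "(!!r. r < k ==> decorrelated alpha a (theta r)) ==> decorrelated alpha a (\<lambda>n. \<Sum>r<(k::nat). theta r n)"
proof (induction k)
 case 0 show ?case by (simp add: decorrelated_def cesaro_def[abs_def] convergent_const)
next
 case (Suc k) thus ?case using decorrelated_add[of alpha a "\<lambda>n. \<Sum>r<k. theta r n" "theta k"] by simp
qed

lemma decorrelated_approx:
 assumes a: "!!n. norm (a n) <= A" and ap: "!!e. e > 0 ==> \<exists>theta. decorrelated alpha a theta & (\<forall>n\<ge>1. norm (eta n - theta n) <= e)"
 shows "decorrelated alpha a eta"
 unfolding decorrelated_def
proof
 have A: "A >= 0" using a[of 0] norm_ge_zero order_trans by blast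
 have near: "norm (cesaro eta N - cesaro theta N) <= e" if "!!n. n >= 1 ==> norm (eta n - theta n) <= e" "e > 0" for theta e N
  by (rule norm_cesaro_diff_le) (use that in auto)
 have "Cauchy (cesaro eta)"
 proof (rule metric_CauchyI)
  fix e :: real assume e: "e > 0"
  then obtain theta where theta: "decorrelated alpha a theta" "!!n. n >= 1 ==> norm (eta n - theta n) <= e / 4" using ap[of "e/4"] by auto
  have "Cauchy (cesaro theta)" using theta(1) by (simp add: decorrelated_def convergent_Cauchy)
  then obtain M where M: "\<forall>m\<ge>M. \<forall>n\<ge>M. dist (cesaro theta m) (cesaro theta n) < e / 4" using e by (meson metric_CauchyD zero_less_divide_iff zero_less_numeral)
  have "dist (cesaro eta m) (cesaro eta n) < e" if mn: "m >= M" "n >= M" for m n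
  proof -
   have "e / 4 > 0" using e by simp
   note nr = near[OF theta(2) this]
   have "dist (cesaro theta m) (cesaro theta n) < e / 4" using M mn by blast
   moreover have "dist (cesaro eta m) (cesaro theta m) <= e / 4" "dist (cesaro theta n) (cesaro eta n) <= e / 4"
    using nr[of m] nr[of n] by (simp_all add: dist_norm norm_minus_commute)
   ultimately show ?thesis
    using dist_triangle[of "cesaro eta m" "cesaro eta n" "cesaro theta m"] dist_triangle[of "cesaro theta m" "cesaro eta n" "cesaro theta n"] e by linarith
  qed
  thus "\<exists>M. \<forall>m\<ge>M. \<forall>n\<ge>M. dist (cesaro eta m) (cesaro eta n) < e" by blast
 qed
 thus "convergent (cesaro eta)" by (simp add: Cauchy_convergent_iff)
 show "(\<lambda>N. cesaro (\<lambda>n. eta n * a n) N - alpha * cesaro eta N) \<longlonglongrightarrow> 0"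
  unfolding tendsto_iff
 proof (intro allI impI)
  fix e :: real assume e: "e > 0"
  define d where "d = e / (2 * (A + norm alpha + 1))"
  have "c * (e / (2 * c)) = e / 2" if "c ~= 0" for c using that by simp
  from this[of "A + norm alpha + 1"] have d: "d > 0" "(A + norm alpha + 1) * d = e / 2"
   using A e norm_ge_zero[of alpha] unfolding d_def by (simp_all add: add_nonneg_pos)
  obtain theta where theta: "decorrelated alpha a theta" "!!n. n >= 1 ==> norm (eta n - theta n) <= d" using ap[OF d(1)] by auto
  have "\<forall>\<^sub>F N in sequentially. dist (cesaro (\<lambda>n. theta n * a n) N - alpha * cesaro theta N) 0 < d"
   using theta(1) d(1) unfolding decorrelated_def by (intro tendstoD) auto
  thus "\<forall>\<^sub>F N in sequentially. dist (cesaro (\<lambda>n. eta n * a n) N - alpha * cesaro eta N) 0 < e"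
  proof eventually_elim
   case (elim N)
   have 1: "norm (cesaro (\<lambda>n. eta n * a n) N - cesaro (\<lambda>n. theta n * a n) N) <= d * A"
   proof (rule norm_cesaro_diff_le)
    show "norm (eta n * a n - theta n * a n) <= d * A" if "n >= 1" for n
     using mult_mono[OF theta(2)[OF that] a[of n]] d(1) by (simp add: norm_mult flip: left_diff_distrib)
   qed (use d A in simp)
   have 2: "norm (alpha * (cesaro theta N - cesaro eta N)) <= norm alpha * d"
    unfolding norm_mult using near[OF theta(2) d(1), of N] by (intro mult_left_mono) (auto simp: norm_minus_commute)
   have 3: "norm (cesaro (\<lambda>n. theta n * a n) N - alpha * cesaro theta N) < d" using elim by simp
   have *: "cesaro (\<lambda>n. eta n * a n) N - alpha * cesaro eta N = (cesaro (\<lambda>n. eta n * a n) N - cesaro (\<lambda>n. theta n * a n) N)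
    + alpha * (cesaro theta N - cesaro eta N) + (cesaro (\<lambda>n. theta n * a n) N - alpha * cesaro theta N)" by (simp add: algebra_simps)
   have "norm (cesaro (\<lambda>n. eta n * a n) N - alpha * cesaro eta N) <= d * A + norm alpha * d + d"
    unfolding * by (rule norm_triangle_mono[OF norm_triangle_mono[OF 1 2] less_imp_le[OF 3]])
   also have "... = e / 2" using d(2) by (simp add: algebra_simps)
   finally show ?case using e by simp
  qed
 qed
qed

theorem corollary1p28:
  fixes S :: "nat \<Rightarrow> 'y::metric_space \<Rightarrow> 'y"
    and \<nu> :: "'y measure"
    and \<eta> :: "nat \<Rightarrow> complex"
    and g :: "'y \<Rightarrow> complex"
    and y :: 'y
  assumes "mult_tds S"
    and "aperiodic S"
    and "finitely_generated S"
    and "strongly_uniquely_ergodic S"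
    and "borel_probability \<nu>" and "pretends_invariant S \<nu>"
    and "nilsequence TYPE('g) TYPE('e::real_normed_vector) \<eta>"
    and "continuous_on UNIV g"
  shows "(\<lambda>N. (\<Sum>n=1..N. \<eta> n * g (S n y)) / of_nat N)
           \<longlonglongrightarrow> mean_value \<eta> * (\<integral>x. g x \<partial>\<nu>)"
proof -
 define a where "a n = g (S n y)" for n
 define alpha where "alpha = (\<integral>x. g x \<partial>\<nu>)"
 have aalpha: "cesaro a \<longlonglongrightarrow> alpha" unfolding a_def alpha_def by (rule orbit_average_tendsto_integral) (use assms in auto)
 have "compact (UNIV :: 'y set)" using assms(1) by (simp add: mult_tds_def)
 then obtain A where A: "!!x. norm (g x) <= A" "A > 0" using compact_continuous_bounded[OF _ assms(8)] by blast
 have aA: "norm (a n) <= A" for n using A(1) by (simp add: a_def)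
 obtain k where k: "k >= 1" "!!r e. e > 0 ==> \<exists>w. oscillating_sum w & (\<forall>n. n * k + r >= 1 --> norm (\<eta> (n * k + r) - w n) <= e)"
  using nilsequence_approximation[OF assms(7)] by blast
 obtain \<R> where \<R>: "finite \<R>" "!!p. prime p ==> S p \<in> \<R>" using assms(3) unfolding finitely_generated_def by blast
 \<comment> \<open>Besides the map \<open>S p\<close> the residue modulo \<open>k\<close> is fixed,
   for the use of \<open>oscillating_residue\<close>; \<open>p > k\<close> makes \<open>p\<close>
   coprime to \<open>k\<close>.\<close>
 define Q where "Q i = {p. prime p & p > k & p mod k = fst i & S p = snd i}" for i
 have "recip_divergent ({..k} \<union> (\<Union>i\<in>{..<k} \<times> \<R>. Q i))"
 proof -
  have "{p. prime p} \<subseteq> {..k} \<union> (\<Union>i\<in>{..<k} \<times> \<R>. Q i)"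
  proof
   fix p :: nat assume "p \<in> {p. prime p}"
   thus "p \<in> {..k} \<union> (\<Union>i\<in>{..<k} \<times> \<R>. Q i)"
    using \<R>(2) k(1) by (cases "p <= k") (auto simp: Q_def intro!: bexI[of _ "(p mod k, S p)"])
  qed
  thus ?thesis using recip_divergent_primes unfolding recip_divergent_def by (meson subset_trans)
 qed
 hence "recip_divergent (\<Union>i\<in>{..<k} \<times> \<R>. Q i)" using recip_divergent_Un not_recip_divergent_finite[of "{..k}"] by blast
 then obtain i where "i \<in> {..<k} \<times> \<R>" and i: "recip_divergent (Q i)"
  using recip_divergent_finite_cover[of "{..<k} \<times> \<R>" Q] \<R>(1) by auto
 have S_mult: "S (p * n) = snd i \<circ> S n" if "p \<in> Q i" "n >= 1" for p n
  using assms(1) that prime_ge_1_nat[of p] by (auto simp: mult_tds_def Q_def)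
 have osc: "decorrelated alpha a (\<lambda>n. if n mod k = r then w (n div k) else 0)" if w: "oscillating w" for w r
 proof -
  define theta where "theta n = (if n mod k = r then w (n div k) else 0)" for n
  obtain B where B: "!!n. norm (w n) <= B" using w by (auto simp: oscillating_def)
  have B0: "B >= 0" using B[of 0] norm_ge_zero order_trans by blast
  \<comment> \<open>Used twice: with the constant sequence 1 for the mean of \<open>theta\<close>
    itself, and with \<open>a\<close> for the correlation.\<close>
  have kat: "cesaro (\<lambda>n. theta n * c n) \<longlonglongrightarrow> 0"
   if c: "!!n. norm (c n) <= C" and h: "!!p n. p \<in> Q i ==> n >= 1 ==> c (p * n) = h n" for c h :: "nat => complex" and C
  proof (rule katai_criterion[where B' = "B + \<bar>C\<bar>" and P = "Q i" and h = h])
   show "norm (theta n) <= B + \<bar>C\<bar>" for n using B[of "n div k"] B0 by (simp add: theta_def add_increasing2)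
   show "norm (c n) <= B + \<bar>C\<bar>" for n using c[of n] B0 by linarith
   fix p q assume pq: "p \<in> Q i" "q \<in> Q i" "p ~= q"
   hence "coprime p k" by (intro prime_imp_coprime) (use k(1) in "auto simp: Q_def dest: dvd_imp_le")
   thus "cesaro (\<lambda>n. theta (p * n) * cnj (theta (q * n))) \<longlonglongrightarrow> 0"
    unfolding theta_def by (intro oscillating_residue[OF w pq(3)]) (use pq k(1) in "auto simp: Q_def prime_ge_1_nat")
  qed (use i h in "auto simp: Q_def")
  have 1: "cesaro theta \<longlonglongrightarrow> 0" using kat[of "\<lambda>_. 1" 1 "\<lambda>_. 1"] by simp
  have "cesaro (\<lambda>n. theta n * a n) \<longlonglongrightarrow> 0"
   by (rule kat[of a A "\<lambda>n. g (snd i (S n y))"]) (use aA S_mult in "auto simp: a_def")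
  from tendsto_diff[OF this tendsto_mult_left[OF 1, of alpha]] 1
  show ?thesis unfolding theta_def[symmetric] decorrelated_def convergent_def by auto
 qed
 have const: "decorrelated alpha a (\<lambda>n. if n mod k = r then c else 0)" if r: "r < k" for c r
 proof -
  define theta where "theta n = (if n mod k = r then c else 0)" for n
  have "cesaro (\<lambda>_. c) \<longlonglongrightarrow> c"
   by (rule tendsto_eventually) (use eventually_ge_at_top[of 1] in eventually_elim, simp add: cesaro_const)
  from residue_mean[OF this, of "norm c", OF _ r] have lim: "cesaro theta \<longlonglongrightarrow> c / of_nat k" by (simp add: theta_def[abs_def])
  have "periodic_seq theta" unfolding periodic_seq_def theta_def using k(1) by (intro exI[of _ k]) auto
  moreover have "continuous_on UNIV (\<lambda>x. cnj (g x))" using assms(8) by (intro continuous_intros)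
  ultimately have "asymptotically_uncorrelated theta (\<lambda>n. cnj (g (S n y)))" using assms(2) unfolding aperiodic_def by blast
  hence 1: "(\<lambda>N. cesaro (\<lambda>n. theta n * a n) N - cesaro theta N * cesaro a N) \<longlonglongrightarrow> 0"
   by (simp add: asymptotically_uncorrelated_def a_def[abs_def])
  have "(\<lambda>N. cesaro theta N * (cesaro a N - alpha)) \<longlonglongrightarrow> c / of_nat k * (alpha - alpha)" by (intro tendsto_intros lim aalpha)
  from tendsto_add[OF 1 this] have "(\<lambda>N. cesaro (\<lambda>n. theta n * a n) N - alpha * cesaro theta N) \<longlonglongrightarrow> 0" by (simp add: algebra_simps)
  thus ?thesis using lim unfolding theta_def[symmetric] decorrelated_def convergent_def by auto
 qed
 have sum: "decorrelated alpha a (\<lambda>n. if n mod k = r then w (n div k) else 0)" if "oscillating_sum w" "r < k" for w r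
  using that
 proof (induction rule: oscillating_sum.induct)
  case (add u v)
  have "decorrelated alpha a (\<lambda>n. (if n mod k = r then u (n div k) else 0) + (if n mod k = r then v (n div k) else 0))"
   by (rule decorrelated_add) (use add in auto)
  moreover have "(\<lambda>n. (if n mod k = r then u (n div k) else 0) + (if n mod k = r then v (n div k) else 0)) =
   (\<lambda>n. if n mod k = r then u (n div k) + v (n div k) else 0)" by auto
  ultimately show ?case by (simp only:)
 qed (use osc const in auto)
 have "decorrelated alpha a \<eta>"
 proof (rule decorrelated_approx[OF aA])
  fix e :: real assume e: "e > 0"
  have "\<exists>w. oscillating_sum w & (\<forall>n. n * k + r >= 1 --> norm (\<eta> (n * k + r) - w n) <= e)" for r by (rule k(2)[OF e])
  then obtain w where w: "!!r. oscillating_sum (w r)" "!!r n. n * k + r >= 1 ==> norm (\<eta> (n * k + r) - w r n) <= e" by metis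
  \<comment> \<open>At each \<open>n\<close> exactly one summand is active, the one with
    \<open>r = n mod k\<close>.\<close>
  have "decorrelated alpha a (\<lambda>n. \<Sum>r<k. if n mod k = r then w r (n div k) else 0)" by (intro decorrelated_sum sum w(1))
  moreover have "norm (\<eta> n - (\<Sum>r<k. if n mod k = r then w r (n div k) else 0)) <= e" if "n >= 1" for n
   using w(2)[of "n div k" "n mod k"] that k(1) by simp
  ultimately show "\<exists>theta. decorrelated alpha a theta & (\<forall>n\<ge>1. norm (\<eta> n - theta n) <= e)" by blast
 qed
 hence lim: "cesaro \<eta> \<longlonglongrightarrow> mean_value \<eta>" and 0: "(\<lambda>N. cesaro (\<lambda>n. \<eta> n * a n) N - alpha * cesaro \<eta> N) \<longlonglongrightarrow> 0"
  by (auto simp: decorrelated_def mean_value_def convergent_LIMSEQ_iff)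
 from tendsto_add[OF 0 tendsto_mult_left[OF lim, of alpha]]
 have "cesaro (\<lambda>n. \<eta> n * a n) \<longlonglongrightarrow> mean_value \<eta> * alpha" by (simp add: mult.commute)
 thus ?thesis by (simp add: cesaro_def[abs_def] a_def alpha_def)
qed

end
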